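(* Let $\pi/3<\alpha<2\pi/3$. The length of any simple closed geodesic on a regular tetrahedron in spherical space $\mathbb{S}^3$ with face angle $\alpha$ is less than $2\pi$.
   Context: $\mathbb{S}^3$ is the three-dimensional spherical space of constant curvature $1$ (the unit sphere in $\mathbb{R}^4$). A regular tetrahedron in $\mathbb{S}^3$ is a closed convex polyhedron with four faces, all of whose faces are congruent regular spherical triangles (on a unit two-sphere) and all of whose vertices are regular trihedral angles; its face angle is the interior angle $\alpha$ of a face triangle. For each $\alpha\in(\pi/3,2\pi/3)$ such a tetrahedron exists and is unique up to rigid motion. "On the tetrahedron" refers to its surface (the union of the faces) with the intrinsic metric. A geodesic on it is a locally shortest curve on the surface; it consists of geodesic segments in the faces, forms equal angles with the common edge when passing from one face to the adjacent one, and does not pass through vertices. A closed geodesic is simple if it has no self-intersections and does not repeat itself. *)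

theory Defs
  imports "HOL-Analysis.Analysis"
begin

text \<open>
  Spherical space is the unit sphere \<open>sphere 0 1\<close> of \<open>real ^ 4\<close> with its angular metric.
\<close>

definition sdist :: "'a::real_inner \<Rightarrow> 'a \<Rightarrow> real" where
  "sdist x y = arccos (x \<bullet> y)"

definition vangle :: "'a::real_inner \<Rightarrow> 'a \<Rightarrow> real" where
  "vangle u v = arccos ((u \<bullet> v) / (norm u * norm v))"

definition perp :: "'a::real_inner \<Rightarrow> 'a \<Rightarrow> 'a" where
  "perp u v = v - ((u \<bullet> v) / (u \<bullet> u)) *\<^sub>R u"

text \<open>
  For unit vectors \<open>x\<close> and \<open>y\<close> that are neither equal nor antipodal, \<open>perp x y\<close> is the tangent
  direction at \<open>x\<close> of the great circle arc from \<open>x\<close> to \<open>y\<close>. The interior angle at \<open>x\<close> of the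
  spherical triangle \<open>x y z\<close> is the angle between two such directions.
\<close>

definition interior_angle :: "'a::real_inner \<Rightarrow> 'a \<Rightarrow> 'a \<Rightarrow> real" where
  "interior_angle x y z = vangle (perp x y) (perp x z)"

text \<open>
  The dihedral angle, along the ray through \<open>u\<close>, between the half-planes bounded by that ray's
  line and containing \<open>v\<close> and \<open>w\<close> respectively.
\<close>

definition dihedral_angle :: "'a::real_inner \<Rightarrow> 'a \<Rightarrow> 'a \<Rightarrow> real" where
  "dihedral_angle u v w = vangle (perp u v) (perp u w)"

text \<open>
  The spherical convex hull of linearly independent unit vectors; for three of them, the closed
  spherical triangle (two-dimensional, including its interior) that they span.
\<close>

definition spherical_hull :: "(real ^ 4) set \<Rightarrow> (real ^ 4) set" where
  "spherical_hull F = sphere 0 1 \<inter> convex_cone hull F"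

definition congruent_sets :: "'a::real_inner set \<Rightarrow> 'a set \<Rightarrow> bool" where
  "congruent_sets A B \<longleftrightarrow> (\<exists>f. orthogonal_transformation f \<and> f ` A = B)"

text \<open>Triangles and tetrahedra are given by their vertex sets.\<close>

definition regular_triangle :: "(real ^ 4) set \<Rightarrow> real \<Rightarrow> bool" where
  "regular_triangle F \<alpha> \<longleftrightarrow>
     F \<subseteq> sphere 0 1 \<and> card F = 3 \<and> independent F \<and>
     (\<exists>a. pairwise (\<lambda>x y. sdist x y = a) F) \<and>
     (\<forall>x\<in>F. \<forall>y\<in>F. \<forall>z\<in>F. distinct [x, y, z] \<longrightarrow> interior_angle x y z = \<alpha>)"

text \<open>
  The trihedral angle at \<open>x\<close> whose edges are the arcs from \<open>x\<close> to the three points of \<open>W\<close>: it is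
  regular if its plane angles are equal and its dihedral angles are equal. Dihedral angles are
  measured in the tangent space at \<open>x\<close>.
\<close>

definition regular_trihedral_angle :: "real ^ 4 \<Rightarrow> (real ^ 4) set \<Rightarrow> bool" where
  "regular_trihedral_angle x W \<longleftrightarrow>
     (\<exists>\<beta>. \<forall>y\<in>W. \<forall>z\<in>W. y \<noteq> z \<longrightarrow> vangle (perp x y) (perp x z) = \<beta>) \<and>
     (\<exists>\<delta>. \<forall>y\<in>W. \<forall>z\<in>W. \<forall>w\<in>W. distinct [y, z, w] \<longrightarrow>
        dihedral_angle (perp x y) (perp x z) (perp x w) = \<delta>)"

text \<open>
  A spherical tetrahedron is the (nondegenerate) spherical convex hull of four linearly
  independent unit vectors; its faces are spanned by the triples of vertices.
\<close>

definition regular_tetrahedron :: "(real ^ 4) set \<Rightarrow> real \<Rightarrow> bool" where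
  "regular_tetrahedron V \<alpha> \<longleftrightarrow>
     V \<subseteq> sphere 0 1 \<and> card V = 4 \<and> independent V \<and>
     (\<forall>x\<in>V. regular_triangle (V - {x}) \<alpha>) \<and>
     (\<forall>x\<in>V. \<forall>y\<in>V. congruent_sets (spherical_hull (V - {x})) (spherical_hull (V - {y}))) \<and>
     (\<forall>x\<in>V. regular_trihedral_angle x (V - {x}))"

definition tetrahedron_surface :: "(real ^ 4) set \<Rightarrow> (real ^ 4) set" where
  "tetrahedron_surface V = (\<Union>x\<in>V. spherical_hull (V - {x}))"

text \<open>
  The length of a curve on the unit sphere over the parameter interval from \<open>a\<close> to \<open>b\<close>: the
  supremum of the lengths of inscribed chains \<open>t 0 \<le> t 1 \<le> \<dots> \<le> t n\<close> (infinite if the curve is not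
  rectifiable).
\<close>

definition curve_length :: "real \<Rightarrow> real \<Rightarrow> (real \<Rightarrow> 'a::real_inner) \<Rightarrow> ennreal" where
  "curve_length a b g =
     (SUP (t, n) \<in> {t. incseq t \<and> range t \<subseteq> {a..b}} \<times> (UNIV :: nat set).
        ennreal (\<Sum>i<n. sdist (g (t i)) (g (t (Suc i)))))"

definition intrinsic_dist :: "'a::real_inner set \<Rightarrow> 'a \<Rightarrow> 'a \<Rightarrow> ennreal" where
  "intrinsic_dist S x y =
     (INF p \<in> {p. path p \<and> path_image p \<subseteq> S \<and> pathstart p = x \<and> pathfinish p = y}.
        curve_length 0 1 p)"

text \<open>
  A closed geodesic is a closed curve on \<open>S\<close> that is locally shortest at every parameter, the
  base point included: \<open>\<lambda>s. g (frac s)\<close> is the periodic extension of the loop \<open>g\<close>. Constant loops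
  are not excluded here, but they are not simple.
\<close>

definition closed_geodesic :: "'a::real_inner set \<Rightarrow> (real \<Rightarrow> 'a) \<Rightarrow> bool" where
  "closed_geodesic S g \<longleftrightarrow>
     path g \<and> path_image g \<subseteq> S \<and> pathfinish g = pathstart g \<and>
     (\<forall>t. \<exists>e>0. curve_length (t - e) (t + e) (\<lambda>s. g (frac s)) =
                 intrinsic_dist S (g (frac (t - e))) (g (frac (t + e))))"

definition simple_closed_geodesic :: "'a::real_inner set \<Rightarrow> (real \<Rightarrow> 'a) \<Rightarrow> bool" where
  "simple_closed_geodesic S g \<longleftrightarrow> closed_geodesic S g \<and> simple_path g"

end

theory Submission
  imports Defs
begin

text \<open>
  Parametrised by arc length, a simple closed geodesic \<open>\<gamma>\<close> of length \<open>\<Lambda>\<close> avoids the vertices: the cone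
  angle \<open>3 * \<alpha>\<close> at a vertex is less than \<open>2 * \<pi>\<close>, so a curve through a vertex can be shortened. Unrolling
  the faces that \<open>\<gamma>\<close> crosses onto a two-sphere turns \<open>\<gamma>\<close> into the equator, travelled by arc length.

  Over every half equator \<open>(z, z + \<pi>)\<close> take the largest lune above it that contains no vertex of the
  unrolled triangles. The triangles cover this lune, so it maps into the surface by a local isometry; its image
  is disjoint from \<open>\<gamma>\<close>, because \<open>\<gamma>\<close> is simple. Some vertex \<open>v\<close> lies on the upper edge of the lune, and the
  lune occupies an angle \<open>\<pi>\<close> of the directions at \<open>v\<close>. As \<open>3 * \<alpha> < 2 * \<pi>\<close>, two lunes that touch the same
  vertex have a direction in common; following it from \<open>v\<close> to the first point of \<open>\<gamma>\<close> identifies a point of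
  the first base with a point of the second.

  Suppose \<open>2 * \<pi> \<le> \<Lambda>\<close>. Then the lunes over \<open>(z, z + \<pi>)\<close> and \<open>(z + \<pi>, z + 2 * \<pi>)\<close> touch different
  vertices. So do a lune above and a lune below \<open>\<gamma>\<close>, because near the common direction the two feet would run
  along \<open>\<gamma>\<close> in opposite directions. Hence on one side only two vertices are ever touched, and the lunes over
  \<open>(z, z + \<pi>)\<close> and \<open>(z + \<pi>, z + 2 * \<pi>)\<close> touch one of them each. The touched vertex depends
  semicontinuously on \<open>z\<close>, hence is constant, although it changes from \<open>z\<close> to \<open>z + \<pi>\<close>.
\<close>

section \<open>Spherical distance, arcs and lengths of curves\<close>

lemma inner_unit_bounds:
  assumes "norm x = 1" "norm y = 1"
  shows "- 1 \<le> x \<bullet> y" "x \<bullet> y \<le> 1"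
  using Cauchy_Schwarz_ineq2[of x y] assms by (auto simp: abs_le_iff)

lemma sdist_bounds:
  assumes "norm x = 1" "norm y = 1"
  shows "0 \<le> sdist x y" "sdist x y \<le> pi"
  using arccos_bounded[OF inner_unit_bounds[OF assms]] by (auto simp: sdist_def)

lemma cos_sdist:
  assumes "norm x = 1" "norm y = 1"
  shows "cos (sdist x y) = x \<bullet> y"
  using inner_unit_bounds[OF assms] by (simp add: sdist_def)

lemma sdist_commute: "sdist x y = sdist y x"
  by (simp add: sdist_def inner_commute)

lemma sdist_refl: "norm x = 1 \<Longrightarrow> sdist x x = 0"
  by (simp add: sdist_def power2_norm_eq_inner[symmetric])

lemma inner_eq_1_imp_eq:
  assumes "norm x = 1" "norm y = 1" "x \<bullet> y = 1"
  shows "x = y"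
proof -
  have "(norm (x - y))\<^sup>2 = 0"
    using assms by (simp add: power2_norm_eq_inner inner_diff inner_commute norm_eq_1)
  then show ?thesis by simp
qed

lemma sdist_eq_0_imp_eq:
  assumes "norm x = 1" "norm y = 1" "sdist x y = 0"
  shows "x = y"
  using assms cos_sdist[OF assms(1,2)] inner_eq_1_imp_eq by simp

lemma sdist_eq_iff:
  assumes "norm x = 1" "norm y = 1" "0 \<le> d" "d \<le> pi" "x \<bullet> y = cos d"
  shows "sdist x y = d"
  using assms by (simp add: sdist_def arccos_cos)

lemma continuous_on_sdist:
  fixes f :: "real \<Rightarrow> 'a::real_inner"
  assumes "continuous_on A f" "continuous_on A h" "\<And>t. t \<in> A \<Longrightarrow> norm (f t) = 1" "\<And>t. t \<in> A \<Longrightarrow> norm (h t) = 1"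
  shows "continuous_on A (\<lambda>t. sdist (f t) (h t))"
  unfolding sdist_def
  by (intro continuous_on_arccos continuous_intros assms) (use assms inner_unit_bounds in blast)

definition garc :: "'a::real_inner \<Rightarrow> 'a \<Rightarrow> real \<Rightarrow> 'a" where
  "garc p q t = cos t *\<^sub>R p + sin t *\<^sub>R q"

lemma continuous_on_garc [continuous_intros]:
  fixes f :: "real \<Rightarrow> real"
  shows "continuous_on A f \<Longrightarrow> continuous_on A (\<lambda>t. garc p q (f t))"
  unfolding garc_def by (intro continuous_intros)

lemma inner_garc:
  assumes "norm p = 1" "norm q = 1" "p \<bullet> q = 0"
  shows "garc p q s \<bullet> garc p q t = cos (s - t)"
  using assms by (simp add: garc_def inner_add inner_commute norm_eq_1 cos_diff)

lemma norm_garc: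
  assumes "norm p = 1" "norm q = 1" "p \<bullet> q = 0"
  shows "norm (garc p q t) = 1"
  using inner_garc[OF assms, of t t] by (simp add: norm_eq_1)

lemma sdist_garc:
  assumes "norm p = 1" "norm q = 1" "p \<bullet> q = 0" "\<bar>s - t\<bar> \<le> pi"
  shows "sdist (garc p q s) (garc p q t) = \<bar>s - t\<bar>"
  using assms by (intro sdist_eq_iff) (auto simp: norm_garc inner_garc)

lemma arc_exists:
  fixes x y :: "'a::real_inner"
  assumes "norm x = 1" "norm y = 1" "x \<noteq> y" "y \<noteq> - x"
  obtains q where "norm q = 1" "x \<bullet> q = 0" "y = garc x q (sdist x y)" "0 < sdist x y" "sdist x y < pi"
    "\<And>t. sin (sdist x y) *\<^sub>R garc x q t = sin (sdist x y - t) *\<^sub>R x + sin t *\<^sub>R y"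
proof -
  define r where "r = sdist x y"
  have r0: "0 < r" using sdist_bounds[OF assms(1,2)] sdist_eq_0_imp_eq[OF assms(1,2)] assms(3)
    unfolding r_def by force
  have cr: "cos r = x \<bullet> y" unfolding r_def by (rule cos_sdist[OF assms(1,2)])
  have rpi: "r \<noteq> pi"
  proof
    assume "r = pi"
    then have "x \<bullet> (- y) = 1" using cr by simp
    then have "x = - y" using inner_eq_1_imp_eq[of x "- y"] assms by simp
    then show False using assms by simp
  qed
  then have rpi: "r < pi" using sdist_bounds[OF assms(1,2)] unfolding r_def by simp
  have sr: "0 < sin r" using r0 rpi by (rule sin_gt_zero)
  define q where "q = (1 / sin r) *\<^sub>R (y - cos r *\<^sub>R x)"
  have "(norm (y - cos r *\<^sub>R x))\<^sup>2 = 1 - (cos r)\<^sup>2"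
    using assms(1,2) cr unfolding power2_norm_eq_inner
    by (simp add: inner_diff inner_commute norm_eq_1 power2_eq_square algebra_simps)
  also have "\<dots> = (sin r)\<^sup>2" by (simp add: sin_squared_eq)
  finally have "norm (y - cos r *\<^sub>R x) = sin r" using sr by simp
  then have nq: "norm q = 1" unfolding q_def using sr by simp
  have xq: "x \<bullet> q = 0" unfolding q_def using assms(1) cr by (simp add: inner_diff norm_eq_1)
  have y: "y = garc x q r" unfolding garc_def q_def using sr by simp
  have "sin r *\<^sub>R garc x q t = sin (r - t) *\<^sub>R x + sin t *\<^sub>R y" for t
  proof -
    have "sin (r - t) *\<^sub>R x + sin t *\<^sub>R y = (sin (r - t) + sin t * cos r) *\<^sub>R x + (sin t * sin r) *\<^sub>R q"
      by (subst y) (simp add: garc_def scaleR_add_right scaleR_add_left)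
    also have "sin (r - t) + sin t * cos r = sin r * cos t" by (simp add: sin_diff)
    finally show ?thesis by (simp add: garc_def scaleR_add_right mult.commute)
  qed
  then show ?thesis using that[of q] nq xq y r0 rpi unfolding r_def by blast
qed

lemma sdist_triangle:
  assumes "norm x = 1" "norm y = 1" "norm z = 1"
  shows "sdist x z \<le> sdist x y + sdist y z"
proof -
  define a b where "a = sdist x y" and "b = sdist y z"
  have a: "0 \<le> a" "a \<le> pi" and b: "0 \<le> b" "b \<le> pi"
    using sdist_bounds assms unfolding a_def b_def by auto
  have ca: "cos a = x \<bullet> y" and cb: "cos b = y \<bullet> z"
    unfolding a_def b_def using cos_sdist assms by auto
  show ?thesis
  proof (cases "a + b \<le> pi")
    case False
    then show ?thesis using sdist_bounds(2)[OF assms(1,3)] unfolding a_def b_def by simp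
  next
    case True
    define p where "p = x - cos a *\<^sub>R y"
    define q where "q = z - cos b *\<^sub>R y"
    have xx: "x \<bullet> x = 1" "y \<bullet> y = 1" "z \<bullet> z = 1" using assms by (auto simp: norm_eq_1)
    have "(norm p)\<^sup>2 = 1 - (cos a)\<^sup>2"
      unfolding p_def power2_norm_eq_inner using xx ca
      by (simp add: inner_diff inner_commute power2_eq_square algebra_simps)
    then have "(norm p)\<^sup>2 = (sin a)\<^sup>2" by (simp add: sin_squared_eq)
    then have np: "norm p = sin a" using sin_ge_zero[OF a] by simp
    have "(norm q)\<^sup>2 = 1 - (cos b)\<^sup>2"
      unfolding q_def power2_norm_eq_inner using xx cb
      by (simp add: inner_diff inner_commute power2_eq_square algebra_simps)
    then have "(norm q)\<^sup>2 = (sin b)\<^sup>2" by (simp add: sin_squared_eq)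
    then have nq: "norm q = sin b" using sin_ge_zero[OF b] by simp
    have "p \<bullet> q = x \<bullet> z - cos a * cos b"
      unfolding p_def q_def using xx ca cb by (simp add: inner_diff inner_commute algebra_simps)
    moreover have "- (sin a * sin b) \<le> p \<bullet> q"
      using Cauchy_Schwarz_ineq2[of p q] np nq by (simp add: abs_le_iff)
    ultimately have "cos (a + b) \<le> x \<bullet> z" by (simp add: cos_add)
    then have "arccos (x \<bullet> z) \<le> arccos (cos (a + b))"
      by (intro arccos_le_arccos inner_unit_bounds assms) auto
    also have "\<dots> = a + b" using True a b by (intro arccos_cos) auto
    finally show ?thesis by (simp add: sdist_def a_def b_def)
  qed
qed

lemma sdist_between:
  assumes "norm x = 1" "norm y = 1" "norm z = 1" "z = a *\<^sub>R x + b *\<^sub>R y" "0 \<le> a" "0 \<le> b" "y \<noteq> - x"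
  shows "sdist x z + sdist z y = sdist x y"
proof (cases "x = y")
  case True
  then have "z = (a + b) *\<^sub>R x" using assms by (simp add: scaleR_add_left)
  then have "z = x" using assms by simp
  then show ?thesis using True assms by (simp add: sdist_refl)
next
  case False
  define r where "r = sdist x y"
  obtain q where q: "norm q = 1" "x \<bullet> q = 0" "y = garc x q r" "0 < r" "r < pi"
    using arc_exists[OF assms(1,2) False assms(7)] unfolding r_def by metis
  have z: "z = (a + b * cos r) *\<^sub>R x + (b * sin r) *\<^sub>R q"
    unfolding assms(4) by (subst q(3)) (simp add: garc_def scaleR_add_right scaleR_add_left)
  define t where "t = sdist x z"
  have t: "0 \<le> t" "t \<le> pi" unfolding t_def using sdist_bounds[OF assms(1,3)] by auto
  have xx: "x \<bullet> x = 1" "q \<bullet> q = 1" "q \<bullet> x = 0" using assms q by (auto simp: norm_eq_1 inner_commute)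
  have ct: "cos t = a + b * cos r"
    using cos_sdist[OF assms(1,3)] xx q(2) unfolding t_def[symmetric] by (subst (asm) z) (simp add: inner_add_right)
  have "z \<bullet> z = 1" using assms(3) by (simp add: norm_eq_1)
  then have "(a + b * cos r)\<^sup>2 + (b * sin r)\<^sup>2 = 1"
    unfolding z using xx q(2) by (simp add: inner_add power2_eq_square)
  then have "(sin t)\<^sup>2 = (b * sin r)\<^sup>2" unfolding sin_squared_eq ct by simp
  moreover have sr: "0 < sin r" using q by (intro sin_gt_zero) auto
  ultimately have st: "sin t = b * sin r" using sin_ge_zero[OF t] assms(6) by (simp add: power2_eq_iff_nonneg)
  have "sin (r - t) = a * sin r" unfolding sin_diff ct st by (simp add: algebra_simps)
  then have "0 \<le> sin (r - t)" using sr assms(5) by simp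
  moreover have "sin (r - t) < 0" if "r < t"
    using sin_gt_zero[of "t - r"] that t q by (simp add: sin_diff algebra_simps)
  ultimately have "t \<le> r" by force
  moreover have "z = garc x q t" unfolding z garc_def ct st ..
  ultimately have "sdist z y = r - t"
    using t q sdist_garc[OF assms(1) q(1,2), of t r] by (subst q(3)) auto
  then show ?thesis unfolding t_def r_def by simp
qed

definition chains :: "real \<Rightarrow> real \<Rightarrow> ((nat \<Rightarrow> real) \<times> nat) set" where
  "chains a b = {t. incseq t \<and> range t \<subseteq> {a..b}} \<times> UNIV"

definition chain_sum :: "(real \<Rightarrow> 'a::real_inner) \<Rightarrow> (nat \<Rightarrow> real) \<times> nat \<Rightarrow> real" where
  "chain_sum g p = (\<Sum>i<snd p. sdist (g (fst p i)) (g (fst p (Suc i))))"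

lemma curve_length_eq: "curve_length a b g = (SUP p\<in>chains a b. ennreal (chain_sum g p))"
  by (simp add: curve_length_def chains_def chain_sum_def case_prod_unfold)

lemma chains_nonempty: "a \<le> b \<Longrightarrow> chains a b \<noteq> {}"
  unfolding chains_def by (auto intro!: exI[of _ "\<lambda>_. a"] simp: incseq_def)

lemma sdist_le_curve_length:
  assumes "a \<le> s" "s \<le> t" "t \<le> b"
  shows "ennreal (sdist (g s) (g t)) \<le> curve_length a b g"
proof -
  define u where "u = (\<lambda>i::nat. if i = 0 then s else t)"
  have "(u, 1) \<in> chains a b" unfolding chains_def u_def incseq_def using assms by auto
  then have "ennreal (chain_sum g (u, 1)) \<le> curve_length a b g"
    unfolding curve_length_eq by (rule SUP_upper)
  then show ?thesis by (simp add: chain_sum_def u_def)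
qed

lemma curve_length_leI:
  assumes "\<And>t n. incseq t \<Longrightarrow> range t \<subseteq> {a..b} \<Longrightarrow> ennreal (\<Sum>i<n. sdist (g (t i)) (g (t (Suc i)))) \<le> K"
  shows "curve_length a b g \<le> K"
  unfolding curve_length_eq by (rule SUP_least) (auto simp: chains_def chain_sum_def intro!: assms)

lemma curve_length_cong:
  assumes "\<And>t. a \<le> t \<Longrightarrow> t \<le> b \<Longrightarrow> g t = h t"
  shows "curve_length a b g = curve_length a b h"
  unfolding curve_length_eq
proof (rule SUP_cong[OF refl])
  fix p assume "p \<in> chains a b"
  then have "fst p i \<in> {a..b}" for i unfolding chains_def by (auto simp: subset_eq)
  then show "ennreal (chain_sum g p) = ennreal (chain_sum h p)"
    unfolding chain_sum_def using assms by (auto intro!: arg_cong[where f=ennreal] sum.cong)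
qed

lemma curve_length_reparam:
  assumes "mono_on {a..b} \<phi>" "\<phi> ` {a..b} \<subseteq> {a'..b'}"
  shows "curve_length a b (\<lambda>t. g (\<phi> t)) \<le> curve_length a' b' g"
proof (rule curve_length_leI)
  fix t :: "nat \<Rightarrow> real" and n
  assume t: "incseq t" "range t \<subseteq> {a..b}"
  have "(\<lambda>i. \<phi> (t i), n) \<in> chains a' b'"
  proof -
    have "incseq (\<lambda>i. \<phi> (t i))" using t assms(1) unfolding incseq_def mono_on_def
      by (meson range_subsetD)
    moreover have "range (\<lambda>i. \<phi> (t i)) \<subseteq> {a'..b'}" using t assms(2) by auto
    ultimately show ?thesis by (auto simp: chains_def)
  qed
  then have "ennreal (chain_sum g (\<lambda>i. \<phi> (t i), n)) \<le> curve_length a' b' g"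
    unfolding curve_length_eq by (rule SUP_upper)
  then show "ennreal (\<Sum>i<n. sdist (g (\<phi> (t i))) (g (\<phi> (t (Suc i))))) \<le> curve_length a' b' g"
    by (simp add: chain_sum_def)
qed

lemma curve_length_affine:
  assumes "0 < k"
  shows "curve_length a b (\<lambda>t. g (k * t + d)) = curve_length (k * a + d) (k * b + d) g"
proof (rule antisym)
  show "curve_length a b (\<lambda>t. g (k * t + d)) \<le> curve_length (k * a + d) (k * b + d) g"
    using assms by (intro curve_length_reparam) (auto simp: mono_on_def)
  have "curve_length (k * a + d) (k * b + d) (\<lambda>u. (\<lambda>t. g (k * t + d)) ((u - d) / k))
     \<le> curve_length a b (\<lambda>t. g (k * t + d))"
    using assms by (intro curve_length_reparam) (auto simp: mono_on_def field_simps)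
  then show "curve_length (k * a + d) (k * b + d) g \<le> curve_length a b (\<lambda>t. g (k * t + d))"
    using assms by simp
qed

lemma curve_length_reverse:
  "curve_length a b (\<lambda>t. g (- t)) = curve_length (- b) (- a) g"
proof -
  have *: "curve_length a b (\<lambda>t. g (- t)) \<le> curve_length (- b) (- a) g" for a b and g :: "real \<Rightarrow> 'a"
  proof (rule curve_length_leI)
    fix t :: "nat \<Rightarrow> real" and n
    assume t: "incseq t" "range t \<subseteq> {a..b}"
    define u where "u = (\<lambda>i. - t (n - i))"
    have "(u, n) \<in> chains (- b) (- a)"
    proof -
      have "incseq u" unfolding u_def incseq_def using t(1) by (auto simp: incseq_def)
      moreover have "range u \<subseteq> {-b..-a}" using t(2) unfolding u_def by (auto simp: subset_eq)
      ultimately show ?thesis by (auto simp: chains_def)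
    qed
    then have "ennreal (chain_sum g (u, n)) \<le> curve_length (- b) (- a) g"
      unfolding curve_length_eq by (rule SUP_upper)
    also have "chain_sum g (u, n) = (\<Sum>i<n. sdist (g (- t (n - i))) (g (- t (n - Suc i))))"
      by (simp add: chain_sum_def u_def)
    also have "\<dots> = (\<Sum>i<n. sdist (g (- t (Suc i))) (g (- t i)))"
      by (rule sum.reindex_bij_witness[of _ "\<lambda>i. n - Suc i" "\<lambda>i. n - Suc i"])
         (auto simp: Suc_diff_Suc)
    finally show "ennreal (\<Sum>i<n. sdist (g (- t i)) (g (- t (Suc i)))) \<le> curve_length (- b) (- a) g"
      by (simp add: sdist_commute)
  qed
  show ?thesis
    by (rule antisym[OF *]) (use *[of "- b" "- a" "\<lambda>t. g (- t)"] in simp)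
qed

lemma curve_length_add:
  assumes "a \<le> m" "m \<le> b" and unit: "\<And>t. a \<le> t \<Longrightarrow> t \<le> b \<Longrightarrow> norm (g t) = 1"
  shows "curve_length a b g = curve_length a m g + curve_length m b g"
proof (rule antisym)
  show "curve_length a b g \<le> curve_length a m g + curve_length m b g"
  proof (rule curve_length_leI)
    fix t :: "nat \<Rightarrow> real" and n
    assume t: "incseq t" "range t \<subseteq> {a..b}"
    define u v where "u = (\<lambda>i. min (t i) m)" and "v = (\<lambda>i. max (t i) m)"
    have tb: "a \<le> t i" "t i \<le> b" "t i \<le> t (Suc i)" for i
      using t by (auto simp: subset_eq incseq_def)
    have u: "(u, n) \<in> chains a m" and v: "(v, n) \<in> chains m b"
    proof -
      have "t i \<le> t j" if "i \<le> j" for i j using t(1) that by (auto simp: incseq_def)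
      then have "incseq u" "incseq v" unfolding incseq_def u_def v_def
        by (simp_all add: min.coboundedI1 max.coboundedI1 max.mono min.mono)
      then show "(u, n) \<in> chains a m" "(v, n) \<in> chains m b"
        using tb(1,2) assms(1,2) by (auto simp: chains_def u_def v_def)
    qed
    have nn: "0 \<le> sdist (g (u i)) (g (u (Suc i)))" "0 \<le> sdist (g (v i)) (g (v (Suc i)))" for i
      using tb assms(1,2) unfolding u_def v_def by (auto intro!: sdist_bounds unit simp: min_le_iff_disj le_max_iff_disj)
    have "sdist (g (t i)) (g (t (Suc i))) \<le> sdist (g (u i)) (g (u (Suc i))) + sdist (g (v i)) (g (v (Suc i)))" for i
    proof -
      consider "t (Suc i) \<le> m" | "m \<le> t i" | "t i < m" "m < t (Suc i)" by linarith
      then show ?thesis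
      proof cases
        case 1
        then have "t i \<le> m" using tb(3)[of i] by linarith
        then show ?thesis using 1 nn[of i] by (simp add: u_def min_absorb1)
      next
        case 2
        then have "m \<le> t (Suc i)" using tb(3)[of i] by linarith
        then show ?thesis using 2 nn[of i] by (simp add: v_def max_absorb1)
      next
        case 3 then show ?thesis using tb[of i] tb[of "Suc i"] assms
          by (simp add: u_def v_def min_def max_def sdist_triangle unit)
      qed
    qed
    then have "(\<Sum>i<n. sdist (g (t i)) (g (t (Suc i)))) \<le> chain_sum g (u, n) + chain_sum g (v, n)"
      unfolding chain_sum_def by (simp add: sum.distrib[symmetric] sum_mono)
    then have "ennreal (\<Sum>i<n. sdist (g (t i)) (g (t (Suc i)))) \<le> ennreal (chain_sum g (u, n)) + ennreal (chain_sum g (v, n))"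
      using nn by (subst ennreal_plus[symmetric]) (auto simp: chain_sum_def intro!: sum_nonneg ennreal_leI)
    also have "\<dots> \<le> curve_length a m g + curve_length m b g"
      unfolding curve_length_eq by (intro add_mono SUP_upper u v)
    finally show "ennreal (\<Sum>i<n. sdist (g (t i)) (g (t (Suc i)))) \<le> curve_length a m g + curve_length m b g" .
  qed
  have *: "ennreal (chain_sum g p) + ennreal (chain_sum g q) \<le> curve_length a b g"
    if p: "p \<in> chains a m" and q: "q \<in> chains m b" for p q
  proof -
    obtain t n where p_eq: "p = (t, n)" by (cases p)
    obtain u k where q_eq: "q = (u, k)" by (cases q)
    have t: "incseq t" "\<And>i. a \<le> t i" "\<And>i. t i \<le> m" using p by (auto simp: chains_def p_eq subset_eq)
    have u: "incseq u" "\<And>i. m \<le> u i" "\<And>i. u i \<le> b" using q by (auto simp: chains_def q_eq subset_eq)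
    define w where "w = (\<lambda>i. if i \<le> n then t i else u (i - Suc n))"
    have w: "(w, Suc (n + k)) \<in> chains a b"
    proof -
      have "incseq w"
        unfolding incseq_def w_def
      proof (intro allI impI)
        fix i j :: nat assume ij: "i \<le> j"
        show "(if i \<le> n then t i else u (i - Suc n)) \<le> (if j \<le> n then t j else u (j - Suc n))"
          using ij t(1) u(1) order_trans[OF t(3)[of i] u(2)[of "j - Suc n"]] unfolding incseq_def by auto
      qed
      moreover have "range w \<subseteq> {a..b}"
        using t u assms(1,2) order_trans[OF t(3) assms(2)] order_trans[OF assms(1) u(2)] unfolding w_def by auto
      ultimately show ?thesis by (simp add: chains_def)
    qed
    have wr: "a \<le> w i" "w i \<le> b" for i using w by (auto simp: chains_def subset_eq)
    have "chain_sum g p + chain_sum g q \<le> chain_sum g (w, Suc (n + k))"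
    proof -
      have "chain_sum g (w, Suc (n + k)) = (\<Sum>i<n. sdist (g (w i)) (g (w (Suc i)))) + (\<Sum>i<Suc k. sdist (g (w (i + n))) (g (w (Suc (i + n)))))"
        unfolding chain_sum_def using sum.atLeastLessThan_concat[of 0 n "n + Suc k" "\<lambda>i. sdist (g (w i)) (g (w (Suc i)))"]
          sum.shift_bounds_nat_ivl[of "\<lambda>i. sdist (g (w i)) (g (w (Suc i)))" 0 n "Suc k"]
        by (simp add: lessThan_atLeast0 add.commute del: sum.op_ivl_Suc)
      also have "(\<Sum>i<n. sdist (g (w i)) (g (w (Suc i)))) = chain_sum g p"
        unfolding chain_sum_def p_eq w_def by (auto intro!: sum.cong)
      also have "(\<Sum>i<Suc k. sdist (g (w (i + n))) (g (w (Suc (i + n))))) =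
         sdist (g (w n)) (g (w (Suc n))) + chain_sum g q"
        unfolding sum.lessThan_Suc_shift chain_sum_def q_eq by (simp add: w_def)
      finally show ?thesis using sdist_bounds(1)[OF unit unit, OF wr wr] by simp
    qed
    moreover have "0 \<le> chain_sum g p" "0 \<le> chain_sum g q"
      unfolding chain_sum_def p_eq q_eq using t u assms
      by (auto intro!: sum_nonneg sdist_bounds unit intro: order_trans)
    ultimately have "ennreal (chain_sum g p) + ennreal (chain_sum g q) \<le> ennreal (chain_sum g (w, Suc (n + k)))"
      by (simp add: ennreal_leI flip: ennreal_plus)
    also have "\<dots> \<le> curve_length a b g" unfolding curve_length_eq by (rule SUP_upper[OF w])
    finally show ?thesis .
  qed
  show "curve_length a m g + curve_length m b g \<le> curve_length a b g"
  proof -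
    have "ennreal (chain_sum g p) + curve_length m b g \<le> curve_length a b g" if "p \<in> chains a m" for p
      using * that ennreal_SUP_add_right[OF chains_nonempty[OF assms(2)],
        of "ennreal (chain_sum g p)" "\<lambda>q. ennreal (chain_sum g q)"]
      unfolding curve_length_eq[of m b] by (metis (no_types, lifting) SUP_least)
    then show ?thesis
      using ennreal_SUP_add_left[OF chains_nonempty[OF assms(1)],
        of "\<lambda>p. ennreal (chain_sum g p)" "curve_length m b g"]
      unfolding curve_length_eq[of a m] by (metis (no_types, lifting) SUP_least)
  qed
qed

lemma curve_length_garc_le:
  assumes "norm p = 1" "norm q = 1" "p \<bullet> q = 0" "0 \<le> r" "r \<le> pi"
  shows "curve_length 0 r (garc p q) \<le> ennreal r"
proof (rule curve_length_leI)
  fix t :: "nat \<Rightarrow> real" and n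
  assume t: "incseq t" "range t \<subseteq> {0..r}"
  have tb: "0 \<le> t i" "t i \<le> r" "t i \<le> t (Suc i)" for i
    using t by (auto simp: subset_eq incseq_def)
  have "\<bar>t i - t (Suc i)\<bar> \<le> pi" for i using tb[of i] tb[of "Suc i"] assms by auto
  then have "(\<Sum>i<n. sdist (garc p q (t i)) (garc p q (t (Suc i)))) = (\<Sum>i<n. t (Suc i) - t i)"
    using assms tb by (intro sum.cong) (auto simp: sdist_garc)
  also have "\<dots> = t n - t 0" by (rule sum_lessThan_telescope)
  also have "\<dots> \<le> r" using tb[of n] tb[of 0] by simp
  finally show "ennreal (\<Sum>i<n. sdist (garc p q (t i)) (garc p q (t (Suc i)))) \<le> ennreal r"
    by (rule ennreal_leI)
qed

lemma garc_of_isometry: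
  assumes "\<And>s t. \<lbrakk>\<bar>s\<bar> < d; \<bar>t\<bar> < d\<rbrakk> \<Longrightarrow> f s \<bullet> f t = cos (s - t)" "0 < d"
  obtains p q where "norm p = 1" "norm q = 1" "p \<bullet> q = 0" "\<And>t. \<bar>t\<bar> < d \<Longrightarrow> f t = garc p q t"
proof -
  define e where "e = min (d / 2) 1"
  have e: "0 < e" "e < d" "e < pi" using assms(2) pi_gt3 unfolding e_def by (auto simp: min_def)
  have se: "0 < sin e" using e by (intro sin_gt_zero) auto
  define p where "p = f 0"
  define q where "q = (1 / sin e) *\<^sub>R (f e - cos e *\<^sub>R p)"
  have pp: "p \<bullet> p = 1" unfolding p_def using assms(1)[of 0 0] assms(2) by simp
  have ee: "f e \<bullet> f e = 1" "f e \<bullet> p = cos e" unfolding p_def using assms(1)[of e e] assms(1)[of e 0] e by auto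
  have pq: "p \<bullet> q = 0" unfolding q_def using pp ee by (simp add: inner_diff inner_commute)
  have "(f e - cos e *\<^sub>R p) \<bullet> (f e - cos e *\<^sub>R p) = (sin e)\<^sup>2"
    using pp ee by (simp add: inner_diff inner_commute power2_eq_square sin_squared_eq[unfolded power2_eq_square])
  then have qq: "q \<bullet> q = 1" unfolding q_def using se by (simp add: power2_eq_square)
  have "f t = garc p q t" if t: "\<bar>t\<bar> < d" for t
  proof -
    have tp: "f t \<bullet> p = cos t" unfolding p_def using assms(1)[of t 0] t assms(2) by simp
    have te: "f t \<bullet> f e = cos (t - e)" using assms(1)[of t e] t e by simp
    have tq: "f t \<bullet> q = sin t"
      unfolding q_def using te tp se by (simp add: inner_diff cos_diff field_simps)
    have tt: "f t \<bullet> f t = 1" using assms(1)[of t t] t by simp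
    have "(f t - garc p q t) \<bullet> (f t - garc p q t) = 1 - (cos t)\<^sup>2 - (sin t)\<^sup>2"
      unfolding garc_def using tt tp tq pp qq pq
      by (simp add: inner_diff inner_add inner_commute power2_eq_square algebra_simps)
    also have "1 - (cos t)\<^sup>2 - (sin t)\<^sup>2 = 0" using sin_cos_squared_add[of t] by linarith
    finally show ?thesis by simp
  qed
  then show ?thesis using that[of p q] pp qq pq by (simp add: norm_eq_1)
qed

lemma intrinsic_dist_le_path:
  assumes "a \<le> b" "continuous_on {a..b} g" "g ` {a..b} \<subseteq> S"
  shows "intrinsic_dist S (g a) (g b) \<le> curve_length a b g"
proof -
  define p where "p = (\<lambda>t. g ((b - a) * t + a))"
  have rng: "(b - a) * t + a \<in> {a..b}" if "t \<in> {0..1}" for t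
  proof -
    have "0 \<le> (b - a) * t" "(b - a) * t \<le> (b - a) * 1"
      using that assms by (auto simp del: mult_1_right intro!: mult_left_mono)
    then show ?thesis by auto
  qed
  have "path p" unfolding path_def p_def
    by (rule continuous_on_compose2[OF assms(2)]) (auto intro!: continuous_intros rng)
  moreover have "path_image p \<subseteq> S" unfolding path_image_def p_def using rng assms(3) by blast
  moreover have "pathstart p = g a" "pathfinish p = g b" by (auto simp: p_def pathstart_def pathfinish_def)
  ultimately have "intrinsic_dist S (g a) (g b) \<le> curve_length 0 1 p"
    unfolding intrinsic_dist_def by (intro INF_lower) auto
  also have "\<dots> \<le> curve_length a b g" unfolding p_def
    using assms(1) rng by (intro curve_length_reparam) (auto simp: mono_on_def intro!: mult_left_mono)
  finally show ?thesis .
qed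

lemma intrinsic_dist_commute: "intrinsic_dist S x y = intrinsic_dist S y x"
proof -
  have *: "intrinsic_dist S y x \<le> intrinsic_dist S x y" for x y
    unfolding intrinsic_dist_def
  proof (rule INF_mono)
    fix p assume p: "p \<in> {p. path p \<and> path_image p \<subseteq> S \<and> pathstart p = x \<and> pathfinish p = y}"
    have "curve_length 0 1 (reversepath p) = curve_length 0 1 (\<lambda>t. (\<lambda>u. p (1 * u + 1)) (- t))"
      by (rule curve_length_cong) (simp add: reversepath_def)
    also have "\<dots> = curve_length 0 1 p"
      by (subst curve_length_reverse, subst curve_length_affine) auto
    finally have "curve_length 0 1 (reversepath p) \<le> curve_length 0 1 p" by simp
    then show "\<exists>q\<in>{p. path p \<and> path_image p \<subseteq> S \<and> pathstart p = y \<and> pathfinish p = x}.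
        curve_length 0 1 q \<le> curve_length 0 1 p"
      using p by (intro bexI[of _ "reversepath p"]) auto
  qed
  show ?thesis by (rule antisym[OF * *])
qed

lemma INF_ennreal_add_right:
  fixes f :: "'i \<Rightarrow> ennreal"
  assumes "I \<noteq> {}"
  shows "(INF i\<in>I. f i + c) = (INF i\<in>I. f i) + c"
  using continuous_at_Inf_mono[of "\<lambda>x. x + c" "f ` I"] assms
  using continuous_add[of "at_right (Inf (f ` I))", of "\<lambda>x. x" "\<lambda>x. c"]
  by (auto simp: mono_def image_comp)

lemma INF_ennreal_add_left:
  fixes f :: "'i \<Rightarrow> ennreal"
  assumes "I \<noteq> {}"
  shows "(INF i\<in>I. c + f i) = c + (INF i\<in>I. f i)"
  using INF_ennreal_add_right[OF assms, of f c] by (simp add: ac_simps)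

lemma intrinsic_dist_triangle:
  assumes "S \<subseteq> sphere 0 1"
  shows "intrinsic_dist S x z \<le> intrinsic_dist S x y + intrinsic_dist S y z"
proof -
  define P where "P = (\<lambda>x y. {p. path p \<and> path_image p \<subseteq> S \<and> pathstart p = x \<and> pathfinish p = y})"
  have D: "intrinsic_dist S x y = (INF p\<in>P x y. curve_length 0 1 p)" for x y
    unfolding intrinsic_dist_def P_def ..
  have *: "intrinsic_dist S x z \<le> curve_length 0 1 p + curve_length 0 1 q" if p: "p \<in> P x y" and q: "q \<in> P y z" for p q
  proof -
    have pq: "path (p +++ q)" "path_image (p +++ q) \<subseteq> S" using p q unfolding P_def by (auto simp: path_image_join)
    then have "intrinsic_dist S ((p +++ q) 0) ((p +++ q) 1) \<le> curve_length 0 1 (p +++ q)"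
      by (intro intrinsic_dist_le_path) (auto simp: path_def path_image_def)
    moreover have "(p +++ q) 0 = x" "(p +++ q) 1 = z"
      using p q unfolding P_def by (auto simp: joinpaths_def pathstart_def pathfinish_def)
    moreover have "curve_length 0 1 (p +++ q) = curve_length 0 (1/2) (p +++ q) + curve_length (1/2) 1 (p +++ q)"
    proof (rule curve_length_add)
      fix t :: real assume "0 \<le> t" "t \<le> 1"
      then have "(p +++ q) t \<in> S" using pq(2) unfolding path_image_def by auto
      then show "norm ((p +++ q) t) = 1" using assms by auto
    qed auto
    moreover have "curve_length 0 (1/2) (p +++ q) = curve_length 0 1 p"
    proof -
      have "curve_length 0 (1/2) (p +++ q) = curve_length 0 (1/2) (\<lambda>t. p (2 * t + 0))"
        by (rule curve_length_cong) (auto simp: joinpaths_def)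
      then show ?thesis by (subst (asm) curve_length_affine) auto
    qed
    moreover have "curve_length (1/2) 1 (p +++ q) = curve_length 0 1 q"
    proof -
      have "curve_length (1/2) 1 (p +++ q) = curve_length (1/2) 1 (\<lambda>t. q (2 * t + (-1)))"
        using p q unfolding P_def
        by (intro curve_length_cong) (auto simp: joinpaths_def pathstart_def pathfinish_def field_simps)
      then show ?thesis by (subst (asm) curve_length_affine) auto
    qed
    ultimately show ?thesis by simp
  qed
  show ?thesis
  proof (cases "P x y = {} \<or> P y z = {}")
    case True
    then show ?thesis by (auto simp: D[of x y] D[of y z] top_add)
  next
    case False
    have "intrinsic_dist S x z \<le> (INF p\<in>P x y. curve_length 0 1 p + (INF q\<in>P y z. curve_length 0 1 q))"
    proof (rule INF_greatest)
      fix p assume "p \<in> P x y"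
      then have "intrinsic_dist S x z \<le> (INF q\<in>P y z. curve_length 0 1 p + curve_length 0 1 q)"
        by (intro INF_greatest *)
      then show "intrinsic_dist S x z \<le> curve_length 0 1 p + (INF q\<in>P y z. curve_length 0 1 q)"
        using False by (simp add: INF_ennreal_add_left)
    qed
    then show ?thesis using False by (simp add: D[of x y] D[of y z] INF_ennreal_add_right)
  qed
qed

section \<open>The surface of a regular tetrahedron\<close>

text \<open>Here \<open>c\<close> is the cosine of the edge length; \<open>cos_alpha\<close> is the spherical law of cosines in a face.\<close>

locale regular_tetra =
  fixes V :: "(real ^ 4) set" and c \<alpha> :: real
  assumes card_V: "card V = 4" and indep_V: "independent V"
    and norm_V: "w \<in> V \<Longrightarrow> norm w = 1"
    and inner_V: "\<lbrakk>w \<in> V; w' \<in> V; w \<noteq> w'\<rbrakk> \<Longrightarrow> w \<bullet> w' = c"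
    and c_bounds: "- 1 < 3 * c" "c < 1"
    and cos_alpha: "(1 + c) * cos \<alpha> = c"
    and alpha_bounds: "pi / 3 < \<alpha>" "\<alpha> < 2 * pi / 3"
begin

lemma finite_V: "finite V"
  using card_V by (metis card.infinite zero_neq_numeral)

lemma c1_pos: "0 < 1 + c" "0 < 1 - c" "0 < 1 + 3 * c"
  using c_bounds by auto

definition vsum :: "real ^ 4" where "vsum = \<Sum>V"

definition dual :: "real ^ 4 \<Rightarrow> real ^ 4" where
  "dual w = (1 / (1 - c)) *\<^sub>R (w - (c / (1 + 3 * c)) *\<^sub>R vsum)"

definition bary :: "real ^ 4 \<Rightarrow> real ^ 4 \<Rightarrow> real" where
  "bary w x = x \<bullet> dual w"

lemma bary_add [simp]: "bary w (x + y) = bary w x + bary w y"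
  and bary_diff [simp]: "bary w (x - y) = bary w x - bary w y"
  and bary_scaleR [simp]: "bary w (r *\<^sub>R x) = r * bary w x"
  and bary_minus [simp]: "bary w (- x) = - bary w x"
  and bary_zero [simp]: "bary w 0 = 0"
  by (auto simp: bary_def inner_add_left inner_diff_left)

lemma bary_sum: "bary w (sum f A) = (\<Sum>x\<in>A. bary w (f x))"
  by (simp add: bary_def inner_sum_left)

lemma continuous_on_bary [continuous_intros]:
  "continuous_on A f \<Longrightarrow> continuous_on A (\<lambda>t. bary w (f t))"
  unfolding bary_def by (intro continuous_intros)

lemma V_rest:
  assumes "k \<in> V" "l \<in> V" "k \<noteq> l"
  obtains i j where "i \<in> V" "j \<in> V" "distinct [i, j, k, l]" "V = {i, j, k, l}"
proof -
  have "card (V - {k, l}) = 2"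
    using assms card_V finite_V by (subst card_Diff_subset) auto
  then obtain i j where ij: "V - {k, l} = {i, j}" "i \<noteq> j" by (auto simp: card_2_iff)
  then have "V = {i, j, k, l}" using assms by blast
  moreover have "i \<notin> {k, l}" "j \<notin> {k, l}" using ij(1) by blast+
  ultimately show ?thesis using ij(2) assms by (intro that[of i j]) auto
qed

lemma sum_V:
  assumes "V = {i, j, k, l}" "distinct [i, j, k, l]"
  shows "sum f V = f i + f j + f k + f l"
  using assms by (simp add: add.assoc)

lemma V_third:
  assumes "k \<in> V" "l \<in> V"
  obtains i where "i \<in> V" "i \<noteq> k" "i \<noteq> l"
proof -
  have "\<not> V \<subseteq> {k, l}"
  proof
    assume "V \<subseteq> {k, l}"
    then have "card V \<le> card {k, l}" by (intro card_mono) auto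
    then show False using card_V by (simp add: card_insert_if split: if_splits)
  qed
  then show ?thesis using that by blast
qed

lemma inner_vsum: "w \<in> V \<Longrightarrow> w \<bullet> vsum = 1 + 3 * c"
proof -
  assume w: "w \<in> V"
  have "w \<bullet> vsum = (\<Sum>v\<in>V. w \<bullet> v)" unfolding vsum_def by (rule inner_sum_right)
  also have "\<dots> = w \<bullet> w + (\<Sum>v\<in>V - {w}. w \<bullet> v)" using w finite_V by (rule sum.remove[rotated])
  also have "(\<Sum>v\<in>V - {w}. w \<bullet> v) = (\<Sum>v\<in>V - {w}. c)" using w by (intro sum.cong) (auto simp: inner_V)
  also have "\<dots> = 3 * c" using w card_V finite_V by simp
  also have "w \<bullet> w = 1" using norm_V[OF w] by (simp add: norm_eq_1)
  finally show ?thesis .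
qed

lemma bary_V:
  assumes "w \<in> V" "w' \<in> V"
  shows "bary w w' = (if w = w' then 1 else 0)"
proof -
  have "bary w w' = (w' \<bullet> w - c) / (1 - c)"
    unfolding bary_def dual_def using inner_vsum[OF assms(2)] c1_pos by (simp add: inner_diff_right)
  also have "w' \<bullet> w = (if w = w' then 1 else c)"
    using assms norm_V[OF assms(1)] inner_V by (auto simp: norm_eq_1)
  finally show ?thesis using c1_pos by auto
qed

lemma bary_self [simp]: "w \<in> V \<Longrightarrow> bary w w = 1"
  and bary_other [simp]: "\<lbrakk>w \<in> V; w' \<in> V; w \<noteq> w'\<rbrakk> \<Longrightarrow> bary w w' = 0"
  by (simp_all add: bary_V)

lemma bary_expand: "(\<Sum>w\<in>V. bary w x *\<^sub>R w) = x"
proof -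
  have "dim V = DIM(real ^ 4)"
    using indep_V card_V by (simp add: dim_eq_card_independent)
  then have "span V = UNIV" by (simp only: dim_eq_full)
  moreover have "linear (\<lambda>x. \<Sum>w\<in>V. bary w x *\<^sub>R w)"
    by (intro linear_compose_sum linearI ballI) (simp_all add: scaleR_add_left)
  moreover have "linear (\<lambda>x::real ^ 4. x)" by (rule linear_ident)
  moreover have "(\<Sum>w\<in>V. bary w v *\<^sub>R w) = v" if v: "v \<in> V" for v
  proof -
    have "(\<Sum>w\<in>V. bary w v *\<^sub>R w) = (\<Sum>w\<in>V. if w = v then v else 0)"
      by (rule sum.cong) (use v in \<open>auto simp: bary_V\<close>)
    then show ?thesis using v finite_V by simp
  qed
  ultimately show ?thesis
    using linear_eq_on_span[of "\<lambda>x. \<Sum>w\<in>V. bary w x *\<^sub>R w" "\<lambda>x. x" V x] by simp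
qed

lemma bary_expand4:
  assumes "V = {i, j, k, l}" "distinct [i, j, k, l]"
  shows "x = bary i x *\<^sub>R i + bary j x *\<^sub>R j + bary k x *\<^sub>R k + bary l x *\<^sub>R l"
  using bary_expand[of x, symmetric] unfolding sum_V[OF assms] .

lemma bary_eqI: "(\<And>w. w \<in> V \<Longrightarrow> bary w x = bary w y) \<Longrightarrow> x = y"
proof -
  assume *: "\<And>w. w \<in> V \<Longrightarrow> bary w x = bary w y"
  have "(\<Sum>w\<in>V. bary w x *\<^sub>R w) = (\<Sum>w\<in>V. bary w y *\<^sub>R w)"
    by (rule sum.cong) (simp_all add: *)
  then show "x = y" by (simp add: bary_expand)
qed

definition \<kappa> :: real where "\<kappa> = 2 * cos \<alpha>"

lemma kappa: "(1 + c) * \<kappa> = 2 * c"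
  using cos_alpha by (simp add: \<kappa>_def)

definition \<xi> :: "real ^ 4 \<Rightarrow> real ^ 4 \<Rightarrow> real ^ 4" where
  "\<xi> k l = k + l - \<kappa> *\<^sub>R (vsum - k - l)"

lemma xi_commute: "\<xi> k l = \<xi> l k"
  by (simp add: \<xi>_def algebra_simps)

lemma bary_vsum: "w \<in> V \<Longrightarrow> bary w vsum = 1"
  unfolding vsum_def by (subst bary_sum) (use finite_V in \<open>simp add: bary_V\<close>)

lemma bary_xi:
  assumes "k \<in> V" "l \<in> V" "k \<noteq> l" "w \<in> V"
  shows "bary w (\<xi> k l) = (if w = k \<or> w = l then 1 else - \<kappa>)"
  using assms by (auto simp: \<xi>_def bary_vsum bary_V)

lemma xi_eq_dual:
  "\<xi> k l = ((1 + \<kappa>) * (1 - c)) *\<^sub>R (dual k + dual l)"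
proof -
  have "(1 + \<kappa>) * (2 * c) = \<kappa> * (1 + 3 * c)"
    using kappa by (simp add: algebra_simps)
  then have "(1 + \<kappa>) * (2 * c) / (1 + 3 * c) = \<kappa>"
    using c1_pos by simp
  then have "(1 + \<kappa>) * (c / (1 + 3 * c) + c / (1 + 3 * c)) = \<kappa>"
    by simp
  then have *: "(1 + \<kappa>) *\<^sub>R ((c / (1 + 3 * c)) *\<^sub>R vsum + (c / (1 + 3 * c)) *\<^sub>R vsum) = \<kappa> *\<^sub>R vsum"
    by (simp only: scaleR_left_distrib[symmetric] scaleR_scaleR)
  have "((1 + \<kappa>) * (1 - c)) *\<^sub>R (dual k + dual l) =
     (1 + \<kappa>) *\<^sub>R (k + l) - (1 + \<kappa>) *\<^sub>R ((c / (1 + 3 * c)) *\<^sub>R vsum + (c / (1 + 3 * c)) *\<^sub>R vsum)"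
    unfolding dual_def using c1_pos by (simp add: scaleR_add_right scaleR_diff_right)
  then show ?thesis unfolding * \<xi>_def by (simp add: scaleR_add_left scaleR_diff_right scaleR_add_right)
qed

lemma inner_xi: "\<xi> k l \<bullet> y = (1 + \<kappa>) * (1 - c) * (bary k y + bary l y)"
  by (simp add: xi_eq_dual bary_def inner_add_left inner_add_right inner_commute)

lemma inner_xi_right: "y \<bullet> \<xi> k l = (1 + \<kappa>) * (1 - c) * (bary k y + bary l y)"
  by (subst inner_commute) (rule inner_xi)

text \<open>Folding the two faces missing \<open>l\<close> and missing \<open>k\<close> flat into the great sphere of the former is
  the restriction of a single linear map.\<close>

definition unfold_map :: "real ^ 4 \<Rightarrow> real ^ 4 \<Rightarrow> real ^ 4 \<Rightarrow> real ^ 4" where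
  "unfold_map k l x = x - bary l x *\<^sub>R \<xi> k l"

lemma unfold_map_id: "bary l x = 0 \<Longrightarrow> unfold_map k l x = x"
  by (simp add: unfold_map_def)

lemma unfold_map_linear:
  "unfold_map k l (r *\<^sub>R x + s *\<^sub>R y) = r *\<^sub>R unfold_map k l x + s *\<^sub>R unfold_map k l y"
  by (simp add: unfold_map_def scaleR_add_left scaleR_diff_right scaleR_add_right)

lemma continuous_on_unfold_map [continuous_intros]:
  "continuous_on A f \<Longrightarrow> continuous_on A (\<lambda>t. unfold_map k l (f t))"
  unfolding unfold_map_def by (intro continuous_intros)

lemma bary_unfold_map:
  assumes "k \<in> V" "l \<in> V" "k \<noteq> l"
  shows "bary l (unfold_map k l x) = 0" "bary k (unfold_map k l x) = bary k x - bary l x"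
    "\<lbrakk>w \<in> V; w \<noteq> k; w \<noteq> l\<rbrakk> \<Longrightarrow> bary w (unfold_map k l x) = bary w x + \<kappa> * bary l x"
  using assms by (auto simp: unfold_map_def bary_xi)

lemma unfold_map_inner:
  assumes "k \<in> V" "l \<in> V" "k \<noteq> l" "(bary k x = 0 \<and> bary k y = 0) \<or> (bary l x = 0 \<and> bary l y = 0)"
  shows "unfold_map k l x \<bullet> unfold_map k l y = x \<bullet> y"
  using assms(4)
proof
  assume k: "bary k x = 0 \<and> bary k y = 0"
  have "\<xi> k l \<bullet> \<xi> k l = (1 + \<kappa>) * (1 - c) * 2" using assms by (simp add: inner_xi bary_xi)
  then show ?thesis using k
    by (simp add: unfold_map_def inner_diff inner_xi inner_xi_right bary_xi assms algebra_simps)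
next
  assume "bary l x = 0 \<and> bary l y = 0"
  then show ?thesis by (simp add: unfold_map_id)
qed

lemma unfold_map_norm:
  assumes "k \<in> V" "l \<in> V" "k \<noteq> l" "bary k x = 0 \<or> bary l x = 0"
  shows "norm (unfold_map k l x) = norm x"
  using unfold_map_inner[OF assms(1-3), of x x] assms(4) by (auto simp: norm_eq_sqrt_inner)

definition face :: "real ^ 4 \<Rightarrow> (real ^ 4) set" where
  "face f = {x. norm x = 1 \<and> (\<forall>w\<in>V. 0 \<le> bary w x) \<and> bary f x = 0}"

definition surface :: "(real ^ 4) set" where
  "surface = {x. norm x = 1 \<and> (\<forall>w\<in>V. 0 \<le> bary w x) \<and> (\<exists>f\<in>V. bary f x = 0)}"

lemma surface_eq_faces: "surface = (\<Union>f\<in>V. face f)"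
  by (auto simp: surface_def face_def)

lemma spherical_hull_eq_face:
  assumes "f \<in> V"
  shows "spherical_hull (V - {f}) = face f"
proof -
  define C where "C = {x. (\<forall>w\<in>V. 0 \<le> bary w x) \<and> bary f x = 0}"
  have "convex_cone C"
    unfolding convex_cone_def convex_def conic_def C_def by (auto intro!: exI[of _ 0])
  moreover have "V - {f} \<subseteq> C" using assms by (auto simp: C_def bary_V)
  ultimately have 1: "convex_cone hull (V - {f}) \<subseteq> C" by (rule hull_minimal[rotated])
  have 2: "x \<in> convex_cone hull (V - {f})" if x: "x \<in> C" for x
  proof -
    have "x = (\<Sum>w\<in>V. bary w x *\<^sub>R w)" by (simp add: bary_expand)
    also have "\<dots> = bary f x *\<^sub>R f + (\<Sum>w\<in>V - {f}. bary w x *\<^sub>R w)"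
      using assms finite_V by (rule sum.remove[rotated])
    also have "\<dots> = (\<Sum>w\<in>V - {f}. bary w x *\<^sub>R w)" using x by (simp add: C_def)
    finally have x_eq: "x = (\<Sum>w\<in>V - {f}. bary w x *\<^sub>R w)" .
    have "(\<Sum>w\<in>B. bary w x *\<^sub>R w) \<in> convex_cone hull (V - {f})" if "B \<subseteq> V - {f}" "finite B" for B
      using that(2,1)
    proof induction
      case empty
      then show ?case by (simp add: convex_cone_hull_contains_0)
    next
      case (insert b B)
      then have "bary b x *\<^sub>R b \<in> convex_cone hull (V - {f})"
        using x by (intro convex_cone_hull_mul hull_inc) (auto simp: C_def)
      then show ?case using insert by (auto intro!: convex_cone_hull_add)
    qed
    from this[of "V - {f}"] show ?thesis using x_eq finite_V by simp
  qed
  have "face f = sphere 0 1 \<inter> C" unfolding face_def C_def by auto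
  then show ?thesis unfolding spherical_hull_def using 1 2 by auto
qed

lemma tetrahedron_surface_eq: "tetrahedron_surface V = surface"
  unfolding tetrahedron_surface_def surface_eq_faces by (auto simp: spherical_hull_eq_face)

lemma surface_subset_sphere: "surface \<subseteq> sphere 0 1"
  by (auto simp: surface_def)

lemma surface_norm: "x \<in> surface \<Longrightarrow> norm x = 1"
  by (auto simp: surface_def)

lemma V_subset_surface: "V \<subseteq> surface"
proof
  fix w assume w: "w \<in> V"
  obtain f where "f \<in> V" "f \<noteq> w" using V_third[OF w w] by blast
  then show "w \<in> surface" using w norm_V by (auto simp: surface_def bary_V)
qed

lemma surface_antipode: "x \<in> surface \<Longrightarrow> y \<in> surface \<Longrightarrow> y \<noteq> - x"
proof
  assume xy: "x \<in> surface" "y \<in> surface" "y = - x"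
  then have "bary w x = bary w 0" if "w \<in> V" for w using that by (force simp: surface_def)
  then have "x = 0" by (rule bary_eqI)
  then show False using xy by (simp add: surface_def)
qed

lemma face_subset: "f \<in> V \<Longrightarrow> face f \<subseteq> surface"
  by (auto simp: surface_eq_faces)

lemma face_arc:
  assumes "x \<in> face f" "y \<in> face f" "f \<in> V"
  shows "intrinsic_dist surface x y \<le> ennreal (sdist x y)"
proof -
  have xy: "norm x = 1" "norm y = 1" "x \<in> surface" "y \<in> surface"
    using assms face_subset[of f] by (auto simp: face_def)
  show ?thesis
  proof (cases "x = y")
    case True
    have "intrinsic_dist surface x y \<le> curve_length 0 1 (\<lambda>_. x)"
      using intrinsic_dist_le_path[of 0 1 "\<lambda>_. x" surface] xy True by auto
    also have "\<dots> \<le> 0"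
      by (rule curve_length_leI) (simp add: sdist_refl xy)
    finally show ?thesis by simp
  next
    case False
    obtain q where q: "norm q = 1" "x \<bullet> q = 0" "y = garc x q (sdist x y)" "0 < sdist x y" "sdist x y < pi"
      and sg: "\<And>t. sin (sdist x y) *\<^sub>R garc x q t = sin (sdist x y - t) *\<^sub>R x + sin t *\<^sub>R y"
      using arc_exists[OF xy(1,2) False] surface_antipode[OF xy(3,4)] by metis
    have sp: "0 < sin (sdist x y)" using q by (intro sin_gt_zero) auto
    have "garc x q t \<in> face f" if t: "t \<in> {0..sdist x y}" for t
    proof -
      have "0 \<le> sin (sdist x y - t)" "0 \<le> sin t" using t q by (auto intro!: sin_ge_zero)
      moreover have "sin (sdist x y) * bary w (garc x q t) = sin (sdist x y - t) * bary w x + sin t * bary w y" for w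
        using arg_cong[OF sg[of t], of "bary w"] by simp
      ultimately have "0 \<le> sin (sdist x y) * bary w (garc x q t)" if "w \<in> V" for w
        using that assms by (simp add: face_def)
      moreover have "sin (sdist x y) * bary f (garc x q t) = 0"
        using \<open>\<And>w. sin (sdist x y) * bary w (garc x q t) = _\<close>[of f] assms by (simp add: face_def)
      ultimately show ?thesis using sp norm_garc[OF xy(1) q(1,2)]
        by (auto simp: face_def zero_le_mult_iff)
    qed
    then have "intrinsic_dist surface (garc x q 0) (garc x q (sdist x y)) \<le> curve_length 0 (sdist x y) (garc x q)"
      using q face_subset[OF assms(3)] by (intro intrinsic_dist_le_path) (auto intro!: continuous_intros)
    also have "\<dots> \<le> ennreal (sdist x y)" using xy q by (intro curve_length_garc_le) auto
    also have "garc x q 0 = x" by (simp add: garc_def)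
    finally show ?thesis using q(3) by simp
  qed
qed

lemma intrinsic_dist_finite:
  assumes "x \<in> surface" "y \<in> surface"
  shows "intrinsic_dist surface x y < top"
proof -
  obtain f f' where f: "f \<in> V" "x \<in> face f" and f': "f' \<in> V" "y \<in> face f'"
    using assms by (auto simp: surface_eq_faces)
  obtain u where u: "u \<in> V" "u \<noteq> f" "u \<noteq> f'" using V_third[OF f(1) f'(1)] by blast
  then have uf: "u \<in> face f" "u \<in> face f'" using f f' norm_V by (auto simp: face_def bary_V)
  have "intrinsic_dist surface x y \<le> intrinsic_dist surface x u + intrinsic_dist surface u y"
    by (rule intrinsic_dist_triangle[OF surface_subset_sphere])
  also have "\<dots> \<le> ennreal (sdist x u) + ennreal (sdist u y)"
    by (intro add_mono face_arc[OF f(2) uf(1) f(1)] face_arc[OF uf(2) f'(2) f'(1)])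
  also have "\<dots> < top" by simp
  finally show ?thesis .
qed

lemma bary_pos_exists: "x \<in> surface \<Longrightarrow> \<exists>w\<in>V. 0 < bary w x"
proof (rule ccontr)
  assume x: "x \<in> surface" and "\<not> (\<exists>w\<in>V. 0 < bary w x)"
  then have "bary w x = bary w 0" if "w \<in> V" for w using that by (force simp: surface_def)
  then have "x = 0" by (rule bary_eqI)
  then show False using x by (simp add: surface_def)
qed

lemma nonvertex_two_pos:
  assumes "x \<in> surface" "x \<notin> V"
  obtains i j where "i \<in> V" "j \<in> V" "i \<noteq> j" "0 < bary i x" "0 < bary j x"
proof -
  obtain i where i: "i \<in> V" "0 < bary i x" using bary_pos_exists[OF assms(1)] by blast
  have "\<exists>j\<in>V. j \<noteq> i \<and> 0 < bary j x"
  proof (rule ccontr)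
    assume "\<not> ?thesis"
    then have "bary w x = bary w (bary i x *\<^sub>R i)" if "w \<in> V" for w
      using that i assms by (force simp: surface_def bary_V)
    then have x: "x = bary i x *\<^sub>R i" by (rule bary_eqI)
    then have "norm x = bary i x" using i norm_V[OF i(1)] by (metis abs_of_pos mult.right_neutral norm_scaleR)
    then have "x = i" using x assms by (simp add: surface_def)
    then show False using i assms by simp
  qed
  then show ?thesis using that i by blast
qed

end

section \<open>Directions at a vertex\<close>

context regular_tetra
begin

definition tang :: "real ^ 4 \<Rightarrow> real ^ 4 \<Rightarrow> real ^ 4" where
  "tang v w = (1 / sqrt (1 - c\<^sup>2)) *\<^sub>R (w - c *\<^sub>R v)"

lemma c_sq: "c\<^sup>2 < 1"
  using c_bounds by (simp add: power2_less_1_iff abs_square_less_1[symmetric] abs_less_iff)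

lemma alpha_range: "0 < \<alpha>" "\<alpha> < pi" "pi < 3 * \<alpha>" "3 * \<alpha> < 2 * pi"
  using alpha_bounds pi_gt_zero by linarith+

lemma sin_alpha_pos: "0 < sin \<alpha>"
  using alpha_range by (intro sin_gt_zero) auto

lemma inner_V_self: "w \<in> V \<Longrightarrow> w \<bullet> w = 1"
  using norm_V by (simp add: norm_eq_1)

lemma tang_inner_vertex:
  assumes "v \<in> V" "w \<in> V" "v \<noteq> w"
  shows "v \<bullet> tang v w = 0"
  using assms by (simp add: tang_def inner_diff inner_V inner_V_self)

lemma tang_inner_self:
  assumes "v \<in> V" "w \<in> V" "v \<noteq> w"
  shows "tang v w \<bullet> tang v w = 1"
proof -
  have "(w - c *\<^sub>R v) \<bullet> (w - c *\<^sub>R v) = 1 - c\<^sup>2"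
    using assms inner_V[of v w] inner_commute[of w v]
    by (simp add: inner_diff inner_V_self power2_eq_square algebra_simps)
  moreover have "sqrt (1 - c\<^sup>2) * sqrt (1 - c\<^sup>2) = 1 - c\<^sup>2" using c_sq by simp
  ultimately show ?thesis using c_sq by (simp add: tang_def)
qed

lemma tang_inner:
  assumes "v \<in> V" "w \<in> V" "u \<in> V" "distinct [v, w, u]"
  shows "tang v w \<bullet> tang v u = cos \<alpha>"
proof -
  have "(w - c *\<^sub>R v) \<bullet> (u - c *\<^sub>R v) = c - c\<^sup>2"
    using assms inner_V[of v w] inner_commute[of w v] inner_V[of v u] inner_commute[of u v] inner_V[of w u]
    by (simp add: inner_diff inner_V_self power2_eq_square algebra_simps)
  also have "\<dots> = cos \<alpha> * (1 - c\<^sup>2)"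
  proof -
    have "c * (1 - c) = ((1 + c) * cos \<alpha>) * (1 - c)" by (simp only: cos_alpha)
    then show ?thesis by (simp add: power2_eq_square algebra_simps)
  qed
  finally have "(w - c *\<^sub>R v) \<bullet> (u - c *\<^sub>R v) = cos \<alpha> * (1 - c\<^sup>2)" .
  moreover have "sqrt (1 - c\<^sup>2) * sqrt (1 - c\<^sup>2) = 1 - c\<^sup>2" using c_sq by simp
  ultimately show ?thesis using c_sq by (simp add: tang_def)
qed

definition cyc3 :: "'a \<Rightarrow> 'a \<Rightarrow> 'a \<Rightarrow> int \<Rightarrow> 'a" where
  "cyc3 p q r j = (if j mod 3 = 0 then p else if j mod 3 = 1 then q else r)"

lemma cyc3_period [simp]: "cyc3 p q r (j + 3) = cyc3 p q r j" "cyc3 p q r (j + 3 * n) = cyc3 p q r j"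
  by (simp_all add: cyc3_def)

lemma cyc3_cases:
  "(cyc3 p q r j, cyc3 p q r (j + 1), cyc3 p q r (j + 2)) \<in> {(p, q, r), (q, r, p), (r, p, q)}"
proof -
  have "(j mod 3 = 0 \<and> (j + 1) mod 3 = 1 \<and> (j + 2) mod 3 = 2) \<or>
        (j mod 3 = 1 \<and> (j + 1) mod 3 = 2 \<and> (j + 2) mod 3 = 0) \<or>
        (j mod 3 = 2 \<and> (j + 1) mod 3 = 0 \<and> (j + 2) mod 3 = 1)" by presburger
  then show ?thesis by (elim disjE conjE) (simp_all add: cyc3_def)
qed

text \<open>The tangent direction at \<open>v\<close> that makes the angle \<open>\<tau>\<close> with the edge to \<open>L 0\<close>, measured within the surface.\<close>

definition linkdir :: "real ^ 4 \<Rightarrow> (int \<Rightarrow> real ^ 4) \<Rightarrow> real \<Rightarrow> real ^ 4" where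
  "linkdir v L \<tau> = (let j = \<lfloor>\<tau> / \<alpha>\<rfloor>; \<beta> = \<tau> - j * \<alpha> in
     (1 / sin \<alpha>) *\<^sub>R (sin (\<alpha> - \<beta>) *\<^sub>R tang v (L j) + sin \<beta> *\<^sub>R tang v (L (j + 1))))"

lemma linkdir_sector:
  fixes j :: int
  assumes "j * \<alpha> \<le> \<tau>" "\<tau> \<le> (j + 1) * \<alpha>"
  shows "linkdir v L \<tau> = (1 / sin \<alpha>) *\<^sub>R (sin ((j + 1) * \<alpha> - \<tau>) *\<^sub>R tang v (L j) + sin (\<tau> - j * \<alpha>) *\<^sub>R tang v (L (j + 1)))"
proof (cases "\<tau> = (j + 1) * \<alpha>")
  case False
  then have "\<lfloor>\<tau> / \<alpha>\<rfloor> = j"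
    using assms alpha_range(1) by (intro floor_unique) (auto simp: field_simps)
  then show ?thesis by (simp add: linkdir_def Let_def algebra_simps)
next
  case True
  then have "\<lfloor>\<tau> / \<alpha>\<rfloor> = j + 1"
    using alpha_range(1) by (intro floor_unique) (auto simp: field_simps)
  then have "linkdir v L \<tau> = (1 / sin \<alpha>) *\<^sub>R (sin \<alpha> *\<^sub>R tang v (L (j + 1)))"
    using True by (simp add: linkdir_def Let_def)
  then show ?thesis using True by (simp add: algebra_simps)
qed

lemma linkdir_period:
  assumes "\<And>j. L (j + 3) = L j"
  shows "linkdir v L (\<tau> + 3 * \<alpha>) = linkdir v L \<tau>"
proof -
  have "\<lfloor>(\<tau> + 3 * \<alpha>) / \<alpha>\<rfloor> = \<lfloor>\<tau> / \<alpha>\<rfloor> + 3"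
    using alpha_range(1) by (simp add: add_divide_distrib)
  moreover have "L (\<lfloor>\<tau> / \<alpha>\<rfloor> + 3 + 1) = L (\<lfloor>\<tau> / \<alpha>\<rfloor> + 1)"
    using assms[of "\<lfloor>\<tau> / \<alpha>\<rfloor> + 1"] by (simp add: add.commute add.left_commute)
  moreover have "\<tau> + 3 * \<alpha> - of_int (\<lfloor>\<tau> / \<alpha>\<rfloor> + 3) * \<alpha> = \<tau> - of_int \<lfloor>\<tau> / \<alpha>\<rfloor> * \<alpha>"
    by (simp add: algebra_simps)
  ultimately show ?thesis unfolding linkdir_def Let_def by (simp only: assms)
qed

lemma linkdir_period_int:
  assumes "\<And>j. L (j + 3) = L j"
  shows "linkdir v L (\<tau> + 3 * \<alpha> * of_int n) = linkdir v L \<tau>"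
proof (induction n rule: int_induct[of _ 0])
  case base
  then show ?case by simp
next
  case (step1 i)
  then show ?case using linkdir_period[of L v "\<tau> + 3 * \<alpha> * of_int i"] assms by (simp add: algebra_simps)
next
  case (step2 i)
  then show ?case using linkdir_period[of L v "\<tau> + 3 * \<alpha> * of_int (i - 1)"] assms by (simp add: algebra_simps)
qed

definition corner :: "real ^ 4 \<Rightarrow> real ^ 4 \<Rightarrow> real ^ 4 \<Rightarrow> real ^ 4 \<Rightarrow> bool" where
  "corner v p q r \<longleftrightarrow> {v, p, q, r} \<subseteq> V \<and> distinct [v, p, q, r]"

lemma corner_V:
  assumes "corner v p q r"
  shows "V = {v, p, q, r}"
proof -
  have "card {v, p, q, r} = 4" using assms by (simp add: corner_def)
  then show ?thesis
    using assms card_V finite_V by (intro card_subset_eq[symmetric]) (simp_all add: corner_def)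
qed

lemma corner_cyc3:
  assumes "corner v p q r"
  shows "corner v (cyc3 p q r j) (cyc3 p q r (j + 1)) (cyc3 p q r (j + 2))"
  using cyc3_cases[of p q r j] assms by (auto simp: corner_def)

lemma cornerD:
  assumes "corner v p q r"
  shows "v \<in> V" "p \<in> V" "q \<in> V" "r \<in> V" "distinct [v, p, q, r]"
  using assms by (auto simp: corner_def)

lemma linkdir_sector_inner:
  fixes j :: int
  assumes "corner v p q r" "j * \<alpha> \<le> \<tau>" "\<tau> \<le> (j + 1) * \<alpha>" "j * \<alpha> \<le> \<tau>'" "\<tau>' \<le> (j + 1) * \<alpha>"
  shows "linkdir v (cyc3 p q r) \<tau> \<bullet> linkdir v (cyc3 p q r) \<tau>' = cos (\<tau> - \<tau>')"
proof -
  let ?L = "cyc3 p q r"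
  note C = cornerD[OF corner_cyc3[OF assms(1), of j]]
  define x y where "x = tang v (?L j)" and "y = tang v (?L (j + 1))"
  have xy: "x \<bullet> x = 1" "y \<bullet> y = 1" "x \<bullet> y = cos \<alpha>" "y \<bullet> x = cos \<alpha>"
    unfolding x_def y_def using C by (auto intro!: tang_inner_self tang_inner)
  define a b where "a = \<tau> - j * \<alpha>" and "b = \<tau>' - j * \<alpha>"
  have e: "(j + 1) * \<alpha> - \<tau> = \<alpha> - a" "(j + 1) * \<alpha> - \<tau>' = \<alpha> - b" "\<tau> - \<tau>' = a - b"
    by (auto simp: a_def b_def algebra_simps)
  have "(sin (\<alpha> - a) *\<^sub>R x + sin a *\<^sub>R y) \<bullet> (sin (\<alpha> - b) *\<^sub>R x + sin b *\<^sub>R y)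
     = sin (\<alpha> - a) * sin (\<alpha> - b) + sin a * sin b + cos \<alpha> * (sin (\<alpha> - a) * sin b + sin a * sin (\<alpha> - b))"
    by (simp add: inner_add xy algebra_simps)
  also have "\<dots> = (sin \<alpha>)\<^sup>2 * cos (a - b)"
  proof -
    have "(cos \<alpha>)\<^sup>2 = 1 - (sin \<alpha>)\<^sup>2" by (simp add: cos_squared_eq)
    then show ?thesis unfolding sin_diff cos_diff by algebra
  qed
  finally show ?thesis
    unfolding linkdir_sector[OF assms(2,3)] linkdir_sector[OF assms(4,5)] e x_def[symmetric] y_def[symmetric]
    using sin_alpha_pos a_def b_def by (simp add: power2_eq_square)
qed

lemma sector_exists:
  obtains j :: int where "j * \<alpha> \<le> \<tau>" "\<tau> < (j + 1) * \<alpha>"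
proof -
  have "\<lfloor>\<tau> / \<alpha>\<rfloor> * \<alpha> \<le> \<tau>" "\<tau> < (\<lfloor>\<tau> / \<alpha>\<rfloor> + 1) * \<alpha>"
    using mult_right_mono[OF of_int_floor_le[of "\<tau> / \<alpha>"], of \<alpha>]
      mult_strict_right_mono[OF real_of_int_floor_add_one_gt[of "\<tau> / \<alpha>"], of \<alpha>] alpha_range(1)
    by simp_all
  then show ?thesis using that[of "\<lfloor>\<tau> / \<alpha>\<rfloor>"] by simp
qed

lemma linkdir_norm: "corner v p q r \<Longrightarrow> norm (linkdir v (cyc3 p q r) \<tau>) = 1"
  using linkdir_sector_inner[of v p q r _ \<tau> \<tau>] sector_exists[of \<tau>]
  by (metis cos_zero diff_self less_eq_real_def norm_eq_1)

lemma linkdir_orth: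
  assumes "corner v p q r"
  shows "v \<bullet> linkdir v (cyc3 p q r) \<tau> = 0"
proof -
  obtain j :: int where j: "j * \<alpha> \<le> \<tau>" "\<tau> < (j + 1) * \<alpha>" by (rule sector_exists)
  note C = cornerD[OF corner_cyc3[OF assms(1), of j]]
  show ?thesis using C j by (subst linkdir_sector[of j]) (auto simp: inner_add_right tang_inner_vertex)
qed

definition near_rad :: real where
  "near_rad = (SOME e. 0 < e \<and> e < pi / 2 \<and> (\<forall>\<rho>. 0 \<le> \<rho> \<and> \<rho> \<le> e \<longrightarrow> 2 * \<bar>c\<bar> * sin \<rho> \<le> sin \<alpha> * sqrt (1 - c\<^sup>2) * cos \<rho>))"

lemma near_rad:
  "0 < near_rad" "near_rad < pi / 2"
  "\<lbrakk>0 \<le> \<rho>; \<rho> \<le> near_rad\<rbrakk> \<Longrightarrow> 2 * \<bar>c\<bar> * sin \<rho> \<le> sin \<alpha> * sqrt (1 - c\<^sup>2) * cos \<rho>"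
proof -
  have "\<exists>e. 0 < e \<and> e < pi / 2 \<and> (\<forall>\<rho>. 0 \<le> \<rho> \<and> \<rho> \<le> e \<longrightarrow> 2 * \<bar>c\<bar> * sin \<rho> \<le> sin \<alpha> * sqrt (1 - c\<^sup>2) * cos \<rho>)"
  proof -
    define f where "f = (\<lambda>\<rho>. sin \<alpha> * sqrt (1 - c\<^sup>2) * cos \<rho> - 2 * \<bar>c\<bar> * sin \<rho>)"
    have "isCont f 0" unfolding f_def by (intro continuous_intros)
    moreover have "0 < f 0" unfolding f_def using sin_alpha_pos c_sq by simp
    ultimately have "\<forall>\<^sub>F x in at 0. 0 < f x"
      unfolding isCont_def by (rule order_tendstoD)
    then obtain d where d: "0 < d" "\<And>x. x \<noteq> 0 \<Longrightarrow> \<bar>x\<bar> < d \<Longrightarrow> 0 < f x"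
      unfolding eventually_at by (auto simp: dist_real_def)
    have "0 < f x" if "\<bar>x\<bar> < d" for x using d(2)[of x] that \<open>0 < f 0\<close> by (cases "x = 0") auto
    then have "2 * \<bar>c\<bar> * sin \<rho> \<le> sin \<alpha> * sqrt (1 - c\<^sup>2) * cos \<rho>" if "0 \<le> \<rho>" "\<rho> \<le> min (d / 2) 1" for \<rho>
      using that d(1) unfolding f_def by (smt (verit, ccfv_SIG) field_sum_of_halves min_le_iff_disj)
    then show ?thesis using d(1) pi_gt3
      by (intro exI[of _ "min (d / 2) 1"]) auto
  qed
  from someI_ex[OF this] show "0 < near_rad" "near_rad < pi / 2"
    "\<lbrakk>0 \<le> \<rho>; \<rho> \<le> near_rad\<rbrakk> \<Longrightarrow> 2 * \<bar>c\<bar> * sin \<rho> \<le> sin \<alpha> * sqrt (1 - c\<^sup>2) * cos \<rho>"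
    unfolding near_rad_def[symmetric] by auto
qed

lemma bary_tang:
  assumes "v \<in> V" "w \<in> V" "u \<in> V" "v \<noteq> w"
  shows "bary u (tang v w) = (if u = w then 1 else if u = v then - c else 0) / sqrt (1 - c\<^sup>2)"
  using assms by (auto simp: tang_def bary_V)

lemma linkdir_near_face:
  fixes j :: int
  assumes "corner v p q r" "j * \<alpha> \<le> \<tau>" "\<tau> \<le> (j + 1) * \<alpha>" "0 \<le> \<rho>" "\<rho> \<le> near_rad"
  shows "garc v (linkdir v (cyc3 p q r) \<tau>) \<rho> \<in> face (cyc3 p q r (j + 2))"
proof -
  let ?L = "cyc3 p q r"
  note C = cornerD[OF corner_cyc3[OF assms(1), of j]]
  note VC = corner_V[OF corner_cyc3[OF assms(1), of j]]
  define s1 s2 where "s1 = sin ((j + 1) * \<alpha> - \<tau>)" and "s2 = sin (\<tau> - j * \<alpha>)"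
  have s: "0 \<le> s1" "0 \<le> s2" "s1 \<le> 1" "s2 \<le> 1"
    unfolding s1_def s2_def using assms alpha_range by (auto intro!: sin_ge_zero simp: algebra_simps)
  have sr: "0 \<le> sin \<rho>" "0 < cos \<rho>" using assms near_rad(2)
    by (auto intro!: sin_ge_zero cos_gt_zero_pi)
  have sq: "0 < sqrt (1 - c\<^sup>2)" using c_sq by simp
  have b: "bary u (garc v (linkdir v ?L \<tau>) \<rho>) = cos \<rho> * bary u v + sin \<rho> * ((s1 * bary u (tang v (?L j)) + s2 * bary u (tang v (?L (j+1)))) / sin \<alpha>)" for u
    unfolding garc_def linkdir_sector[OF assms(2,3)] s1_def s2_def by simp
  have "0 \<le> bary v (garc v (linkdir v ?L \<tau>) \<rho>)"
  proof -
    have bv: "bary v (garc v (linkdir v ?L \<tau>) \<rho>) = cos \<rho> - c * sin \<rho> * (s1 + s2) / (sin \<alpha> * sqrt (1 - c\<^sup>2))"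
      unfolding b using C sin_alpha_pos sq by (simp add: bary_tang field_simps)
    have "c * sin \<rho> * (s1 + s2) \<le> 2 * \<bar>c\<bar> * sin \<rho>"
    proof -
      have "c * sin \<rho> * (s1 + s2) \<le> \<bar>c\<bar> * sin \<rho> * (s1 + s2)" using s sr by (intro mult_right_mono) auto
      also have "\<dots> \<le> \<bar>c\<bar> * sin \<rho> * 2" using s sr by (intro mult_left_mono) auto
      finally show ?thesis by (simp add: algebra_simps)
    qed
    then have "c * sin \<rho> * (s1 + s2) \<le> cos \<rho> * (sin \<alpha> * sqrt (1 - c\<^sup>2))"
      using near_rad(3)[OF assms(4,5)] by (simp add: mult.commute)
    then have "c * sin \<rho> * (s1 + s2) / (sin \<alpha> * sqrt (1 - c\<^sup>2)) \<le> cos \<rho>"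
      using sin_alpha_pos sq by (simp add: pos_divide_le_eq)
    then show ?thesis unfolding bv by simp
  qed
  moreover have "0 \<le> bary u (garc v (linkdir v ?L \<tau>) \<rho>)" if "u \<in> {?L j, ?L (j + 1)}" for u
    using that C s sr sin_alpha_pos sq unfolding b by (auto simp: bary_tang)
  moreover have "bary (?L (j + 2)) (garc v (linkdir v ?L \<tau>) \<rho>) = 0"
    using C unfolding b by (auto simp: bary_tang)
  moreover have "norm (garc v (linkdir v ?L \<tau>) \<rho>) = 1"
    using assms(1) C by (intro norm_garc linkdir_norm linkdir_orth norm_V) auto
  moreover have "u \<in> V \<Longrightarrow> u = v \<or> u \<in> {?L j, ?L (j + 1)} \<or> u = ?L (j + 2)" for u
    using VC by simp
  ultimately show ?thesis unfolding face_def by force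
qed


lemma polar_exists:
  assumes "corner v p q r" "x \<in> surface" "x \<noteq> v" "0 < bary v x"
  obtains \<tau> where "0 \<le> \<tau>" "\<tau> \<le> 3 * \<alpha>" "x = garc v (linkdir v (cyc3 p q r) \<tau>) (sdist v x)" "0 < sdist v x"
proof -
  let ?L = "cyc3 p q r"
  note C0 = cornerD[OF assms(1)]
  obtain f where f: "f \<in> V" "bary f x = 0" using assms(2) by (auto simp: surface_def)
  then have "f \<in> {p, q, r}" using corner_V[OF assms(1)] assms(4) by auto
  then obtain j :: int where j: "f = ?L (j + 2)" "0 \<le> j" "j \<le> 2"
  proof -
    have "?L (0 + 2) = r" "?L (1 + 2) = p" "?L (2 + 2) = q" by (simp_all add: cyc3_def)
    then show ?thesis using \<open>f \<in> {p, q, r}\<close> that[of 0] that[of 1] that[of 2] by auto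
  qed
  note C = cornerD[OF corner_cyc3[OF assms(1), of j]]
  note V_eq = corner_V[OF corner_cyc3[OF assms(1), of j]]
  define P Q where "P = ?L j" and "Q = ?L (j + 1)"
  have PQ: "P \<in> V" "Q \<in> V" "distinct [v, P, Q, f]" "v \<in> V"
    using C unfolding P_def Q_def j by auto
  have PQV: "V = {v, P, Q, f}" using V_eq unfolding P_def Q_def j .
  define \<rho> where "\<rho> = sdist v x"
  have nv: "norm v = 1" "norm x = 1" using C0 assms by (auto simp: norm_V surface_norm)
  have "x \<noteq> - v" using surface_antipode[of v x] C0 V_subset_surface assms by blast
  then obtain D where D: "norm D = 1" "v \<bullet> D = 0" "x = garc v D \<rho>" "0 < \<rho>" "\<rho> < pi"
    using arc_exists[OF nv] assms(3) unfolding \<rho>_def by metis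
  have sr: "0 < sin \<rho>" using D by (intro sin_gt_zero) auto
  have b: "bary u x = sin \<rho> * bary u D" if "u \<in> V" "u \<noteq> v" for u
    using that PQ(4) by (subst D(3)) (simp add: garc_def)
  have bP: "0 \<le> bary P D" "0 \<le> bary Q D" "bary f D = 0"
  proof -
    have "0 \<le> sin \<rho> * bary P D" "0 \<le> sin \<rho> * bary Q D" "sin \<rho> * bary f D = 0"
      using b[of P] b[of Q] b[of f] PQ assms(2) f by (auto simp: surface_def)
    then show "0 \<le> bary P D" "0 \<le> bary Q D" "bary f D = 0" using sr by (auto simp: zero_le_mult_iff)
  qed
  define S where "S = sqrt (1 - c\<^sup>2)"
  have S: "0 < S" using c_sq by (simp add: S_def)
  define a b where "a = S * bary P D" and "b = S * bary Q D"
  have ab: "0 \<le> a" "0 \<le> b" using bP S by (auto simp: a_def b_def)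
  have Dexp: "D = bary v D *\<^sub>R v + bary P D *\<^sub>R P + bary Q D *\<^sub>R Q"
    using bary_expand4[OF PQV PQ(3), of D] bP by simp
  have "bary v D + c * bary P D + c * bary Q D = 0"
    using D(2) PQ inner_V[of v P] inner_V[of v Q]
    by (subst (asm) Dexp) (simp add: inner_add_right inner_V_self mult.commute)
  then have bv: "bary v D = - (c * bary P D + c * bary Q D)" by simp
  have "D = - (c * bary P D + c * bary Q D) *\<^sub>R v + bary P D *\<^sub>R P + bary Q D *\<^sub>R Q"
    using Dexp unfolding bv .
  also have "\<dots> = bary P D *\<^sub>R (P - c *\<^sub>R v) + bary Q D *\<^sub>R (Q - c *\<^sub>R v)"
    by (simp add: scaleR_diff_right scaleR_diff_left scaleR_add_left mult.commute)
  also have "\<dots> = a *\<^sub>R tang v P + b *\<^sub>R tang v Q"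
    using S by (simp add: a_def b_def tang_def S_def)
  finally have Dab: "D = a *\<^sub>R tang v P + b *\<^sub>R tang v Q" .
  have t: "tang v P \<bullet> tang v P = 1" "tang v Q \<bullet> tang v Q = 1" "tang v P \<bullet> tang v Q = cos \<alpha>" "tang v Q \<bullet> tang v P = cos \<alpha>"
    using PQ by (auto intro!: tang_inner_self tang_inner)
  have "D \<bullet> D = 1" using D by (simp add: norm_eq_1)
  then have n1: "a\<^sup>2 + b\<^sup>2 + 2 * a * b * cos \<alpha> = 1"
    unfolding Dab by (simp add: inner_add t power2_eq_square algebra_simps)
  define X where "X = a + b * cos \<alpha>"
  have X1: "X\<^sup>2 + (b * sin \<alpha>)\<^sup>2 = 1"
    using n1 sin_cos_squared_add[of \<alpha>] unfolding X_def by algebra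
  then have "X\<^sup>2 \<le> 1" using zero_le_power2[of "b * sin \<alpha>"] by linarith
  then have X: "- 1 \<le> X" "X \<le> 1" by (auto simp: abs_square_le_1 abs_le_iff)
  define \<beta> where "\<beta> = arccos X"
  have \<beta>: "0 \<le> \<beta>" "\<beta> \<le> pi" "cos \<beta> = X" using arccos_bounded[OF X] X by (auto simp: \<beta>_def)
  have "(sin \<beta>)\<^sup>2 = (b * sin \<alpha>)\<^sup>2" unfolding sin_squared_eq \<beta>(3) using X1 by simp
  then have s\<beta>: "sin \<beta> = b * sin \<alpha>" using sin_ge_zero[OF \<beta>(1,2)] ab sin_alpha_pos by (simp add: power2_eq_iff_nonneg)
  have s\<alpha>: "sin (\<alpha> - \<beta>) = a * sin \<alpha>" unfolding sin_diff \<beta>(3) s\<beta> X_def by (simp add: algebra_simps)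
  have "\<beta> \<le> \<alpha>"
  proof (rule ccontr)
    assume "\<not> \<beta> \<le> \<alpha>"
    then have "0 < sin (\<beta> - \<alpha>)" using \<beta> alpha_range by (intro sin_gt_zero) auto
    then have "sin (\<alpha> - \<beta>) < 0" by (simp add: sin_diff algebra_simps)
    then show False using s\<alpha> ab sin_alpha_pos by (simp add: mult_less_0_iff)
  qed
  define \<tau> where "\<tau> = j * \<alpha> + \<beta>"
  have \<tau>: "j * \<alpha> \<le> \<tau>" "\<tau> \<le> (j + 1) * \<alpha>" using \<open>\<beta> \<le> \<alpha>\<close> \<beta> by (auto simp: \<tau>_def algebra_simps)
  have "linkdir v ?L \<tau> = (1 / sin \<alpha>) *\<^sub>R (sin (\<alpha> - \<beta>) *\<^sub>R tang v P + sin \<beta> *\<^sub>R tang v Q)"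
    unfolding linkdir_sector[OF \<tau>] P_def[symmetric] Q_def[symmetric] by (simp add: \<tau>_def algebra_simps)
  also have "\<dots> = D" unfolding s\<alpha> s\<beta> Dab using sin_alpha_pos by (simp add: scaleR_add_right)
  finally have "x = garc v (linkdir v ?L \<tau>) \<rho>" using D(3) by simp
  moreover have "0 \<le> \<tau>" using j \<beta> alpha_range by (simp add: \<tau>_def)
  moreover have "\<tau> \<le> 3 * \<alpha>"
  proof -
    have "(real_of_int j + 1) * \<alpha> \<le> 3 * \<alpha>" using j alpha_range by (intro mult_right_mono) auto
    then show ?thesis using \<tau> by simp
  qed
  ultimately show ?thesis using that[of \<tau>] D(4) unfolding \<rho>_def by simp
qed

section \<open>Shortest curves avoid the vertices\<close>

text \<open>A point of the unit sphere of \<open>\<real>\<^sup>3\<close> in polar coordinates; a sector of angle less than \<open>\<pi>\<close> at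
  a vertex of the surface is compared with the corresponding sector at the pole.\<close>

definition polar :: "real \<Rightarrow> real \<Rightarrow> real \<times> real \<times> real" where
  "polar \<tau> \<rho> = (cos \<rho>, sin \<rho> * cos \<tau>, sin \<rho> * sin \<tau>)"

lemma polar_inner: "polar \<tau> \<rho> \<bullet> polar \<tau>' \<rho>' = cos \<rho> * cos \<rho>' + sin \<rho> * sin \<rho>' * cos (\<tau> - \<tau>')"
  by (simp add: polar_def cos_diff algebra_simps)

lemma polar_norm: "norm (polar \<tau> \<rho>) = 1"
  using polar_inner[of \<tau> \<rho> \<tau> \<rho>] sin_cos_squared_add[of \<rho>] by (simp add: norm_eq_1 power2_eq_square)

lemma polar_between:
  assumes "\<tau> < \<sigma>" "\<sigma> < \<tau>'" "\<tau>' < \<tau> + pi" "0 < \<rho>" "\<rho> \<le> R" "0 < \<rho>'" "\<rho>' \<le> R" "R < pi / 2"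
  obtains r where "0 < r" "r \<le> R"
    "sdist (polar \<tau> \<rho>) (polar \<sigma> r) + sdist (polar \<sigma> r) (polar \<tau>' \<rho>') = sdist (polar \<tau> \<rho>) (polar \<tau>' \<rho>')"
proof -
  define A B where "A = sin \<rho>' * sin (\<tau>' - \<sigma>)" and "B = sin \<rho> * sin (\<sigma> - \<tau>)"
  have s: "0 < sin \<rho>" "0 < sin \<rho>'" "0 < sin (\<tau>' - \<sigma>)" "0 < sin (\<sigma> - \<tau>)" "0 < sin (\<tau>' - \<tau>)"
    using assms pi_gt_zero by (auto intro!: sin_gt_zero)
  have AB: "0 < A" "0 < B" using s by (auto simp: A_def B_def)
  have cR: "0 < cos R" "cos R \<le> cos \<rho>" "cos R \<le> cos \<rho>'"
    using assms pi_gt_zero by (auto intro!: cos_gt_zero_pi cos_monotone_0_pi_le)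
  define y where "y = A *\<^sub>R polar \<tau> \<rho> + B *\<^sub>R polar \<tau>' \<rho>'"
  define w where "w = sin \<rho> * sin \<rho>' * sin (\<tau>' - \<tau>)"
  have w: "0 < w" using s by (simp add: w_def)
  have y_eq: "y = (A * cos \<rho> + B * cos \<rho>', w * cos \<sigma>, w * sin \<sigma>)"
  proof -
    have 1: "sin (\<tau>' - \<sigma>) * cos \<tau> + sin (\<sigma> - \<tau>) * cos \<tau>' = sin (\<tau>' - \<tau>) * cos \<sigma>"
      unfolding sin_diff by (simp add: algebra_simps)
    have 2: "sin (\<tau>' - \<sigma>) * sin \<tau> + sin (\<sigma> - \<tau>) * sin \<tau>' = sin (\<tau>' - \<tau>) * sin \<sigma>"
      unfolding sin_diff by (simp add: algebra_simps)
    have "A * (sin \<rho> * cos \<tau>) + B * (sin \<rho>' * cos \<tau>') = w * cos \<sigma>"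
      unfolding w_def mult.assoc[of _ _ "cos \<sigma>"] 1[symmetric] by (simp add: A_def B_def algebra_simps)
    moreover have "A * (sin \<rho> * sin \<tau>) + B * (sin \<rho>' * sin \<tau>') = w * sin \<sigma>"
      unfolding w_def mult.assoc[of _ _ "sin \<sigma>"] 2[symmetric] by (simp add: A_def B_def algebra_simps)
    ultimately show ?thesis by (simp add: y_def polar_def)
  qed
  define n where "n = norm y"
  have ny: "n \<noteq> 0" unfolding n_def y_eq using w by (auto simp: zero_prod_def) (metis sin_zero_norm_cos_one norm_zero zero_neq_one)
  then have n: "0 < n" by (simp add: n_def)
  have nAB: "n \<le> A + B"
    unfolding n_def y_def using norm_triangle_ineq[of "A *\<^sub>R polar \<tau> \<rho>" "B *\<^sub>R polar \<tau>' \<rho>'"] AB by (simp add: polar_norm)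
  define z where "z = (1 / n) *\<^sub>R y"
  have nz: "norm z = 1" using n by (simp add: z_def n_def)
  define z0 where "z0 = (A * cos \<rho> + B * cos \<rho>') / n"
  have z0: "cos R \<le> z0"
  proof -
    have "n * cos R \<le> (A + B) * cos R" using nAB cR by (intro mult_right_mono) auto
    also have "\<dots> \<le> A * cos \<rho> + B * cos \<rho>'" using AB cR by (simp add: distrib_right add_mono)
    finally show ?thesis using n by (simp add: z0_def pos_le_divide_eq mult.commute)
  qed
  have z_eq: "z = (z0, w / n * cos \<sigma>, w / n * sin \<sigma>)" unfolding z_def y_eq z0_def by simp
  have "z \<bullet> z = 1" using nz by (simp add: norm_eq_1)
  moreover define k where "k = w / n"
  ultimately have "z0 * z0 + (k * cos \<sigma> * (k * cos \<sigma>) + k * sin \<sigma> * (k * sin \<sigma>)) = 1"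
    unfolding z_eq k_def[symmetric] by simp
  then have "z0\<^sup>2 + k\<^sup>2 = 1" using sin_cos_squared_add[of \<sigma>] by algebra
  then have zz: "z0\<^sup>2 + (w / n)\<^sup>2 = 1" by (simp add: k_def)
  moreover have "0 < w / n" using w n by simp
  ultimately have "z0\<^sup>2 < 1" using zero_less_power2[of "w / n"] by linarith
  then have z01: "z0 < 1" by (simp add: power2_less_1_iff)
  define r where "r = arccos z0"
  have r: "0 \<le> r" "r \<le> pi" "cos r = z0" using arccos[of z0] z01 z0 cR by (auto simp: r_def)
  have r0: "0 < r" using r z01 by (cases "r = 0") auto
  have rR: "r \<le> R"
    using r z0 assms cos_monotone_0_pi[of R r] by (cases "r \<le> R") auto
  have "(sin r)\<^sup>2 = (w / n)\<^sup>2" unfolding sin_squared_eq r(3) using zz by simp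
  then have "sin r = w / n" using sin_ge_zero[OF r(1,2)] \<open>0 < w / n\<close> by (simp add: power2_eq_iff_nonneg)
  then have zp: "z = polar \<sigma> r" unfolding z_eq polar_def using r by simp
  have "polar \<tau>' \<rho>' \<noteq> - polar \<tau> \<rho>"
  proof
    assume "polar \<tau>' \<rho>' = - polar \<tau> \<rho>"
    then have "cos \<rho>' = - cos \<rho>" by (simp add: polar_def)
    then show False using cR by simp
  qed
  then have "sdist (polar \<tau> \<rho>) z + sdist z (polar \<tau>' \<rho>') = sdist (polar \<tau> \<rho>) (polar \<tau>' \<rho>')"
    using AB n by (intro sdist_between[where a = "A / n" and b = "B / n"] polar_norm nz)
      (auto simp: z_def y_def scaleR_add_right)
  then show ?thesis using that[of r] r0 rR unfolding zp by simp
qed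

lemma fan_sector:
  fixes j :: int
  assumes "corner v p q r" "j * \<alpha> \<le> \<tau>" "\<tau> \<le> (j + 1) * \<alpha>" "j * \<alpha> \<le> \<tau>'" "\<tau>' \<le> (j + 1) * \<alpha>"
    "0 \<le> \<rho>" "\<rho> \<le> near_rad" "0 \<le> \<rho>'" "\<rho>' \<le> near_rad"
  shows "intrinsic_dist surface (garc v (linkdir v (cyc3 p q r) \<tau>) \<rho>) (garc v (linkdir v (cyc3 p q r) \<tau>') \<rho>')
    \<le> ennreal (sdist (polar \<tau> \<rho>) (polar \<tau>' \<rho>'))"
proof -
  let ?D = "linkdir v (cyc3 p q r)"
  note C = cornerD[OF corner_cyc3[OF assms(1), of j]]
  have "garc v (?D \<tau>) \<rho> \<bullet> garc v (?D \<tau>') \<rho>' = polar \<tau> \<rho> \<bullet> polar \<tau>' \<rho>'"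
    using C linkdir_orth[OF assms(1)] linkdir_sector_inner[OF assms(1-5)]
    by (simp add: garc_def inner_add polar_inner inner_V_self inner_commute[of "linkdir _ _ _" v] algebra_simps)
  then have "sdist (garc v (?D \<tau>) \<rho>) (garc v (?D \<tau>') \<rho>') = sdist (polar \<tau> \<rho>) (polar \<tau>' \<rho>')"
    by (simp add: sdist_def)
  then show ?thesis
    using face_arc[OF linkdir_near_face[OF assms(1-3,6,7)] linkdir_near_face[OF assms(1,4,5,8,9)] C(4)] by simp
qed

lemma fan_path:
  fixes j :: int
  assumes C: "corner v p q r" and "\<tau> \<le> \<tau>'" "\<tau>' < \<tau> + pi" "0 < \<rho>" "\<rho> \<le> near_rad" "0 < \<rho>'" "\<rho>' \<le> near_rad"
    and "j * \<alpha> \<le> \<tau>" "\<tau> < (j + 1) * \<alpha>" "\<tau>' \<le> (j + 1 + int n) * \<alpha>"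
  shows "intrinsic_dist surface (garc v (linkdir v (cyc3 p q r) \<tau>) \<rho>) (garc v (linkdir v (cyc3 p q r) \<tau>') \<rho>')
    \<le> ennreal (sdist (polar \<tau> \<rho>) (polar \<tau>' \<rho>'))"
  using assms(2-)
proof (induction n arbitrary: j \<tau> \<rho>)
  case (0 j \<tau> \<rho>)
  let ?E = "\<lambda>\<tau> \<rho>. garc v (linkdir v (cyc3 p q r) \<tau>) \<rho>"
  have base: "intrinsic_dist surface (?E \<tau> \<rho>) (?E \<tau>' \<rho>') \<le> ennreal (sdist (polar \<tau> \<rho>) (polar \<tau>' \<rho>'))"
    using 0 C fan_sector[of v p q r j \<tau> \<tau>' \<rho> \<rho>'] by auto
  then show ?case .
next
  case (Suc n j \<tau> \<rho>)
  let ?E = "\<lambda>\<tau> \<rho>. garc v (linkdir v (cyc3 p q r) \<tau>) \<rho>"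
  show ?case
  proof (cases "\<tau>' \<le> (j + 1) * \<alpha>")
    case True
    then show ?thesis using Suc.prems C fan_sector[of v p q r j \<tau> \<tau>' \<rho> \<rho>'] by auto
  next
    case False
    define \<sigma> where "\<sigma> = (j + 1) * \<alpha>"
    have \<sigma>: "\<tau> < \<sigma>" "\<sigma> < \<tau>'" using False Suc.prems by (auto simp: \<sigma>_def)
    obtain s where s: "0 < s" "s \<le> near_rad"
      and sum: "sdist (polar \<tau> \<rho>) (polar \<sigma> s) + sdist (polar \<sigma> s) (polar \<tau>' \<rho>') = sdist (polar \<tau> \<rho>) (polar \<tau>' \<rho>')"
      using polar_between[OF \<sigma> Suc.prems(2-6) near_rad(2)] by blast
    have "intrinsic_dist surface (?E \<tau> \<rho>) (?E \<tau>' \<rho>') \<le>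
       intrinsic_dist surface (?E \<tau> \<rho>) (?E \<sigma> s) + intrinsic_dist surface (?E \<sigma> s) (?E \<tau>' \<rho>')"
      by (rule intrinsic_dist_triangle[OF surface_subset_sphere])
    also have "\<dots> \<le> ennreal (sdist (polar \<tau> \<rho>) (polar \<sigma> s)) + ennreal (sdist (polar \<sigma> s) (polar \<tau>' \<rho>'))"
    proof (rule add_mono)
      show "intrinsic_dist surface (?E \<tau> \<rho>) (?E \<sigma> s) \<le> ennreal (sdist (polar \<tau> \<rho>) (polar \<sigma> s))"
        using Suc.prems C s \<sigma> fan_sector[of v p q r j \<tau> \<sigma> \<rho> s] by (auto simp: \<sigma>_def)
      show "intrinsic_dist surface (?E \<sigma> s) (?E \<tau>' \<rho>') \<le> ennreal (sdist (polar \<sigma> s) (polar \<tau>' \<rho>'))"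
        using Suc.prems \<sigma> s alpha_range(1) by (intro Suc.IH[of \<sigma> s "j + 1"]) (auto simp: \<sigma>_def algebra_simps)
    qed
    also have "\<dots> = ennreal (sdist (polar \<tau> \<rho>) (polar \<tau>' \<rho>'))"
      unfolding sum[symmetric] by (simp add: sdist_bounds polar_norm)
    finally show ?thesis .
  qed
qed

lemma corner_shortcut_polar:
  assumes C: "corner v p q r" and "\<tau> \<le> \<tau>'" "\<tau>' < \<tau> + pi" "0 < \<rho>" "\<rho> \<le> near_rad" "0 < \<rho>'" "\<rho>' \<le> near_rad"
  shows "intrinsic_dist surface (garc v (linkdir v (cyc3 p q r) \<tau>) \<rho>) (garc v (linkdir v (cyc3 p q r) \<tau>') \<rho>')
    < ennreal (\<rho> + \<rho>')"
proof -
  obtain j :: int where j: "j * \<alpha> \<le> \<tau>" "\<tau> < (j + 1) * \<alpha>" by (rule sector_exists)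
  obtain n :: nat where "(\<tau>' - (j + 1) * \<alpha>) / \<alpha> \<le> n" using real_arch_simple by blast
  then have "\<tau>' - (j + 1) * \<alpha> \<le> n * \<alpha>" using alpha_range(1) by (simp add: pos_divide_le_eq)
  then have n: "\<tau>' \<le> (j + 1 + int n) * \<alpha>" by (simp add: algebra_simps)
  have "sdist (polar \<tau> \<rho>) (polar \<tau>' \<rho>') < \<rho> + \<rho>'"
  proof -
    have "0 < sin \<rho>" "0 < sin \<rho>'" using assms near_rad pi_gt_zero by (auto intro!: sin_gt_zero)
    moreover have "- 1 < cos (\<tau> - \<tau>')"
    proof -
      have "cos pi < cos (\<tau>' - \<tau>)" using assms by (intro cos_monotone_0_pi) auto
      then show ?thesis by (simp add: cos_diff mult.commute)
    qed
    ultimately have "sin \<rho> * sin \<rho>' * (- 1) < sin \<rho> * sin \<rho>' * cos (\<tau> - \<tau>')"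
      by (intro mult_strict_left_mono) auto
    then have "cos (\<rho> + \<rho>') < polar \<tau> \<rho> \<bullet> polar \<tau>' \<rho>'" unfolding polar_inner cos_add by simp
    then have "arccos (polar \<tau> \<rho> \<bullet> polar \<tau>' \<rho>') < arccos (cos (\<rho> + \<rho>'))"
      by (intro arccos_less_arccos inner_unit_bounds polar_norm) auto
    also have "\<dots> = \<rho> + \<rho>'" using assms near_rad by (intro arccos_cos) auto
    finally show ?thesis by (simp add: sdist_def)
  qed
  moreover have "0 < \<rho> + \<rho>'" using assms by simp
  ultimately have "ennreal (sdist (polar \<tau> \<rho>) (polar \<tau>' \<rho>')) < ennreal (\<rho> + \<rho>')"
    by (simp add: ennreal_less_iff sdist_bounds polar_norm)
  then show ?thesis using fan_path[OF assms j n] by (rule order_le_less_trans[rotated])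
qed

lemma corner_shortcut:
  assumes "v \<in> V" "x \<in> surface" "y \<in> surface" "x \<noteq> v" "y \<noteq> v" "0 < bary v x" "0 < bary v y"
    "sdist v x \<le> near_rad" "sdist v y \<le> near_rad"
  shows "intrinsic_dist surface x y < ennreal (sdist x v + sdist v y)"
proof -
  obtain p where "p \<in> V" "p \<noteq> v" using V_third[OF assms(1,1)] by blast
  then obtain q r where "q \<in> V" "r \<in> V" "distinct [q, r, v, p]"
    using V_rest[OF assms(1), of p] by metis
  then have C: "corner v p q r" using \<open>p \<in> V\<close> assms(1) by (auto simp: corner_def)
  let ?L = "cyc3 p q r"
  obtain \<tau> where \<tau>: "0 \<le> \<tau>" "\<tau> \<le> 3 * \<alpha>" "x = garc v (linkdir v ?L \<tau>) (sdist v x)" "0 < sdist v x"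
    using polar_exists[OF C assms(2,4,6)] by blast
  obtain \<tau>' where \<tau>': "0 \<le> \<tau>'" "\<tau>' \<le> 3 * \<alpha>" "y = garc v (linkdir v ?L \<tau>') (sdist v y)" "0 < sdist v y"
    using polar_exists[OF C assms(3,5,7)] by blast
  have per: "linkdir v ?L (t + 3 * \<alpha>) = linkdir v ?L t" for t by (rule linkdir_period) simp
  have fwd: "intrinsic_dist surface x y < ennreal (sdist v x + sdist v y)" if "\<tau> \<le> \<tau>'" "\<tau>' < \<tau> + pi"
    using corner_shortcut_polar[OF C that \<tau>(4) assms(8) \<tau>'(4) assms(9)] \<tau>(3) \<tau>'(3) by simp
  have bwd: "intrinsic_dist surface x y < ennreal (sdist v x + sdist v y)" if "\<tau>' \<le> \<tau>" "\<tau> < \<tau>' + pi"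
    using corner_shortcut_polar[OF C that \<tau>'(4) assms(9) \<tau>(4) assms(8)] \<tau>(3) \<tau>'(3)
    by (simp add: add.commute intrinsic_dist_commute)
  have fwd': "intrinsic_dist surface x y < ennreal (sdist v x + sdist v y)" if "\<tau> + 3 * \<alpha> < \<tau>' + pi" "\<tau>' \<le> \<tau> + 3 * \<alpha>"
    using corner_shortcut_polar[OF C that(2,1) \<tau>'(4) assms(9) \<tau>(4) assms(8)] \<tau>(3) \<tau>'(3)
    by (simp add: add.commute intrinsic_dist_commute per)
  have bwd': "intrinsic_dist surface x y < ennreal (sdist v x + sdist v y)" if "\<tau>' + 3 * \<alpha> < \<tau> + pi" "\<tau> \<le> \<tau>' + 3 * \<alpha>"
    using corner_shortcut_polar[OF C that(2,1) \<tau>(4) assms(8) \<tau>'(4) assms(9)] \<tau>(3) \<tau>'(3)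
    by (simp add: per)
  have "intrinsic_dist surface x y < ennreal (sdist v x + sdist v y)"
  proof (cases "\<tau> \<le> \<tau>'")
    case True
    then show ?thesis using fwd fwd' \<tau> \<tau>' alpha_range by (cases "\<tau>' < \<tau> + pi") auto
  next
    case False
    then show ?thesis using bwd bwd' \<tau> \<tau>' alpha_range by (cases "\<tau> < \<tau>' + pi") auto
  qed
  then show ?thesis by (simp add: sdist_commute)
qed

end

section \<open>Unfolding a locally shortest curve\<close>

context regular_tetra
begin

definition wedge :: "real ^ 4 \<Rightarrow> real ^ 4 \<Rightarrow> real ^ 4 \<Rightarrow> bool" where
  "wedge k l x \<longleftrightarrow> x \<in> surface \<and> (\<forall>w\<in>V - {k, l}. 0 < bary w x)"

definition convex_wedge :: "real ^ 4 \<Rightarrow> real ^ 4 \<Rightarrow> real ^ 4 \<Rightarrow> bool" where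
  "convex_wedge k l x \<longleftrightarrow> wedge k l x \<and> (\<forall>w\<in>V - {k, l}. 0 < bary w (unfold_map k l x))"

lemma wedge_zero:
  assumes "wedge k l x"
  shows "bary k x = 0 \<or> bary l x = 0"
proof -
  obtain f where "f \<in> V" "bary f x = 0" using assms by (auto simp: wedge_def surface_def)
  then show ?thesis using assms by (force simp: wedge_def)
qed

lemma wedge_nonneg: "wedge k l x \<Longrightarrow> w \<in> V \<Longrightarrow> 0 \<le> bary w x"
  by (auto simp: wedge_def surface_def)

lemma wedge_norm: "wedge k l x \<Longrightarrow> norm x = 1"
  by (auto simp: wedge_def surface_def)

lemma unfold_map_wedge_norm:
  assumes "k \<in> V" "l \<in> V" "k \<noteq> l" "wedge k l x"
  shows "norm (unfold_map k l x) = 1"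
  using unfold_map_norm[OF assms(1-3) wedge_zero[OF assms(4)]] wedge_norm[OF assms(4)] by simp

lemma unfold_map_inj:
  assumes "k \<in> V" "l \<in> V" "k \<noteq> l" "wedge k l x" "wedge k l y" "unfold_map k l x = unfold_map k l y"
  shows "x = y"
proof -
  have "bary k x - bary l x = bary k y - bary l y"
    using bary_unfold_map(2)[OF assms(1-3), of x] bary_unfold_map(2)[OF assms(1-3), of y] assms(6) by simp
  then have kl: "bary k x = bary k y" "bary l x = bary l y"
    using wedge_zero[OF assms(4)] wedge_zero[OF assms(5)] wedge_nonneg[OF assms(4)] wedge_nonneg[OF assms(5)] assms(1,2)
    by (smt (verit))+
  then show ?thesis using assms(6) by (simp add: unfold_map_def)
qed

lemma dist_le_unfold_aux:
  assumes "k \<in> V" "l \<in> V" "k \<noteq> l" "convex_wedge k l x" "convex_wedge k l y" "bary l x = 0" "bary k y = 0"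
  shows "intrinsic_dist surface x y \<le> ennreal (sdist (unfold_map k l x) (unfold_map k l y))"
proof -
  have wx: "wedge k l x" and wy: "wedge k l y" using assms by (auto simp: convex_wedge_def)
  have fx: "x \<in> face l" and fy: "y \<in> face k"
    using wx wy assms by (auto simp: wedge_def surface_def face_def)
  have Ux: "unfold_map k l x = x" using assms by (simp add: unfold_map_id)
  define y' where "y' = unfold_map k l y"
  have ny: "norm x = 1" "norm y' = 1" "norm y = 1"
    using wedge_norm[OF wx] wedge_norm[OF wy] unfold_map_wedge_norm[OF assms(1-3) wy] by (auto simp: y'_def)
  show ?thesis
  proof (cases "bary k x = 0 \<or> bary l y = 0")
    case True
    then show ?thesis
    proof
      assume *: "bary k x = 0"
      then have "x \<in> face k" using fx by (simp add: face_def)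
      then have "intrinsic_dist surface x y \<le> ennreal (sdist x y)" using fy assms(1) by (rule face_arc)
      then show ?thesis using unfold_map_inner[OF assms(1-3), of x y] * assms by (simp add: sdist_def)
    next
      assume *: "bary l y = 0"
      then have "y \<in> face l" using fy by (simp add: face_def)
      then have "intrinsic_dist surface x y \<le> ennreal (sdist x y)" using fx assms(2) by (intro face_arc)
      then show ?thesis using unfold_map_inner[OF assms(1-3), of x y] * assms by (simp add: sdist_def)
    qed
  next
    case False
    define a b where "a = bary l y" and "b = bary k x"
    have ab: "0 < a" "0 < b" using False wedge_nonneg[OF wx assms(1)] wedge_nonneg[OF wy assms(2)] by (auto simp: a_def b_def)
    define z' where "z' = a *\<^sub>R x + b *\<^sub>R y'"
    have yb: "bary k y' = - a" "bary l y' = 0" using bary_unfold_map[OF assms(1-3), of y] assms by (auto simp: y'_def a_def)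
    have zk: "bary k z' = 0" "bary l z' = 0" using yb assms by (auto simp: z'_def b_def)
    have zw: "0 < bary w z'" "0 < bary w x" "0 < bary w y'" if "w \<in> V - {k, l}" for w
    proof -
      show "0 < bary w x" "0 < bary w y'" using that assms by (auto simp: convex_wedge_def wedge_def y'_def)
      then show "0 < bary w z'" using ab by (simp add: z'_def add_pos_pos)
    qed
    obtain w where w: "w \<in> V - {k, l}" using V_third[OF assms(1,2)] by blast
    then have "z' \<noteq> 0" using zw[OF w] by auto
    then have nz': "0 < norm z'" by simp
    define z where "z = (1 / norm z') *\<^sub>R z'"
    have nz: "norm z = 1" using nz' by (simp add: z_def)
    have "0 \<le> bary u z" if "u \<in> V" for u using that zk zw[of u] nz' unfolding z_def
      by (cases "u = k \<or> u = l") (auto simp: less_imp_le)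
    then have fz: "z \<in> face k" "z \<in> face l" using zk nz by (auto simp: face_def z_def)
    have "y' \<noteq> - x" using zw[OF w] by auto
    then have "sdist x z + sdist z y' = sdist x y'"
      using ab nz' by (intro sdist_between[of _ _ _ "a / norm z'" "b / norm z'"] ny nz) (auto simp: z_def z'_def scaleR_add_right)
    moreover have "sdist z y' = sdist z y"
      using unfold_map_inner[OF assms(1-3), of z y] fz assms(7) by (simp add: sdist_def y'_def face_def unfold_map_id)
    ultimately have sum: "sdist x y' = sdist x z + sdist z y" by simp
    have "intrinsic_dist surface x y \<le> intrinsic_dist surface x z + intrinsic_dist surface z y"
      by (rule intrinsic_dist_triangle[OF surface_subset_sphere])
    also have "\<dots> \<le> ennreal (sdist x z) + ennreal (sdist z y)"
      by (intro add_mono face_arc[OF fx fz(2) assms(2)] face_arc[OF fz(1) fy assms(1)])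
    also have "\<dots> = ennreal (sdist x y')" unfolding sum using ny nz by (simp add: sdist_bounds)
    finally show ?thesis by (simp add: Ux y'_def)
  qed
qed

lemma dist_le_unfold:
  assumes "k \<in> V" "l \<in> V" "k \<noteq> l" "convex_wedge k l x" "convex_wedge k l y"
  shows "intrinsic_dist surface x y \<le> ennreal (sdist (unfold_map k l x) (unfold_map k l y))"
proof -
  have z: "bary k x = 0 \<or> bary l x = 0" "bary k y = 0 \<or> bary l y = 0"
    using assms wedge_zero by (auto simp: convex_wedge_def)
  have fc: "x \<in> face f" "y \<in> face f" if "bary f x = 0" "bary f y = 0" for f
    using that assms(4,5) by (auto simp: convex_wedge_def wedge_def surface_def face_def)
  have same: ?thesis if "f \<in> {k, l}" "bary f x = 0" "bary f y = 0" for f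
  proof -
    have "f \<in> V" using that(1) assms(1,2) by auto
    then have "intrinsic_dist surface x y \<le> ennreal (sdist x y)" by (rule face_arc[OF fc[OF that(2,3)]])
    then show ?thesis using unfold_map_inner[OF assms(1-3), of x y] that by (auto simp: sdist_def)
  qed
  from z show ?thesis
    using same[of k] same[of l] dist_le_unfold_aux[OF assms] dist_le_unfold_aux[OF assms(1-3,5,4)]
    by (auto simp: intrinsic_dist_commute[of _ y x] sdist_commute[of _ "unfold_map k l x"])
qed

lemma unfold_le_curve_length:
  assumes "k \<in> V" "l \<in> V" "k \<noteq> l" "a \<le> b" "continuous_on {a..b} G" "\<And>t. t \<in> {a..b} \<Longrightarrow> wedge k l (G t)"
  shows "ennreal (sdist (unfold_map k l (G a)) (unfold_map k l (G b))) \<le> curve_length a b G"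
proof -
  let ?U = "unfold_map k l"
  have W: "wedge k l (G a)" "wedge k l (G b)" using assms by auto
  have same: ?thesis if "f \<in> {k, l}" "bary f (G a) = 0" "bary f (G b) = 0" for f
  proof -
    have "sdist (?U (G a)) (?U (G b)) = sdist (G a) (G b)"
      using unfold_map_inner[OF assms(1-3), of "G a" "G b"] that by (auto simp: sdist_def)
    then show ?thesis using sdist_le_curve_length[of a a b b G] assms(4) by simp
  qed
  show ?thesis
  proof (cases "\<exists>f\<in>{k, l}. bary f (G a) = 0 \<and> bary f (G b) = 0")
    case True
    then show ?thesis using same by blast
  next
    case False
    define h where "h = (\<lambda>t. bary k (G t) - bary l (G t))"
    have "h a * h b \<le> 0"
      using False wedge_zero[OF W(1)] wedge_zero[OF W(2)] wedge_nonneg[OF W(1)] wedge_nonneg[OF W(2)] assms(1,2)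
      by (auto simp: h_def mult_le_0_iff)
    moreover have "continuous_on {a..b} h" unfolding h_def by (intro continuous_intros assms)
    ultimately have "\<exists>m. a \<le> m \<and> m \<le> b \<and> h m = 0"
      using IVT'[of h a 0 b] IVT2'[of h b 0 a] assms(4) by (auto simp: mult_le_0_iff)
    then obtain m where m: "a \<le> m" "m \<le> b" "h m = 0" by blast
    have wm: "wedge k l (G m)" using m assms by auto
    have bm: "bary k (G m) = 0" "bary l (G m) = 0" using m(3) wedge_zero[OF wm] by (auto simp: h_def)
    have n: "norm (G a) = 1" "norm (G m) = 1" "norm (G b) = 1" using W wm wedge_norm by auto
    have nU: "norm (?U (G a)) = 1" "norm (?U (G m)) = 1" "norm (?U (G b)) = 1"
      using unfold_map_wedge_norm[OF assms(1-3)] W wm by auto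
    have e: "sdist (?U (G a)) (?U (G m)) = sdist (G a) (G m)" "sdist (?U (G m)) (?U (G b)) = sdist (G m) (G b)"
      using unfold_map_inner[OF assms(1-3)] wedge_zero[OF W(1)] wedge_zero[OF W(2)] bm by (auto simp: sdist_def)
    have "sdist (?U (G a)) (?U (G b)) \<le> sdist (G a) (G m) + sdist (G m) (G b)"
      using sdist_triangle[OF nU] e by simp
    then have "ennreal (sdist (?U (G a)) (?U (G b))) \<le> ennreal (sdist (G a) (G m)) + ennreal (sdist (G m) (G b))"
      using n by (simp add: sdist_bounds ennreal_leI flip: ennreal_plus)
    also have "\<dots> \<le> curve_length a m G + curve_length m b G"
      using m by (intro add_mono sdist_le_curve_length) auto
    also have "\<dots> = curve_length a b G"
      using m assms(6) by (intro curve_length_add[symmetric] wedge_norm) auto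
    finally show ?thesis .
  qed
qed

definition straight_at :: "(real \<Rightarrow> real ^ 4) \<Rightarrow> real \<Rightarrow> bool" where
  "straight_at f t \<longleftrightarrow> (\<exists>k l p q d. k \<in> V \<and> l \<in> V \<and> k \<noteq> l \<and> 0 < d \<and>
     (\<forall>\<tau>. \<bar>\<tau>\<bar> < d \<longrightarrow> wedge k l (f (t + \<tau>)) \<and> unfold_map k l (f (t + \<tau>)) = garc p q \<tau>))"

end

lemma eventually_near_iff:
  "(\<forall>\<^sub>F s in nhds t. P s) \<longleftrightarrow> (\<exists>d>0. \<forall>s. \<bar>s - t\<bar> < d \<longrightarrow> P s)" for t :: real
  by (simp add: eventually_nhds_metric dist_real_def)

lemma continuous_pos_near:
  fixes f :: "real \<Rightarrow> real"
  assumes "continuous_on UNIV f" "a < f t"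
  shows "\<forall>\<^sub>F s in nhds t. a < f s"
proof -
  have "(f \<longlongrightarrow> f t) (nhds t)"
    using assms(1) by (simp add: continuous_on_eq_continuous_at isCont_def tendsto_nhds_iff)
  then show ?thesis using assms(2) by (rule order_tendstoD)
qed

locale shortest_loop = regular_tetra +
  fixes G :: "real \<Rightarrow> real ^ 4"
  assumes cont_G: "continuous_on UNIV G"
    and G_surface: "G t \<in> surface"
    and loc_shortest: "\<exists>e>0. curve_length (t - e) (t + e) G = intrinsic_dist surface (G (t - e)) (G (t + e))"
    and G_period: "G (t + 1) = G t"
    and G_inj: "G s = G t \<Longrightarrow> s - t \<in> \<int>"
begin

lemma G_norm: "norm (G t) = 1"
  using G_surface surface_norm by blast

lemma cont_G_on: "continuous_on A G"
  using cont_G by (rule continuous_on_subset) simp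

lemma G_inj_near: "G s = G t \<Longrightarrow> \<bar>s - t\<bar> < 1 \<Longrightarrow> s = t"
  using G_inj[of s t] Ints_nonzero_abs_less1[of "s - t"] by auto

lemma subarc_shortest:
  obtains e where "0 < e" "\<And>a b. \<lbrakk>t - e \<le> a; a \<le> b; b \<le> t + e\<rbrakk> \<Longrightarrow> curve_length a b G = intrinsic_dist surface (G a) (G b)"
proof -
  obtain e where e: "0 < e" "curve_length (t - e) (t + e) G = intrinsic_dist surface (G (t - e)) (G (t + e))"
    using loc_shortest by blast
  have dle: "intrinsic_dist surface (G a) (G b) \<le> curve_length a b G" if "a \<le> b" for a b
    using that G_surface by (intro intrinsic_dist_le_path cont_G_on) auto
  have "curve_length a b G = intrinsic_dist surface (G a) (G b)" if ab: "t - e \<le> a" "a \<le> b" "b \<le> t + e" for a b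
  proof (rule antisym[OF _ dle[OF ab(2)]])
    let ?c = "t - e" and ?d = "t + e" and ?D = "intrinsic_dist surface"
    have L: "curve_length ?c ?d G = curve_length ?c a G + (curve_length a b G + curve_length b ?d G)"
      using ab by (subst curve_length_add[of ?c a ?d], simp_all add: G_norm) (subst curve_length_add[of a b ?d], simp_all add: G_norm)
    have "curve_length ?c ?d G < top" using e(2) intrinsic_dist_finite[OF G_surface G_surface] by simp
    then have fin: "curve_length ?c a G \<noteq> top" "curve_length b ?d G \<noteq> top"
      unfolding L by auto
    have "curve_length ?c a G + (curve_length a b G + curve_length b ?d G) = ?D (G ?c) (G ?d)"
      using L e(2) by simp
    also have "\<dots> \<le> ?D (G ?c) (G a) + ?D (G a) (G ?d)"
      by (rule intrinsic_dist_triangle[OF surface_subset_sphere])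
    also have "\<dots> \<le> ?D (G ?c) (G a) + (?D (G a) (G b) + ?D (G b) (G ?d))"
      by (intro add_left_mono intrinsic_dist_triangle[OF surface_subset_sphere])
    also have "\<dots> \<le> curve_length ?c a G + (?D (G a) (G b) + curve_length b ?d G)"
      using ab by (intro add_mono dle order_refl) auto
    finally show "curve_length a b G \<le> ?D (G a) (G b)"
      using fin by (simp add: ennreal_add_left_cancel_le add.commute[of _ "curve_length b ?d G"])
  qed
  then show ?thesis using that e(1) by blast
qed

lemma G_not_vertex: "G t \<notin> V"
proof
  assume v: "G t \<in> V"
  define v where "v = G t"
  obtain e where e: "0 < e" "\<And>a b. \<lbrakk>t - e \<le> a; a \<le> b; b \<le> t + e\<rbrakk> \<Longrightarrow> curve_length a b G = intrinsic_dist surface (G a) (G b)"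
    using subarc_shortest[of t] by blast
  have "\<forall>\<^sub>F s in nhds t. 0 < bary v (G s)"
    using v by (intro continuous_pos_near continuous_intros cont_G) (simp add: v_def)
  moreover have "\<forall>\<^sub>F s in nhds t. - near_rad < - sdist v (G s)"
    using v near_rad(1) by (intro continuous_pos_near continuous_intros continuous_on_sdist cont_G) (auto simp: v_def G_norm sdist_refl)
  ultimately have "\<forall>\<^sub>F s in nhds t. 0 < bary v (G s) \<and> sdist v (G s) < near_rad"
    by eventually_elim simp
  then obtain d where d: "0 < d" "\<And>s. \<bar>s - t\<bar> < d \<Longrightarrow> 0 < bary v (G s) \<and> sdist v (G s) < near_rad"
    unfolding eventually_near_iff by blast
  define m where "m = min (min e (d / 2)) (1 / 2)"
  have m: "0 < m" "m \<le> e" "m < d" "m < 1" using e d by (auto simp: m_def)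
  let ?x = "G (t - m)" and ?y = "G (t + m)"
  have "intrinsic_dist surface ?x ?y < ennreal (sdist ?x v + sdist v ?y)"
  proof (rule corner_shortcut)
    show "?x \<noteq> v" "?y \<noteq> v" using G_inj_near[of "t - m" t] G_inj_near[of "t + m" t] m by (auto simp: v_def)
  qed (use v m d(2)[of "t - m"] d(2)[of "t + m"] G_surface in \<open>auto simp: v_def\<close>)
  moreover have "intrinsic_dist surface ?x ?y = curve_length (t - m) (t + m) G"
    using e(2)[of "t - m" "t + m"] m by simp
  moreover have "\<dots> = curve_length (t - m) t G + curve_length t (t + m) G"
    using m by (intro curve_length_add G_norm) auto
  moreover have "ennreal (sdist ?x v) + ennreal (sdist v ?y) \<le> \<dots>"
    using m unfolding v_def by (intro add_mono sdist_le_curve_length) auto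
  moreover have "ennreal (sdist ?x v) + ennreal (sdist v ?y) = ennreal (sdist ?x v + sdist v ?y)"
    unfolding v_def by (simp add: sdist_bounds G_norm)
  ultimately show False by simp
qed

lemma local_unfold:
  obtains k l e where "k \<in> V" "l \<in> V" "k \<noteq> l" "0 < e"
    "\<And>s. \<bar>s - t\<bar> \<le> e \<Longrightarrow> convex_wedge k l (G s)"
    "\<And>a b. \<lbrakk>t - e \<le> a; a \<le> b; b \<le> t + e\<rbrakk> \<Longrightarrow> curve_length a b G = ennreal (sdist (unfold_map k l (G a)) (unfold_map k l (G b)))"
proof -
  obtain i j where ij: "i \<in> V" "j \<in> V" "i \<noteq> j" "0 < bary i (G t)" "0 < bary j (G t)"
    using nonvertex_two_pos[OF G_surface G_not_vertex] by metis
  obtain l where l: "l \<in> V" "bary l (G t) = 0" using G_surface[of t] by (auto simp: surface_def)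
  have "l \<noteq> i" "l \<noteq> j" using ij l by auto
  obtain k where k: "k \<in> V" "distinct [i, j, k, l]"
  proof -
    obtain a b where ab: "a \<in> V" "b \<in> V" "distinct [a, b, i, j]" "V = {a, b, i, j}"
      using V_rest[OF ij(1-3)] by metis
    then have "l = a \<or> l = b" using l \<open>l \<noteq> i\<close> \<open>l \<noteq> j\<close> by blast
    then show ?thesis using that[of a] that[of b] ab(1-3) by auto
  qed
  have kl: "k \<in> V" "l \<in> V" "k \<noteq> l" using k l by auto
  have rest: "w = i \<or> w = j" if "w \<in> V - {k, l}" for w
  proof -
    have "card {i, j, k, l} = 4" using k(2) by simp
    then have "{i, j, k, l} = V" using ij k l card_V finite_V by (intro card_subset_eq) auto
    then show ?thesis using that by blast
  qed
  have Ut: "unfold_map k l (G t) = G t" using l by (simp add: unfold_map_id)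
  have "\<forall>\<^sub>F s in nhds t. 0 < bary w (G s) \<and> 0 < bary w (unfold_map k l (G s))" if "w \<in> {i, j}" for w
    using that ij by (intro eventually_conj continuous_pos_near continuous_intros cont_G) (auto simp: Ut)
  then have "\<forall>\<^sub>F s in nhds t. \<forall>w\<in>{i, j}. 0 < bary w (G s) \<and> 0 < bary w (unfold_map k l (G s))"
    by (intro eventually_ball_finite) auto
  then obtain d where d: "0 < d" "\<And>s. \<bar>s - t\<bar> < d \<Longrightarrow> \<forall>w\<in>{i, j}. 0 < bary w (G s) \<and> 0 < bary w (unfold_map k l (G s))"
    unfolding eventually_near_iff by blast
  have cw: "convex_wedge k l (G s)" if "\<bar>s - t\<bar> < d" for s
    using d(2)[OF that] rest G_surface[of s] unfolding convex_wedge_def wedge_def by blast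
  obtain e where e: "0 < e" "\<And>a b. \<lbrakk>t - e \<le> a; a \<le> b; b \<le> t + e\<rbrakk> \<Longrightarrow> curve_length a b G = intrinsic_dist surface (G a) (G b)"
    using subarc_shortest[of t] by blast
  define m where "m = min e (d / 2)"
  have m: "0 < m" "m \<le> e" "m < d" using e d by (auto simp: m_def)
  show ?thesis
  proof (rule that[OF kl m(1)])
    show "convex_wedge k l (G s)" if "\<bar>s - t\<bar> \<le> m" for s using that m by (intro cw) auto
    fix a b assume ab: "t - m \<le> a" "a \<le> b" "b \<le> t + m"
    have cab: "convex_wedge k l (G s)" if "s \<in> {a..b}" for s using that ab m by (intro cw) auto
    show "curve_length a b G = ennreal (sdist (unfold_map k l (G a)) (unfold_map k l (G b)))"
    proof (rule antisym)
      show "curve_length a b G \<le> ennreal (sdist (unfold_map k l (G a)) (unfold_map k l (G b)))"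
        using e(2)[of a b] ab m cab by (simp add: dist_le_unfold[OF kl])
      show "ennreal (sdist (unfold_map k l (G a)) (unfold_map k l (G b))) \<le> curve_length a b G"
        using cab by (intro unfold_le_curve_length kl ab(2) cont_G_on) (simp add: convex_wedge_def)
    qed
  qed
qed

lemma curve_length_finite: "a \<le> b \<Longrightarrow> curve_length a b G < top"
proof (induction a b rule: Bolzano)
  case (trans a b c)
  then show ?case by (subst curve_length_add[of a b c]) (auto simp: G_norm)
next
  case (local t)
  obtain k l e where "0 < e" "\<And>a b. \<lbrakk>t - e \<le> a; a \<le> b; b \<le> t + e\<rbrakk> \<Longrightarrow> curve_length a b G = ennreal (sdist (unfold_map k l (G a)) (unfold_map k l (G b)))"
    using local_unfold[of t] by metis
  then show ?case by (intro exI[of _ e]) auto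
qed

definition arclen :: "real \<Rightarrow> real" where
  "arclen t = (if 0 \<le> t then enn2real (curve_length 0 t G) else - enn2real (curve_length t 0 G))"

lemma enn2real_add:
  assumes "a \<le> b" "b \<le> d"
  shows "enn2real (curve_length a d G) = enn2real (curve_length a b G) + enn2real (curve_length b d G)"
  using assms curve_length_finite by (subst curve_length_add[of a b d]) (auto simp: G_norm enn2real_plus)

lemma arclen_diff:
  assumes "a \<le> b"
  shows "enn2real (curve_length a b G) = arclen b - arclen a"
  using assms enn2real_add[of 0 a b] enn2real_add[of a 0 b] enn2real_add[of a b 0] enn2real_add[of 0 0 0]
  by (auto simp: arclen_def)

lemma arclen_local:
  obtains k l e where "k \<in> V" "l \<in> V" "k \<noteq> l" "0 < e"
    "\<And>s. \<bar>s - t\<bar> \<le> e \<Longrightarrow> wedge k l (G s)"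
    "\<And>a b. \<lbrakk>\<bar>a - t\<bar> \<le> e; \<bar>b - t\<bar> \<le> e\<rbrakk> \<Longrightarrow> \<bar>arclen b - arclen a\<bar> = sdist (unfold_map k l (G a)) (unfold_map k l (G b))"
proof -
  obtain k l e where kl: "k \<in> V" "l \<in> V" "k \<noteq> l" and e: "0 < e"
    "\<And>s. \<bar>s - t\<bar> \<le> e \<Longrightarrow> convex_wedge k l (G s)"
    "\<And>a b. \<lbrakk>t - e \<le> a; a \<le> b; b \<le> t + e\<rbrakk> \<Longrightarrow> curve_length a b G = ennreal (sdist (unfold_map k l (G a)) (unfold_map k l (G b)))"
    using local_unfold[of t] by metis
  have w: "wedge k l (G s)" if "\<bar>s - t\<bar> \<le> e" for s using e(2)[OF that] by (simp add: convex_wedge_def)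
  have nn: "0 \<le> sdist (unfold_map k l (G a)) (unfold_map k l (G b))" if "\<bar>a - t\<bar> \<le> e" "\<bar>b - t\<bar> \<le> e" for a b
    using that by (intro sdist_bounds unfold_map_wedge_norm kl w)
  have 1: "arclen b - arclen a = sdist (unfold_map k l (G a)) (unfold_map k l (G b))"
    if "\<bar>a - t\<bar> \<le> e" "\<bar>b - t\<bar> \<le> e" "a \<le> b" for a b
    using e(3)[of a b] that nn[of a b] arclen_diff[of a b] by (auto simp: abs_le_iff)
  have "\<bar>arclen b - arclen a\<bar> = sdist (unfold_map k l (G a)) (unfold_map k l (G b))"
    if "\<bar>a - t\<bar> \<le> e" "\<bar>b - t\<bar> \<le> e" for a b
    using 1[OF that] 1[OF that(2,1)] nn[OF that] by (cases "a \<le> b") (auto simp: sdist_commute)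
  then show ?thesis using that[OF kl e(1) w] by blast
qed

lemma arclen_mono: "a \<le> b \<Longrightarrow> arclen a \<le> arclen b"
  using arclen_diff[of a b] enn2real_nonneg[of "curve_length a b G"] by simp

lemma arclen_strict:
  assumes "a < b"
  shows "arclen a < arclen b"
proof -
  obtain k l e where kl: "k \<in> V" "l \<in> V" "k \<noteq> l" and e: "0 < e"
    "\<And>s. \<bar>s - a\<bar> \<le> e \<Longrightarrow> wedge k l (G s)"
    "\<And>x y. \<lbrakk>\<bar>x - a\<bar> \<le> e; \<bar>y - a\<bar> \<le> e\<rbrakk> \<Longrightarrow> \<bar>arclen y - arclen x\<bar> = sdist (unfold_map k l (G x)) (unfold_map k l (G y))"
    using arclen_local[of a] by metis
  define m where "m = min (min e (b - a)) (1 / 2)"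
  have m: "0 < m" "m \<le> e" "a + m \<le> b" "m < 1" using e assms by (auto simp: m_def)
  have w: "wedge k l (G a)" "wedge k l (G (a + m))"
    using e(1) m by (auto intro!: e(2))
  have "arclen a \<noteq> arclen (a + m)"
  proof
    assume "arclen a = arclen (a + m)"
    then have "sdist (unfold_map k l (G a)) (unfold_map k l (G (a + m))) = 0" using e(3)[of a "a + m"] e(1) m by simp
    then have "unfold_map k l (G a) = unfold_map k l (G (a + m))"
      by (rule sdist_eq_0_imp_eq[OF unfold_map_wedge_norm[OF kl w(1)] unfold_map_wedge_norm[OF kl w(2)]])
    then have "G a = G (a + m)" by (rule unfold_map_inj[OF kl w])
    then show False using G_inj_near[of a "a + m"] m by auto
  qed
  then show ?thesis using arclen_mono[of a "a + m"] arclen_mono[of "a + m" b] m by simp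
qed

lemma arclen_less_iff: "arclen a < arclen b \<longleftrightarrow> a < b"
  using arclen_strict[of a b] arclen_mono[of b a] by fastforce

lemma isCont_arclen: "isCont arclen t"
proof -
  obtain k l e where kl: "k \<in> V" "l \<in> V" "k \<noteq> l" and e: "0 < e"
    "\<And>s. \<bar>s - t\<bar> \<le> e \<Longrightarrow> wedge k l (G s)"
    "\<And>x y. \<lbrakk>\<bar>x - t\<bar> \<le> e; \<bar>y - t\<bar> \<le> e\<rbrakk> \<Longrightarrow> \<bar>arclen y - arclen x\<bar> = sdist (unfold_map k l (G x)) (unfold_map k l (G y))"
    using arclen_local[of t] by metis
  define f where "f = (\<lambda>s. sdist (unfold_map k l (G t)) (unfold_map k l (G s)))"
  have "continuous_on {t - e..t + e} f" unfolding f_def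
    using e by (intro continuous_on_sdist continuous_intros cont_G_on unfold_map_wedge_norm kl) (auto simp: abs_le_iff)
  then have "isCont f t" using e(1) by (intro continuous_on_interior[of "{t - e..t + e}"]) auto
  moreover have "f t = 0" unfolding f_def using e by (intro sdist_refl unfold_map_wedge_norm kl) auto
  ultimately have "(f \<longlongrightarrow> 0) (at t)" by (simp add: isCont_def)
  moreover have "\<forall>\<^sub>F s in at t. norm (arclen s - arclen t) \<le> f s"
    unfolding eventually_at using e by (intro exI[of _ e]) (auto simp: f_def dist_real_def)
  ultimately have "((\<lambda>s. arclen s - arclen t) \<longlongrightarrow> 0) (at t)" by (rule Lim_null_comparison[rotated])
  then show ?thesis by (simp add: isCont_def LIM_zero_iff)
qed

definition loop_len :: real where "loop_len = arclen 1"

lemma arclen_0: "arclen 0 = 0"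
  using arclen_diff[of 0 0] by (simp add: arclen_def)

lemma loop_len_pos: "0 < loop_len"
  using arclen_strict[of 0 1] by (simp add: loop_len_def arclen_0)

lemma curve_length_loop: "curve_length 0 1 G = ennreal loop_len"
proof -
  have "curve_length 0 1 G = ennreal (enn2real (curve_length 0 1 G))"
    using curve_length_finite[of 0 1] by simp
  then show ?thesis using arclen_diff[of 0 1] by (simp add: loop_len_def arclen_0)
qed

lemma arclen_period: "arclen (t + 1) = arclen t + loop_len"
proof -
  have shift: "curve_length (a + 1) (b + 1) G = curve_length a b G" for a b
    using curve_length_affine[of 1 a b G 1] by (simp add: G_period)
  have "arclen (b + 1) - arclen (a + 1) = arclen b - arclen a" if "a \<le> b" for a b
    using arclen_diff[of a b] arclen_diff[of "a + 1" "b + 1"] shift that by simp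
  from this[of 0 t] this[of t 0] show ?thesis by (cases "0 \<le> t") (auto simp: arclen_0 loop_len_def)
qed

lemma arclen_of_int: "arclen (t + of_int n) = arclen t + of_int n * loop_len"
proof (induction n rule: int_induct[of _ 0])
  case (step1 i)
  then show ?case using arclen_period[of "t + of_int i"] by (simp add: algebra_simps)
next
  case (step2 i)
  then show ?case using arclen_period[of "t + of_int (i - 1)"] by (simp add: algebra_simps)
qed simp

lemma arclen_surj: "\<exists>t. arclen t = s"
proof -
  obtain n :: nat where n: "\<bar>s\<bar> / loop_len \<le> n" using real_arch_simple by blast
  then have "\<bar>s\<bar> \<le> n * loop_len" using loop_len_pos by (simp add: pos_divide_le_eq)
  then have "arclen (- real n) \<le> s" "s \<le> arclen (real n)"
    using arclen_of_int[of 0 "int n"] arclen_of_int[of 0 "- int n"] by (auto simp: arclen_0)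
  then show ?thesis using IVT[of arclen "- real n" s "real n"] isCont_arclen by auto
qed

definition param :: "real \<Rightarrow> real" where "param s = (SOME t. arclen t = s)"

lemma arclen_param [simp]: "arclen (param s) = s"
  unfolding param_def by (rule someI_ex) (rule arclen_surj)

definition unit_curve :: "real \<Rightarrow> real ^ 4" where "unit_curve s = G (param s)"

lemma param_eqI: "arclen t = s \<Longrightarrow> param s = t"
  using arclen_param[of s] arclen_less_iff[of t "param s"] arclen_less_iff[of "param s" t] by fastforce

lemma unit_curve_period: "unit_curve (s + loop_len) = unit_curve s"
proof -
  have "param (s + loop_len) = param s + 1" by (rule param_eqI) (simp add: arclen_period)
  then show ?thesis by (simp add: unit_curve_def G_period)
qed

lemma unit_curve_inj:
  assumes "unit_curve s = unit_curve t"
  obtains n :: int where "s = t + n * loop_len"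
proof -
  have "param s - param t \<in> \<int>" using assms by (intro G_inj) (simp add: unit_curve_def)
  then obtain n where "param s - param t = of_int n" by (auto simp: Ints_def)
  then have "param s = param t + of_int n" by simp
  then have "s = t + n * loop_len" using arclen_of_int[of "param t" n] arclen_param by metis
  then show ?thesis by (rule that)
qed

lemma unit_curve_straight: "straight_at unit_curve s"
proof -
  define t where "t = param s"
  obtain k l e where kl: "k \<in> V" "l \<in> V" "k \<noteq> l" and e: "0 < e"
    "\<And>s. \<bar>s - t\<bar> \<le> e \<Longrightarrow> wedge k l (G s)"
    "\<And>x y. \<lbrakk>\<bar>x - t\<bar> \<le> e; \<bar>y - t\<bar> \<le> e\<rbrakk> \<Longrightarrow> \<bar>arclen y - arclen x\<bar> = sdist (unfold_map k l (G x)) (unfold_map k l (G y))"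
    using arclen_local[of t] by metis
  define d where "d = min (arclen (t + e) - s) (s - arclen (t - e))"
  have st: "s = arclen t" by (simp add: t_def)
  have d: "0 < d" using arclen_strict[of t "t + e"] arclen_strict[of "t - e" t] e(1) by (simp add: d_def st)
  have near: "\<bar>param (s + \<tau>) - t\<bar> \<le> e" if "\<bar>\<tau>\<bar> < d" for \<tau>
  proof -
    have "arclen (t - e) < arclen (param (s + \<tau>))" "arclen (param (s + \<tau>)) < arclen (t + e)"
      using that by (auto simp: d_def)
    then show ?thesis unfolding arclen_less_iff by (simp add: abs_le_iff)
  qed
  define f where "f = (\<lambda>\<tau>. unfold_map k l (unit_curve (s + \<tau>)))"
  have "f x \<bullet> f y = cos (x - y)" if "\<bar>x\<bar> < d" "\<bar>y\<bar> < d" for x y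
  proof -
    have n: "norm (f x) = 1" "norm (f y) = 1"
      unfolding f_def unit_curve_def using near that e(2) by (auto intro!: unfold_map_wedge_norm kl)
    have "sdist (f x) (f y) = \<bar>x - y\<bar>"
      using e(3)[OF near[OF that(1)] near[OF that(2)]] unfolding f_def unit_curve_def by (simp add: abs_minus_commute)
    then show ?thesis using cos_sdist[OF n] by simp
  qed
  then obtain p q where "\<And>\<tau>. \<bar>\<tau>\<bar> < d \<Longrightarrow> f \<tau> = garc p q \<tau>" using garc_of_isometry[of d f] d by metis
  then show ?thesis unfolding straight_at_def
    using kl d near e(2) by (intro exI[of _ k] exI[of _ l] exI[of _ p] exI[of _ q] exI[of _ d]) (auto simp: f_def unit_curve_def)
qed

end

section \<open>Straight curves\<close>

lemma garc_shift: "garc p q (s + t) = garc (garc p q s) (garc p q (s + pi / 2)) t"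
  by (simp add: garc_def cos_add sin_add scaleR_add_right algebra_simps)

lemma garc_0 [simp]: "garc p q 0 = p"
  by (simp add: garc_def)

lemma garc_eqD:
  assumes "\<And>t. t \<in> {a<..<b} \<Longrightarrow> garc p q t = garc p' q' t" "a < b"
  shows "garc p q = garc p' q'"
proof
  fix t
  define u v where "u = p - p'" and "v = q - q'"
  have uv: "cos t *\<^sub>R u + sin t *\<^sub>R v = 0" if "t \<in> {a<..<b}" for t
    using assms(1)[OF that] by (simp add: garc_def u_def v_def algebra_simps)
  define m where "m = (a + b) / 2"
  define e where "e = min ((b - a) / 4) 1"
  have e: "0 < e" "e < pi" "m \<in> {a<..<b}" "m + e \<in> {a<..<b}"
    using assms(2) pi_gt3 by (auto simp: e_def m_def field_simps min_def)
  have se: "0 < sin e" using e by (intro sin_gt_zero) auto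
  have 1: "cos m *\<^sub>R u + sin m *\<^sub>R v = 0" and 2: "cos (m + e) *\<^sub>R u + sin (m + e) *\<^sub>R v = 0"
    using uv e by auto
  have "sin e *\<^sub>R v = cos m *\<^sub>R (cos (m + e) *\<^sub>R u + sin (m + e) *\<^sub>R v) - cos (m + e) *\<^sub>R (cos m *\<^sub>R u + sin m *\<^sub>R v)"
  proof -
    have "cos m * sin (m + e) - cos (m + e) * sin m = sin e"
      using sin_diff[of "m + e" m] by simp
    then show ?thesis by (simp add: algebra_simps flip: scaleR_diff_left)
  qed
  then have v0: "v = 0" using 1 2 se by simp
  have "sin e *\<^sub>R u = sin (m + e) *\<^sub>R (cos m *\<^sub>R u + sin m *\<^sub>R v) - sin m *\<^sub>R (cos (m + e) *\<^sub>R u + sin (m + e) *\<^sub>R v)"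
  proof -
    have "sin (m + e) * cos m - sin m * cos (m + e) = sin e"
      using sin_diff[of "m + e" m] by simp
    then show ?thesis by (simp add: algebra_simps flip: scaleR_diff_left)
  qed
  then have "u = 0" using 1 2 se by simp
  then show "garc p q t = garc p' q' t" using v0 by (simp add: u_def v_def)
qed

lemma garc_unit_imp:
  assumes "\<And>t. \<bar>t\<bar> < d \<Longrightarrow> norm (garc p q t) = 1" "0 < d"
  shows "norm p = 1" "norm q = 1" "p \<bullet> q = 0"
proof -
  show p: "norm p = 1" using assms(1)[of 0] assms(2) by simp
  define e where "e = min (d / 2) 1"
  have e: "0 < e" "e < d" "e < pi / 2" using assms(2) pi_gt3 by (auto simp: e_def min_def)
  have s: "0 < sin e" "0 < cos e" using e by (auto intro!: sin_gt_zero cos_gt_zero_pi)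
  have n: "(cos t)\<^sup>2 + (sin t)\<^sup>2 * (q \<bullet> q) + 2 * (cos t * sin t) * (p \<bullet> q) = 1" if "\<bar>t\<bar> < d" for t
    using assms(1)[OF that] p
    by (simp add: norm_eq_1 garc_def inner_add power2_eq_square inner_commute algebra_simps)
  have "(cos e)\<^sup>2 + (sin e)\<^sup>2 * (q \<bullet> q) + 2 * (cos e * sin e) * (p \<bullet> q) = 1"
    "(cos e)\<^sup>2 + (sin e)\<^sup>2 * (q \<bullet> q) - 2 * (cos e * sin e) * (p \<bullet> q) = 1"
    using n[of e] n[of "- e"] e by simp_all
  then have "cos e * sin e * (p \<bullet> q) = 0" by linarith
  then show pq: "p \<bullet> q = 0" using s by simp
  have "(cos e)\<^sup>2 + (sin e)\<^sup>2 * (q \<bullet> q) = 1" using n[of e] e pq by simp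
  then have "(sin e)\<^sup>2 * (q \<bullet> q) = (sin e)\<^sup>2" using sin_cos_squared_add[of e] by linarith
  then show "norm q = 1" using s by (simp add: norm_eq_1)
qed

lemma garc_global:
  fixes f :: "real \<Rightarrow> 'a::real_inner"
  assumes "\<And>t. \<exists>p q d. 0 < d \<and> (\<forall>\<tau>. \<bar>\<tau>\<bar> < d \<longrightarrow> f (t + \<tau>) = garc p q \<tau>)"
  obtains p q where "\<And>t. f t = garc p q t"
proof -
  obtain p q d where pq: "0 < d" "\<And>\<tau>. \<bar>\<tau>\<bar> < d \<Longrightarrow> f \<tau> = garc p q \<tau>" using assms[of 0] by force
  have loc: "\<exists>d>0. \<exists>p q. \<forall>s. \<bar>s - t\<bar> < d \<longrightarrow> f s = garc p q s" for t
  proof -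
    obtain p q d where *: "0 < d" "\<And>\<tau>. \<bar>\<tau>\<bar> < d \<Longrightarrow> f (t + \<tau>) = garc p q \<tau>" using assms[of t] by blast
    have "f s = garc (garc p q (- t)) (garc p q (- t + pi / 2)) s" if "\<bar>s - t\<bar> < d" for s
      using *(2)[of "s - t"] that garc_shift[of p q "- t" s] by simp
    then show ?thesis using * by blast
  qed
  define R where "R = {t. \<exists>d>0. \<forall>s. \<bar>s - t\<bar> < d \<longrightarrow> f s = garc p q s}"
  have 0: "0 \<in> R" using pq by (auto simp: R_def)
  have opn: "open R"
    unfolding open_dist
  proof
    fix t assume "t \<in> R"
    then obtain d where d: "0 < d" "\<And>s. \<bar>s - t\<bar> < d \<Longrightarrow> f s = garc p q s" by (auto simp: R_def)
    have "y \<in> R" if "dist y t < d / 2" for y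
    proof -
      have "f s = garc p q s" if "\<bar>s - y\<bar> < d / 2" for s
      proof -
        have "\<bar>s - t\<bar> < d" using that \<open>dist y t < d / 2\<close> unfolding dist_real_def by arith
        then show ?thesis by (rule d(2))
      qed
      then show ?thesis using d(1) by (auto simp: R_def intro!: exI[of _ "d / 2"])
    qed
    then show "\<exists>e>0. \<forall>y. dist y t < e \<longrightarrow> y \<in> R" using d(1) by (intro exI[of _ "d / 2"]) auto
  qed
  have "open (- R)"
    unfolding open_dist
  proof
    fix t assume t: "t \<in> - R"
    obtain d p' q' where d: "0 < d" "\<And>s. \<bar>s - t\<bar> < d \<Longrightarrow> f s = garc p' q' s" using loc[of t] by blast
    have "y \<in> - R" if y: "dist y t < d" for y
    proof
      assume "y \<in> R"
      then obtain e where e: "0 < e" "\<And>s. \<bar>s - y\<bar> < e \<Longrightarrow> f s = garc p q s" by (auto simp: R_def)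
      define m where "m = min e (d - dist y t)"
      have m: "0 < m" using e y by (simp add: m_def)
      have "garc p q s = garc p' q' s" if "s \<in> {y - m<..<y + m}" for s
      proof -
        have "\<bar>s - y\<bar> < e" "\<bar>s - t\<bar> < d" using that unfolding m_def dist_real_def by auto
        then show ?thesis using e(2) d(2) by metis
      qed
      then have "garc p q = garc p' q'" using m by (intro garc_eqD[of "y - m" "y + m"]) auto
      then have "t \<in> R" using d by (auto simp: R_def)
      then show False using t by simp
    qed
    then show "\<exists>e>0. \<forall>y. dist y t < e \<longrightarrow> y \<in> - R" using d(1) by blast
  qed
  then have "closed R" by (simp add: closed_def)
  then have "R = {} \<or> R = UNIV" using opn clopen[of R] by blast
  then have "R = UNIV" using 0 by blast
  have "f t = garc p q t" for t
  proof -
    have "t \<in> R" using \<open>R = UNIV\<close> by simp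
    then obtain d where "0 < d" "\<And>s. \<bar>s - t\<bar> < d \<Longrightarrow> f s = garc p q s" by (auto simp: R_def)
    then show ?thesis by simp
  qed
  then show ?thesis by (rule that)
qed

context regular_tetra
begin

lemma unfold_map_garc: "unfold_map k l (garc p q t) = garc (unfold_map k l p) (unfold_map k l q) t"
  by (simp add: garc_def unfold_map_linear)

lemma bary_garc: "bary w (garc p q t) = cos t * bary w p + sin t * bary w q"
  by (simp add: garc_def)

lemma unfold_swap:
  assumes "k \<in> V" "l \<in> V" "k \<noteq> l"
  shows "unfold_map l k (unfold_map k l x) = unfold_map l k x"
  using assms by (simp add: unfold_map_def xi_commute[of l k] bary_xi algebra_simps)

lemma wedge_swap: "wedge k l x = wedge l k x"
  by (simp add: wedge_def insert_commute)

lemma wedge_refold: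
  assumes "k \<in> V" "l \<in> V" "k \<noteq> l" "wedge k l x"
  shows "x = unfold_map k l x + max 0 (- bary k (unfold_map k l x)) *\<^sub>R \<xi> k l"
proof -
  have "max 0 (- (bary k x - bary l x)) = bary l x"
    using wedge_zero[OF assms(4)] wedge_nonneg[OF assms(4)] assms(1,2) by (force simp: max_def)
  then show ?thesis unfolding bary_unfold_map[OF assms(1-3)] by (simp add: unfold_map_def)
qed

lemma straight_atD:
  assumes "straight_at f t" "g \<in> V" "bary g (f t) = 0"
  obtains k p q d where "k \<in> V" "k \<noteq> g" "0 < d"
    "\<And>\<tau>. \<bar>\<tau>\<bar> < d \<Longrightarrow> wedge k g (f (t + \<tau>)) \<and> unfold_map k g (f (t + \<tau>)) = garc p q \<tau>"
proof -
  obtain k l p q d where kl: "k \<in> V" "l \<in> V" "k \<noteq> l" "0 < d"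
    and *: "\<And>\<tau>. \<bar>\<tau>\<bar> < d \<Longrightarrow> wedge k l (f (t + \<tau>)) \<and> unfold_map k l (f (t + \<tau>)) = garc p q \<tau>"
    using assms(1) unfolding straight_at_def by blast
  have "wedge k l (f t)" using *[of 0] kl(4) by simp
  then have "g = k \<or> g = l" using assms(2,3) by (force simp: wedge_def)
  then show ?thesis
  proof
    assume "g = l"
    then show ?thesis using that[of k d p q] kl * by blast
  next
    assume g: "g = k"
    have "wedge l k (f (t + \<tau>)) \<and> unfold_map l k (f (t + \<tau>)) = garc (unfold_map l k p) (unfold_map l k q) \<tau>"
      if "\<bar>\<tau>\<bar> < d" for \<tau>
      using *[OF that] unfold_swap[OF kl(1-3), of "f (t + \<tau>)"] by (simp add: unfold_map_garc wedge_swap)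
    then show ?thesis using that[of l d] kl g by blast
  qed
qed

lemma straight_at_surface: "straight_at f t \<Longrightarrow> f t \<in> surface"
  unfolding straight_at_def wedge_def by (metis abs_zero add.right_neutral)

lemma straight_at_two_pos:
  assumes "straight_at f t"
  obtains k l where "k \<in> V" "l \<in> V" "k \<noteq> l" "wedge k l (f t)"
  using assms unfolding straight_at_def by (metis abs_zero add.right_neutral)

lemma straight_at_isCont:
  assumes "straight_at f t"
  shows "isCont f t"
proof -
  obtain k l p q d where kl: "k \<in> V" "l \<in> V" "k \<noteq> l" "0 < d"
    and *: "\<And>\<tau>. \<bar>\<tau>\<bar> < d \<Longrightarrow> wedge k l (f (t + \<tau>)) \<and> unfold_map k l (f (t + \<tau>)) = garc p q \<tau>"
    using assms(1) unfolding straight_at_def by blast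
  define h where "h = (\<lambda>s. garc p q (s - t) + max 0 (- bary k (garc p q (s - t))) *\<^sub>R \<xi> k l)"
  have "continuous_on UNIV h" unfolding h_def by (intro continuous_intros)
  then have "isCont h t" by (simp add: continuous_on_eq_continuous_at)
  moreover have "f s = h s" if "\<bar>s - t\<bar> < d" for s
    using *[OF that] wedge_refold[OF kl(1-3), of "f s"] by (simp add: h_def)
  then have "\<forall>\<^sub>F s in nhds t. f s = h s" unfolding eventually_near_iff using kl(4) by blast
  ultimately show ?thesis using isCont_cong by blast
qed

lemma straight_at_face_garc:
  assumes "straight_at f t" "g \<in> V" "bary g (f t) = 0" "\<And>w. w \<in> V \<Longrightarrow> w \<noteq> g \<Longrightarrow> 0 < bary w (f t)"
  obtains p q d where "0 < d" "\<And>\<tau>. \<bar>\<tau>\<bar> < d \<Longrightarrow> f (t + \<tau>) = garc p q \<tau>"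
    "\<And>\<tau> w. \<lbrakk>\<bar>\<tau>\<bar> < d; w \<in> V; w \<noteq> g\<rbrakk> \<Longrightarrow> 0 < bary w (f (t + \<tau>))"
    "\<And>\<tau>. \<bar>\<tau>\<bar> < d \<Longrightarrow> bary g (f (t + \<tau>)) = 0" "\<And>\<tau>. \<bar>\<tau>\<bar> < d \<Longrightarrow> f (t + \<tau>) \<in> surface"
proof -
  obtain k p q d where k: "k \<in> V" "k \<noteq> g" "0 < d"
    and *: "\<And>\<tau>. \<bar>\<tau>\<bar> < d \<Longrightarrow> wedge k g (f (t + \<tau>)) \<and> unfold_map k g (f (t + \<tau>)) = garc p q \<tau>"
    using straight_atD[OF assms(1-3)] by metis
  have "((\<lambda>s. bary k (f s)) \<longlongrightarrow> bary k (f t)) (nhds t)"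
    using straight_at_isCont[OF assms(1)] unfolding isCont_def bary_def
    by (intro tendsto_intros) (simp add: tendsto_nhds_iff)
  then have "\<forall>\<^sub>F s in nhds t. 0 < bary k (f s)"
    using assms(4)[OF k(1,2)] by (rule order_tendstoD)
  then obtain e where e: "0 < e" "\<And>s. \<bar>s - t\<bar> < e \<Longrightarrow> 0 < bary k (f s)"
    unfolding eventually_near_iff by blast
  define m where "m = min d e"
  have m: "0 < m" "m \<le> d" "m \<le> e" using k e by (auto simp: m_def)
  have kp: "0 < bary k (f (t + \<tau>))" if "\<bar>\<tau>\<bar> < m" for \<tau> using e(2)[of "t + \<tau>"] that m by simp
  have g0: "bary g (f (t + \<tau>)) = 0" if "\<bar>\<tau>\<bar> < m" for \<tau>
    using wedge_zero[of k g "f (t + \<tau>)"] *[of \<tau>] kp[OF that] that m by force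
  show ?thesis
  proof (rule that[of m p q])
    show "f (t + \<tau>) = garc p q \<tau>" if "\<bar>\<tau>\<bar> < m" for \<tau>
      using *[of \<tau>] g0[OF that] that m by (simp add: unfold_map_id)
    show "0 < bary w (f (t + \<tau>))" if "\<bar>\<tau>\<bar> < m" "w \<in> V" "w \<noteq> g" for \<tau> w
      using *[of \<tau>] kp[OF that(1)] that m by (cases "w = k") (auto simp: wedge_def)
    show "f (t + \<tau>) \<in> surface" if "\<bar>\<tau>\<bar> < m" for \<tau>
      using *[of \<tau>] that m by (auto simp: wedge_def)
  qed (use m g0 in auto)
qed

lemma straight_unique_local:
  assumes "straight_at f t" "straight_at g t" "0 < e" "\<And>s. \<lbrakk>t - e < s; s < t\<rbrakk> \<Longrightarrow> f s = g s"
  obtains d where "0 < d" "\<And>s. \<bar>s - t\<bar> < d \<Longrightarrow> f s = g s"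
proof -
  have lim: "(f \<longlongrightarrow> f t) (at_left t)" "(g \<longlongrightarrow> g t) (at_left t)"
    using straight_at_isCont[OF assms(1)] straight_at_isCont[OF assms(2)]
    by (auto simp: isCont_def intro: tendsto_within_subset)
  have "\<forall>\<^sub>F s in at_left t. f s = g s"
    using eventually_at_left_real[of "t - e" t] assms(3) by (auto elim!: eventually_mono intro: assms(4))
  then have ft: "f t = g t"
    using lim tendsto_unique[of "at_left t" f "f t" "g t"] tendsto_cong[of f g "at_left t" "g t"] by auto
  obtain h where h: "h \<in> V" "bary h (f t) = 0" using straight_at_surface[OF assms(1)] by (auto simp: surface_def)
  have ext: ?thesis if "0 < d" "\<And>\<tau>. \<bar>\<tau>\<bar> < d \<Longrightarrow> F (f (t + \<tau>)) = garc p q \<tau>" "\<And>\<tau>. \<bar>\<tau>\<bar> < d \<Longrightarrow> F (g (t + \<tau>)) = garc p' q' \<tau>"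
      "\<And>\<tau>. \<bar>\<tau>\<bar> < d \<Longrightarrow> F (f (t + \<tau>)) = F (g (t + \<tau>)) \<Longrightarrow> f (t + \<tau>) = g (t + \<tau>)"
    for F :: "real ^ 4 \<Rightarrow> real ^ 4" and d p q p' q'
  proof -
    have "garc p q \<tau> = garc p' q' \<tau>" if \<tau>: "\<tau> \<in> {- min d e<..<0}" for \<tau>
      using \<open>\<And>\<tau>. \<bar>\<tau>\<bar> < d \<Longrightarrow> F (f (t + \<tau>)) = garc p q \<tau>\<close>[of \<tau>]
        \<open>\<And>\<tau>. \<bar>\<tau>\<bar> < d \<Longrightarrow> F (g (t + \<tau>)) = garc p' q' \<tau>\<close>[of \<tau>] assms(4)[of "t + \<tau>"] \<tau> by auto
    then have "garc p q = garc p' q'" using that(1) assms(3) by (intro garc_eqD[of "- min d e" 0]) auto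
    then have "f (t + \<tau>) = g (t + \<tau>)" if "\<bar>\<tau>\<bar> < d" for \<tau>
      using \<open>\<And>\<tau>. \<bar>\<tau>\<bar> < d \<Longrightarrow> F (f (t + \<tau>)) = garc p q \<tau>\<close>[OF that]
        \<open>\<And>\<tau>. \<bar>\<tau>\<bar> < d \<Longrightarrow> F (g (t + \<tau>)) = garc p' q' \<tau>\<close>[OF that]
        \<open>\<And>\<tau>. \<bar>\<tau>\<bar> < d \<Longrightarrow> F (f (t + \<tau>)) = F (g (t + \<tau>)) \<Longrightarrow> f (t + \<tau>) = g (t + \<tau>)\<close>[OF that] by simp
    then have "f s = g s" if "\<bar>s - t\<bar> < d" for s using that by (metis add_diff_cancel_left' diff_add_cancel add.commute)
    then show ?thesis using that(1) \<open>\<And>d. \<lbrakk>0 < d; \<And>s. \<bar>s - t\<bar> < d \<Longrightarrow> f s = g s\<rbrakk> \<Longrightarrow> thesis\<close> by blast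
  qed
  show ?thesis
  proof (cases "\<exists>k\<in>V. k \<noteq> h \<and> bary k (f t) = 0")
    case False
    then have pos: "0 < bary w (f t)" if "w \<in> V" "w \<noteq> h" for w
      using that straight_at_surface[OF assms(1)] by (force simp: surface_def)
    obtain p q d where 1: "0 < d" "\<And>\<tau>. \<bar>\<tau>\<bar> < d \<Longrightarrow> f (t + \<tau>) = garc p q \<tau>"
      using straight_at_face_garc[OF assms(1) h pos] by metis
    obtain p' q' d' where 2: "0 < d'" "\<And>\<tau>. \<bar>\<tau>\<bar> < d' \<Longrightarrow> g (t + \<tau>) = garc p' q' \<tau>"
      using straight_at_face_garc[OF assms(2) h[unfolded ft] pos[unfolded ft]] by metis
    have "0 < min d d'" using 1(1) 2(1) by simp
    moreover have "f (t + \<tau>) = garc p q \<tau>" "g (t + \<tau>) = garc p' q' \<tau>" if "\<bar>\<tau>\<bar> < min d d'" for \<tau>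
      using 1(2)[of \<tau>] 2(2)[of \<tau>] that by auto
    ultimately show ?thesis by (rule ext[where F = "\<lambda>x. x"])
  next
    case True
    then obtain k where k: "k \<in> V" "k \<noteq> h" "bary k (f t) = 0" by blast
    obtain k1 p q d where 1: "k1 \<in> V" "k1 \<noteq> h" "0 < d"
      "\<And>\<tau>. \<bar>\<tau>\<bar> < d \<Longrightarrow> wedge k1 h (f (t + \<tau>)) \<and> unfold_map k1 h (f (t + \<tau>)) = garc p q \<tau>"
      using straight_atD[OF assms(1) h] by metis
    obtain k2 p' q' d' where 2: "k2 \<in> V" "k2 \<noteq> h" "0 < d'"
      "\<And>\<tau>. \<bar>\<tau>\<bar> < d' \<Longrightarrow> wedge k2 h (g (t + \<tau>)) \<and> unfold_map k2 h (g (t + \<tau>)) = garc p' q' \<tau>"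
      using straight_atD[OF assms(2) h[unfolded ft]] by metis
    have "wedge k1 h (f t)" "wedge k2 h (f t)" using 1(3) 1(4)[of 0] 2(3) 2(4)[of 0] ft by auto
    then have kk: "k1 = k" "k2 = k" using k by (force simp: wedge_def)+
    have w1: "wedge k h (f (t + \<tau>))" "unfold_map k h (f (t + \<tau>)) = garc p q \<tau>" if "\<bar>\<tau>\<bar> < min d d'" for \<tau>
      using 1(4)[of \<tau>] that unfolding kk by auto
    have w2: "wedge k h (g (t + \<tau>))" "unfold_map k h (g (t + \<tau>)) = garc p' q' \<tau>" if "\<bar>\<tau>\<bar> < min d d'" for \<tau>
      using 2(4)[of \<tau>] that unfolding kk by auto
    have "0 < min d d'" using 1(3) 2(3) by simp
    then show ?thesis
      using w1(2) w2(2) unfold_map_inj[OF k(1) h(1) k(2) w1(1) w2(1)] by (rule ext)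
  qed
qed

lemma straight_unique:
  assumes "\<And>t. a < t \<Longrightarrow> t < b \<Longrightarrow> straight_at f t" "\<And>t. a < t \<Longrightarrow> t < b \<Longrightarrow> straight_at g t"
    and "a < e" "\<And>t. a < t \<Longrightarrow> t < e \<Longrightarrow> f t = g t" "a < s" "s < b"
  shows "f s = g s"
proof -
  define Q where "Q = {u. a < u \<and> u \<le> b \<and> (\<forall>t. a < t \<and> t < u \<longrightarrow> f t = g t)}"
  have Q0: "min e b \<in> Q" using assms by (auto simp: Q_def)
  have bdd: "bdd_above Q" by (auto simp: Q_def intro!: bdd_aboveI[of _ b])
  define u where "u = Sup Q"
  have u: "min e b \<le> u" "u \<le> b"
  proof -
    have "Q \<noteq> {}" using Q0 by blast
    moreover have "x \<le> b" if "x \<in> Q" for x using that by (simp add: Q_def)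
    ultimately have "Sup Q \<le> b" by (rule cSup_least)
    then show "min e b \<le> u" "u \<le> b" unfolding u_def using cSup_upper[OF Q0 bdd] by blast+
  qed
  have au: "a < u" using u assms by auto
  have eq: "f t = g t" if t: "a < t" "t < u" for t
  proof -
    obtain v where "v \<in> Q" "t < v" using less_cSup_iff[of Q t] bdd Q0 t(2) unfolding u_def by blast
    then show ?thesis using t by (auto simp: Q_def)
  qed
  have "u = b"
  proof (rule ccontr)
    assume "u \<noteq> b"
    then have ub: "u < b" using u by simp
    obtain d where d: "0 < d" "\<And>s. \<bar>s - u\<bar> < d \<Longrightarrow> f s = g s"
      using straight_unique_local[OF assms(1)[OF au ub] assms(2)[OF au ub], of "u - a"] eq au by auto
    have "min (u + d) b \<in> Q"
    proof -
      have "f t = g t" if "a < t" "t < u + d" for t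
        using that eq[of t] d(2)[of t] by (cases "t < u") auto
      then show ?thesis using au ub d(1) by (auto simp: Q_def)
    qed
    then have "min (u + d) b \<le> u" unfolding u_def by (intro cSup_upper bdd)
    then show False using ub d(1) by auto
  qed
  then show ?thesis using eq assms(5,6) by simp
qed

lemma straight_at_affine:
  assumes "straight_at f (a + t)"
  shows "straight_at (\<lambda>s. f (a + s)) t" "straight_at (\<lambda>s. f (a - s)) (- t)"
proof -
  obtain k l p q d where kl: "k \<in> V" "l \<in> V" "k \<noteq> l" "0 < d"
    and *: "\<And>\<tau>. \<bar>\<tau>\<bar> < d \<Longrightarrow> wedge k l (f (a + t + \<tau>)) \<and> unfold_map k l (f (a + t + \<tau>)) = garc p q \<tau>"
    using assms(1) unfolding straight_at_def by blast
  show "straight_at (\<lambda>s. f (a + s)) t"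
    unfolding straight_at_def using kl *
    by (intro exI[of _ k] exI[of _ l] exI[of _ p] exI[of _ q] exI[of _ d]) (simp add: add.assoc)
  show "straight_at (\<lambda>s. f (a - s)) (- t)"
    unfolding straight_at_def using kl *[of "- \<tau>" for \<tau>]
    by (intro exI[of _ k] exI[of _ l] exI[of _ p] exI[of _ "- q"] exI[of _ d]) (simp add: garc_def algebra_simps)
qed

end

section \<open>Developing a straight curve along a great circle\<close>

type_synonym pt3 = "real \<times> real \<times> real"

definition eqc :: "real \<Rightarrow> pt3" where "eqc s = (cos s, sin s, 0)"

definition eqt :: "real \<Rightarrow> pt3" where "eqt s = (- sin s, cos s, 0)"

definition hgt :: "pt3 \<Rightarrow> real" where "hgt x = snd (snd x)"

lemma hgt_simps [simp]: "hgt (x + y) = hgt x + hgt y" "hgt (x - y) = hgt x - hgt y" "hgt (r *\<^sub>R x) = r * hgt x" "hgt (- x) = - hgt x"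
  "hgt (eqc s) = 0" "hgt (eqt s) = 0"
  by (simp_all add: hgt_def eqc_def eqt_def)

lemma eqc_add: "eqc (s + t) = cos t *\<^sub>R eqc s + sin t *\<^sub>R eqt s"
  by (simp add: eqc_def eqt_def cos_add sin_add algebra_simps)

lemma eqc_inner: "eqc s \<bullet> eqc t = cos (s - t)" "eqc s \<bullet> eqt t = sin (s - t)" "eqt t \<bullet> eqc s = sin (s - t)" "eqt s \<bullet> eqt t = cos (s - t)"
  by (simp_all add: eqc_def eqt_def cos_diff sin_diff)

context regular_tetra
begin

definition frame :: "real ^ 4 \<Rightarrow> (pt3 \<Rightarrow> real ^ 4) \<Rightarrow> bool" where
  "frame f A \<longleftrightarrow> f \<in> V \<and> linear A \<and> (\<forall>x y. A x \<bullet> A y = x \<bullet> y) \<and> (\<forall>x. bary f (A x) = 0)"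

definition adj :: "(pt3 \<Rightarrow> real ^ 4) \<Rightarrow> real ^ 4 \<Rightarrow> pt3" where
  "adj A x = (x \<bullet> A (1, 0, 0), x \<bullet> A (0, 1, 0), x \<bullet> A (0, 0, 1))"

lemma frame_linear:
  assumes "frame f A"
  shows "A (x + y) = A x + A y" "A (r *\<^sub>R x) = r *\<^sub>R A x" "A (x - y) = A x - A y" "A (- x) = - A x"
proof -
  have "linear A" using assms by (simp add: frame_def)
  then show "A (x + y) = A x + A y" "A (r *\<^sub>R x) = r *\<^sub>R A x" "A (x - y) = A x - A y" "A (- x) = - A x"
    by (simp_all add: linear_add linear_cmul linear_diff linear_neg)
qed

lemma frameD:
  assumes "frame f A"
  shows "f \<in> V" "A x \<bullet> A y = x \<bullet> y" "bary f (A x) = 0"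
  using assms unfolding frame_def by blast+

lemma frame_norm: "frame f A \<Longrightarrow> norm (A x) = norm x"
  by (simp only: norm_eq_sqrt_inner frameD(2))

lemma frame_inj: "frame f A \<Longrightarrow> A x = A y \<Longrightarrow> x = y"
  using frame_norm[of f A "x - y"] frame_linear(3)[of f A x y] by simp

lemma frame_expand:
  assumes "frame f A"
  shows "A (a, b, d) = a *\<^sub>R A (1, 0, 0) + b *\<^sub>R A (0, 1, 0) + d *\<^sub>R A (0, 0, 1)"
proof -
  have "(a, b, d) = a *\<^sub>R (1, 0, 0) + b *\<^sub>R (0, 1, 0) + d *\<^sub>R ((0, 0, 1) :: pt3)" by simp
  then show ?thesis using frame_linear(1,2)[OF assms] by metis
qed

lemma frame_adj:
  assumes "frame f A" "bary f x = 0"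
  shows "A (adj A x) = x"
proof (rule ccontr)
  assume ne: "A (adj A x) \<noteq> x"
  define u where "u = x - A (adj A x)"
  have iso: "A y \<bullet> A z = y \<bullet> z" and z: "bary f (A y) = 0" and f: "f \<in> V" for y z
    using frameD[OF assms(1)] by auto
  let ?e1 = "A (1, 0, 0)" and ?e2 = "A (0, 1, 0)" and ?e3 = "A (0, 0, 1)"
  have u1: "u \<bullet> ?e1 = 0" "u \<bullet> ?e2 = 0" "u \<bullet> ?e3 = 0"
    unfolding u_def by (simp_all add: inner_diff_left iso adj_def)
  have ud: "u \<bullet> dual f = 0" using assms(2) z[of "adj A x"] by (simp add: u_def bary_def inner_diff_left)
  have ed: "A y \<bullet> dual f = 0" for y using z[of y] by (simp add: bary_def)
  have ee: "?e1 \<bullet> ?e1 = 1" "?e2 \<bullet> ?e2 = 1" "?e3 \<bullet> ?e3 = 1" "?e1 \<bullet> ?e2 = 0" "?e1 \<bullet> ?e3 = 0" "?e2 \<bullet> ?e3 = 0"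
    by (simp_all add: iso)
  have un: "u \<noteq> 0" using ne by (simp add: u_def)
  have dn: "dual f \<noteq> 0" using bary_self[OF f] by (auto simp: bary_def)
  let ?S = "{u, dual f, ?e1, ?e2, ?e3}"
  have "pairwise orthogonal ?S"
    unfolding pairwise_def orthogonal_def using u1 ud ed ee by (auto simp: inner_commute)
  moreover have "0 \<notin> ?S" using un dn ee by auto
  ultimately have "independent ?S" by (rule pairwise_orthogonal_independent)
  then have "card ?S \<le> DIM(real ^ 4)" using independent_bound by blast
  moreover have "card ?S = 5"
  proof -
    have "u \<noteq> dual f" "u \<noteq> ?e1" "u \<noteq> ?e2" "u \<noteq> ?e3" using un u1 ud by (metis inner_eq_zero_iff)+
    moreover have "dual f \<noteq> ?e1" "dual f \<noteq> ?e2" "dual f \<noteq> ?e3" using ed dn by (metis inner_eq_zero_iff)+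
    moreover have "?e1 \<noteq> ?e2" "?e1 \<noteq> ?e3" "?e2 \<noteq> ?e3" using ee by (metis zero_neq_one)+
    ultimately show ?thesis by simp
  qed
  ultimately show False by simp
qed

lemma adj_frame:
  assumes "frame f A"
  shows "adj A (A y) = y"
  using frame_inj[OF assms frame_adj[OF assms, of "A y"]] frameD[OF assms] by simp

lemma frame_exists:
  assumes "f \<in> V" "norm p = 1" "norm q = 1" "p \<bullet> q = 0" "bary f p = 0" "bary f q = 0"
  obtains A where "frame f A" "A (1, 0, 0) = p" "A (0, 1, 0) = q"
proof -
  let ?S = "{dual f, p, q}"
  have "dim (span ?S) \<le> card ?S" by (simp add: dim_le_card')
  also have "card ?S \<le> 3" by (simp add: card_insert_if)
  finally have "dim (span ?S) < DIM(real ^ 4)" by simp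
  then obtain r where r: "r \<noteq> 0" "\<And>y. y \<in> span ?S \<Longrightarrow> orthogonal r y"
    using orthogonal_to_subspace_exists[of ?S] by auto
  define e where "e = (1 / norm r) *\<^sub>R r"
  have e: "norm e = 1" "e \<bullet> p = 0" "e \<bullet> q = 0" "bary f e = 0"
    using r span_base[of _ ?S] by (auto simp: e_def orthogonal_def bary_def)
  define A where "A = (\<lambda>(a, b, d). a *\<^sub>R p + b *\<^sub>R q + d *\<^sub>R e)"
  have "frame f A"
    unfolding frame_def
  proof (intro conjI allI)
    show "linear A" by (intro linearI) (auto simp: A_def algebra_simps)
    show "A x \<bullet> A y = x \<bullet> y" for x y
      using assms e unfolding A_def
      by (cases x; cases y) (simp add: inner_add norm_eq_1 inner_commute algebra_simps)
    show "bary f (A x) = 0" for x using assms e by (cases x) (simp add: A_def)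
  qed (rule assms)
  then show ?thesis using that[of A] by (simp add: A_def)
qed

definition cross_frame :: "real ^ 4 \<Rightarrow> real ^ 4 \<Rightarrow> (pt3 \<Rightarrow> real ^ 4) \<Rightarrow> pt3 \<Rightarrow> real ^ 4" where
  "cross_frame k l A x = A x - bary k (A x) *\<^sub>R \<xi> k l"

lemma frame_cross:
  assumes "frame l A" "k \<in> V" "k \<noteq> l"
  shows "frame k (cross_frame k l A)"
proof -
  have l: "l \<in> V" "\<And>x. bary l (A x) = 0" "\<And>x y. A x \<bullet> A y = x \<bullet> y" using frameD[OF assms(1)] by auto
  have "\<xi> k l \<bullet> \<xi> k l = (1 + \<kappa>) * (1 - c) * 2" using assms l by (simp add: inner_xi bary_xi)
  moreover have "linear (cross_frame k l A)"
    by (intro linearI) (simp_all add: cross_frame_def frame_linear[OF assms(1)] algebra_simps)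
  ultimately show ?thesis
    unfolding frame_def using assms l
    by (simp add: cross_frame_def bary_xi inner_diff inner_xi inner_xi_right algebra_simps)
qed

lemma bary_frame_eqc:
  assumes "frame f A"
  shows "bary w (A (eqc (s + t))) = cos t * bary w (A (eqc s)) + sin t * bary w (A (eqt s))"
  by (simp add: eqc_add frame_linear[OF assms])

end

locale geodesic_loop = regular_tetra +
  fixes \<gamma> :: "real \<Rightarrow> real ^ 4" and \<Lambda> :: real
  assumes period_pos: "0 < \<Lambda>"
    and loop_period: "\<gamma> (s + \<Lambda>) = \<gamma> s"
    and loop_inj: "\<gamma> s = \<gamma> t \<Longrightarrow> \<exists>n::int. s = t + n * \<Lambda>"
    and loop_straight: "straight_at \<gamma> s"

lemma (in regular_tetra) frame_eqc: "frame f A \<Longrightarrow> A (eqc s) = garc (A (1, 0, 0)) (A (0, 1, 0)) s"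
  using frame_expand[of f A "cos s" "sin s" 0] by (simp add: eqc_def garc_def)

lemma (in regular_tetra) frame_eqc_shift: "frame f A \<Longrightarrow> A (eqc (s + t)) = garc (A (eqc s)) (A (eqt s)) t"
  by (simp add: eqc_add garc_def frame_linear)

context geodesic_loop
begin

lemma loop_surface: "\<gamma> s \<in> surface"
  by (rule straight_at_surface[OF loop_straight])

lemma loop_isCont: "isCont \<gamma> s"
  by (rule straight_at_isCont[OF loop_straight])

lemma loop_norm: "norm (\<gamma> s) = 1"
  by (rule surface_norm[OF loop_surface])

lemma loop_period_int: "\<gamma> (s + of_int n * \<Lambda>) = \<gamma> s"
proof (induction n rule: int_induct[of _ 0])
  case (step1 i)
  then show ?case using loop_period[of "s + of_int i * \<Lambda>"] by (simp add: algebra_simps)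
next
  case (step2 i)
  then show ?case using loop_period[of "s + of_int (i - 1) * \<Lambda>"] by (simp add: algebra_simps)
qed simp

definition in_face :: "real ^ 4 \<Rightarrow> (pt3 \<Rightarrow> real ^ 4) \<Rightarrow> real \<Rightarrow> bool" where
  "in_face f A \<sigma> \<longleftrightarrow> \<gamma> \<sigma> = A (eqc \<sigma>) \<and> (\<forall>w\<in>V - {f}. 0 < bary w (\<gamma> \<sigma>))"

definition enters :: "real ^ 4 \<Rightarrow> (pt3 \<Rightarrow> real ^ 4) \<Rightarrow> real \<Rightarrow> bool" where
  "enters f A s \<longleftrightarrow> frame f A \<and> (\<exists>d>0. \<forall>\<sigma>. s < \<sigma> \<and> \<sigma> < s + d \<longrightarrow> in_face f A \<sigma>)"

lemma meets_open_face: "\<exists>t g. g \<in> V \<and> bary g (\<gamma> t) = 0 \<and> (\<forall>w\<in>V - {g}. 0 < bary w (\<gamma> t))"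
proof (rule ccontr)
  assume *: "\<not> ?thesis"
  have two: "\<exists>k\<in>V. k \<noteq> g \<and> bary k (\<gamma> t) = 0" if "g \<in> V" "bary g (\<gamma> t) = 0" for t g
    using * that loop_surface[of t] by (force simp: surface_def)
  have "\<exists>p q d. 0 < d \<and> (\<forall>\<tau>. \<bar>\<tau>\<bar> < d \<longrightarrow> \<gamma> (t + \<tau>) = garc p q \<tau>)" for t
  proof -
    obtain g where g: "g \<in> V" "bary g (\<gamma> t) = 0" using loop_surface[of t] by (auto simp: surface_def)
    obtain k p q d where k: "k \<in> V" "k \<noteq> g" "0 < d"
      and *: "\<And>\<tau>. \<bar>\<tau>\<bar> < d \<Longrightarrow> wedge k g (\<gamma> (t + \<tau>)) \<and> unfold_map k g (\<gamma> (t + \<tau>)) = garc p q \<tau>"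
      using straight_atD[OF loop_straight g] by metis
    have "\<gamma> (t + \<tau>) = garc p q \<tau>" if "\<bar>\<tau>\<bar> < d" for \<tau>
    proof -
      have w: "wedge k g (\<gamma> (t + \<tau>))" using *[OF that] by blast
      obtain h where h: "h \<in> V" "bary h (\<gamma> (t + \<tau>)) = 0" using loop_surface[of "t + \<tau>"] by (auto simp: surface_def)
      obtain h' where h': "h' \<in> V" "h' \<noteq> h" "bary h' (\<gamma> (t + \<tau>)) = 0" using two[OF h] by blast
      have "h \<in> {k, g}" "h' \<in> {k, g}" using w h h' by (force simp: wedge_def)+
      then have "bary g (\<gamma> (t + \<tau>)) = 0" using h h' by auto
      then show ?thesis using *[OF that] by (simp add: unfold_map_id)
    qed
    then show ?thesis using k(3) by blast
  qed
  then obtain p q where "\<And>t. \<gamma> t = garc p q t" using garc_global[of \<gamma>] by metis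
  then have "\<gamma> pi = - \<gamma> 0" by (simp add: garc_def)
  then show False using surface_antipode[OF loop_surface loop_surface] by blast
qed

lemma enters_exists: "\<exists>f A s. enters f A s"
proof -
  obtain t g where g: "g \<in> V" "bary g (\<gamma> t) = 0" and pos: "\<And>w. w \<in> V \<Longrightarrow> w \<noteq> g \<Longrightarrow> 0 < bary w (\<gamma> t)"
    using meets_open_face by blast
  obtain p q d where d: "0 < d" and pq: "\<And>\<tau>. \<bar>\<tau>\<bar> < d \<Longrightarrow> \<gamma> (t + \<tau>) = garc p q \<tau>"
    "\<And>\<tau> w. \<lbrakk>\<bar>\<tau>\<bar> < d; w \<in> V; w \<noteq> g\<rbrakk> \<Longrightarrow> 0 < bary w (\<gamma> (t + \<tau>))"
    "\<And>\<tau>. \<bar>\<tau>\<bar> < d \<Longrightarrow> bary g (\<gamma> (t + \<tau>)) = 0"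
    using straight_at_face_garc[OF loop_straight g pos] by metis
  have on: "norm p = 1" "norm q = 1" "p \<bullet> q = 0"
    using garc_unit_imp[of d p q] pq(1) d loop_norm by metis+
  have bg: "bary g (garc p q \<tau>) = 0" if "\<bar>\<tau>\<bar> < d" for \<tau> using pq(1,3)[OF that] by simp
  have bp: "bary g p = 0" using bg[of 0] d by simp
  define e where "e = min (d / 2) 1"
  have e: "\<bar>e\<bar> < d" "0 < e" "e < pi" using d pi_gt3 by (auto simp: e_def min_def)
  then have "sin e * bary g q = 0" using bg[of e] bp by (simp add: bary_garc)
  then have bq: "bary g q = 0" using sin_gt_zero[of e] e by simp
  define p' q' where "p' = garc p q (- t)" and "q' = garc p q (- t + pi / 2)"
  have "norm p' = 1" "norm q' = 1" "p' \<bullet> q' = 0"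
    using on by (auto simp: p'_def q'_def norm_garc inner_garc)
  moreover have "bary g p' = 0" "bary g q' = 0" by (simp_all add: p'_def q'_def bary_garc bp bq)
  ultimately obtain A where A: "frame g A" "A (1, 0, 0) = p'" "A (0, 1, 0) = q'"
    using frame_exists[OF g(1)] by metis
  have "A (eqc \<sigma>) = garc p q (\<sigma> - t)" for \<sigma>
    unfolding frame_eqc[OF A(1)] A(2,3) p'_def q'_def garc_shift[of p q "- t" \<sigma>, symmetric] by (simp add: algebra_simps)
  then have "in_face g A \<sigma>" if "t < \<sigma>" "\<sigma> < t + d" for \<sigma>
    using pq(1)[of "\<sigma> - t"] pq(2)[of "\<sigma> - t"] that by (auto simp: in_face_def)
  then show ?thesis unfolding enters_def using A(1) d by blast
qed

lemma crossing_exists: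
  assumes "enters f A s"
  obtains s' f' where "s < s'" "f' \<in> V" "f' \<noteq> f" "\<And>\<sigma>. s < \<sigma> \<Longrightarrow> \<sigma> < s' \<Longrightarrow> in_face f A \<sigma>"
    "\<gamma> s' = A (eqc s')" "bary f' (\<gamma> s') = 0" "\<And>w. w \<in> V - {f, f'} \<Longrightarrow> 0 < bary w (\<gamma> s')"
    "enters f' (cross_frame f' f A) s'"
proof -
  have A: "frame f A" using assms by (simp add: enters_def)
  have fV: "f \<in> V" by (rule frameD(1)[OF A])
  obtain d0 where d0: "0 < d0" "\<And>\<sigma>. s < \<sigma> \<Longrightarrow> \<sigma> < s + d0 \<Longrightarrow> in_face f A \<sigma>"
    using assms unfolding enters_def by blast
  define Q where "Q = {u. s < u \<and> (\<forall>\<sigma>. s < \<sigma> \<and> \<sigma> < u \<longrightarrow> in_face f A \<sigma>)}"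
  have Q0: "s + d0 \<in> Q" using d0 by (auto simp: Q_def)
  have "u \<le> s + pi" if "u \<in> Q" for u
  proof (rule ccontr)
    assume u: "\<not> u \<le> s + pi"
    define \<sigma> where "\<sigma> = (s + (u - pi)) / 2"
    have \<sigma>: "s < \<sigma>" "\<sigma> + pi < u" using u by (simp_all add: \<sigma>_def field_simps)
    moreover have "\<sigma> < u" "s < \<sigma> + pi" using \<sigma> pi_gt_zero by linarith+
    ultimately have "in_face f A \<sigma>" "in_face f A (\<sigma> + pi)" using that by (auto simp: Q_def)
    then have "\<gamma> (\<sigma> + pi) = - \<gamma> \<sigma>" by (simp add: in_face_def eqc_add frame_linear[OF A])
    then show False using surface_antipode[OF loop_surface loop_surface] by blast
  qed
  then have bdd: "bdd_above Q" by (intro bdd_aboveI)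
  define s' where "s' = Sup Q"
  have "s + d0 \<le> s'" unfolding s'_def by (rule cSup_upper[OF Q0 bdd])
  then have ss: "s < s'" using d0 by simp
  have in_f: "in_face f A \<sigma>" if t: "s < \<sigma>" "\<sigma> < s'" for \<sigma>
  proof -
    obtain v where "v \<in> Q" "\<sigma> < v" using less_cSup_iff[of Q \<sigma>] bdd Q0 t(2) unfolding s'_def by blast
    then show ?thesis using t by (auto simp: Q_def)
  qed
  have left: "\<forall>\<^sub>F \<sigma> in at_left s'. \<gamma> \<sigma> = A (eqc \<sigma>)"
    using eventually_at_left_real[OF ss] by eventually_elim (use in_f in \<open>auto simp: in_face_def\<close>)
  have "(\<gamma> \<longlongrightarrow> \<gamma> s') (at_left s')"
    using loop_isCont[of s'] by (auto simp: isCont_def intro: tendsto_within_subset)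
  moreover have "((\<lambda>\<sigma>. A (eqc \<sigma>)) \<longlongrightarrow> A (eqc s')) (at_left s')"
  proof -
    have "continuous_on UNIV (\<lambda>\<sigma>. A (eqc \<sigma>))"
      unfolding frame_eqc[OF A] by (intro continuous_intros)
    then have "isCont (\<lambda>\<sigma>. A (eqc \<sigma>)) s'" by (simp add: continuous_on_eq_continuous_at)
    then show ?thesis by (auto simp: isCont_def intro: tendsto_within_subset)
  qed
  ultimately have at_s': "\<gamma> s' = A (eqc s')"
    using left tendsto_unique[of "at_left s'" \<gamma> "\<gamma> s'" "A (eqc s')"] tendsto_cong[OF left] by auto
  have f0: "bary f (\<gamma> s') = 0" unfolding at_s' by (rule frameD(3)[OF A])
  define P Q' where "P = A (eqc s')" and "Q' = A (eqt s')"
  have A_shift: "A (eqc (s' + \<tau>)) = garc P Q' \<tau>" for \<tau>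
    unfolding P_def Q'_def by (rule frame_eqc_shift[OF A])
  have "\<exists>f'\<in>V. f' \<noteq> f \<and> bary f' (\<gamma> s') = 0"
  proof (rule ccontr)
    assume "\<not> ?thesis"
    then have pos: "0 < bary w (\<gamma> s')" if "w \<in> V" "w \<noteq> f" for w
      using that loop_surface[of s'] by (force simp: surface_def)
    obtain p q d where d: "0 < d" and pq: "\<And>\<tau>. \<bar>\<tau>\<bar> < d \<Longrightarrow> \<gamma> (s' + \<tau>) = garc p q \<tau>"
      "\<And>\<tau> w. \<lbrakk>\<bar>\<tau>\<bar> < d; w \<in> V; w \<noteq> f\<rbrakk> \<Longrightarrow> 0 < bary w (\<gamma> (s' + \<tau>))"
      using straight_at_face_garc[OF loop_straight fV f0 pos] by metis
    define m where "m = min d (s' - s)"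
    have m: "0 < m" "m \<le> d" "m \<le> s' - s" using d ss by (auto simp: m_def)
    have "garc p q \<tau> = garc P Q' \<tau>" if "\<tau> \<in> {- m<..<0}" for \<tau>
      using pq(1)[of \<tau>] in_f[of "s' + \<tau>"] that m by (auto simp: in_face_def A_shift)
    then have eq: "garc p q = garc P Q'" using m by (intro garc_eqD[of "- m" 0]) auto
    have "in_face f A \<sigma>" if "s < \<sigma>" "\<sigma> < s' + d" for \<sigma>
    proof (cases "\<sigma> < s'")
      case True then show ?thesis using in_f that by blast
    next
      case False
      then show ?thesis using pq(1)[of "\<sigma> - s'"] pq(2)[of "\<sigma> - s'"] that A_shift[of "\<sigma> - s'"]
        by (auto simp: in_face_def eq)
    qed
    then have "s' + d \<in> Q" using ss d by (auto simp: Q_def)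
    then have "s' + d \<le> s'" unfolding s'_def by (intro cSup_upper bdd)
    then show False using d by simp
  qed
  then obtain f' where f': "f' \<in> V" "f' \<noteq> f" "bary f' (\<gamma> s') = 0" by blast
  obtain k p q d where k: "k \<in> V" "k \<noteq> f" "0 < d"
    and *: "\<And>\<tau>. \<bar>\<tau>\<bar> < d \<Longrightarrow> wedge k f (\<gamma> (s' + \<tau>)) \<and> unfold_map k f (\<gamma> (s' + \<tau>)) = garc p q \<tau>"
    using straight_atD[OF loop_straight fV f0] by metis
  have w0: "wedge k f (\<gamma> s')" using *[of 0] k by simp
  then have kf: "k = f'" using f' by (force simp: wedge_def)
  have pos: "0 < bary w (\<gamma> s')" if "w \<in> V - {f, f'}" for w
    using w0 that by (auto simp: wedge_def kf)
  define m where "m = min (min d (s' - s)) 1"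
  have m: "0 < m" "m \<le> d" "m \<le> s' - s" "m < pi" using k ss pi_gt3 by (auto simp: m_def min_def)
  have "garc p q \<tau> = garc P Q' \<tau>" if "\<tau> \<in> {- m<..<0}" for \<tau>
  proof -
    have "\<gamma> (s' + \<tau>) = A (eqc (s' + \<tau>))" using in_f[of "s' + \<tau>"] that m by (auto simp: in_face_def)
    then have "bary f (\<gamma> (s' + \<tau>)) = 0" "\<gamma> (s' + \<tau>) = garc P Q' \<tau>" using frameD(3)[OF A, of "eqc (s' + \<tau>)"] A_shift[of \<tau>] by auto
    then show ?thesis using *[of \<tau>] that m by (simp add: unfold_map_id)
  qed
  then have eq: "garc p q = garc P Q'" using m by (intro garc_eqD[of "- m" 0]) auto
  define \<eta> where "\<eta> = bary f' Q'"
  have fP: "bary f' P = 0" using f'(3) at_s' by (simp add: P_def)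
  have b: "bary f' (garc P Q' \<tau>) = sin \<tau> * \<eta>" for \<tau> by (simp add: bary_garc fP \<eta>_def)
  have "\<eta> < 0"
  proof -
    have "0 < bary f' (\<gamma> (s' + - (m / 2)))" "\<gamma> (s' + - (m / 2)) = garc P Q' (- (m / 2))"
      using in_f[of "s' + - (m / 2)"] m f' A_shift[of "- (m / 2)"] by (auto simp: in_face_def)
    moreover have "0 < sin (m / 2)" using m by (intro sin_gt_zero) auto
    ultimately show ?thesis using b[of "- (m / 2)"] by (simp add: mult_less_0_iff zero_less_mult_iff)
  qed
  have "in_face f' (cross_frame f' f A) \<sigma>" if \<sigma>: "s' < \<sigma>" "\<sigma> < s' + m" for \<sigma>
  proof -
    define \<tau> where "\<tau> = \<sigma> - s'"
    have \<tau>: "0 < \<tau>" "\<tau> < m" "s' + \<tau> = \<sigma>" using \<sigma> by (auto simp: \<tau>_def)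
    have w: "wedge f' f (\<gamma> \<sigma>)" and U: "unfold_map f' f (\<gamma> \<sigma>) = garc P Q' \<tau>"
      using *[of \<tau>] \<tau> m kf eq by auto
    have "0 < sin \<tau>" using \<tau> m by (intro sin_gt_zero) auto
    then have neg: "sin \<tau> * \<eta> < 0" using \<open>\<eta> < 0\<close> by (rule mult_pos_neg)
    have d: "bary f' (\<gamma> \<sigma>) - bary f (\<gamma> \<sigma>) = sin \<tau> * \<eta>"
      using bary_unfold_map(2)[OF f'(1) fV f'(2), of "\<gamma> \<sigma>"] U b by simp
    then have z: "bary f' (\<gamma> \<sigma>) = 0" "0 < bary f (\<gamma> \<sigma>)"
      using neg wedge_zero[OF w] wedge_nonneg[OF w] f' fV by fastforce+
    have bf: "bary f (\<gamma> \<sigma>) = - (sin \<tau> * \<eta>)" using d z by simp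
    have "\<gamma> \<sigma> = garc P Q' \<tau> + bary f (\<gamma> \<sigma>) *\<^sub>R \<xi> f' f"
      using U by (simp add: unfold_map_def algebra_simps)
    also have "\<dots> = garc P Q' \<tau> - (sin \<tau> * \<eta>) *\<^sub>R \<xi> f' f" by (simp add: bf)
    also have "\<dots> = cross_frame f' f A (eqc \<sigma>)"
      unfolding cross_frame_def using A_shift[of \<tau>] b[of \<tau>] \<tau>(3) by simp
    finally have "\<gamma> \<sigma> = cross_frame f' f A (eqc \<sigma>)" .
    moreover have "0 < bary w (\<gamma> \<sigma>)" if "w \<in> V - {f'}" for w
      using w z that by (cases "w = f") (auto simp: wedge_def)
    ultimately show ?thesis unfolding in_face_def by blast
  qed
  then have "enters f' (cross_frame f' f A) s'"
    unfolding enters_def using m frame_cross[OF A f'(1,2)] by blast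
  then show ?thesis using that[OF ss f'(1,2) in_f at_s' f'(3) pos] by blast
qed

text \<open>The loop enters the face missing \<open>f n\<close> at time \<open>s n\<close>, and \<open>A n\<close> maps the unrolled great sphere of this
  face back to \<open>real ^ 4\<close>, taking the equator to \<open>\<gamma>\<close>. Only the times \<open>s (Suc n)\<close> are crossings of edges.\<close>

definition strip :: "(nat \<Rightarrow> real) \<Rightarrow> (nat \<Rightarrow> real ^ 4) \<Rightarrow> (nat \<Rightarrow> pt3 \<Rightarrow> real ^ 4) \<Rightarrow> bool" where
  "strip s f A \<longleftrightarrow> (\<forall>n. s n < s (Suc n)) \<and> (\<forall>M. \<exists>n. M < s n) \<and> (\<forall>n. frame (f n) (A n)) \<and>
     (\<forall>n \<sigma>. s n < \<sigma> \<and> \<sigma> < s (Suc n) \<longrightarrow> in_face (f n) (A n) \<sigma>) \<and>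
     (\<forall>n. f (Suc n) \<noteq> f n \<and> \<gamma> (s (Suc n)) = A n (eqc (s (Suc n))) \<and> bary (f (Suc n)) (\<gamma> (s (Suc n))) = 0 \<and>
        (\<forall>w\<in>V - {f n, f (Suc n)}. 0 < bary w (\<gamma> (s (Suc n)))) \<and> A (Suc n) = cross_frame (f (Suc n)) (f n) (A n))"

lemma strip_exists: "\<exists>s f A. strip s f A"
proof -
  define T where "T = (\<lambda>(s, f, A) (s', f', A'). s < s' \<and> f' \<noteq> f \<and> (\<forall>\<sigma>. s < \<sigma> \<and> \<sigma> < s' \<longrightarrow> in_face f A \<sigma>) \<and>
    \<gamma> s' = A (eqc s') \<and> bary f' (\<gamma> s') = 0 \<and> (\<forall>w\<in>V - {f, f'}. 0 < bary w (\<gamma> s')) \<and> A' = cross_frame f' f A)"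
  have "\<exists>y. (case y of (s', f', A') \<Rightarrow> enters f' A' s') \<and> T x y" if "case x of (s, f, A) \<Rightarrow> enters f A s" for x :: "real \<times> (real ^ 4) \<times> (pt3 \<Rightarrow> real ^ 4)"
  proof -
    obtain s f A where x: "x = (s, f, A)" by (cases x)
    obtain s' f' where *: "s < s'" "f' \<in> V" "f' \<noteq> f" "\<And>\<sigma>. s < \<sigma> \<Longrightarrow> \<sigma> < s' \<Longrightarrow> in_face f A \<sigma>"
      "\<gamma> s' = A (eqc s')" "bary f' (\<gamma> s') = 0" "\<And>w. w \<in> V - {f, f'} \<Longrightarrow> 0 < bary w (\<gamma> s')"
      "enters f' (cross_frame f' f A) s'"
      using crossing_exists[of f A s] \<open>case x of (s, f, A) \<Rightarrow> enters f A s\<close> unfolding x by auto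
    then show ?thesis unfolding T_def x by (intro exI[of _ "(s', f', cross_frame f' f A)"]) auto
  qed
  moreover have "\<exists>x. case x of (s, f, A) \<Rightarrow> enters f A s" using enters_exists by auto
  ultimately obtain F where F: "\<And>n. case F n of (s, f, A) \<Rightarrow> enters f A s" "\<And>n. T (F n) (F (Suc n))"
    using dependent_nat_choice[of "\<lambda>_ x. case x of (s, f, A) \<Rightarrow> enters f A s" "\<lambda>_. T"] by metis
  define s f A where "s = (\<lambda>n. fst (F n))" and "f = (\<lambda>n. fst (snd (F n)))" and "A = (\<lambda>n. snd (snd (F n)))"
  have Fn: "F n = (s n, f n, A n)" for n by (simp add: s_def f_def A_def)
  have en: "enters (f n) (A n) (s n)" for n using F(1)[of n] unfolding Fn by simp
  have T: "s n < s (Suc n)" "f (Suc n) \<noteq> f n" "\<And>\<sigma>. s n < \<sigma> \<Longrightarrow> \<sigma> < s (Suc n) \<Longrightarrow> in_face (f n) (A n) \<sigma>"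
    "\<gamma> (s (Suc n)) = A n (eqc (s (Suc n)))" "bary (f (Suc n)) (\<gamma> (s (Suc n))) = 0"
    "\<And>w. w \<in> V - {f n, f (Suc n)} \<Longrightarrow> 0 < bary w (\<gamma> (s (Suc n)))" "A (Suc n) = cross_frame (f (Suc n)) (f n) (A n)" for n
    using F(2)[of n] unfolding Fn T_def by auto
  have fr: "frame (f n) (A n)" for n using en[of n] by (simp add: enters_def)
  have "\<exists>n. M < s n" for M
  proof (rule ccontr)
    assume "\<nexists>n. M < s n"
    then have bdd: "bdd_above (range s)" by (auto intro!: bdd_aboveI[of _ M] simp: not_less)
    have inc: "incseq s" using T(1) by (intro incseq_SucI) (simp add: less_imp_le)
    define t where "t = (SUP n. s n)"
    have st: "s n < t" for n
      using cSUP_upper[OF _ bdd, of "Suc n"] T(1)[of n] unfolding t_def by simp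
    have lim: "s \<longlonglongrightarrow> t" unfolding t_def by (rule LIMSEQ_incseq_SUP[OF bdd inc])
    obtain g where g: "g \<in> V" "bary g (\<gamma> t) = 0" using loop_surface[of t] by (auto simp: surface_def)
    obtain k p q d where k: "k \<in> V" "k \<noteq> g" "0 < d"
      and *: "\<And>\<tau>. \<bar>\<tau>\<bar> < d \<Longrightarrow> wedge k g (\<gamma> (t + \<tau>)) \<and> unfold_map k g (\<gamma> (t + \<tau>)) = garc p q \<tau>"
      using straight_atD[OF loop_straight g] by metis
    define m where "m = min d 1"
    have m: "0 < m" "m \<le> d" "m < pi" using k pi_gt3 by (auto simp: m_def min_def)
    have "\<forall>\<^sub>F n in sequentially. t - m < s n" using lim m by (intro order_tendstoD(1)) auto
    then obtain N where N: "\<And>n. N \<le> n \<Longrightarrow> t - m < s n" unfolding eventually_sequentially by blast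
    have z: "bary k (garc p q (s (Suc n) - t)) = 0" if "N \<le> n" for n
    proof -
      have w: "wedge k g (\<gamma> (s (Suc n)))" and U: "unfold_map k g (\<gamma> (s (Suc n))) = garc p q (s (Suc n) - t)"
        using *[of "s (Suc n) - t"] N[of "Suc n"] that st[of "Suc n"] m by auto
      have z2: "bary (f n) (\<gamma> (s (Suc n))) = 0" "bary (f (Suc n)) (\<gamma> (s (Suc n))) = 0"
        using T(4,5)[of n] frameD(3)[OF fr, of n "eqc (s (Suc n))"] by simp_all
      then have "f n \<in> {k, g}" "f (Suc n) \<in> {k, g}" using w frameD(1)[OF fr] by (force simp: wedge_def)+
      then have "bary k (\<gamma> (s (Suc n))) = 0" "bary g (\<gamma> (s (Suc n))) = 0" using z2 T(2)[of n] by auto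
      then show ?thesis using bary_unfold_map(2)[OF k(1) g(1) k(2), of "\<gamma> (s (Suc n))"] U by simp
    qed
    define \<tau>1 \<tau>2 where "\<tau>1 = s (Suc N) - t" and "\<tau>2 = s (Suc (Suc N)) - t"
    have \<tau>: "- m < \<tau>1" "\<tau>1 < \<tau>2" "\<tau>2 < 0" using N[of "Suc N"] T(1)[of "Suc N"] st[of "Suc (Suc N)"] by (auto simp: \<tau>1_def \<tau>2_def)
    have z12: "bary k (garc p q \<tau>1) = 0" "bary k (garc p q \<tau>2) = 0" using z[of N] z[of "Suc N"] by (auto simp: \<tau>1_def \<tau>2_def)
    define \<eta> where "\<eta> = bary k (garc p q (\<tau>1 + pi / 2))"
    have sinus: "bary k (garc p q (\<tau>1 + x)) = sin x * \<eta>" for x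
      unfolding garc_shift[of p q \<tau>1 x] bary_garc[of k "garc p q \<tau>1"] using z12 by (simp add: \<eta>_def)
    have "sin (\<tau>2 - \<tau>1) * \<eta> = 0" using sinus[of "\<tau>2 - \<tau>1"] z12 by simp
    moreover have "0 < sin (\<tau>2 - \<tau>1)" using \<tau> m by (intro sin_gt_zero) auto
    ultimately have "\<eta> = 0" by simp
    then have zero: "bary k (garc p q x) = 0" for x using sinus[of "x - \<tau>1"] by simp
    define \<tau>3 where "\<tau>3 = (\<tau>1 + \<tau>2) / 2"
    have \<tau>3: "\<tau>1 < \<tau>3" "\<tau>3 < \<tau>2" using \<tau> by (auto simp: \<tau>3_def)
    have "in_face (f (Suc N)) (A (Suc N)) (t + \<tau>3)"
      using \<tau>3 by (intro T(3)) (auto simp: \<tau>1_def \<tau>2_def)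
    then have pos: "\<And>w. w \<in> V \<Longrightarrow> w \<noteq> f (Suc N) \<Longrightarrow> 0 < bary w (\<gamma> (t + \<tau>3))" by (auto simp: in_face_def)
    have w: "wedge k g (\<gamma> (t + \<tau>3))" and U: "unfold_map k g (\<gamma> (t + \<tau>3)) = garc p q \<tau>3"
      using *[of \<tau>3] \<tau> \<tau>3 m by auto
    have "bary k (\<gamma> (t + \<tau>3)) - bary g (\<gamma> (t + \<tau>3)) = 0"
      using bary_unfold_map(2)[OF k(1) g(1) k(2), of "\<gamma> (t + \<tau>3)"] U zero by simp
    then have "bary k (\<gamma> (t + \<tau>3)) = 0" "bary g (\<gamma> (t + \<tau>3)) = 0" using wedge_zero[OF w] by auto
    then show False using pos[OF k(1)] pos[OF g(1)] k(2) by (cases "k = f (Suc N)") auto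
  qed
  then show ?thesis unfolding strip_def using T fr by (intro exI[of _ s] exI[of _ f] exI[of _ A]) auto
qed

lemma reverse_loop: "geodesic_loop V c \<alpha> (\<lambda>s. \<gamma> (- s)) \<Lambda>"
proof unfold_locales
  show "\<gamma> (- (s + \<Lambda>)) = \<gamma> (- s)" for s using loop_period[of "- s - \<Lambda>"] by simp
  show "\<exists>n::int. s = t + of_int n * \<Lambda>" if "\<gamma> (- s) = \<gamma> (- t)" for s t
  proof -
    have "\<exists>n::int. - s = - t + of_int n * \<Lambda>" by (rule loop_inj[OF that])
    then obtain n :: int where "- s = - t + of_int n * \<Lambda>" ..
    then have "s = t + of_int (- n) * \<Lambda>" by simp
    then show ?thesis by blast
  qed
  show "straight_at (\<lambda>s. \<gamma> (- s)) s" for s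
    using straight_at_affine(2)[of \<gamma> 0 "- s"] loop_straight by simp
qed (rule period_pos)

end

section \<open>The triangles along a developed loop\<close>

lemma eqc_exists:
  assumes "norm x = 1" "hgt x = 0"
  obtains t where "x = eqc t"
proof -
  obtain a b where x: "x = (a, b, 0)" using assms(2) by (cases x) (auto simp: hgt_def)
  have "a\<^sup>2 + b\<^sup>2 = 1" using assms(1) by (simp add: x norm_eq_1 power2_eq_square)
  then obtain t where "a = cos t" "b = sin t" using sincos_total_2pi by metis
  then show ?thesis using that[of t] by (simp add: x eqc_def)
qed

locale developed_loop = geodesic_loop +
  fixes s :: "nat \<Rightarrow> real" and f :: "nat \<Rightarrow> real ^ 4" and A :: "nat \<Rightarrow> pt3 \<Rightarrow> real ^ 4"
  assumes is_strip: "strip s f A"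
begin

lemma s_less: "s n < s (Suc n)"
  and s_unbounded: "\<exists>n. M < s n"
  and frm: "frame (f n) (A n)"
  and in_face_between: "\<lbrakk>s n < \<sigma>; \<sigma> < s (Suc n)\<rbrakk> \<Longrightarrow> in_face (f n) (A n) \<sigma>"
  and f_Suc: "f (Suc n) \<noteq> f n"
  and at_crossing: "\<gamma> (s (Suc n)) = A n (eqc (s (Suc n)))"
  and zero_at_crossing: "bary (f (Suc n)) (\<gamma> (s (Suc n))) = 0"
  and pos_at_crossing: "\<lbrakk>w \<in> V; w \<noteq> f n; w \<noteq> f (Suc n)\<rbrakk> \<Longrightarrow> 0 < bary w (\<gamma> (s (Suc n)))"
  and A_Suc: "A (Suc n) x = A n x - bary (f (Suc n)) (A n x) *\<^sub>R \<xi> (f (Suc n)) (f n)"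
proof -
  note S = is_strip[unfolded strip_def]
  show "s n < s (Suc n)" "\<exists>n. M < s n" "frame (f n) (A n)" using S by blast+
  show "\<lbrakk>s n < \<sigma>; \<sigma> < s (Suc n)\<rbrakk> \<Longrightarrow> in_face (f n) (A n) \<sigma>" "f (Suc n) \<noteq> f n" using S by blast+
  show "\<gamma> (s (Suc n)) = A n (eqc (s (Suc n)))" "bary (f (Suc n)) (\<gamma> (s (Suc n))) = 0" using S by blast+
  show "\<lbrakk>w \<in> V; w \<noteq> f n; w \<noteq> f (Suc n)\<rbrakk> \<Longrightarrow> 0 < bary w (\<gamma> (s (Suc n)))" using S by blast
  have "A (Suc n) = cross_frame (f (Suc n)) (f n) (A n)" using S by blast
  then show "A (Suc n) x = A n x - bary (f (Suc n)) (A n x) *\<^sub>R \<xi> (f (Suc n)) (f n)"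
    by (simp add: cross_frame_def)
qed

lemma f_V: "f n \<in> V"
  by (rule frameD(1)[OF frm])

lemma s_mono: "n \<le> m \<Longrightarrow> s n \<le> s m"
  by (rule lift_Suc_mono_le[of s]) (simp_all add: s_less less_imp_le)

lemma s_strict: "n < m \<Longrightarrow> s n < s m"
  by (rule lift_Suc_mono_less[of s]) (simp_all add: s_less)

lemma A_lin: "A n (x + y) = A n x + A n y" "A n (r *\<^sub>R x) = r *\<^sub>R A n x" "A n (x - y) = A n x - A n y" "A n (- x) = - A n x"
  by (rule frame_linear[OF frm])+

lemma A_zero: "bary (f n) (A n x) = 0"
  by (rule frameD(3)[OF frm])

lemma A_garc: "A n (garc u v t) = garc (A n u) (A n v) t"
  by (simp add: garc_def A_lin)

lemma continuous_on_A [continuous_intros]: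
  "continuous_on S g \<Longrightarrow> continuous_on S (\<lambda>x. A n (g x))"
proof -
  assume g: "continuous_on S g"
  have "linear (A n)" using frm[of n] by (simp add: frame_def)
  then have "continuous_on UNIV (A n)" by (intro linear_continuous_on) (simp add: linear_conv_bounded_linear)
  then show "continuous_on S (\<lambda>x. A n (g x))" by (rule continuous_on_compose2[OF _ g]) simp
qed

definition lft :: "nat \<Rightarrow> pt3 \<Rightarrow> real" where "lft n x = bary (f (n - 1)) (A n x)"
definition rgt :: "nat \<Rightarrow> pt3 \<Rightarrow> real" where "rgt n x = bary (f (Suc n)) (A n x)"

lemma rgt_eq: "rgt n x = - lft (Suc n) x"
  using f_Suc[of n] by (simp add: lft_def rgt_def A_Suc bary_xi f_V A_zero)

lemma A_Suc_eq: "rgt n x = 0 \<Longrightarrow> A (Suc n) x = A n x"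
  by (simp add: A_Suc rgt_def)

lemma A_at:
  assumes "0 < n"
  shows "\<gamma> (s n) = A n (eqc (s n))"
proof -
  obtain m where n: "n = Suc m" using assms by (cases n) auto
  have "rgt m (eqc (s n)) = 0" using zero_at_crossing[of m] at_crossing[of m] by (simp add: rgt_def n)
  then show ?thesis using A_Suc_eq[of m] at_crossing[of m] by (simp add: n)
qed

lemma loop_eq_A: "\<gamma> \<sigma> = A n (eqc \<sigma>)" if "0 < n" "s n \<le> \<sigma>" "\<sigma> \<le> s (Suc n)"
  using that in_face_between[of n \<sigma>] A_at[of n] at_crossing[of n]
  by (cases "\<sigma> = s n"; cases "\<sigma> = s (Suc n)") (auto simp: in_face_def)

lemma gap_less_pi: "0 < n \<Longrightarrow> s (Suc n) < s n + pi"
proof (rule ccontr)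
  assume n: "0 < n" and "\<not> s (Suc n) < s n + pi"
  then have "\<gamma> (s n + pi) = - \<gamma> (s n)"
    using loop_eq_A[of n "s n"] loop_eq_A[of n "s n + pi"] s_less[of n] by (simp add: eqc_add A_lin)
  then show False using surface_antipode[OF loop_surface loop_surface] by blast
qed

lemma bary_A_eqc: "bary w (A n (eqc (a + t))) = cos t * bary w (A n (eqc a)) + sin t * bary w (A n (eqt a))"
  by (rule bary_frame_eqc[OF frm])

lemma zero_at_left: "0 < n \<Longrightarrow> lft n (eqc (s n)) = 0"
proof -
  assume "0 < n"
  then obtain m where n: "n = Suc m" by (cases n) auto
  have "bary (f m) (\<gamma> (s n)) = 0" using at_crossing[of m] A_zero[of m] by (simp add: n)
  then show ?thesis using A_at[of n] by (simp add: lft_def n)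
qed

definition \<eta> :: "nat \<Rightarrow> real" where "\<eta> n = lft n (eqt (s n))"

lemma lft_eqc: "0 < n \<Longrightarrow> lft n (eqc \<sigma>) = \<eta> n * sin (\<sigma> - s n)"
  using bary_A_eqc[of "f (n - 1)" n "s n" "\<sigma> - s n"] zero_at_left[of n] by (simp add: lft_def \<eta>_def)

lemma f_pred: "0 < n \<Longrightarrow> f (n - 1) \<noteq> f n"
  using f_Suc[of "n - 1"] by simp

lemma eta_pos: "0 < n \<Longrightarrow> 0 < \<eta> n"
proof -
  assume n: "0 < n"
  define \<sigma> where "\<sigma> = (s n + s (Suc n)) / 2"
  have \<sigma>: "s n < \<sigma>" "\<sigma> < s (Suc n)" using s_less[of n] by (auto simp: \<sigma>_def)
  have "0 < lft n (eqc \<sigma>)"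
    using in_face_between[OF \<sigma>] f_pred[OF n] f_V by (auto simp: in_face_def lft_def)
  moreover have "0 < sin (\<sigma> - s n)" using \<sigma> gap_less_pi[OF n] by (intro sin_gt_zero) auto
  ultimately show ?thesis using lft_eqc[OF n] by (simp add: zero_less_mult_iff)
qed

lemma rgt_eqc: "rgt n (eqc \<sigma>) = - \<eta> (Suc n) * sin (\<sigma> - s (Suc n))"
  by (simp add: rgt_eq lft_eqc)

lemma f_pred_Suc: "0 < n \<Longrightarrow> f (n - 1) \<noteq> f (Suc n)"
proof
  assume n: "0 < n" and eq: "f (n - 1) = f (Suc n)"
  have "lft n (eqc (s (Suc n))) = 0"
    unfolding lft_def eq at_crossing[symmetric] by (rule zero_at_crossing)
  moreover have "0 < sin (s (Suc n) - s n)" using gap_less_pi[OF n] s_less[of n] by (intro sin_gt_zero) auto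
  ultimately show False using lft_eqc[OF n] eta_pos[OF n] by simp
qed

definition apex :: "nat \<Rightarrow> real ^ 4" where
  "apex n = (SOME w. w \<in> V \<and> w \<noteq> f (n - 1) \<and> w \<noteq> f n \<and> w \<noteq> f (Suc n))"

lemma apex:
  assumes "0 < n"
  shows "apex n \<in> V" "apex n \<noteq> f (n - 1)" "apex n \<noteq> f n" "apex n \<noteq> f (Suc n)"
proof -
  have "\<exists>w. w \<in> V \<and> w \<noteq> f (n - 1) \<and> w \<noteq> f n \<and> w \<noteq> f (Suc n)"
  proof (rule ccontr)
    assume "\<not> ?thesis"
    then have "V \<subseteq> {f (n - 1), f n, f (Suc n)}" by blast
    then have "card V \<le> card {f (n - 1), f n, f (Suc n)}" by (intro card_mono) auto
    then show False using card_V by (simp add: card_insert_if split: if_splits)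
  qed
  from someI_ex[OF this] show "apex n \<in> V" "apex n \<noteq> f (n - 1)" "apex n \<noteq> f n" "apex n \<noteq> f (Suc n)"
    unfolding apex_def[symmetric] by auto
qed

lemma corner_apex: "0 < n \<Longrightarrow> corner (apex n) (f (n - 1)) (f n) (f (Suc n))"
  using apex[of n] f_V f_pred[of n] f_Suc[of n] f_pred_Suc[of n] by (auto simp: corner_def)

lemma V_cases:
  assumes "0 < n" "w \<in> V"
  obtains "w = apex n" | "w = f (n - 1)" | "w = f n" | "w = f (Suc n)"
  using corner_V[OF corner_apex[OF assms(1)]] assms(2) by blast

definition mid :: "nat \<Rightarrow> pt3 \<Rightarrow> real" where "mid n x = bary (apex n) (A n x)"

definition pos :: "nat \<Rightarrow> real ^ 4 \<Rightarrow> pt3" where "pos n w = adj (A n) w"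

lemma A_pos: "w \<in> V \<Longrightarrow> w \<noteq> f n \<Longrightarrow> A n (pos n w) = w"
  unfolding pos_def by (rule frame_adj[OF frm]) (simp add: f_V)

lemma pos_eqI: "A n x = w \<Longrightarrow> pos n w = x"
  unfolding pos_def using adj_frame[OF frm[of n], of x] by simp

lemma tri_expand:
  assumes "0 < n"
  shows "x = mid n x *\<^sub>R pos n (apex n) + lft n x *\<^sub>R pos n (f (n - 1)) + rgt n x *\<^sub>R pos n (f (Suc n))"
proof (rule frame_inj[OF frm[of n]])
  note c = corner_apex[OF assms]
  have "A n x = mid n x *\<^sub>R apex n + lft n x *\<^sub>R f (n - 1) + bary (f n) (A n x) *\<^sub>R f n + rgt n x *\<^sub>R f (Suc n)"
    using bary_expand4[OF corner_V[OF c] cornerD(5)[OF c], of "A n x"] by (simp add: mid_def lft_def rgt_def)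
  then show "A n x = A n (mid n x *\<^sub>R pos n (apex n) + lft n x *\<^sub>R pos n (f (n - 1)) + rgt n x *\<^sub>R pos n (f (Suc n)))"
    using apex[OF assms] f_V f_pred[OF assms] f_Suc[of n] by (simp add: A_lin A_pos A_zero)
qed

lemma mid_pos:
  assumes "0 < n" "s n \<le> \<sigma>" "\<sigma> \<le> s (Suc n)"
  shows "0 < mid n (eqc \<sigma>)"
proof -
  have "0 < bary (apex n) (\<gamma> \<sigma>)"
  proof -
    consider "\<sigma> = s n" | "\<sigma> = s (Suc n)" | "s n < \<sigma>" "\<sigma> < s (Suc n)" using assms by linarith
    then show ?thesis
    proof cases
      case 1
      then show ?thesis using pos_at_crossing[of "apex n" "n - 1"] assms(1) apex[OF assms(1)] by simp
    next
      case 2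
      then show ?thesis using pos_at_crossing[of "apex n" n] apex[OF assms(1)] by simp
    next
      case 3
      then show ?thesis using in_face_between[of n \<sigma>] apex[OF assms(1)] by (auto simp: in_face_def)
    qed
  qed
  then show ?thesis using loop_eq_A[OF assms] by (simp add: mid_def)
qed

lemma lft_pos: "\<lbrakk>0 < n; s n < \<sigma>; \<sigma> \<le> s (Suc n)\<rbrakk> \<Longrightarrow> 0 < lft n (eqc \<sigma>)"
  using gap_less_pi[of n] eta_pos[of n] by (auto simp: lft_eqc intro!: mult_pos_pos sin_gt_zero)

lemma rgt_pos: "\<lbrakk>0 < n; s n \<le> \<sigma>; \<sigma> < s (Suc n)\<rbrakk> \<Longrightarrow> 0 < rgt n (eqc \<sigma>)"
proof -
  assume n: "0 < n" "s n \<le> \<sigma>" "\<sigma> < s (Suc n)"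
  then have "0 < sin (s (Suc n) - \<sigma>)" using gap_less_pi[of n] by (intro sin_gt_zero) auto
  moreover have "sin (\<sigma> - s (Suc n)) = - sin (s (Suc n) - \<sigma>)" by (metis minus_diff_eq sin_minus)
  ultimately show ?thesis using eta_pos[of "Suc n"] by (simp add: rgt_eqc)
qed

lemma left_crossing:
  assumes "0 < n"
  shows "eqc (s n) = mid n (eqc (s n)) *\<^sub>R pos n (apex n) + rgt n (eqc (s n)) *\<^sub>R pos n (f (Suc n))"
    "0 < mid n (eqc (s n))" "0 < rgt n (eqc (s n))"
  using tri_expand[OF assms, of "eqc (s n)"] zero_at_left[OF assms] mid_pos[OF assms] rgt_pos[OF assms] s_less[of n] by auto

lemma right_crossing:
  assumes "0 < n"
  shows "eqc (s (Suc n)) = mid n (eqc (s (Suc n))) *\<^sub>R pos n (apex n) + lft n (eqc (s (Suc n))) *\<^sub>R pos n (f (n - 1))"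
    "0 < mid n (eqc (s (Suc n)))" "0 < lft n (eqc (s (Suc n)))"
  using tri_expand[OF assms, of "eqc (s (Suc n))"] mid_pos[OF assms] lft_pos[OF assms] s_less[of n]
  by (auto simp: rgt_eqc)

lemma loop_not_vertex: "\<gamma> \<sigma> \<notin> V"
proof
  assume v: "\<gamma> \<sigma> \<in> V"
  obtain k l where kl: "k \<in> V" "l \<in> V" "k \<noteq> l" "wedge k l (\<gamma> \<sigma>)"
    using straight_at_two_pos[OF loop_straight] by metis
  obtain i j where "i \<in> V" "j \<in> V" "distinct [i, j, k, l]" using V_rest[OF kl(1-3)] by metis
  then have "0 < bary i (\<gamma> \<sigma>)" "0 < bary j (\<gamma> \<sigma>)" "i \<noteq> j" using kl(4) by (auto simp: wedge_def)
  then show False using v \<open>i \<in> V\<close> \<open>j \<in> V\<close> by (auto simp: bary_V split: if_splits)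
qed

lemma hgt_apex_nonzero:
  assumes "0 < n"
  shows "hgt (pos n (apex n)) \<noteq> 0"
proof
  assume h: "hgt (pos n (apex n)) = 0"
  have A: "A n (pos n (apex n)) = apex n" using apex[OF assms] by (intro A_pos)
  have "norm (pos n (apex n)) = 1" using frame_norm[OF frm[of n], of "pos n (apex n)"] A norm_V[OF apex(1)[OF assms]] by simp
  then obtain t where t: "pos n (apex n) = eqc t" using h by (rule eqc_exists)
  have "lft n (eqc t) = 0" using A apex[OF assms] f_V unfolding t[symmetric] lft_def by simp
  then have "sin (t - s n) = 0" using lft_eqc[OF assms] eta_pos[OF assms] by simp
  then have "eqc t = cos (t - s n) *\<^sub>R eqc (s n)" using eqc_add[of "s n" "t - s n"] by simp
  then have e: "apex n = cos (t - s n) *\<^sub>R \<gamma> (s n)" using A A_at[OF assms] by (simp add: t A_lin)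
  have "(cos (t - s n))\<^sup>2 = 1" using \<open>sin (t - s n) = 0\<close> by (simp add: cos_squared_eq)
  then have "cos (t - s n) = 1 \<or> cos (t - s n) = - 1" by (simp add: power2_eq_1_iff)
  then show False
  proof
    assume "cos (t - s n) = 1"
    then show False using e loop_not_vertex[of "s n"] apex(1)[OF assms] by simp
  next
    assume "cos (t - s n) = - 1"
    then show False using e surface_antipode[OF loop_surface[of "s n"]] apex(1)[OF assms] V_subset_surface by fastforce
  qed
qed

lemma hgt_opposite:
  assumes "0 < n"
  shows "hgt (pos n (apex n)) * hgt (pos n (f (n - 1))) < 0" "hgt (pos n (apex n)) * hgt (pos n (f (Suc n))) < 0"
proof -
  have opp: "x * y < 0" if "a * x + b * y = 0" "0 < a" "0 < b" "x \<noteq> 0" for a b x y :: real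
  proof -
    have "y = - (a / b) * x" using that by (simp add: field_simps)
    then have "x * y = - (a / b) * x\<^sup>2" by (simp add: power2_eq_square)
    then show ?thesis using that by (simp add: mult_less_0_iff)
  qed
  show "hgt (pos n (apex n)) * hgt (pos n (f (n - 1))) < 0"
    using arg_cong[OF right_crossing(1)[OF assms], of hgt]
    by (intro opp[OF _ right_crossing(2,3)[OF assms] hgt_apex_nonzero[OF assms]]) simp
  show "hgt (pos n (apex n)) * hgt (pos n (f (Suc n))) < 0"
    using arg_cong[OF left_crossing(1)[OF assms], of hgt]
    by (intro opp[OF _ left_crossing(2,3)[OF assms] hgt_apex_nonzero[OF assms]]) simp
qed

lemma pos_Suc: "\<lbrakk>w \<in> V; w \<noteq> f n; w \<noteq> f (Suc n)\<rbrakk> \<Longrightarrow> pos (Suc n) w = pos n w"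
  using A_pos[of w n] A_Suc_eq[of n "pos n w"] f_V by (intro pos_eqI) (simp add: rgt_def)

definition tri :: "nat \<Rightarrow> pt3 set" where "tri n = {x. \<forall>w\<in>V. 0 \<le> bary w (A n x)}"

lemma tri_iff:
  assumes "0 < n"
  shows "x \<in> tri n \<longleftrightarrow> 0 \<le> mid n x \<and> 0 \<le> lft n x \<and> 0 \<le> rgt n x"
proof -
  have "x \<in> tri n \<longleftrightarrow> (\<forall>w\<in>{apex n, f (n - 1), f n, f (Suc n)}. 0 \<le> bary w (A n x))"
    unfolding tri_def using corner_V[OF corner_apex[OF assms]] by simp
  then show ?thesis by (auto simp: mid_def lft_def rgt_def A_zero)
qed

lemma eqc_in_tri:
  assumes "0 < n" "eqc \<sigma> \<in> tri n" "s n - pi < \<sigma>" "\<sigma> < s n + 2 * pi" "\<sigma> < s (Suc n) + pi" "s (Suc n) - 2 * pi < \<sigma>"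
  shows "s n \<le> \<sigma>" "\<sigma> \<le> s (Suc n)"
proof -
  have "0 \<le> lft n (eqc \<sigma>)" "0 \<le> rgt n (eqc \<sigma>)" using assms tri_iff by auto
  then have 1: "0 \<le> sin (\<sigma> - s n)" "sin (\<sigma> - s (Suc n)) \<le> 0"
    using eta_pos[OF assms(1)] eta_pos[of "Suc n"] by (auto simp: lft_eqc[OF assms(1)] rgt_eqc zero_le_mult_iff mult_le_0_iff)
  show "s n \<le> \<sigma>"
  proof (rule ccontr)
    assume "\<not> s n \<le> \<sigma>"
    then have "0 < sin (s n - \<sigma>)" using assms by (intro sin_gt_zero) auto
    moreover have "sin (\<sigma> - s n) = - sin (s n - \<sigma>)" by (metis minus_diff_eq sin_minus)
    ultimately show False using 1 by simp
  qed
  show "\<sigma> \<le> s (Suc n)"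
  proof (rule ccontr)
    assume "\<not> \<sigma> \<le> s (Suc n)"
    then have "0 < sin (\<sigma> - s (Suc n))" using assms by (intro sin_gt_zero) auto
    then show False using 1 by simp
  qed
qed

end

section \<open>Lunes\<close>

text \<open>If an edge joins an upper vertex outside the half-space \<open>m > 0\<close> to a lower vertex and contains
  an upper point of that half-space, then it meets the equator inside the half-space.\<close>

lemma crossing_in_halfspace_up:
  fixes hW hL mW mL a b \<mu> l :: real
  assumes "0 < hW" "hL < 0" "mW \<le> 0" "0 < a" "0 < b" "a * hW + b * hL = 0"
    "0 < \<mu> * hW + l * hL" "0 < \<mu> * mW + l * mL" "0 \<le> l"
  shows "0 < a * mW + b * mL" "0 < l"
proof -
  have "0 \<le> - (l * hL)" using assms by (simp add: mult_nonneg_nonpos)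
  then have "0 < \<mu> * hW" using assms(7) by simp
  then have mu: "0 < \<mu>" using assms(1) by (simp add: zero_less_mult_iff)
  then have "\<mu> * mW \<le> 0" using assms(3) by (simp add: mult_nonneg_nonpos)
  then have "0 < l * mL" using assms(8) by simp
  then show l: "0 < l" using assms(9) by (simp add: zero_less_mult_iff)
  have "hL = - (a * hW) / b" using assms by (simp add: field_simps)
  then have "0 < hW * (\<mu> - l * a / b)" using assms(7) by (simp add: algebra_simps)
  then have "l * a / b < \<mu>" using assms(1) by (simp add: zero_less_mult_iff)
  then have "\<mu> * mW \<le> l * a / b * mW" using assms(3) by (intro mult_right_mono_neg) auto
  then have "0 < l * a / b * mW + l * mL" using assms(8) by linarith
  also have "\<dots> = (l / b) * (a * mW + b * mL)" using assms(5) by (simp add: field_simps)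
  finally show "0 < a * mW + b * mL" using l assms(5) by (simp add: zero_less_mult_iff zero_less_divide_iff)
qed

lemma crossing_in_halfspace_down:
  fixes hW hL mW mL a b \<mu> l :: real
  assumes "hW < 0" "0 < hL" "mL \<le> 0" "0 < mW" "0 < a" "0 < b" "a * hW + b * hL = 0"
    "0 < \<mu> * hW + l * hL" "0 < \<mu> * mW + l * mL" "0 \<le> l"
  shows "0 < a * mW + b * mL" "0 < l"
proof -
  have "l * mL \<le> 0" using assms by (simp add: mult_nonneg_nonpos)
  then have "0 < \<mu> * mW" using assms(9) by simp
  then have mu: "0 < \<mu>" using assms(4) by (simp add: zero_less_mult_iff)
  have "0 < b * hL * l + b * \<mu> * hW" using mult_pos_pos[OF assms(6,8)] by (simp add: algebra_simps)
  also have "b * hL = - (a * hW)" using assms(7) by simp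
  finally have "0 < (- hW) * (a * l - b * \<mu>)" by (simp add: algebra_simps)
  then have *: "b * \<mu> < a * l" using assms(1) by (simp add: zero_less_mult_iff mult_less_0_iff)
  moreover have "0 < b * \<mu>" using assms mu by simp
  ultimately have "0 < a * l" by simp
  then show "0 < l" using assms(5) by (simp add: zero_less_mult_iff)
  have "0 < a * (\<mu> * mW + l * mL)" using assms by simp
  also have "\<dots> = \<mu> * (a * mW) + (a * l) * mL" by (simp add: algebra_simps)
  also have "\<dots> \<le> \<mu> * (a * mW) + (b * \<mu>) * mL" using * assms(3) by (intro add_left_mono mult_right_mono_neg) auto
  also have "\<dots> = \<mu> * (a * mW + b * mL)" by (simp add: algebra_simps)
  finally show "0 < a * mW + b * mL" using mu by (simp add: zero_less_mult_iff)
qed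

text \<open>The great circles through \<open>eqc z\<close> are the zero sets of \<open>hsp z t\<close>; as \<open>t\<close> grows, the lune between such a
  circle and the equator shrinks towards the half equator from \<open>z\<close> to \<open>z + \<pi>\<close>.\<close>

definition hsp :: "real \<Rightarrow> real \<Rightarrow> pt3 \<Rightarrow> real" where "hsp z t x = x \<bullet> eqt z - t * hgt x"

lemma hsp_simps [simp]: "hsp z t (x + y) = hsp z t x + hsp z t y" "hsp z t (x - y) = hsp z t x - hsp z t y"
  "hsp z t (r *\<^sub>R x) = r * hsp z t x" "hsp z t (eqc \<sigma>) = sin (\<sigma> - z)"
  by (simp_all add: hsp_def inner_add_left inner_diff_left eqc_inner algebra_simps)

lemma continuous_on_hsp [continuous_intros]: "continuous_on S g \<Longrightarrow> continuous_on S (\<lambda>x. hsp z t (g x))"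
  unfolding hsp_def hgt_def by (intro continuous_intros)

lemma continuous_on_hgt [continuous_intros]: "continuous_on S g \<Longrightarrow> continuous_on S (\<lambda>x. hgt (g x))"
  unfolding hgt_def by (intro continuous_intros)

definition lune :: "real \<Rightarrow> real \<Rightarrow> pt3 set" where
  "lune z t = {x. 0 < hgt x \<and> 0 < hsp z t x}"

lemma open_lune: "open (lune z t)"
proof -
  have "open {x. 0 < hgt x}" "open {x. 0 < hsp z t x}"
    by (auto intro!: open_Collect_less continuous_intros)
  moreover have "lune z t = {x. 0 < hgt x} \<inter> {x. 0 < hsp z t x}" by (auto simp: lune_def)
  ultimately show ?thesis by auto
qed

context developed_loop
begin

definition base :: "real \<Rightarrow> nat set" where
  "base z = {n. s n < z + pi \<and> z < s (Suc n)}"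

definition free :: "real \<Rightarrow> real \<Rightarrow> bool" where
  "free z t \<longleftrightarrow> (\<forall>n\<in>base z. \<forall>w\<in>V - {f n}. 0 < hgt (pos n w) \<longrightarrow> hsp z t (pos n w) \<le> 0)"

end

context developed_loop
begin

lemma base_pos_aux: "\<lbrakk>s 1 < z; n \<in> base z\<rbrakk> \<Longrightarrow> 0 < n"
  by (cases n) (auto simp: base_def)

lemma finite_base: "finite (base z)"
proof -
  obtain N where "z + pi < s N" using s_unbounded by blast
  moreover have "n \<le> N" if "s n < s N" for n using that s_mono[of N n] by (meson not_le le_cases)
  ultimately have "base z \<subseteq> {..N}" by (auto simp: base_def)
  then show ?thesis by (rule finite_subset) simp
qed

lemma base_nonempty_aux:
  assumes "s 1 < z"
  shows "base z \<noteq> {}"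
proof -
  define n where "n = (LEAST n. z < s (Suc n))"
  have ex: "\<exists>n. z < s (Suc n)" using s_unbounded[of z] s_less by (meson less_trans)
  then have n: "z < s (Suc n)" unfolding n_def by (rule LeastI_ex)
  then have "0 < n" using assms by (cases n) auto
  then have "\<not> z < s (Suc (n - 1))" unfolding n_def using not_less_Least[of "n - 1" "\<lambda>n. z < s (Suc n)"] n_def by auto
  then have "s n \<le> z" using \<open>0 < n\<close> by simp
  then have "s n < z + pi" using pi_gt_zero by linarith
  then have "n \<in> base z" using n by (simp add: base_def)
  then show ?thesis by blast
qed

end

locale free_lune = developed_loop +
  fixes z t :: real
  assumes z_gt: "s 1 < z" and is_free: "free z t"
begin

lemmas base_pos = base_pos_aux[OF z_gt]
lemmas base_nonempty = base_nonempty_aux[OF z_gt]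

lemma base_between: "\<lbrakk>i \<in> base z; j \<in> base z; i \<le> n; n \<le> j\<rbrakk> \<Longrightarrow> n \<in> base z"
  using s_mono[of n j] s_mono[of "Suc i" "Suc n"] by (auto simp: base_def)

lemma base_point:
  assumes "n \<in> base z"
  obtains \<sigma> where "s n < \<sigma>" "\<sigma> < s (Suc n)" "z < \<sigma>" "\<sigma> < z + pi"
proof -
  have "max (s n) z < min (s (Suc n)) (z + pi)" using assms s_less[of n] pi_gt_zero by (auto simp: base_def)
  then obtain \<sigma> where "max (s n) z < \<sigma>" "\<sigma> < min (s (Suc n)) (z + pi)" using dense by blast
  then show ?thesis using that by auto
qed

abbreviation "W n \<equiv> pos n (apex n)"
abbreviation "L n \<equiv> pos n (f (n - 1))"
abbreviation "K n \<equiv> pos n (f (Suc n))"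
abbreviation "m \<equiv> hsp z t"

lemma tri_sides:
  assumes n: "n \<in> base z"
  shows "(0 < hgt (W n) \<and> hgt (L n) < 0 \<and> hgt (K n) < 0 \<and> m (W n) \<le> 0) \<or>
         (hgt (W n) < 0 \<and> 0 < hgt (L n) \<and> 0 < hgt (K n) \<and> m (L n) \<le> 0 \<and> m (K n) \<le> 0 \<and> 0 < m (W n))"
proof -
  have n0: "0 < n" by (rule base_pos[OF n])
  have fr: "hsp z t (pos n w) \<le> 0" if "w \<in> V" "w \<noteq> f n" "0 < hgt (pos n w)" for w
    using is_free n that by (auto simp: free_def)
  show ?thesis
  proof (cases "0 < hgt (W n)")
    case True
    then show ?thesis using hgt_opposite[OF n0] fr[of "apex n"] apex[OF n0] by (auto simp: mult_less_0_iff)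
  next
    case False
    then have h: "hgt (W n) < 0" "0 < hgt (L n)" "0 < hgt (K n)"
      using hgt_opposite[OF n0] by (auto simp: mult_less_0_iff)
    have mm: "m (L n) \<le> 0" "m (K n) \<le> 0"
      using h fr f_V f_pred[OF n0] f_Suc[of n] by auto
    obtain \<sigma> where \<sigma>: "s n < \<sigma>" "\<sigma> < s (Suc n)" "z < \<sigma>" "\<sigma> < z + pi" by (rule base_point[OF n])
    have c: "0 < mid n (eqc \<sigma>)" "0 < lft n (eqc \<sigma>)" "0 < rgt n (eqc \<sigma>)"
      using mid_pos[OF n0] lft_pos[OF n0] rgt_pos[OF n0] \<sigma> by auto
    have "0 < sin (\<sigma> - z)" using \<sigma> by (intro sin_gt_zero) auto
    also have "\<dots> = mid n (eqc \<sigma>) * m (W n) + lft n (eqc \<sigma>) * m (L n) + rgt n (eqc \<sigma>) * m (K n)"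
      using arg_cong[OF tri_expand[OF n0, of "eqc \<sigma>"], of m] by simp
    also have "\<dots> \<le> mid n (eqc \<sigma>) * m (W n)"
      using c mm by (simp add: mult_nonneg_nonpos add_nonpos_nonpos)
    finally have "0 < m (W n)" using c by (simp add: zero_less_mult_iff)
    then show ?thesis using h mm by simp
  qed
qed

lemma mid_pos_lune:
  assumes n: "n \<in> base z" and x: "x \<in> lune z t" "0 \<le> lft n x" "0 \<le> rgt n x"
  shows "0 < mid n x"
proof -
  have n0: "0 < n" by (rule base_pos[OF n])
  have h: "0 < mid n x * hgt (W n) + lft n x * hgt (L n) + rgt n x * hgt (K n)"
    using arg_cong[OF tri_expand[OF n0, of x], of hgt] x by (simp add: lune_def)
  have mm: "0 < mid n x * m (W n) + lft n x * m (L n) + rgt n x * m (K n)"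
    using arg_cong[OF tri_expand[OF n0, of x], of m] x by (simp add: lune_def)
  from tri_sides[OF n] show ?thesis
  proof (elim disjE conjE)
    assume a: "0 < hgt (W n)" "hgt (L n) < 0" "hgt (K n) < 0"
    then have "lft n x * hgt (L n) \<le> 0" "rgt n x * hgt (K n) \<le> 0" using x by (auto simp: mult_nonneg_nonpos)
    then have "0 < mid n x * hgt (W n)" using h by simp
    then show ?thesis using a by (simp add: zero_less_mult_iff)
  next
    assume a: "m (L n) \<le> 0" "m (K n) \<le> 0" "0 < m (W n)"
    then have "lft n x * m (L n) \<le> 0" "rgt n x * m (K n) \<le> 0" using x by (auto simp: mult_nonneg_nonpos)
    then have "0 < mid n x * m (W n)" using mm by simp
    then show ?thesis using a by (simp add: zero_less_mult_iff)
  qed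
qed

lemma lft_add: "lft n (x + r *\<^sub>R y) = lft n x + r * lft n y"
  and rgt_add: "rgt n (x + r *\<^sub>R y) = rgt n x + r * rgt n y"
  by (simp_all add: lft_def rgt_def A_lin)

lemma exit_right:
  assumes n: "n \<in> base z" and x: "x \<in> lune z t" "0 \<le> lft n x" "rgt n x \<le> 0"
  shows "Suc n \<in> base z" "rgt n x = 0 \<Longrightarrow> 0 < lft n x"
proof -
  have n0: "0 < n" by (rule base_pos[OF n])
  obtain \<sigma> where \<sigma>: "s n < \<sigma>" "\<sigma> < s (Suc n)" "z < \<sigma>" "\<sigma> < z + pi" by (rule base_point[OF n])
  define y where "y = eqc \<sigma>"
  have y: "0 < lft n y" "0 < rgt n y" "hgt y = 0" "0 < m y"
    using lft_pos[OF n0, of \<sigma>] rgt_pos[OF n0, of \<sigma>] \<sigma> by (auto simp: y_def intro!: sin_gt_zero)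
  define \<tau> where "\<tau> = - rgt n x / rgt n y"
  have \<tau>: "0 \<le> \<tau>" "rgt n x + \<tau> * rgt n y = 0" using x y by (auto simp: \<tau>_def divide_nonpos_pos)
  define x' where "x' = x + \<tau> *\<^sub>R y"
  have x': "rgt n x' = 0" "0 \<le> lft n x'" "lft n x' = lft n x + \<tau> * lft n y" "0 < hgt x'" "0 < m x'"
    using x y \<tau> by (auto simp: x'_def rgt_add lft_add lune_def add_pos_nonneg)
  have e: "x' = mid n x' *\<^sub>R W n + lft n x' *\<^sub>R L n" using tri_expand[OF n0, of x'] x'(1) by simp
  have hm: "0 < mid n x' * hgt (W n) + lft n x' * hgt (L n)" "0 < mid n x' * m (W n) + lft n x' * m (L n)"
    using arg_cong[OF e, of hgt] arg_cong[OF e, of m] x'(4,5) by simp_all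
  define q where "q = eqc (s (Suc n))"
  have q: "0 < mid n q" "0 < lft n q" "q = mid n q *\<^sub>R W n + lft n q *\<^sub>R L n"
    using right_crossing[OF n0] by (auto simp: q_def)
  have hq: "mid n q * hgt (W n) + lft n q * hgt (L n) = 0"
    using arg_cong[OF q(3), of hgt] by (simp add: q_def)
  have mq: "mid n q * m (W n) + lft n q * m (L n) = sin (s (Suc n) - z)"
    using arg_cong[OF q(3), of m] by (simp add: q_def)
  have *: "0 < mid n q * m (W n) + lft n q * m (L n) \<and> 0 < lft n x'"
    using tri_sides[OF n]
  proof (elim disjE conjE)
    assume "0 < hgt (W n)" "hgt (L n) < 0" "hgt (K n) < 0" "m (W n) \<le> 0"
    then show ?thesis
      using crossing_in_halfspace_up[of "hgt (W n)" "hgt (L n)" "m (W n)" "mid n q" "lft n q" "mid n x'" "lft n x'" "m (L n)"]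
        q hq hm x' by auto
  next
    assume "hgt (W n) < 0" "0 < hgt (L n)" "0 < hgt (K n)" "m (L n) \<le> 0" "m (K n) \<le> 0" "0 < m (W n)"
    then show ?thesis
      using crossing_in_halfspace_down[of "hgt (W n)" "hgt (L n)" "m (L n)" "m (W n)" "mid n q" "lft n q" "mid n x'" "lft n x'"]
        q hq hm x' by auto
  qed
  have "s (Suc n) < z + pi"
  proof (rule ccontr)
    assume "\<not> s (Suc n) < z + pi"
    then have "0 \<le> sin (s (Suc n) - z - pi)"
      using n gap_less_pi[OF n0] by (intro sin_ge_zero) (auto simp: base_def)
    then show False using * mq by (simp add: sin_diff)
  qed
  then show "Suc n \<in> base z" using n s_less[of "Suc n"] by (auto simp: base_def)
  show "0 < lft n x" if "rgt n x = 0" using * x'(3) that by (simp add: \<tau>_def)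
qed

lemma exit_left:
  assumes n: "n \<in> base z" and x: "x \<in> lune z t" "0 \<le> rgt n x" "lft n x \<le> 0"
  shows "z < s n" "n - 1 \<in> base z" "lft n x = 0 \<Longrightarrow> 0 < rgt n x"
proof -
  have n0: "0 < n" by (rule base_pos[OF n])
  obtain \<sigma> where \<sigma>: "s n < \<sigma>" "\<sigma> < s (Suc n)" "z < \<sigma>" "\<sigma> < z + pi" by (rule base_point[OF n])
  define y where "y = eqc \<sigma>"
  have y: "0 < lft n y" "0 < rgt n y" "hgt y = 0" "0 < m y"
    using lft_pos[OF n0, of \<sigma>] rgt_pos[OF n0, of \<sigma>] \<sigma> by (auto simp: y_def intro!: sin_gt_zero)
  define \<tau> where "\<tau> = - lft n x / lft n y"
  have \<tau>: "0 \<le> \<tau>" "lft n x + \<tau> * lft n y = 0" using x y by (auto simp: \<tau>_def divide_nonpos_pos)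
  define x' where "x' = x + \<tau> *\<^sub>R y"
  have x': "lft n x' = 0" "0 \<le> rgt n x'" "rgt n x' = rgt n x + \<tau> * rgt n y" "0 < hgt x'" "0 < m x'"
    using x y \<tau> by (auto simp: x'_def rgt_add lft_add lune_def add_pos_nonneg)
  have e: "x' = mid n x' *\<^sub>R W n + rgt n x' *\<^sub>R K n" using tri_expand[OF n0, of x'] x'(1) by simp
  have hm: "0 < mid n x' * hgt (W n) + rgt n x' * hgt (K n)" "0 < mid n x' * m (W n) + rgt n x' * m (K n)"
    using arg_cong[OF e, of hgt] arg_cong[OF e, of m] x'(4,5) by simp_all
  define q where "q = eqc (s n)"
  have q: "0 < mid n q" "0 < rgt n q" "q = mid n q *\<^sub>R W n + rgt n q *\<^sub>R K n"
    using left_crossing[OF n0] by (auto simp: q_def)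
  have hq: "mid n q * hgt (W n) + rgt n q * hgt (K n) = 0"
    using arg_cong[OF q(3), of hgt] by (simp add: q_def)
  have mq: "mid n q * m (W n) + rgt n q * m (K n) = sin (s n - z)"
    using arg_cong[OF q(3), of m] by (simp add: q_def)
  have *: "0 < mid n q * m (W n) + rgt n q * m (K n) \<and> 0 < rgt n x'"
    using tri_sides[OF n]
  proof (elim disjE conjE)
    assume "0 < hgt (W n)" "hgt (L n) < 0" "hgt (K n) < 0" "m (W n) \<le> 0"
    then show ?thesis
      using crossing_in_halfspace_up[of "hgt (W n)" "hgt (K n)" "m (W n)" "mid n q" "rgt n q" "mid n x'" "rgt n x'" "m (K n)"]
        q hq hm x' by auto
  next
    assume "hgt (W n) < 0" "0 < hgt (L n)" "0 < hgt (K n)" "m (L n) \<le> 0" "m (K n) \<le> 0" "0 < m (W n)"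
    then show ?thesis
      using crossing_in_halfspace_down[of "hgt (W n)" "hgt (K n)" "m (K n)" "m (W n)" "mid n q" "rgt n q" "mid n x'" "rgt n x'"]
        q hq hm x' by auto
  qed
  show zs: "z < s n"
  proof (rule ccontr)
    assume "\<not> z < s n"
    then have "0 \<le> sin (z - s n)"
      using n gap_less_pi[OF n0] by (intro sin_ge_zero) (auto simp: base_def)
    moreover have "sin (s n - z) = - sin (z - s n)" by (metis minus_diff_eq sin_minus)
    ultimately show False using * mq by simp
  qed
  have "s (n - 1) < s n" using n0 by (intro s_strict) auto
  then show "n - 1 \<in> base z" using n zs n0 by (auto simp: base_def)
  show "0 < rgt n x" if "lft n x = 0" using * x'(3) that by (simp add: \<tau>_def)
qed

lemma side_order:
  assumes n: "n \<in> base z" "Suc n \<in> base z" "z < s n" and x: "0 < hgt x" "0 \<le> m x" "rgt n x \<le> 0"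
  shows "0 < lft n x \<or> lft n x = 0 \<and> rgt n x = 0"
proof (rule ccontr)
  assume neg: "\<not> ?thesis"
  have n0: "0 < n" by (rule base_pos[OF n(1)])
  define q1 q2 where "q1 = eqc (s n)" and "q2 = eqc (s (Suc n))"
  have q1: "0 < mid n q1" "0 < rgt n q1" "q1 = mid n q1 *\<^sub>R W n + rgt n q1 *\<^sub>R K n"
    using left_crossing[OF n0] by (auto simp: q1_def)
  have q2: "0 < mid n q2" "0 < lft n q2" "q2 = mid n q2 *\<^sub>R W n + lft n q2 *\<^sub>R L n"
    using right_crossing[OF n0] by (auto simp: q2_def)
  have mq: "0 < m q1" "0 < m q2" "hgt q1 = 0" "hgt q2 = 0"
    using n s_less[of n] by (auto simp: q1_def q2_def base_def intro!: sin_gt_zero)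
  define b1 b2 d1 d2 where "b1 = mid n q1" and "b2 = rgt n q1" and "d1 = mid n q2" and "d2 = lft n q2"
  have q1e: "q1 = b1 *\<^sub>R W n + b2 *\<^sub>R K n" unfolding b1_def b2_def by (rule q1(3))
  have q2e: "q2 = d1 *\<^sub>R W n + d2 *\<^sub>R L n" unfolding d1_def d2_def by (rule q2(3))
  have bd0: "0 < b2" "0 < d2" using q1 q2 by (auto simp: b2_def d2_def)
  define b d where "b = rgt n x / b2" and "d = lft n x / d2"
  have bd: "b \<le> 0" "d \<le> 0" "b \<noteq> 0 \<or> d \<noteq> 0"
    using neg x(3) bd0 by (auto simp: b_def d_def divide_nonpos_pos)
  define \<mu> where "\<mu> = mid n x - b * b1 - d * d1"
  have "x = \<mu> *\<^sub>R W n + b *\<^sub>R q1 + d *\<^sub>R q2"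
  proof -
    have "b *\<^sub>R q1 = (b * b1) *\<^sub>R W n + rgt n x *\<^sub>R K n"
      unfolding q1e using bd0 by (simp add: scaleR_add_right b_def)
    moreover have "d *\<^sub>R q2 = (d * d1) *\<^sub>R W n + lft n x *\<^sub>R L n"
      unfolding q2e using bd0 by (simp add: scaleR_add_right d_def)
    moreover have "mid n x *\<^sub>R W n = \<mu> *\<^sub>R W n + (b * b1) *\<^sub>R W n + (d * d1) *\<^sub>R W n"
      by (simp add: \<mu>_def scaleR_diff_left)
    ultimately have "\<mu> *\<^sub>R W n + b *\<^sub>R q1 + d *\<^sub>R q2 = mid n x *\<^sub>R W n + lft n x *\<^sub>R L n + rgt n x *\<^sub>R K n"
      by simp
    then show ?thesis using tri_expand[OF n0, of x] by simp
  qed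
  then have h: "hgt x = \<mu> * hgt (W n)" and mm: "m x = \<mu> * m (W n) + b * m q1 + d * m q2"
    using mq by simp_all
  have "b * m q1 + d * m q2 < 0"
  proof -
    have "b * m q1 \<le> 0" "d * m q2 \<le> 0" using bd mq by (auto simp: mult_nonpos_nonneg)
    moreover have "b * m q1 \<noteq> 0 \<or> d * m q2 \<noteq> 0" using bd(3) mq by auto
    ultimately show ?thesis by linarith
  qed
  moreover have "\<mu> * m (W n) \<le> 0"
    using tri_sides[OF n(1)] x(1) unfolding h by (auto simp: zero_less_mult_iff mult_le_0_iff)
  ultimately show False using mm x(2) by simp
qed

lemma lune_covered:
  assumes x: "x \<in> lune z t"
  obtains n where "n \<in> base z" "x \<in> tri n"
proof -
  define n0 where "n0 = Min (base z)"
  have n0: "n0 \<in> base z" "\<And>n. n \<in> base z \<Longrightarrow> n0 \<le> n"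
    unfolding n0_def using finite_base base_nonempty by auto
  define N where "N = {n \<in> base z. n = n0 \<or> 0 \<le> lft n x}"
  have "finite N" "N \<noteq> {}" using finite_base n0 by (auto simp: N_def)
  define n where "n = Max N"
  have n: "n \<in> base z" "n = n0 \<or> 0 \<le> lft n x" and nmax: "\<And>j. j \<in> N \<Longrightarrow> j \<le> n"
    using Max_in[OF \<open>finite N\<close> \<open>N \<noteq> {}\<close>] Max_ge[OF \<open>finite N\<close>] unfolding n_def by (auto simp: N_def)
  have np: "0 < n" by (rule base_pos[OF n(1)])
  have rgt_nn: "0 \<le> rgt n x" if "Suc n \<in> base z"
  proof (rule ccontr)
    assume "\<not> 0 \<le> rgt n x"
    then have "Suc n \<in> N" using that by (simp add: N_def rgt_eq)
    then show False using nmax by fastforce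
  qed
  have lft_nn: "0 \<le> lft n x"
  proof (rule ccontr)
    assume neg: "\<not> 0 \<le> lft n x"
    then have nn0: "n = n0" using n by simp
    have "Suc n \<in> base z"
    proof (rule ccontr)
      assume "Suc n \<notin> base z"
      then have "z + pi \<le> s (Suc n)" using n(1) s_less[of "Suc n"] by (auto simp: base_def)
      then have zs: "z < s n" using gap_less_pi[OF np] by simp
      have "s (n - 1) < s n" using np by (intro s_strict) auto
      then have "n - 1 \<in> base z" using n(1) zs np by (auto simp: base_def)
      then show False using n0(2)[of "n - 1"] nn0 np by simp
    qed
    then have "n - 1 \<in> base z" using exit_left(2)[OF n(1) x rgt_nn] neg by simp
    then show False using n0(2)[of "n - 1"] nn0 np by simp
  qed
  have "0 \<le> rgt n x"
  proof (rule ccontr)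
    assume "\<not> 0 \<le> rgt n x"
    then show False using exit_right(1)[OF n(1) x lft_nn] rgt_nn by simp
  qed
  then have "x \<in> tri n" using mid_pos_lune[OF n(1) x lft_nn] lft_nn tri_iff[OF np] by simp
  then show ?thesis using that n(1) by blast
qed

lemma tri_agree_less:
  assumes n: "n \<in> base z" "j \<in> base z" "n \<le> j" and x: "0 < hgt x" "0 \<le> m x" "x \<in> tri n" "x \<in> tri j"
  shows "A j x = A n x"
proof (cases "n = j")
  case False
  then have nj: "n < j" using n(3) by simp
  have np: "0 < n" "0 < j" using n base_pos by auto
  have down: "0 \<le> lft (j - i) x" if "j - i > n" for i
    using that
  proof (induction i)
    case 0
    then show ?case using x(4) tri_iff[OF np(2)] by simp
  next
    case (Suc i)
    define k where "k = j - Suc i"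
    have k: "Suc k = j - i" "n < k" "k \<le> j" "Suc k \<le> j" using Suc.prems by (auto simp: k_def)
    have "0 \<le> lft (Suc k) x" using Suc.IH Suc.prems k by simp
    then have "rgt k x \<le> 0" by (simp add: rgt_eq)
    moreover have "k \<in> base z" "Suc k \<in> base z" using base_between[OF n(1,2)] k by auto
    moreover have "z < s k" using n(1) s_mono[of "Suc n" k] k by (auto simp: base_def)
    ultimately have "0 \<le> lft k x" using side_order[of k x] x by auto
    then show ?case by (simp add: k_def)
  qed
  have lnn: "0 \<le> lft k x" if "n < k" "k \<le> j" for k using down[of "j - k"] that by simp
  have "Suc n \<le> k \<Longrightarrow> k \<le> j \<Longrightarrow> lft k x = 0" for k
  proof (induction rule: dec_induct)
    case base
    then show ?case using lnn[of "Suc n"] nj x(3) tri_iff[OF np(1)] by (simp add: rgt_eq)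
  next
    case (step k)
    have "rgt k x \<le> 0" using lnn[of "Suc k"] step by (simp add: rgt_eq)
    moreover have "k \<in> base z" "Suc k \<in> base z" using base_between[OF n(1,2)] step by auto
    moreover have "z < s k" using n(1) s_mono[of "Suc n" k] step by (auto simp: base_def)
    ultimately show ?case using side_order[of k x] x step by (auto simp: rgt_eq)
  qed
  then have zero: "lft k x = 0" if "n < k" "k \<le> j" for k using that by simp
  have "A (n + i) x = A n x" if "n + i \<le> j" for i
    using that
  proof (induction i)
    case (Suc i)
    then have "rgt (n + i) x = 0" using zero[of "Suc (n + i)"] by (simp add: rgt_eq)
    then show ?case using A_Suc_eq[of "n + i"] Suc by simp
  qed simp
  from this[of "j - n"] show ?thesis using nj by simp
qed simp

lemma tri_agree:
  assumes "n \<in> base z" "j \<in> base z" "0 < hgt x" "0 \<le> m x" "x \<in> tri n" "x \<in> tri j"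
  shows "A j x = A n x"
  using tri_agree_less[OF assms(1,2)] tri_agree_less[OF assms(2,1)] assms by (metis linear)

text \<open>By \<open>tri_agree\<close> the choice of the triangle is immaterial.\<close>

definition E :: "pt3 \<Rightarrow> real ^ 4" where
  "E x = A (SOME n. n \<in> base z \<and> x \<in> tri n) x"

lemma E_eq:
  assumes "n \<in> base z" "x \<in> tri n" "x \<in> lune z t"
  shows "E x = A n x"
proof -
  have "(SOME n. n \<in> base z \<and> x \<in> tri n) \<in> base z \<and> x \<in> tri (SOME n. n \<in> base z \<and> x \<in> tri n)"
    by (rule someI[of _ n]) (use assms in auto)
  then show ?thesis unfolding E_def using tri_agree[OF assms(1) _ _ _ assms(2)] assms(3) by (auto simp: lune_def)
qed

lemma continuous_pos_ball:
  fixes g :: "pt3 \<Rightarrow> real"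
  assumes "continuous_on UNIV g" "0 < g x"
  shows "\<forall>\<^sub>F y in nhds x. 0 < g y"
proof -
  have "isCont g x" using assms(1) by (rule continuous_on_interior) simp
  then have "(g \<longlongrightarrow> g x) (nhds x)" by (simp add: isCont_def tendsto_nhds_iff)
  then show ?thesis using assms(2) by (rule order_tendstoD)
qed

lemma cont_sides: "continuous_on UNIV (lft n)" "continuous_on UNIV (rgt n)" "continuous_on UNIV (mid n)"
  "continuous_on UNIV (\<lambda>x. bary w (A n x))"
  unfolding lft_def[abs_def] rgt_def[abs_def] mid_def[abs_def] by (intro continuous_intros)+

lemma ev_lune: "x \<in> lune z t \<Longrightarrow> \<forall>\<^sub>F y in nhds x. y \<in> lune z t"
  using open_lune by (rule eventually_nhds_in_open)

lemma wedge_A: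
  assumes "norm x = 1" "x \<in> tri n" "\<And>w. w \<in> V \<Longrightarrow> w \<noteq> k \<Longrightarrow> w \<noteq> l \<Longrightarrow> 0 < bary w (A n x)"
  shows "wedge k l (A n x)"
  using assms A_zero[of n x] f_V[of n] frame_norm[OF frm[of n], of x] by (auto simp: wedge_def surface_def tri_def)

lemma E_chart:
  assumes x: "x \<in> lune z t"
  obtains n where "n \<in> base z" "x \<in> tri n"
    "\<And>k. \<lbrakk>k \<in> V; k \<noteq> f n; wedge k (f n) (A n x)\<rbrakk> \<Longrightarrow>
      \<forall>\<^sub>F y in nhds x. norm y = 1 \<longrightarrow> y \<in> lune z t \<and> wedge k (f n) (E y) \<and> unfold_map k (f n) (E y) = A n y"
    "\<exists>k\<in>V. k \<noteq> f n \<and> (norm x = 1 \<longrightarrow> wedge k (f n) (A n x))"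
proof -
  obtain n' where n': "n' \<in> base z" "x \<in> tri n'" by (rule lune_covered[OF x])
  have n'p: "0 < n'" by (rule base_pos[OF n'(1)])
  obtain n where n: "n \<in> base z" "x \<in> tri n" "0 < lft n x"
  proof (cases "0 < lft n' x")
    case True
    then show ?thesis using that n' by blast
  next
    case False
    then have l0: "lft n' x = 0" "0 \<le> rgt n' x" using n'(2) tri_iff[OF n'p] by auto
    have nb: "n' - 1 \<in> base z" using exit_left(2)[OF n'(1) x l0(2)] l0 by simp
    have "0 < n' - 1" by (rule base_pos[OF nb])
    have r0: "rgt (n' - 1) x = 0" using l0(1) n'p by (simp add: rgt_eq)
    then have "A n' x = A (n' - 1) x" using A_Suc_eq[of "n' - 1" x] n'p by simp
    then have t: "x \<in> tri (n' - 1)" using n'(2) by (simp add: tri_def)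
    then have "0 \<le> lft (n' - 1) x" using tri_iff[OF \<open>0 < n' - 1\<close>] by simp
    then have "0 < lft (n' - 1) x" using exit_right(2)[OF nb x _ _ r0] r0 by simp
    then show ?thesis using that nb t by blast
  qed
  have np: "0 < n" by (rule base_pos[OF n(1)])
  have xn: "0 \<le> rgt n x" using n(2) tri_iff[OF np] by simp
  have mid: "0 < mid n x" using mid_pos_lune[OF n(1) x] n xn by simp
  note ap = apex[OF np]
  note evb = ev_lune[OF x] continuous_pos_ball[OF cont_sides(3) mid] continuous_pos_ball[OF cont_sides(1) n(3)]
  show ?thesis
  proof (rule that[OF n(1,2)])
    show "\<exists>k\<in>V. k \<noteq> f n \<and> (norm x = 1 \<longrightarrow> wedge k (f n) (A n x))"
    proof (intro bexI[of _ "f (Suc n)"] conjI impI)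
      assume "norm x = 1"
      then show "wedge (f (Suc n)) (f n) (A n x)"
      proof (rule wedge_A[OF _ n(2)])
        fix w assume "w \<in> V" "w \<noteq> f (Suc n)" "w \<noteq> f n"
        then show "0 < bary w (A n x)"
          using V_cases[OF np \<open>w \<in> V\<close>] mid n(3) by (metis lft_def mid_def)
      qed
    qed (use f_V f_Suc in auto)
    fix k assume k: "k \<in> V" "k \<noteq> f n" "wedge k (f n) (A n x)"
    show "\<forall>\<^sub>F y in nhds x. norm y = 1 \<longrightarrow> y \<in> lune z t \<and> wedge k (f n) (E y) \<and> unfold_map k (f n) (E y) = A n y"
    proof (cases "0 < rgt n x")
      case True
      show ?thesis using evb continuous_pos_ball[OF cont_sides(2) True]
      proof eventually_elim
        case (elim y)
        then have ty: "y \<in> tri n" using tri_iff[OF np] by simp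
        have Ey: "E y = A n y" by (rule E_eq[OF n(1) ty elim(1)])
        have "0 < bary w (A n y)" if "w \<in> V" "w \<noteq> f n" for w
          using V_cases[OF np that(1)] that(2) elim by (metis lft_def mid_def rgt_def)
        then show ?case using elim(1) unfolding Ey by (auto intro!: wedge_A ty simp: unfold_map_id A_zero)
      qed
    next
      case False
      then have r0: "rgt n x = 0" using xn by simp
      have Sb: "Suc n \<in> base z" using exit_right(1)[OF n(1) x] n(3) r0 by simp
      have "bary (f (Suc n)) (A n x) = 0" using r0 by (simp add: rgt_def)
      then have kf: "k = f (Suc n)" using k(3) f_V[of "Suc n"] f_Suc[of n] by (force simp: wedge_def)
      have AS: "A (Suc n) x = A n x" by (rule A_Suc_eq[OF r0])
      have 1: "0 < bary (apex n) (A (Suc n) x)" "0 < bary (f (n - 1)) (A (Suc n) x)"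
        unfolding AS using mid n(3) by (auto simp: mid_def lft_def)
      show ?thesis using evb continuous_pos_ball[OF cont_sides(4) 1(1)] continuous_pos_ball[OF cont_sides(4) 1(2)]
      proof eventually_elim
        case (elim y)
        show ?case
        proof (intro impI)
          assume ny: "norm y = 1"
          show "y \<in> lune z t \<and> wedge k (f n) (E y) \<and> unfold_map k (f n) (E y) = A n y"
          proof (cases "0 \<le> rgt n y")
            case True
            then have ty: "y \<in> tri n" using elim tri_iff[OF np] by simp
            have Ey: "E y = A n y" by (rule E_eq[OF n(1) ty elim(1)])
            have "0 < bary w (A n y)" if "w \<in> V" "w \<noteq> k" "w \<noteq> f n" for w
              using V_cases[OF np that(1)] that(2,3) elim kf by (metis lft_def mid_def)
            then show ?thesis using elim(1) ny unfolding Ey by (auto intro!: wedge_A ty simp: unfold_map_id A_zero)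
          next
            case False
            then have lS: "0 < bary (f n) (A (Suc n) y)" using rgt_eq[of n y] by (simp add: lft_def)
            have p: "0 < bary w (A (Suc n) y)" if "w \<in> V" "w \<noteq> k" for w
              using V_cases[OF np that(1)] that(2) elim lS kf by metis
            then have ty: "y \<in> tri (Suc n)" using A_zero[of "Suc n" y] kf by (force simp: tri_def)
            have Ey: "E y = A (Suc n) y" by (rule E_eq[OF Sb ty elim(1)])
            have "unfold_map k (f n) (A (Suc n) y) = A n y"
            proof -
              have lr: "bary (f n) (A (Suc n) y) = - bary (f (Suc n)) (A n y)"
                using rgt_eq[of n y] by (simp add: lft_def rgt_def)
              show ?thesis unfolding unfold_map_def lr unfolding kf A_Suc by simp
            qed
            moreover have "wedge k (f n) (A (Suc n) y)" using p by (intro wedge_A ny ty) auto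
            ultimately show ?thesis using elim(1) unfolding Ey by blast
          qed
        qed
      qed
    qed
  qed
qed

lemma E_straight:
  assumes on: "norm u = 1" "norm v = 1" "u \<bullet> v = 0" and x: "garc u v r \<in> lune z t"
  shows "straight_at (\<lambda>r. E (garc u v r)) r"
proof -
  obtain n k where n: "n \<in> base z" "garc u v r \<in> tri n" and k: "k \<in> V" "k \<noteq> f n" "wedge k (f n) (A n (garc u v r))"
    and ev: "\<forall>\<^sub>F y in nhds (garc u v r). norm y = 1 \<longrightarrow> y \<in> lune z t \<and> wedge k (f n) (E y) \<and> unfold_map k (f n) (E y) = A n y"
  proof -
    have "\<exists>n k. n \<in> base z \<and> garc u v r \<in> tri n \<and> k \<in> V \<and> k \<noteq> f n \<and> wedge k (f n) (A n (garc u v r)) \<and>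
      (\<forall>\<^sub>F y in nhds (garc u v r). norm y = 1 \<longrightarrow> y \<in> lune z t \<and> wedge k (f n) (E y) \<and> unfold_map k (f n) (E y) = A n y)"
      by (rule E_chart[OF x]) (use norm_garc[OF on] in blast)
    then show ?thesis using that by blast
  qed
  have "continuous_on UNIV (garc u v)" using continuous_on_garc[of UNIV "\<lambda>r. r" u v] by simp
  then have "(garc u v \<longlongrightarrow> garc u v r) (nhds r)"
    by (simp add: continuous_on_eq_continuous_at isCont_def tendsto_nhds_iff)
  from eventually_compose_filterlim[OF ev this]
  obtain d where d: "0 < d" "\<And>r'. \<bar>r' - r\<bar> < d \<Longrightarrow> wedge k (f n) (E (garc u v r')) \<and> unfold_map k (f n) (E (garc u v r')) = A n (garc u v r')"
    unfolding eventually_near_iff by (auto simp: norm_garc[OF on])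
  define P Q where "P = A n (garc u v r)" and "Q = A n (garc u v (r + pi / 2))"
  have e: "A n (garc u v (r + \<tau>)) = garc P Q \<tau>" for \<tau>
    unfolding garc_shift[of u v r \<tau>] P_def Q_def by (simp add: garc_def A_lin)
  have "wedge k (f n) (E (garc u v (r + \<tau>))) \<and> unfold_map k (f n) (E (garc u v (r + \<tau>))) = garc P Q \<tau>"
    if "\<bar>\<tau>\<bar> < d" for \<tau>
    using d(2)[of "r + \<tau>"] that unfolding e by simp
  then show ?thesis unfolding straight_at_def using k(1,2) f_V[of n] d(1) by blast
qed

lemma E_limit:
  assumes ab: "a < b" and x: "\<And>r. \<lbrakk>a < r; r < b\<rbrakk> \<Longrightarrow> garc u v r \<in> lune z t" and b: "garc u v b = eqc \<sigma>" "z \<le> \<sigma>" "\<sigma> \<le> z + pi"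
  obtains n where "n \<in> base z" "s n \<le> \<sigma>" "\<sigma> \<le> s (Suc n)" "\<And>e. 0 < e \<Longrightarrow> \<exists>r. a < r \<and> b - e < r \<and> r < b \<and> garc u v r \<in> tri n"
proof -
  have "\<exists>n\<in>base z. \<forall>e>0. \<exists>r. a < r \<and> b - e < r \<and> r < b \<and> garc u v r \<in> tri n"
  proof (rule ccontr)
    assume "\<not> ?thesis"
    then have "\<forall>n\<in>base z. \<exists>e>0. \<forall>r. \<not> (a < r \<and> b - e < r \<and> r < b \<and> garc u v r \<in> tri n)" by blast
    then obtain e where e: "\<And>n. n \<in> base z \<Longrightarrow> 0 < e n" "\<And>n r. \<lbrakk>n \<in> base z; a < r; b - e n < r; r < b\<rbrakk> \<Longrightarrow> garc u v r \<notin> tri n"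
      by metis
    define d where "d = min (b - a) (Min (e ` base z))"
    have d: "0 < d" "d \<le> b - a" "\<And>n. n \<in> base z \<Longrightarrow> d \<le> e n"
      using e(1) ab finite_base base_nonempty by (auto simp: d_def min.coboundedI2)
    define r where "r = b - d / 2"
    have r: "a < r" "r < b" using d by (auto simp: r_def)
    obtain n where n: "n \<in> base z" "garc u v r \<in> tri n" by (rule lune_covered[OF x[OF r]])
    then show False using e(2)[OF n(1) r(1) _ r(2)] d(1) d(3)[OF n(1)] by (auto simp: r_def)
  qed
  then obtain n where n: "n \<in> base z" "\<And>e. 0 < e \<Longrightarrow> \<exists>r. a < r \<and> b - e < r \<and> r < b \<and> garc u v r \<in> tri n" by blast
  have np: "0 < n" by (rule base_pos[OF n(1)])
  have "eqc \<sigma> \<in> tri n"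
    unfolding tri_def
  proof (intro CollectI ballI, rule ccontr)
    fix w assume w: "w \<in> V" "\<not> 0 \<le> bary w (A n (eqc \<sigma>))"
    have "continuous_on UNIV (\<lambda>r. - bary w (A n (garc u v r)))" by (intro continuous_intros)
    then have "\<forall>\<^sub>F r in nhds b. 0 < - bary w (A n (garc u v r))"
      using w b by (intro continuous_pos_near) auto
    then obtain d where d: "0 < d" "\<And>r. \<bar>r - b\<bar> < d \<Longrightarrow> 0 < - bary w (A n (garc u v r))"
      unfolding eventually_near_iff by blast
    obtain r where r: "b - d < r" "r < b" "garc u v r \<in> tri n" using n(2)[OF d(1)] by blast
    then show False using d(2)[of r] w(1) by (auto simp: tri_def)
  qed
  then have "s n \<le> \<sigma>" "\<sigma> \<le> s (Suc n)"
    using n(1) gap_less_pi[OF np] b by (auto intro!: eqc_in_tri[OF np] simp: base_def)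
  then show ?thesis using that n by blast
qed

end

lemma frequently_eq_imp_eq:
  fixes F G :: "real \<Rightarrow> 'a::metric_space"
  assumes "isCont F b" "isCont G b" "\<And>e. 0 < e \<Longrightarrow> \<exists>r. b - e < r \<and> r < b \<and> F r = G r"
  shows "F b = G b"
proof (rule ccontr)
  assume "F b \<noteq> G b"
  then have "0 < dist (F b) (G b)" by simp
  moreover have "((\<lambda>r. dist (F r) (G r)) \<longlongrightarrow> dist (F b) (G b)) (nhds b)"
    using assms(1,2) by (intro tendsto_dist) (simp_all add: isCont_def tendsto_nhds_iff)
  ultimately have "\<forall>\<^sub>F r in nhds b. 0 < dist (F r) (G r)" by (rule order_tendstoD(1)[rotated])
  then obtain d where d: "0 < d" "\<And>r. \<bar>r - b\<bar> < d \<Longrightarrow> 0 < dist (F r) (G r)"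
    unfolding eventually_near_iff by blast
  obtain r where "b - d < r" "r < b" "F r = G r" using assms(3)[OF d(1)] by blast
  then show False using d(2)[of r] by simp
qed

lemma isCont_garc: "isCont (garc p q) b"
proof -
  have "continuous_on UNIV (garc p q)" using continuous_on_garc[of UNIV "\<lambda>r. r" p q] by simp
  then show ?thesis by (rule continuous_on_interior) simp
qed

lemma eqc_period: "eqc (s + 2 * pi * of_int n) = eqc s"
proof -
  have "cos (s + 2 * pi * of_int n) = cos s" "sin (s + 2 * pi * of_int n) = sin s"
    using cos_int_2pin[of n] sin_int_2pin[of n] by (simp_all add: cos_add sin_add)
  then show ?thesis by (simp add: eqc_def)
qed

lemma sin_nonneg_range:
  assumes "0 \<le> x" "x < 2 * pi" "0 \<le> sin x"
  shows "x \<le> pi"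
  using assms sin_lt_zero[of x] by (cases "pi < x") auto

lemma base_param:
  assumes "norm y = 1" "hgt y = 0" "0 \<le> hsp z t y"
  obtains \<sigma> where "y = eqc \<sigma>" "z \<le> \<sigma>" "\<sigma> \<le> z + pi"
proof -
  obtain r where r: "y = eqc r" using eqc_exists[OF assms(1,2)] by blast
  define k where "k = \<lfloor>(r - z) / (2 * pi)\<rfloor>"
  define \<sigma> where "\<sigma> = r + 2 * pi * of_int (- k)"
  have y: "y = eqc \<sigma>" unfolding \<sigma>_def eqc_period by (rule r)
  have "of_int k \<le> (r - z) / (2 * pi)" "(r - z) / (2 * pi) < of_int k + 1"
    unfolding k_def by (rule of_int_floor_le) (rule real_of_int_floor_add_one_gt)
  then have "of_int k * (2 * pi) \<le> r - z" "r - z < (of_int k + 1) * (2 * pi)"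
    by (simp_all add: pos_le_divide_eq pos_divide_less_eq)
  then have "0 \<le> \<sigma> - z" "\<sigma> - z < 2 * pi" by (auto simp: \<sigma>_def algebra_simps)
  moreover have "0 \<le> sin (\<sigma> - z)" using assms(3) by (simp add: y)
  ultimately have "\<sigma> - z \<le> pi" by (rule sin_nonneg_range)
  then show ?thesis using that[of \<sigma>] y \<open>0 \<le> \<sigma> - z\<close> by simp
qed

lemma garc_between:
  assumes "0 < b"
  shows "sin b *\<^sub>R garc u v r = sin (b - r) *\<^sub>R u + sin r *\<^sub>R garc u v b"
proof -
  have "sin (b - r) + sin r * cos b = sin b * cos r" by (simp add: sin_diff)
  then show ?thesis by (simp add: garc_def scaleR_add_right mult.commute flip: scaleR_add_left add.assoc)
qed

context free_lune
begin

lemma arc_in_lune: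
  assumes "0 < b" "b < pi" "0 < r" "r < b" "0 \<le> hgt u" "0 \<le> m u" "0 \<le> hgt (garc u v b)" "0 \<le> m (garc u v b)"
    "0 < hgt u \<or> 0 < hgt (garc u v b)" "0 < m u \<or> 0 < m (garc u v b)"
  shows "garc u v r \<in> lune z t"
proof -
  have s: "0 < sin b" "0 < sin (b - r)" "0 < sin r" using assms by (auto intro!: sin_gt_zero)
  note e = garc_between[OF assms(1), of u v r]
  have "0 < sin (b - r) * hgt u + sin r * hgt (garc u v b)"
    using s assms by (metis add_nonneg_pos add_pos_nonneg mult_nonneg_nonneg mult_pos_pos less_imp_le)
  then have "0 < sin b * hgt (garc u v r)" using arg_cong[OF e, of hgt] by simp
  moreover have "0 < sin (b - r) * m u + sin r * m (garc u v b)"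
    using s assms by (metis add_nonneg_pos add_pos_nonneg mult_nonneg_nonneg mult_pos_pos less_imp_le)
  then have "0 < sin b * m (garc u v r)" using arg_cong[OF e, of m] by simp
  ultimately show ?thesis using s(1) by (simp add: lune_def zero_less_mult_iff)
qed

lemma no_intrusion_dir:
  assumes \<epsilon>: "\<epsilon> = 1 \<or> \<epsilon> = - 1" and on: "norm u = 1" "norm v = 1" "u \<bullet> v = 0" and u: "u \<in> lune z t"
    and b: "0 < b" "b < pi" "hgt (garc u v b) = 0" "0 \<le> m (garc u v b)"
    and d: "0 < d" "\<And>r. \<lbrakk>0 < r; r < d\<rbrakk> \<Longrightarrow> E (garc u v r) = \<gamma> (s0 + \<epsilon> * r)"
  shows False
proof -
  have in_lune: "garc u v r \<in> lune z t" if "0 < r" "r < b" for r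
    using that b u by (intro arc_in_lune[of b]) (auto simp: lune_def)
  have eq: "E (garc u v r) = \<gamma> (s0 + \<epsilon> * r)" if r: "0 < r" "r < b" for r
  proof (rule straight_unique[of 0 b "\<lambda>r. E (garc u v r)" "\<lambda>r. \<gamma> (s0 + \<epsilon> * r)" d r])
    show "straight_at (\<lambda>r. E (garc u v r)) x" if "0 < x" "x < b" for x
      by (rule E_straight[OF on in_lune[OF that]])
    show "straight_at (\<lambda>r. \<gamma> (s0 + \<epsilon> * r)) x" for x
      using \<epsilon> straight_at_affine(1)[of \<gamma> s0 x] straight_at_affine(2)[of \<gamma> s0 "- x"] loop_straight by auto
  qed (use d r in auto)
  obtain \<sigma> where \<sigma>: "garc u v b = eqc \<sigma>" "z \<le> \<sigma>" "\<sigma> \<le> z + pi"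
    using base_param[OF norm_garc[OF on] b(3,4)] by metis
  obtain n where n: "n \<in> base z" "s n \<le> \<sigma>" "\<sigma> \<le> s (Suc n)"
    and freq: "\<And>e. 0 < e \<Longrightarrow> \<exists>r. 0 < r \<and> b - e < r \<and> r < b \<and> garc u v r \<in> tri n"
    using E_limit[OF b(1) in_lune \<sigma>] by metis
  have np: "0 < n" by (rule base_pos[OF n(1)])
  have on_tri: "\<gamma> (s0 + \<epsilon> * r) = A n (garc u v r)" if "0 < r" "r < b" "garc u v r \<in> tri n" for r
    using eq[OF that(1,2)] E_eq[OF n(1) that(3) in_lune[OF that(1,2)]] by simp
  have "\<gamma> (s0 + \<epsilon> * b) = A n (garc u v b)"
  proof (rule frequently_eq_imp_eq[of b "\<lambda>r. \<gamma> (s0 + \<epsilon> * r)" "\<lambda>r. A n (garc u v r)"])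
    show "isCont (\<lambda>r. \<gamma> (s0 + \<epsilon> * r)) b"
      by (rule isCont_o2[of _ _ \<gamma>]) (auto intro!: loop_isCont)
    have "continuous_on UNIV (\<lambda>r. A n (garc u v r))" by (intro continuous_intros)
    then show "isCont (\<lambda>r. A n (garc u v r)) b" by (rule continuous_on_interior) simp
    show "\<exists>r. b - e < r \<and> r < b \<and> \<gamma> (s0 + \<epsilon> * r) = A n (garc u v r)" if "0 < e" for e
      using freq[OF that] on_tri by blast
  qed
  then have "\<gamma> (s0 + \<epsilon> * b) = \<gamma> \<sigma>" using loop_eq_A[OF np n(2,3)] \<sigma>(1) by simp
  then obtain j :: int where j: "s0 + \<epsilon> * b = \<sigma> + of_int j * \<Lambda>" using loop_inj by blast
  define g where "g x = (if \<sigma> = x then 1 else \<bar>\<sigma> - x\<bar>)" for x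
  define e where "e = min (min (s n - s (n - 1)) (s (Suc n) - s n)) (min (s (Suc (Suc n)) - s (Suc n)) (min (g (s n)) (g (s (Suc n)))))"
  have sn1: "s (n - 1) < s n" using np by (intro s_strict) auto
  have "0 < g x" for x by (simp add: g_def)
  then have e0: "0 < e" unfolding e_def using s_less[of n] s_less[of "Suc n"] sn1 by simp
  have e_g: "e \<le> g (s n)" "e \<le> g (s (Suc n))" unfolding e_def by (simp_all add: min_le_iff_disj)
  have e_le: "e \<le> s n - s (n - 1)" "e \<le> s (Suc n) - s n" "e \<le> s (Suc (Suc n)) - s (Suc n)"
    "\<sigma> \<noteq> s n \<Longrightarrow> e \<le> \<bar>\<sigma> - s n\<bar>" "\<sigma> \<noteq> s (Suc n) \<Longrightarrow> e \<le> \<bar>\<sigma> - s (Suc n)\<bar>"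
    using e_g unfolding g_def by (simp_all add: e_def min_le_iff_disj)
  obtain r where r: "0 < r" "b - e < r" "r < b" "garc u v r \<in> tri n" using freq[OF e0] by blast
  define \<sigma>' where "\<sigma>' = \<sigma> - \<epsilon> * (b - r)"
  have "s0 + \<epsilon> * r = \<sigma>' + of_int j * \<Lambda>" using j by (simp add: \<sigma>'_def algebra_simps)
  then have g: "\<gamma> \<sigma>' = A n (garc u v r)" using on_tri[OF r(1,3,4)] loop_period_int[of \<sigma>' j] by simp
  have f0: "bary (f n) (\<gamma> \<sigma>') = 0" unfolding g by (rule A_zero)
  have "s (n - 1) < \<sigma>' \<and> \<sigma>' < s n \<or> s n < \<sigma>' \<and> \<sigma>' < s (Suc n) \<or> s (Suc n) < \<sigma>' \<and> \<sigma>' < s (Suc (Suc n))"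
    using \<epsilon>
  proof
    assume "\<epsilon> = 1"
    then have \<sigma>': "\<sigma>' = \<sigma> - (b - r)" by (simp add: \<sigma>'_def)
    show ?thesis
    proof (cases "\<sigma> = s n")
      case True
      then show ?thesis using r(2,3) e_le(1) unfolding \<sigma>' by linarith
    next
      case False
      then have "e \<le> \<sigma> - s n" using e_le(4) n(2) by linarith
      then show ?thesis using r(2,3) n(3) unfolding \<sigma>' by linarith
    qed
  next
    assume "\<epsilon> = - 1"
    then have \<sigma>': "\<sigma>' = \<sigma> + (b - r)" by (simp add: \<sigma>'_def)
    show ?thesis
    proof (cases "\<sigma> = s (Suc n)")
      case True
      then show ?thesis using r(2,3) e_le(3) unfolding \<sigma>' by linarith
    next
      case False
      then have "e \<le> s (Suc n) - \<sigma>" using e_le(5) n(3) by linarith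
      then show ?thesis using r(2,3) n(2) unfolding \<sigma>' by linarith
    qed
  qed
  then show False
  proof (elim disjE conjE)
    assume "s (n - 1) < \<sigma>'" "\<sigma>' < s n"
    then have "in_face (f (n - 1)) (A (n - 1)) \<sigma>'" using in_face_between[of "n - 1"] np by simp
    then have "\<forall>w\<in>V - {f (n - 1)}. 0 < bary w (\<gamma> \<sigma>')" unfolding in_face_def by (rule conjunct2)
    moreover have "f n \<in> V - {f (n - 1)}" using f_V[of n] f_pred[OF np] by auto
    ultimately have "0 < bary (f n) (\<gamma> \<sigma>')" by (rule bspec)
    then show False using f0 by simp
  next
    assume "s n < \<sigma>'" "\<sigma>' < s (Suc n)"
    then have "A n (eqc \<sigma>') = A n (garc u v r)" using g in_face_between[of n \<sigma>'] by (simp add: in_face_def)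
    then have "garc u v r = eqc \<sigma>'" using frame_inj[OF frm] by metis
    then show False using in_lune[OF r(1,3)] by (simp add: lune_def)
  next
    assume "s (Suc n) < \<sigma>'" "\<sigma>' < s (Suc (Suc n))"
    then have "in_face (f (Suc n)) (A (Suc n)) \<sigma>'" by (rule in_face_between)
    then have "\<forall>w\<in>V - {f (Suc n)}. 0 < bary w (\<gamma> \<sigma>')" unfolding in_face_def by (rule conjunct2)
    moreover have "f n \<in> V - {f (Suc n)}" using f_V[of n] f_Suc[of n] by auto
    ultimately have "0 < bary (f n) (\<gamma> \<sigma>')" by (rule bspec)
    then show False using f0 by simp
  qed
qed

text \<open>The loop cannot enter the image of the open lune: it would be developed there as an arc of a
  great circle, which leaves the lune through the base, where the loop would cross itself.\<close>

lemma no_intrusion: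
  assumes x: "x \<in> lune z t" "norm x = 1"
  shows "E x \<noteq> \<gamma> s0"
proof
  assume Ex: "E x = \<gamma> s0"
  obtain n where n: "n \<in> base z" "x \<in> tri n" and chart:
    "\<And>k. \<lbrakk>k \<in> V; k \<noteq> f n; wedge k (f n) (A n x)\<rbrakk> \<Longrightarrow>
      \<forall>\<^sub>F y in nhds x. norm y = 1 \<longrightarrow> y \<in> lune z t \<and> wedge k (f n) (E y) \<and> unfold_map k (f n) (E y) = A n y"
    using E_chart[OF x(1)] by blast
  have Ax: "\<gamma> s0 = A n x" using E_eq[OF n x(1)] Ex by simp
  have "bary (f n) (\<gamma> s0) = 0" unfolding Ax by (rule A_zero)
  then obtain k p q d where k: "k \<in> V" "k \<noteq> f n" "0 < d"
    and *: "\<And>\<tau>. \<bar>\<tau>\<bar> < d \<Longrightarrow> wedge k (f n) (\<gamma> (s0 + \<tau>)) \<and> unfold_map k (f n) (\<gamma> (s0 + \<tau>)) = garc p q \<tau>"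
    using straight_atD[OF loop_straight f_V] by metis
  have bz: "bary (f n) (garc p q \<tau>) = 0" if "\<bar>\<tau>\<bar> < d" for \<tau>
    using *[OF that] bary_unfold_map(1)[OF k(1) f_V k(2), of "\<gamma> (s0 + \<tau>)"] by simp
  have bp: "bary (f n) p = 0" using bz[of 0] k(3) by simp
  define e where "e = min (d / 2) 1"
  have e: "\<bar>e\<bar> < d" "0 < e" "e < pi" using k(3) pi_gt3 by (auto simp: e_def min_def)
  have "sin e * bary (f n) q = 0" using bz[OF e(1)] bp by (simp add: bary_garc)
  then have bq: "bary (f n) q = 0" using sin_gt_zero[of e] e by simp
  define u v where "u = adj (A n) p" and "v = adj (A n) q"
  have Auv: "A n (garc u v \<tau>) = garc p q \<tau>" for \<tau>
    unfolding A_garc u_def v_def by (simp add: frame_adj[OF frm] bp bq)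
  have p_eq: "p = A n x"
    using *[of 0] k(3) Ax A_zero[of n x] by (simp add: unfold_map_id)
  have ux: "u = x" unfolding u_def p_eq by (rule adj_frame[OF frm])
  have "norm (garc u v \<tau>) = 1" if "\<bar>\<tau>\<bar> < d" for \<tau>
    using *[OF that] unfold_map_wedge_norm[OF k(1) f_V k(2), of "\<gamma> (s0 + \<tau>)"] frame_norm[OF frm, of n "garc u v \<tau>"]
    by (simp add: Auv)
  then have on: "norm u = 1" "norm v = 1" "u \<bullet> v = 0" using garc_unit_imp[of d u v] k(3) by auto
  have w0: "wedge k (f n) (A n x)" using *[of 0] k(3) Ax by simp
  have "(garc u v \<longlongrightarrow> x) (nhds 0)" using isCont_garc[of 0 u v] by (simp add: isCont_def tendsto_nhds_iff ux)
  from eventually_compose_filterlim[OF chart[OF k(1,2) w0] this]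
  obtain d' where d': "0 < d'" "\<And>r. \<bar>r\<bar> < d' \<Longrightarrow> wedge k (f n) (E (garc u v r)) \<and> unfold_map k (f n) (E (garc u v r)) = A n (garc u v r)"
    unfolding eventually_near_iff by (auto simp: norm_garc[OF on])
  define D where "D = min d d'"
  have D: "0 < D" using k d' by (simp add: D_def)
  have near: "E (garc u v r) = \<gamma> (s0 + r)" if "\<bar>r\<bar> < D" for r
  proof -
    have "\<bar>r\<bar> < d" "\<bar>r\<bar> < d'" using that by (auto simp: D_def)
    then show ?thesis using d'(2)[of r] *[of r] unfold_map_inj[OF k(1) f_V[of n] k(2), of "E (garc u v r)" "\<gamma> (s0 + r)"]
      unfolding Auv by simp
  qed
  have hu: "0 < hgt u" using x(1) by (simp add: ux lune_def)
  have "\<exists>b. 0 \<le> b \<and> b \<le> pi \<and> hgt (garc u v b) = 0"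
    using hu by (intro IVT2') (auto simp: garc_def intro!: continuous_intros)
  then obtain b where b: "0 \<le> b" "b \<le> pi" "hgt (garc u v b) = 0" by blast
  have "b \<noteq> 0" "b \<noteq> pi" using b(3) hu by (auto simp: garc_def)
  then have b': "0 < b" "b < pi" using b by auto
  show False
  proof (cases "0 \<le> m (garc u v b)")
    case True
    show False
      by (rule no_intrusion_dir[of 1 u v b D s0]) (use on x ux b b' True D near in auto)
  next
    case False
    have mv: "garc u (- v) r = garc u v (- r)" for r by (simp add: garc_def)
    have e: "garc u (- v) (pi - b) = - garc u v b" unfolding mv by (simp add: garc_def)
    show False
    proof (rule no_intrusion_dir[of "- 1" u "- v" "pi - b" D s0])
      show "hgt (garc u (- v) (pi - b)) = 0" "0 \<le> m (garc u (- v) (pi - b))"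
        unfolding e using b(3) False hsp_simps(3)[of z t "- 1" "garc u v b"] by auto
      show "E (garc u (- v) r) = \<gamma> (s0 + - 1 * r)" if "0 < r" "r < D" for r
        unfolding mv using near[of "- r"] that by simp
    qed (use on x ux b' D in auto)
  qed
qed

lemma E_limit_eventually:
  assumes ab: "a < b" "b \<le> a + pi" and x: "\<And>r. \<lbrakk>a < r; r < b\<rbrakk> \<Longrightarrow> garc u v r \<in> lune z t"
    and b: "garc u v b = eqc \<sigma>" "z \<le> \<sigma>" "\<sigma> \<le> z + pi"
  obtains n r0 where "n \<in> base z" "a < r0" "r0 < b" "\<gamma> \<sigma> = A n (eqc \<sigma>)"
    "\<And>r. \<lbrakk>r0 < r; r < b\<rbrakk> \<Longrightarrow> E (garc u v r) = A n (garc u v r)"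
proof -
  obtain n where n: "n \<in> base z" "s n \<le> \<sigma>" "\<sigma> \<le> s (Suc n)"
    and freq: "\<And>e. 0 < e \<Longrightarrow> \<exists>r. a < r \<and> b - e < r \<and> r < b \<and> garc u v r \<in> tri n"
    using E_limit[OF ab(1) x b] by metis
  obtain r0 where r0: "a < r0" "r0 < b" "garc u v r0 \<in> tri n" using freq[of "b - a"] ab by auto
  have "E (garc u v r) = A n (garc u v r)" if r: "r0 < r" "r < b" for r
  proof (rule E_eq[OF n(1)])
    show "garc u v r \<in> lune z t" using r r0 by (intro x) auto
    obtain r1 where r1: "r < r1" "r1 < b" "garc u v r1 \<in> tri n" using freq[of "b - r"] r by auto
    define u' v' where "u' = garc u v r0" and "v' = garc u v (r0 + pi / 2)"
    have sh: "garc u v (r0 + x) = garc u' v' x" for x unfolding u'_def v'_def by (rule garc_shift)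
    have e: "sin (r1 - r0) *\<^sub>R garc u v r = sin (r1 - r) *\<^sub>R garc u v r0 + sin (r - r0) *\<^sub>R garc u v r1"
      using garc_between[of "r1 - r0" u' v' "r - r0"] sh[of "r - r0"] sh[of "r1 - r0"] r r1 by (simp add: u'_def)
    have s: "0 < sin (r1 - r0)" "0 < sin (r1 - r)" "0 < sin (r - r0)"
      using r r1 r0 ab by (auto intro!: sin_gt_zero)
    show "garc u v r \<in> tri n"
      unfolding tri_def
    proof (intro CollectI ballI)
      fix w assume "w \<in> V"
      then have "0 \<le> sin (r1 - r) * bary w (A n (garc u v r0)) + sin (r - r0) * bary w (A n (garc u v r1))"
        using r0 r1 s by (auto simp: tri_def)
      also have "\<dots> = sin (r1 - r0) * bary w (A n (garc u v r))"
        using arg_cong[OF e, of "\<lambda>x. bary w (A n x)"] by (simp add: A_lin)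
      finally show "0 \<le> bary w (A n (garc u v r))" using s by (simp add: zero_le_mult_iff)
    qed
  qed
  moreover have "\<gamma> \<sigma> = A n (eqc \<sigma>)" by (rule loop_eq_A[OF base_pos[OF n(1)] n(2,3)])
  ultimately show ?thesis using that n(1) r0(1,2) by blast
qed

end

section \<open>The fan of triangles at a vertex on the boundary of a lune\<close>

context regular_tetra
begin

definition vidx :: "real ^ 4 \<Rightarrow> nat" where "vidx = (SOME h. inj_on h V)"

lemma vidx_inj: "inj_on vidx V"
proof -
  have "\<exists>h::real ^ 4 \<Rightarrow> nat. inj_on h V" using finite_imp_inj_to_nat_seg[OF finite_V] by metis
  then show ?thesis unfolding vidx_def by (rule someI_ex)
qed

text \<open>A Vandermonde product; only its sign matters, which is alternating in the four vertices.\<close>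

definition ori :: "real ^ 4 \<Rightarrow> real ^ 4 \<Rightarrow> real ^ 4 \<Rightarrow> real ^ 4 \<Rightarrow> real" where
  "ori a b c' d = (real (vidx b) - vidx a) * (real (vidx c') - vidx a) * (real (vidx d) - vidx a) *
     (real (vidx c') - vidx b) * (real (vidx d) - vidx b) * (real (vidx d) - vidx c')"

lemma ori_swap: "ori b a c' d = - ori a b c' d" "ori a c' b d = - ori a b c' d" "ori a b d c' = - ori a b c' d"
  unfolding ori_def by algebra+

lemma ori_nonzero: "corner v p q r \<Longrightarrow> ori v p q r \<noteq> 0"
  using vidx_inj by (auto simp: corner_def ori_def inj_on_eq_iff)

lemma corner_ori_cases:
  assumes "corner v p q r" "corner v p' q' r'" "ori v p q r < 0" "ori v p' q' r' < 0"
  shows "(p', q', r') \<in> {(p, q, r), (q, r, p), (r, p, q)}"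
proof -
  have "p' \<in> {p, q, r}" "q' \<in> {p, q, r}" "r' \<in> {p, q, r}" "distinct [p', q', r']"
    using corner_V[OF assms(1)] cornerD[OF assms(2)] by auto
  moreover have "ori v q p r = - ori v p q r" "ori v p r q = - ori v p q r" "ori v r q p = - ori v p q r"
    using ori_swap(2)[of v p q r] ori_swap(3)[of v p q r] ori_swap(2)[of v q r p] ori_swap(3)[of v q p r] ori_swap(2)[of v p r q]
      ori_swap(3)[of v r p q] by auto
  ultimately show ?thesis using assms(3,4) by auto
qed

lemma cyc3_shift:
  assumes "(p', q', r') \<in> {(p, q, r), (q, r, p), (r, p, q)}"
  obtains k where "\<And>j. cyc3 p' q' r' j = cyc3 p q r (j + k)"
proof -
  have "cyc3 q r p j = cyc3 p q r (j + 1)" "cyc3 r p q j = cyc3 p q r (j + 2)" for j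
  proof -
    have "(j mod 3 = 0 \<and> (j + 1) mod 3 = 1 \<and> (j + 2) mod 3 = 2) \<or>
        (j mod 3 = 1 \<and> (j + 1) mod 3 = 2 \<and> (j + 2) mod 3 = 0) \<or>
        (j mod 3 = 2 \<and> (j + 1) mod 3 = 0 \<and> (j + 2) mod 3 = 1)"
    proof -
      have "j mod 3 = 0 \<or> j mod 3 = 1 \<or> j mod 3 = 2"
        using pos_mod_sign[of 3 j] pos_mod_bound[of 3 j] by linarith
      moreover have "(j + 1) mod 3 = (j mod 3 + 1) mod 3" "(j + 2) mod 3 = (j mod 3 + 2) mod 3" by (rule mod_add_left_eq[symmetric])+
      ultimately show ?thesis by (elim disjE) simp_all
    qed
    then show "cyc3 q r p j = cyc3 p q r (j + 1)" "cyc3 r p q j = cyc3 p q r (j + 2)"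
      by (elim disjE conjE; simp add: cyc3_def)+
  qed
  then show ?thesis using assms that[of 0] that[of 1] that[of 2] by auto
qed

lemma linkdir_shift:
  assumes "\<And>j. L' j = L (j + k)"
  shows "linkdir v L' \<tau> = linkdir v L (\<tau> + of_int k * \<alpha>)"
proof -
  obtain j :: int where j: "j * \<alpha> \<le> \<tau>" "\<tau> < (j + 1) * \<alpha>" by (rule sector_exists)
  have jk: "of_int (j + k) * \<alpha> \<le> \<tau> + of_int k * \<alpha>" "\<tau> + of_int k * \<alpha> \<le> of_int (j + k + 1) * \<alpha>"
    using j by (simp_all add: algebra_simps)
  have "linkdir v L' \<tau> = (1 / sin \<alpha>) *\<^sub>R (sin ((j + 1) * \<alpha> - \<tau>) *\<^sub>R tang v (L' j) + sin (\<tau> - j * \<alpha>) *\<^sub>R tang v (L' (j + 1)))"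
    using j by (intro linkdir_sector) auto
  moreover have "linkdir v L (\<tau> + of_int k * \<alpha>) = (1 / sin \<alpha>) *\<^sub>R (sin (of_int (j + k + 1) * \<alpha> - (\<tau> + of_int k * \<alpha>)) *\<^sub>R tang v (L (j + k))
      + sin (\<tau> + of_int k * \<alpha> - of_int (j + k) * \<alpha>) *\<^sub>R tang v (L (j + k + 1)))"
    by (rule linkdir_sector[OF jk])
  moreover have "(real_of_int j + 1) * \<alpha> = real_of_int (j + 1) * \<alpha>" by simp
  moreover have "of_int (j + k + 1) * \<alpha> - (\<tau> + of_int k * \<alpha>) = (j + 1) * \<alpha> - \<tau>" "\<tau> + of_int k * \<alpha> - of_int (j + k) * \<alpha> = \<tau> - j * \<alpha>"
    by (simp_all add: algebra_simps)
  moreover have "L' j = L (j + k)" "L' (j + 1) = L (j + k + 1)" using assms[of j] assms[of "j + 1"] by (simp_all add: algebra_simps)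
  ultimately show ?thesis by (simp only:)
qed

lemma tang_expand:
  assumes C: "corner v p q f" and x: "v \<bullet> x = 0" "bary f x = 0"
  shows "x = (sqrt (1 - c\<^sup>2) * bary p x) *\<^sub>R tang v p + (sqrt (1 - c\<^sup>2) * bary q x) *\<^sub>R tang v q"
proof -
  note D = cornerD[OF C]
  have S: "0 < sqrt (1 - c\<^sup>2)" using c_sq by simp
  have e: "x = bary v x *\<^sub>R v + bary p x *\<^sub>R p + bary q x *\<^sub>R q"
    using bary_expand4[OF corner_V[OF C] D(5), of x] x by simp
  have "v \<bullet> x = bary v x + c * bary p x + c * bary q x"
    by (subst e) (use D inner_V[of v p] inner_V[of v q] in \<open>simp add: inner_add_right inner_V_self mult.commute\<close>)
  then have bv: "bary v x = - (c * bary p x + c * bary q x)" using x by simp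
  have "x = - (c * bary p x + c * bary q x) *\<^sub>R v + bary p x *\<^sub>R p + bary q x *\<^sub>R q"
    using e unfolding bv .
  also have "\<dots> = bary p x *\<^sub>R (p - c *\<^sub>R v) + bary q x *\<^sub>R (q - c *\<^sub>R v)"
    by (simp add: scaleR_diff_right scaleR_diff_left scaleR_add_left mult.commute)
  also have "\<dots> = (sqrt (1 - c\<^sup>2) * bary p x) *\<^sub>R tang v p + (sqrt (1 - c\<^sup>2) * bary q x) *\<^sub>R tang v q"
    using S by (simp add: tang_def)
  finally show ?thesis .
qed

lemma tang_unfold:
  assumes C: "corner v k \<mu> l"
  shows "tang v l = (2 * cos \<alpha>) *\<^sub>R tang v \<mu> - (tang v k - bary k (tang v k) *\<^sub>R \<xi> k l)"
proof -
  note D = cornerD[OF C]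
  define S where "S = sqrt (1 - c\<^sup>2)"
  have S: "0 < S" using c_sq by (simp add: S_def)
  have vs: "vsum = v + k + \<mu> + l"
    unfolding vsum_def using sum_V[OF corner_V[OF C] D(5), of "\<lambda>x. x"] by simp
  have "S *\<^sub>R ((2 * cos \<alpha>) *\<^sub>R tang v \<mu> - (tang v k - bary k (tang v k) *\<^sub>R \<xi> k l)) =
     \<kappa> *\<^sub>R (\<mu> - c *\<^sub>R v) - (k - c *\<^sub>R v) + \<xi> k l"
    using S D by (simp add: bary_tang) (simp add: tang_def S_def[symmetric] \<kappa>_def scaleR_diff_right)
  also have "\<dots> = l + (c - \<kappa> * c - \<kappa>) *\<^sub>R v"
    unfolding \<xi>_def vs by (simp add: scaleR_diff_right scaleR_add_right scaleR_diff_left)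
  also have "c - \<kappa> * c - \<kappa> = - c" using kappa by (simp add: algebra_simps)
  also have "l + (- c) *\<^sub>R v = S *\<^sub>R tang v l" using S by (simp add: tang_def S_def[symmetric])
  finally show ?thesis using S by simp
qed

end

definition det3 :: "pt3 \<Rightarrow> pt3 \<Rightarrow> pt3 \<Rightarrow> real" where
  "det3 = (\<lambda>(a, b, c) (d, e, f) (g, h, i). a * (e * i - f * h) - b * (d * i - f * g) + c * (d * h - e * g))"

lemma det3_linear:
  "det3 x y (u + v) = det3 x y u + det3 x y v" "det3 x y (r *\<^sub>R u) = r * det3 x y u" "det3 x y (u - v) = det3 x y u - det3 x y v"
  "det3 x (u + v) y = det3 x u y + det3 x v y" "det3 x (r *\<^sub>R u) y = r * det3 x u y" "det3 x (u - v) y = det3 x u y - det3 x v y"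
  "det3 x x y = 0" "det3 x y x = 0" "det3 x y y = 0"
  by (cases x; cases y; cases u; cases v; simp add: det3_def algebra_simps)+

lemma det3_swap: "det3 x y z = - det3 x z y"
  by (cases x; cases y; cases z; simp add: det3_def algebra_simps)

lemma det3_equator: "det3 x (eqc s) (eqc t) = hgt x * sin (t - s)" "det3 x (eqc s) (eqt s) = hgt x"
proof -
  have 1: "cos s * cos s + sin s * sin s = 1" by (rule sin_cos_squared_add3)
  obtain x1 x2 x3 where x: "x = (x1, x2, x3)" by (cases x)
  have "x1 * (sin s * 0 - 0 * cos s) - x2 * (cos s * 0 - 0 * - sin s) + x3 * (cos s * cos s - sin s * - sin s) =
    x3 * (cos s * cos s + sin s * sin s)" by (simp add: algebra_simps)
  then show "det3 x (eqc s) (eqt s) = hgt x"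
    unfolding 1 by (simp add: x det3_def eqc_def eqt_def hgt_def)
  show "det3 x (eqc s) (eqc t) = hgt x * sin (t - s)"
    by (cases x) (simp add: det3_def eqc_def hgt_def sin_diff algebra_simps)
qed

locale touched_lune = free_lune +
  fixes v :: "real ^ 4" and n1 :: nat
  assumes n1_base: "n1 \<in> base z" and v_V: "v \<in> V" and v_n1: "v \<noteq> f n1"
    and P_up: "0 < hgt (pos n1 v)" and P_touch: "hsp z t (pos n1 v) = 0"
    and oriented: "\<And>n. 0 < n \<Longrightarrow> 0 < hgt (pos n (apex n)) * ori (apex n) (f (n - 1)) (f (Suc n)) (f n)"
begin

definition P :: pt3 where "P = pos n1 v"

lemma A_P: "A n1 P = v"
  unfolding P_def by (rule A_pos[OF v_V v_n1])

lemma hgt_P: "0 < hgt P" and m_P: "m P = 0"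
  using P_up P_touch by (auto simp: P_def)

lemma norm_P: "norm P = 1"
  using frame_norm[OF frm[of n1], of P] A_P norm_V[OF v_V] by simp

definition Kset :: "nat set" where "Kset = {n \<in> base z. A n P = v}"

lemma KsetD:
  assumes "n \<in> Kset"
  shows "n \<in> base z" "A n P = v" "0 < n" "v \<noteq> f n"
proof -
  show n: "n \<in> base z" "A n P = v" using assms by (auto simp: Kset_def)
  show "0 < n" by (rule base_pos[OF n(1)])
  show "v \<noteq> f n" using A_zero[of n P] n(2) v_V by auto
qed

lemma Kset_pos: "n \<in> Kset \<Longrightarrow> pos n v = P"
  by (rule pos_eqI) (rule KsetD)

lemma P_tri: "n \<in> Kset \<Longrightarrow> P \<in> tri n"
  using KsetD(2)[of n] v_V by (auto simp: tri_def bary_V)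

lemma Kset_n1: "n1 \<in> Kset"
  using n1_base A_P by (simp add: Kset_def)

lemma Kset_tri: "\<lbrakk>n \<in> base z; P \<in> tri n\<rbrakk> \<Longrightarrow> n \<in> Kset"
  using tri_agree[OF n1_base, of n P] hgt_P m_P P_tri[OF Kset_n1] A_P by (simp add: Kset_def)

lemma Kset_between:
  assumes "i \<in> Kset" "j \<in> Kset" "i \<le> n" "n \<le> j"
  shows "n \<in> Kset"
proof -
  have nb: "n \<in> base z" by (rule base_between[OF KsetD(1)[OF assms(1)] KsetD(1)[OF assms(2)] assms(3,4)])
  show ?thesis
  proof (cases "n = i")
    case False
    then have ni: "i < n" using assms by simp
    have "A (i + l) P = v" if "i + l \<le> j" for l
      using that
    proof (induction l)
      case 0
      then show ?case using KsetD(2)[OF assms(1)] by simp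
    next
      case (Suc l)
      define k where "k = i + l"
      have k: "i \<le> k" "Suc k \<le> j" "A k P = v" using Suc by (auto simp: k_def)
      have kb: "k \<in> base z" "Suc k \<in> base z"
        using base_between[OF KsetD(1)[OF assms(1)] KsetD(1)[OF assms(2)]] k by auto
      have Pk: "P \<in> tri k" using k(3) v_V by (auto simp: tri_def bary_V)
      have down: "0 \<le> lft (Suc k) P"
      proof -
        have "0 \<le> lft (j - x) P" if "Suc k \<le> j - x" for x
          using that
        proof (induction x)
          case 0
          then show ?case using P_tri[OF assms(2)] tri_iff[OF KsetD(3)[OF assms(2)]] by simp
        next
          case (Suc x)
          define y where "y = j - Suc x"
          have y: "Suc y = j - x" "Suc k \<le> y" "Suc y \<le> j" using Suc.prems by (auto simp: y_def)
          have "rgt y P \<le> 0" using Suc.IH Suc.prems y by (simp add: rgt_eq)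
          moreover have "y \<in> base z" "Suc y \<in> base z" using base_between[OF kb(1) KsetD(1)[OF assms(2)]] y by auto
          moreover have "z < s y" using kb(1) s_mono[of "Suc k" y] y by (auto simp: base_def)
          ultimately have "0 \<le> lft y P" using side_order[of y P] hgt_P m_P by auto
          then show ?case by (simp add: y_def)
        qed
        from this[of "j - Suc k"] show ?thesis using k(2) by simp
      qed
      moreover have "0 \<le> rgt k P" using Pk tri_iff[OF base_pos[OF kb(1)]] by simp
      ultimately have "rgt k P = 0" by (simp add: rgt_eq)
      then show ?case using A_Suc_eq[of k P] k(3) by (simp add: k_def)
    qed
    from this[of "n - i"] show ?thesis using ni assms nb by (simp add: Kset_def)
  qed (use assms in simp)
qed

text \<open>The other two vertices of triangle \<open>n\<close>, in the cyclic order fixed by \<open>oriented\<close>.\<close>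

definition lam :: "nat \<Rightarrow> real ^ 4" where
  "lam n = (if v = f (Suc n) then apex n else f (Suc n))"
definition rho :: "nat \<Rightarrow> real ^ 4" where
  "rho n = (if v = f (n - 1) then apex n else f (n - 1))"

lemma lam_rho:
  assumes "n \<in> Kset"
  shows "corner v (lam n) (rho n) (f n)" "ori v (lam n) (rho n) (f n) < 0"
proof -
  note K = KsetD[OF assms]
  note C = corner_apex[OF K(3)]
  have or: "0 < hgt (W n) * ori (apex n) (f (n - 1)) (f (Suc n)) (f n)" by (rule oriented[OF K(3)])
  have o: "ori (apex n) (f (Suc n)) (f (n - 1)) (f n) = - ori (apex n) (f (n - 1)) (f (Suc n)) (f n)"
    "ori (f (n - 1)) (f (Suc n)) (apex n) (f n) = ori (apex n) (f (n - 1)) (f (Suc n)) (f n)"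
    "ori (f (Suc n)) (apex n) (f (n - 1)) (f n) = ori (apex n) (f (n - 1)) (f (Suc n)) (f n)"
    unfolding ori_def by algebra+
  have Pp: "0 < hgt (pos n v)" using Kset_pos[OF assms] hgt_P by simp
  from V_cases[OF K(3) v_V] K(4)
  have "corner v (lam n) (rho n) (f n) \<and> ori v (lam n) (rho n) (f n) < 0"
  proof cases
    case 1
    then have "lam n = f (Suc n)" "rho n = f (n - 1)" unfolding lam_def rho_def using apex[OF K(3)] by auto
    moreover have "0 < hgt (W n)" using Pp 1 by simp
    ultimately show ?thesis using 1 C or o(1) by (auto simp: corner_def zero_less_mult_iff)
  next
    case 2
    then have "lam n = f (Suc n)" "rho n = apex n" unfolding lam_def rho_def using f_pred_Suc[OF K(3)] by auto
    moreover have "hgt (W n) < 0" using Pp 2 hgt_opposite(1)[OF K(3)] by (auto simp: mult_less_0_iff)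
    ultimately show ?thesis using 2 C or o(2) by (auto simp: corner_def zero_less_mult_iff)
  next
    case 4
    then have "lam n = apex n" "rho n = f (n - 1)" unfolding lam_def rho_def using f_pred_Suc[OF K(3)] by auto
    moreover have "hgt (W n) < 0" using Pp 4 hgt_opposite(2)[OF K(3)] by (auto simp: mult_less_0_iff)
    ultimately show ?thesis using 4 C or o(3) by (auto simp: corner_def zero_less_mult_iff)
  qed simp
  then show "corner v (lam n) (rho n) (f n)" "ori v (lam n) (rho n) (f n) < 0" by auto
qed

lemma lam_rho_Suc:
  assumes "n \<in> Kset" "Suc n \<in> Kset"
  shows "lam n = f (Suc n)" "lam (Suc n) = rho n" "rho (Suc n) = f n"
proof -
  have v: "v \<noteq> f n" "v \<noteq> f (Suc n)" using KsetD(4) assms by auto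
  then show l: "lam n = f (Suc n)" and r: "rho (Suc n) = f n" by (auto simp: lam_def rho_def)
  note c1 = lam_rho(1)[OF assms(1)] and c2 = lam_rho(1)[OF assms(2)]
  have "lam (Suc n) \<in> {v, f (Suc n), rho n, f n}" using cornerD(2)[OF c2] corner_V[OF c1] unfolding l by blast
  then show "lam (Suc n) = rho n" using c2 unfolding r by (auto simp: corner_def)
qed

definition dir :: "nat \<Rightarrow> real ^ 4 \<Rightarrow> pt3" where "dir n w = adj (A n) (tang v w)"

lemma A_dir: "\<lbrakk>n \<in> Kset; w \<in> V; w \<noteq> v; w \<noteq> f n\<rbrakk> \<Longrightarrow> A n (dir n w) = tang v w"
  unfolding dir_def using f_V[of n] v_V KsetD(4)[of n] by (intro frame_adj[OF frm]) (auto simp: bary_tang)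

lemma A_inner: "A n x \<bullet> A n y = x \<bullet> y"
  by (rule frameD(2)[OF frm])

lemma dir_unit:
  assumes "n \<in> Kset" "w \<in> V" "w \<noteq> v" "w \<noteq> f n"
  shows "dir n w \<bullet> dir n w = 1" "P \<bullet> dir n w = 0"
  using A_inner[of n "dir n w" "dir n w"] A_inner[of n P "dir n w"] A_dir[OF assms] KsetD(2)[OF assms(1)]
    tang_inner_self[OF v_V assms(2)] tang_inner_vertex[OF v_V assms(2)] assms by auto

lemma dir_Suc:
  assumes "n \<in> Kset" "Suc n \<in> Kset"
  shows "dir (Suc n) (lam (Suc n)) = dir n (rho n)"
    "dir (Suc n) (rho (Suc n)) = (2 * cos \<alpha>) *\<^sub>R dir n (rho n) - dir n (lam n)"
proof -
  note c1 = cornerD[OF lam_rho(1)[OF assms(1)]] and c2 = cornerD[OF lam_rho(1)[OF assms(2)]]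
  note e = lam_rho_Suc[OF assms]
  have d1: "A n (dir n (rho n)) = tang v (rho n)" "A n (dir n (lam n)) = tang v (lam n)"
    using c1 by (auto intro!: A_dir[OF assms(1)])
  have d2: "A (Suc n) (dir (Suc n) (lam (Suc n))) = tang v (lam (Suc n))" "A (Suc n) (dir (Suc n) (rho (Suc n))) = tang v (rho (Suc n))"
    using c2 by (auto intro!: A_dir[OF assms(2)])
  have r0: "bary (f (Suc n)) (tang v (rho n)) = 0"
    using c1 c2 e f_V[of "Suc n"] v_V by (auto simp: bary_tang)
  have 1: "A (Suc n) (dir n (rho n)) = tang v (rho n)"
    unfolding A_Suc d1(1) r0 by simp
  then show "dir (Suc n) (lam (Suc n)) = dir n (rho n)"
    using frame_inj[OF frm[of "Suc n"]] d2(1) unfolding e(2) by metis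
  have "A (Suc n) ((2 * cos \<alpha>) *\<^sub>R dir n (rho n) - dir n (lam n)) =
     (2 * cos \<alpha>) *\<^sub>R tang v (rho n) - (tang v (f (Suc n)) - bary (f (Suc n)) (tang v (f (Suc n))) *\<^sub>R \<xi> (f (Suc n)) (f n))"
    unfolding A_lin 1 by (simp add: A_Suc d1(2)[unfolded e(1)] e(1))
  also have "\<dots> = tang v (f n)"
    using lam_rho(1)[OF assms(1)] unfolding e(1) by (intro tang_unfold[symmetric])
  finally show "dir (Suc n) (rho (Suc n)) = (2 * cos \<alpha>) *\<^sub>R dir n (rho n) - dir n (lam n)"
    using frame_inj[OF frm[of "Suc n"]] d2(2) unfolding e(3) by metis
qed

lemma direction_covered:
  assumes d: "norm d = 1" "P \<bullet> d = 0" "0 < m d"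
  obtains n where "n \<in> Kset" "\<And>w. w \<in> V \<Longrightarrow> w \<noteq> v \<Longrightarrow> 0 \<le> bary w (A n d)"
proof -
  have "continuous_on UNIV (\<lambda>r. hgt (garc P d r))" by (intro continuous_intros)
  then have "\<forall>\<^sub>F r in nhds 0. 0 < hgt (garc P d r)" by (rule continuous_pos_near) (simp add: hgt_P)
  then obtain e where e: "0 < e" "\<And>r. \<bar>r\<bar> < e \<Longrightarrow> 0 < hgt (garc P d r)" unfolding eventually_near_iff by auto
  define e' where "e' = min e 1"
  have e': "0 < e'" "e' \<le> e" "e' < pi" using e pi_gt3 by (auto simp: e'_def min_def)
  have in_lune: "garc P d r \<in> lune z t" if "0 < r" "r < e'" for r
    using e(2)[of r] that e' d(3) m_P sin_gt_zero[of r] by (auto simp: lune_def garc_def)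
  have "\<exists>n\<in>base z. \<forall>x>0. \<exists>r. 0 < r \<and> r < x \<and> garc P d r \<in> tri n"
  proof (rule ccontr)
    assume "\<not> ?thesis"
    then have "\<forall>n\<in>base z. \<exists>x>0. \<forall>r. \<not> (0 < r \<and> r < x \<and> garc P d r \<in> tri n)" by blast
    then obtain x where x: "\<And>n. n \<in> base z \<Longrightarrow> 0 < x n" "\<And>n r. \<lbrakk>n \<in> base z; 0 < r; r < x n\<rbrakk> \<Longrightarrow> garc P d r \<notin> tri n"
      by metis
    define y where "y = min e' (Min (x ` base z))"
    have y: "0 < y" "y \<le> e'" "\<And>n. n \<in> base z \<Longrightarrow> y \<le> x n"
      using x(1) e'(1) finite_base base_nonempty by (auto simp: y_def min.coboundedI2)
    have r: "0 < y / 2" "y / 2 < e'" using y by auto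
    obtain n where n: "n \<in> base z" "garc P d (y / 2) \<in> tri n" by (rule lune_covered[OF in_lune[OF r]])
    then show False using x(2)[OF n(1) r(1)] y(1) y(3)[OF n(1)] by auto
  qed
  then obtain n where n: "n \<in> base z" "\<And>x. 0 < x \<Longrightarrow> \<exists>r. 0 < r \<and> r < x \<and> garc P d r \<in> tri n" by blast
  have "P \<in> tri n"
    unfolding tri_def
  proof (intro CollectI ballI, rule ccontr)
    fix w assume w: "w \<in> V" "\<not> 0 \<le> bary w (A n P)"
    have "continuous_on UNIV (\<lambda>r. - bary w (A n (garc P d r)))" by (intro continuous_intros)
    then have "\<forall>\<^sub>F r in nhds 0. 0 < - bary w (A n (garc P d r))"
      using w by (intro continuous_pos_near) auto
    then obtain x where x: "0 < x" "\<And>r. \<bar>r\<bar> < x \<Longrightarrow> 0 < - bary w (A n (garc P d r))"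
      unfolding eventually_near_iff by auto
    obtain r where "0 < r" "r < x" "garc P d r \<in> tri n" using n(2)[OF x(1)] by blast
    then show False using x(2)[of r] w(1) by (auto simp: tri_def)
  qed
  then have nK: "n \<in> Kset" by (rule Kset_tri[OF n(1)])
  have "0 \<le> bary w (A n d)" if w: "w \<in> V" "w \<noteq> v" for w
  proof -
    obtain r where r: "0 < r" "r < pi" "garc P d r \<in> tri n" using n(2)[of pi] pi_gt_zero by blast
    have "0 \<le> bary w (A n (garc P d r))" using r w by (simp add: tri_def)
    also have "\<dots> = sin r * bary w (A n d)" using KsetD(2)[OF nK] w v_V by (simp add: A_garc bary_garc)
    finally show ?thesis using sin_gt_zero[OF r(1,2)] by (simp add: zero_le_mult_iff)
  qed
  then show ?thesis using that nK by blast
qed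

end

lemma sinusoid:
  fixes x y :: real
  assumes "x \<noteq> 0 \<or> y \<noteq> 0"
  obtains M \<theta>0 where "0 < M" "\<And>\<theta>. cos \<theta> * x + sin \<theta> * y = M * sin (\<theta> - \<theta>0)"
proof -
  define M where "M = sqrt (x\<^sup>2 + y\<^sup>2)"
  have M: "0 < M" "M\<^sup>2 = x\<^sup>2 + y\<^sup>2" using assms by (auto simp: M_def sum_power2_gt_zero_iff)
  have "(y / M)\<^sup>2 + (- x / M)\<^sup>2 = 1" using M by (simp add: power_divide flip: add_divide_distrib) (use M in auto)
  then obtain \<theta>0 where "y / M = cos \<theta>0" "- x / M = sin \<theta>0" using sincos_total_2pi by metis
  then have "y = M * cos \<theta>0" "x = - (M * sin \<theta>0)" using M by (auto simp: field_simps)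
  then show ?thesis using that[OF M(1), of \<theta>0] by (simp add: sin_diff algebra_simps)
qed

lemma sin_pos_step:
  assumes "\<theta>0 < x" "x < \<theta>0 + pi" "x < y" "y < x + pi" "0 < sin (y - \<theta>0)"
  shows "y < \<theta>0 + pi"
proof (rule ccontr)
  assume "\<not> y < \<theta>0 + pi"
  then have "0 \<le> sin (y - \<theta>0 - pi)" using assms by (intro sin_ge_zero) auto
  then show False using assms(5) by (simp add: sin_diff)
qed

lemma sin_diff_period: "sin (x - (y + 2 * pi * of_int k)) = sin (x - y)"
proof -
  have "x - (y + 2 * pi * of_int k) = (x - y) - 2 * pi * of_int k" by simp
  then show ?thesis by (simp only: sin_diff[of "x - y"] sin_int_2pin cos_int_2pin)
qed

lemma sin_lift:
  assumes "0 < sin (x - y)"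
  obtains k :: int where "y + 2 * pi * k < x" "x < y + 2 * pi * k + pi"
proof -
  define k where "k = \<lfloor>(x - y) / (2 * pi)\<rfloor>"
  have "k \<le> (x - y) / (2 * pi)" "(x - y) / (2 * pi) < k + 1" unfolding k_def by linarith+
  then have r: "0 \<le> x - (y + 2 * pi * k)" "x - (y + 2 * pi * k) < 2 * pi"
    by (simp_all add: pos_le_divide_eq pos_divide_less_eq algebra_simps)
  have "sin (x - (y + 2 * pi * k)) = sin (x - y)" by (rule sin_diff_period)
  then have s: "0 < sin (x - (y + 2 * pi * k))" using assms by simp
  then have "x - (y + 2 * pi * k) \<le> pi" using sin_nonneg_range[OF r] by simp
  then have "0 < x - (y + 2 * pi * k) \<and> x - (y + 2 * pi * k) < pi"
    using s r by (metis less_eq_real_def sin_pi sin_zero less_irrefl)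
  then show ?thesis using that[of k] by auto
qed

context touched_lune
begin

definition a0 :: nat where "a0 = Min Kset"
definition g1 :: pt3 where "g1 = dir a0 (lam a0)"
definition g2 :: pt3 where "g2 = (1 / sin \<alpha>) *\<^sub>R (dir a0 (rho a0) - cos \<alpha> *\<^sub>R g1)"
definition lab :: "int \<Rightarrow> real ^ 4" where "lab = cyc3 (lam a0) (rho a0) (f a0)"

lemma finite_Kset: "finite Kset"
  using finite_base by (simp add: Kset_def)

lemma a0: "a0 \<in> Kset" "n \<in> Kset \<Longrightarrow> a0 \<le> n"
  unfolding a0_def using Min_in[OF finite_Kset] Min_le[OF finite_Kset] Kset_n1 by auto

lemma dir_frame:
  assumes "n \<in> Kset"
  shows "dir n (lam n) \<bullet> dir n (lam n) = 1" "dir n (rho n) \<bullet> dir n (rho n) = 1"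
    "dir n (lam n) \<bullet> dir n (rho n) = cos \<alpha>" "P \<bullet> dir n (lam n) = 0" "P \<bullet> dir n (rho n) = 0"
    "A n (dir n (lam n)) = tang v (lam n)" "A n (dir n (rho n)) = tang v (rho n)"
proof -
  note D = cornerD[OF lam_rho(1)[OF assms]]
  show l: "A n (dir n (lam n)) = tang v (lam n)" and r: "A n (dir n (rho n)) = tang v (rho n)"
    using A_dir[OF assms, of "lam n"] A_dir[OF assms, of "rho n"] D by auto
  show "dir n (lam n) \<bullet> dir n (lam n) = 1" "P \<bullet> dir n (lam n) = 0"
    using dir_unit[OF assms, of "lam n"] D by auto
  show "dir n (rho n) \<bullet> dir n (rho n) = 1" "P \<bullet> dir n (rho n) = 0"
    using dir_unit[OF assms, of "rho n"] D by auto
  have "tang v (lam n) \<bullet> tang v (rho n) = cos \<alpha>" using D by (intro tang_inner) auto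
  then show "dir n (lam n) \<bullet> dir n (rho n) = cos \<alpha>" using A_inner[of n "dir n (lam n)" "dir n (rho n)"] l r by simp
qed

lemma fan_frame: "norm g1 = 1" "norm g2 = 1" "g1 \<bullet> g2 = 0" "P \<bullet> g1 = 0" "P \<bullet> g2 = 0"
proof -
  note D = dir_frame[OF a0(1)]
  have S: "0 < sin \<alpha>" by (rule sin_alpha_pos)
  show "norm g1 = 1" "P \<bullet> g1 = 0" "P \<bullet> g2 = 0" using D by (simp_all add: g1_def g2_def norm_eq_1 inner_diff_right)
  show "g1 \<bullet> g2 = 0" using D by (simp add: g2_def inner_diff_right g1_def)
  have "(dir a0 (rho a0) - cos \<alpha> *\<^sub>R g1) \<bullet> (dir a0 (rho a0) - cos \<alpha> *\<^sub>R g1) = 1 - cos \<alpha> * cos \<alpha>"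
    using D by (simp add: g1_def inner_diff_right inner_diff_left inner_commute)
  also have "\<dots> = sin \<alpha> * sin \<alpha>" using sin_cos_squared_add3[of \<alpha>] by linarith
  finally have "(dir a0 (rho a0) - cos \<alpha> *\<^sub>R g1) \<bullet> (dir a0 (rho a0) - cos \<alpha> *\<^sub>R g1) = sin \<alpha> * sin \<alpha>" .
  then show "norm g2 = 1" unfolding norm_eq_1 g2_def inner_scaleR_left inner_scaleR_right using S by simp
qed

lemma garc_recurrence: "garc u w (x + 2 * y) = (2 * cos y) *\<^sub>R garc u w (x + y) - garc u w x"
proof -
  have "cos (x + 2 * y) = 2 * cos y * cos (x + y) - cos x" "sin (x + 2 * y) = 2 * cos y * sin (x + y) - sin x"
    using cos_add[of "x + y" y] cos_diff[of "x + y" y] sin_add[of "x + y" y] sin_diff[of "x + y" y] by (simp_all add: algebra_simps)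
  then have "cos (x + 2 * y) *\<^sub>R u + sin (x + 2 * y) *\<^sub>R w =
    (2 * cos y * cos (x + y) - cos x) *\<^sub>R u + (2 * cos y * sin (x + y) - sin x) *\<^sub>R w" by (simp only:)
  then show ?thesis unfolding garc_def by (simp only: scaleR_diff_left scaleR_add_right scaleR_scaleR) (simp only: algebra_simps)
qed

lemma fan:
  assumes "a0 + i \<in> Kset"
  shows "lam (a0 + i) = lab (int i)" "rho (a0 + i) = lab (int i + 1)" "f (a0 + i) = lab (int i + 2)"
    "dir (a0 + i) (lam (a0 + i)) = garc g1 g2 (i * \<alpha>)" "dir (a0 + i) (rho (a0 + i)) = garc g1 g2 (i * \<alpha> + \<alpha>)"
proof -
  have "lam (a0 + i) = lab (int i) \<and> rho (a0 + i) = lab (int i + 1) \<and> f (a0 + i) = lab (int i + 2) \<and>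
    dir (a0 + i) (lam (a0 + i)) = garc g1 g2 (i * \<alpha>) \<and> dir (a0 + i) (rho (a0 + i)) = garc g1 g2 (i * \<alpha> + \<alpha>)"
    using assms
  proof (induction i)
    case 0
    have "dir a0 (rho a0) = garc g1 g2 \<alpha>" using sin_alpha_pos by (simp add: garc_def g2_def)
    then show ?case by (simp add: lab_def cyc3_def g1_def)
  next
    case (Suc i)
    have K: "a0 + i \<in> Kset" using Kset_between[OF a0(1) Suc.prems, of "a0 + i"] by simp
    have K': "Suc (a0 + i) \<in> Kset" using Suc.prems by simp
    note IH = Suc.IH[OF K]
    note S = lam_rho_Suc[OF K K'] dir_Suc[OF K K']
    have L: "lab (int i + 3) = lab (int i)" by (simp add: lab_def)
    have G: "garc g1 g2 (i * \<alpha> + 2 * \<alpha>) = (2 * cos \<alpha>) *\<^sub>R garc g1 g2 (i * \<alpha> + \<alpha>) - garc g1 g2 (i * \<alpha>)"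
      by (rule garc_recurrence)
    have 1: "lam (Suc (a0 + i)) = lab (int i + 1)" "rho (Suc (a0 + i)) = lab (int i + 2)" "f (Suc (a0 + i)) = lab (int i + 3)"
      using IH S(1-3) L by simp_all
    have 2: "dir (Suc (a0 + i)) (lam (Suc (a0 + i))) = garc g1 g2 (i * \<alpha> + \<alpha>)"
      unfolding S(4) using IH by blast
    have 3: "dir (Suc (a0 + i)) (rho (Suc (a0 + i))) = garc g1 g2 (i * \<alpha> + 2 * \<alpha>)"
      unfolding S(5) G using IH by metis
    have "a0 + Suc i = Suc (a0 + i)" "Suc i * \<alpha> = i * \<alpha> + \<alpha>" "i * \<alpha> + \<alpha> + \<alpha> = i * \<alpha> + 2 * \<alpha>"
      "int (Suc i) = int i + 1" "int i + 1 + 1 = int i + 2" "int i + 1 + 2 = int i + 3"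
      by (simp_all add: algebra_simps)
    then show ?case by (simp only: 1 2[unfolded 1] 3[unfolded 1])
  qed
  then show "lam (a0 + i) = lab (int i)" "rho (a0 + i) = lab (int i + 1)" "f (a0 + i) = lab (int i + 2)"
    "dir (a0 + i) (lam (a0 + i)) = garc g1 g2 (i * \<alpha>)" "dir (a0 + i) (rho (a0 + i)) = garc g1 g2 (i * \<alpha> + \<alpha>)" by auto
qed

lemma fan_expand:
  assumes n: "n \<in> Kset" and x: "P \<bullet> x = 0"
  shows "x = (sqrt (1 - c\<^sup>2) * bary (lam n) (A n x)) *\<^sub>R dir n (lam n) + (sqrt (1 - c\<^sup>2) * bary (rho n) (A n x)) *\<^sub>R dir n (rho n)"
proof (rule frame_inj[OF frm[of n]])
  have "v \<bullet> A n x = 0" using A_inner[of n P x] KsetD(2)[OF n] x by simp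
  then show "A n x = A n ((sqrt (1 - c\<^sup>2) * bary (lam n) (A n x)) *\<^sub>R dir n (lam n) + (sqrt (1 - c\<^sup>2) * bary (rho n) (A n x)) *\<^sub>R dir n (rho n))"
    unfolding A_lin dir_frame(6,7)[OF n] by (intro tang_expand[OF lam_rho(1)[OF n]] A_zero)
qed

lemma fan_expand_full:
  assumes n: "n \<in> Kset"
  shows "x = (P \<bullet> x) *\<^sub>R P + (sqrt (1 - c\<^sup>2) * bary (lam n) (A n x)) *\<^sub>R dir n (lam n) + (sqrt (1 - c\<^sup>2) * bary (rho n) (A n x)) *\<^sub>R dir n (rho n)"
proof -
  note D = cornerD[OF lam_rho(1)[OF n]]
  have P1: "P \<bullet> P = 1" using norm_P by (simp add: norm_eq_1)
  have b: "bary (lam n) v = 0" "bary (rho n) v = 0" using D by (auto simp: bary_V)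
  have "P \<bullet> (x - (P \<bullet> x) *\<^sub>R P) = 0" by (simp add: inner_diff_right P1)
  from fan_expand[OF n this] show ?thesis by (simp add: A_lin KsetD(2)[OF n] b algebra_simps)
qed

lemma fan_upper:
  obtains M \<theta>0 where "0 < M" "\<And>\<theta>. m (garc g1 g2 \<theta>) = M * sin (\<theta> - \<theta>0)"
proof -
  have "m g1 \<noteq> 0 \<or> m g2 \<noteq> 0"
  proof (rule ccontr)
    assume "\<not> ?thesis"
    then have "m (garc g1 g2 \<theta>) = 0" for \<theta> by (simp add: garc_def)
    from this[of 0] this[of \<alpha>] have "m (dir a0 (lam a0)) = 0" "m (dir a0 (rho a0)) = 0"
      using fan(4,5)[of 0] a0(1) by simp_all
    then have "m x = 0" for x using arg_cong[OF fan_expand_full[OF a0(1), of x], of m] m_P by simp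
    from this[of "eqc (z + pi / 2)"] show False by simp
  qed
  then obtain M \<theta>0 where M: "0 < M" "\<And>\<theta>. cos \<theta> * m g1 + sin \<theta> * m g2 = M * sin (\<theta> - \<theta>0)"
    using sinusoid[of "m g1" "m g2"] by blast
  show ?thesis by (rule that[OF M(1), of \<theta>0]) (use M(2) in \<open>simp add: garc_def\<close>)
qed

lemma pos_dir:
  assumes "n \<in> Kset" "w \<in> V" "w \<noteq> v" "w \<noteq> f n"
  shows "pos n w = c *\<^sub>R P + sqrt (1 - c\<^sup>2) *\<^sub>R dir n w"
proof (rule pos_eqI)
  have "0 < sqrt (1 - c\<^sup>2)" using c_sq by simp
  then show "A n (c *\<^sub>R P + sqrt (1 - c\<^sup>2) *\<^sub>R dir n w) = w"
    by (simp add: A_lin KsetD(2)[OF assms(1)] A_dir[OF assms]) (simp add: tang_def)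
qed

lemma fan_Suc:
  assumes n: "n \<in> Kset" "Suc n \<in> Kset"
  shows "0 < m (dir (Suc n) (lam (Suc n)))" "0 < det3 P (dir (Suc n) (lam (Suc n))) (dir (Suc n) (rho (Suc n)))"
proof -
  define S where "S = sqrt (1 - c\<^sup>2)"
  have S: "0 < S" using c_sq by (simp add: S_def)
  have v: "v \<noteq> f n" "v \<noteq> f (Suc n)" using KsetD(4) n by auto
  note D = cornerD[OF lam_rho(1)[OF n(2)]]
  have "v = apex (Suc n) \<or> v = f (Suc (Suc n))" using V_cases[of "Suc n" v] v v_V by auto
  then obtain x y where xy: "0 < y" "eqc (s (Suc n)) = x *\<^sub>R pos (Suc n) v + y *\<^sub>R pos (Suc n) (lam (Suc n))"
    using left_crossing[of "Suc n"] apex(4)[of "Suc n"] unfolding lam_def by (auto simp: add.commute)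
  define g where "g = dir (Suc n) (lam (Suc n))"
  have "pos (Suc n) (lam (Suc n)) = c *\<^sub>R P + S *\<^sub>R g"
    unfolding g_def S_def using D by (intro pos_dir[OF n(2)]) auto
  then have e: "eqc (s (Suc n)) = (x + y * c) *\<^sub>R P + (y * S) *\<^sub>R g"
    using xy(2) Kset_pos[OF n(2)] by (simp add: scaleR_add_right scaleR_add_left)
  have "z < s (Suc n)" "s (Suc n) < z + pi" using KsetD(1)[OF n(1)] KsetD(1)[OF n(2)] by (auto simp: base_def)
  then have "0 < sin (s (Suc n) - z)" by (intro sin_gt_zero) auto
  also have "\<dots> = y * S * m g" using arg_cong[OF e, of m] m_P by simp
  finally show "0 < m (dir (Suc n) (lam (Suc n)))" using mult_pos_pos[OF xy(1) S] by (simp add: g_def zero_less_mult_iff[of "y * S"])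
  define q where "q = eqt (s (Suc n))"
  define g' where "g' = dir (Suc n) (rho (Suc n))"
  have "bary (rho (Suc n)) (A (Suc n) q) = \<eta> (Suc n)"
    using lam_rho_Suc(3)[OF n] by (simp add: \<eta>_def lft_def q_def)
  then have q: "q = (P \<bullet> q) *\<^sub>R P + (S * bary (lam (Suc n)) (A (Suc n) q)) *\<^sub>R g + (S * \<eta> (Suc n)) *\<^sub>R g'"
    using fan_expand_full[OF n(2), of q] by (simp add: S_def g_def g'_def)
  have "hgt P = det3 P (eqc (s (Suc n))) q" unfolding q_def by (rule det3_equator(2)[symmetric])
  also have "\<dots> = y * S * det3 P g q" unfolding e by (simp add: det3_linear)
  also have "det3 P g q = S * \<eta> (Suc n) * det3 P g g'" by (subst q) (simp add: det3_linear)
  finally have "0 < y * S * (S * \<eta> (Suc n) * det3 P g g')" using hgt_P by simp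
  then show "0 < det3 P (dir (Suc n) (lam (Suc n))) (dir (Suc n) (rho (Suc n)))"
    using mult_pos_pos[OF xy(1) S] mult_pos_pos[OF S eta_pos[of "Suc n"]]
    by (simp add: zero_less_mult_iff[of "y * S"] zero_less_mult_iff[of "S * \<eta> (Suc n)"] g_def g'_def)
qed

lemma fan_coords:
  assumes n: "a0 + i \<in> Kset" and b: "\<And>w. w \<in> V \<Longrightarrow> w \<noteq> v \<Longrightarrow> 0 \<le> bary w (A (a0 + i) (garc g1 g2 \<theta>))"
  shows "0 \<le> sin (\<theta> - i * \<alpha>)" "0 \<le> sin (i * \<alpha> + \<alpha> - \<theta>)"
    "A (a0 + i) (garc g1 g2 \<theta>) = (1 / sin \<alpha>) *\<^sub>R (sin (i * \<alpha> + \<alpha> - \<theta>) *\<^sub>R tang v (lab (int i)) + sin (\<theta> - i * \<alpha>) *\<^sub>R tang v (lab (int i + 1)))"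
proof -
  define S where "S = sqrt (1 - c\<^sup>2)"
  have S: "0 < S" using c_sq by (simp add: S_def)
  note D = cornerD[OF lam_rho(1)[OF n]]
  define x where "x = garc g1 g2 \<theta>"
  have Px: "P \<bullet> x = 0" using fan_frame by (simp add: x_def garc_def inner_add_right)
  define k l where "k = S * bary (lam (a0 + i)) (A (a0 + i) x)" and "l = S * bary (rho (a0 + i)) (A (a0 + i) x)"
  have kl: "0 \<le> k" "0 \<le> l" unfolding k_def l_def x_def using b D S by auto
  have xe: "x = k *\<^sub>R garc g1 g2 (i * \<alpha>) + l *\<^sub>R garc g1 g2 (i * \<alpha> + \<alpha>)"
    using fan_expand[OF n Px] fan(4,5)[OF n] by (simp add: k_def l_def S_def)
  define F where "F \<phi> y = cos \<phi> * (g2 \<bullet> y) - sin \<phi> * (g1 \<bullet> y)" for \<phi> y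
  have g: "g1 \<bullet> g1 = 1" "g2 \<bullet> g2 = 1" "g1 \<bullet> g2 = 0" "g2 \<bullet> g1 = 0"
    using fan_frame by (simp_all add: norm_eq_1 inner_commute)
  have F: "F \<phi> (garc g1 g2 \<psi>) = sin (\<psi> - \<phi>)" "F \<phi> (y + y') = F \<phi> y + F \<phi> y'" "F \<phi> (r *\<^sub>R y) = r * F \<phi> y" for \<phi> \<psi> y y' r
    by (simp_all add: F_def garc_def inner_add_right g sin_diff algebra_simps)
  have "sin (\<theta> - i * \<alpha>) = F (i * \<alpha>) x" by (simp add: F x_def)
  also have "\<dots> = l * sin \<alpha>" by (subst xe) (simp add: F)
  finally have 1: "sin (\<theta> - i * \<alpha>) = l * sin \<alpha>" .
  have "sin (\<theta> - (i * \<alpha> + \<alpha>)) = F (i * \<alpha> + \<alpha>) x" by (simp add: F x_def)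
  also have "\<dots> = - (k * sin \<alpha>)" by (subst xe) (simp add: F)
  finally have 2: "sin (i * \<alpha> + \<alpha> - \<theta>) = k * sin \<alpha>" by (metis minus_diff_eq sin_minus minus_minus)
  show "0 \<le> sin (\<theta> - i * \<alpha>)" "0 \<le> sin (i * \<alpha> + \<alpha> - \<theta>)" unfolding 1 2 using kl sin_alpha_pos by auto
  have "A (a0 + i) x = k *\<^sub>R tang v (lab (int i)) + l *\<^sub>R tang v (lab (int i + 1))"
    using arg_cong[OF xe, of "A (a0 + i)"] dir_frame(6,7)[OF n] unfolding A_lin fan[OF n, symmetric] by simp
  then show "A (a0 + i) (garc g1 g2 \<theta>) = (1 / sin \<alpha>) *\<^sub>R (sin (i * \<alpha> + \<alpha> - \<theta>) *\<^sub>R tang v (lab (int i)) + sin (\<theta> - i * \<alpha>) *\<^sub>R tang v (lab (int i + 1)))"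
    unfolding 1 2 x_def using sin_alpha_pos by (simp add: scaleR_add_right)
qed

lemma direction_cases:
  assumes "0 < m (garc g1 g2 \<theta>)"
  obtains i where "a0 + i \<in> Kset" "\<And>w. w \<in> V \<Longrightarrow> w \<noteq> v \<Longrightarrow> 0 \<le> bary w (A (a0 + i) (garc g1 g2 \<theta>))"
proof -
  have "norm (garc g1 g2 \<theta>) = 1" using fan_frame by (intro norm_garc)
  moreover have "P \<bullet> garc g1 g2 \<theta> = 0" using fan_frame by (simp add: garc_def inner_add_right)
  ultimately obtain n where n: "n \<in> Kset" "\<And>w. w \<in> V \<Longrightarrow> w \<noteq> v \<Longrightarrow> 0 \<le> bary w (A n (garc g1 g2 \<theta>))"
    using direction_covered[of "garc g1 g2 \<theta>"] assms by blast
  have "a0 \<le> n" by (rule a0(2)[OF n(1)])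
  then obtain i where "n = a0 + i" using le_Suc_ex by blast
  then show ?thesis using that[of i] n by blast
qed

lemma Suc_a0: "Suc a0 \<in> Kset"
proof (rule ccontr)
  assume no: "Suc a0 \<notin> Kset"
  obtain M \<theta>0 where M: "0 < M" "\<And>\<theta>. m (garc g1 g2 \<theta>) = M * sin (\<theta> - \<theta>0)" using fan_upper by blast
  have s: "0 \<le> sin \<theta> \<and> 0 \<le> sin (\<alpha> - \<theta>)" if \<theta>: "\<theta>0 < \<theta>" "\<theta> < \<theta>0 + pi" for \<theta>
  proof -
    have "0 < sin (\<theta> - \<theta>0)" using \<theta> by (intro sin_gt_zero) auto
    then have "0 < m (garc g1 g2 \<theta>)" using M by simp
    then obtain i where i: "a0 + i \<in> Kset" "\<And>w. w \<in> V \<Longrightarrow> w \<noteq> v \<Longrightarrow> 0 \<le> bary w (A (a0 + i) (garc g1 g2 \<theta>))"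
      by (rule direction_cases) blast
    have "i = 0"
    proof (rule ccontr)
      assume "i \<noteq> 0"
      then show False using Kset_between[OF a0(1) i(1), of "Suc a0"] no by simp
    qed
    then show ?thesis using fan_coords(1,2)[OF i] by simp
  qed
  have lim: "0 \<le> F \<theta>0 \<and> 0 \<le> F (\<theta>0 + pi)" if F: "continuous_on UNIV F" "\<And>\<theta>. \<theta>0 < \<theta> \<Longrightarrow> \<theta> < \<theta>0 + pi \<Longrightarrow> 0 \<le> F \<theta>" for F :: "real \<Rightarrow> real"
  proof -
    have "closed {x. 0 \<le> F x}" using F(1) by (intro closed_Collect_le continuous_intros)
    then have "closure {\<theta>0<..<\<theta>0 + pi} \<subseteq> {x. 0 \<le> F x}" using F(2) by (intro closure_minimal) auto
    then have "{\<theta>0..\<theta>0 + pi} \<subseteq> {x. 0 \<le> F x}" by simp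
    then have "\<theta>0 \<in> {x. 0 \<le> F x}" "\<theta>0 + pi \<in> {x. 0 \<le> F x}" by (rule subsetD, simp)+
    then show ?thesis by simp
  qed
  have "0 \<le> sin \<theta>0 \<and> 0 \<le> sin (\<theta>0 + pi)" by (rule lim[of sin]) (auto intro!: continuous_intros simp: s)
  then have 1: "sin \<theta>0 = 0" by simp
  have "0 \<le> sin (\<alpha> - \<theta>0) \<and> 0 \<le> sin (\<alpha> - (\<theta>0 + pi))"
    by (rule lim[of "\<lambda>\<theta>. sin (\<alpha> - \<theta>)"]) (auto intro!: continuous_intros simp: s)
  then have "sin (\<alpha> - \<theta>0) = 0" by (simp add: diff_diff_add[symmetric] sin_diff[of _ pi])
  then have "sin \<alpha> * cos \<theta>0 = 0" using 1 by (simp add: sin_diff)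
  then show False using 1 sin_alpha_pos sin_zero_abs_cos_one[of \<theta>0] by auto
qed

lemma det_fan: "0 < det3 P g1 g2"
proof -
  have K: "a0 + 1 \<in> Kset" using Suc_a0 by simp
  have "0 < det3 P (garc g1 g2 \<alpha>) (garc g1 g2 (\<alpha> + \<alpha>))"
    using fan_Suc(2)[OF a0(1) Suc_a0] fan(4,5)[OF K] by simp
  also have "\<dots> = sin (\<alpha> + \<alpha> - \<alpha>) * det3 P g1 g2"
    unfolding sin_diff by (simp add: garc_def det3_linear det3_swap[of P g2 g1]) (simp add: algebra_simps)
  finally show ?thesis using sin_alpha_pos by (simp add: zero_less_mult_iff)
qed

lemma fan_interval:
  obtains \<theta>0 where "\<And>\<theta>. \<lbrakk>\<theta>0 < \<theta>; \<theta> < \<theta>0 + pi\<rbrakk> \<Longrightarrow> 0 < m (garc g1 g2 \<theta>)"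
    "\<And>\<theta>. \<lbrakk>\<theta>0 < \<theta>; \<theta> < \<theta>0 + pi\<rbrakk> \<Longrightarrow> \<exists>n\<in>Kset. A n (garc g1 g2 \<theta>) = linkdir v lab \<theta> \<and> (\<forall>w\<in>V. w \<noteq> v \<longrightarrow> 0 \<le> bary w (A n (garc g1 g2 \<theta>)))"
proof -
  obtain M \<theta>1 where M: "0 < M" "\<And>\<theta>. m (garc g1 g2 \<theta>) = M * sin (\<theta> - \<theta>1)" using fan_upper by blast
  have up: "0 < sin (i * \<alpha> - \<theta>1)" if i: "a0 + i \<in> Kset" "0 < i" for i
  proof -
    have K: "a0 + (i - 1) \<in> Kset" using Kset_between[OF a0(1) i(1), of "a0 + (i - 1)"] by simp
    have e: "Suc (a0 + (i - 1)) = a0 + i" using i(2) by simp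
    have "0 < m (dir (a0 + i) (lam (a0 + i)))" using fan_Suc(1)[OF K, unfolded e, OF i(1)] .
    then show ?thesis using M fan(4)[OF i(1)] by (simp add: zero_less_mult_iff)
  qed
  have K1: "a0 + 1 \<in> Kset" using Suc_a0 by simp
  obtain k :: int where k: "\<theta>1 + 2 * pi * k < \<alpha>" "\<alpha> < \<theta>1 + 2 * pi * k + pi"
    using sin_lift[of \<alpha> \<theta>1] up[OF K1] by auto
  define \<theta>0 where "\<theta>0 = \<theta>1 + 2 * pi * k"
  have M0: "m (garc g1 g2 \<theta>) = M * sin (\<theta> - \<theta>0)" for \<theta>
    unfolding M(2) \<theta>0_def sin_diff_period ..
  have sin_eq: "sin (x - \<theta>0) = sin (x - \<theta>1)" for x using M0[of x] M(2)[of x] M(1) by simp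
  have in_int: "\<theta>0 < i * \<alpha> \<and> i * \<alpha> < \<theta>0 + pi" if "a0 + i \<in> Kset" "0 < i" for i
    using that
  proof (induction i)
    case (Suc i)
    show ?case
    proof (cases "i = 0")
      case True
      then show ?thesis using k by (simp add: \<theta>0_def)
    next
      case False
      have "a0 + i \<in> Kset" using Kset_between[OF a0(1) Suc.prems(1), of "a0 + i"] by simp
      then have IH: "\<theta>0 < i * \<alpha>" "i * \<alpha> < \<theta>0 + pi" using Suc.IH False by auto
      have st: "Suc i * \<alpha> = i * \<alpha> + \<alpha>" by (simp add: algebra_simps)
      have "0 < sin (Suc i * \<alpha> - \<theta>0)" unfolding sin_eq by (rule up[OF Suc.prems])
      then have "Suc i * \<alpha> < \<theta>0 + pi"
        unfolding st using alpha_range by (intro sin_pos_step[OF IH, of "i * \<alpha> + \<alpha>"]) auto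
      then show ?thesis using IH(1) alpha_range unfolding st by simp
    qed
  qed simp
  have pos: "0 < m (garc g1 g2 \<theta>)" if "\<theta>0 < \<theta>" "\<theta> < \<theta>0 + pi" for \<theta>
    unfolding M0 using that M(1) by (intro mult_pos_pos sin_gt_zero) auto
  show ?thesis
  proof (rule that[OF pos])
    fix \<theta> assume \<theta>: "\<theta>0 < \<theta>" "\<theta> < \<theta>0 + pi"
    obtain i where i: "a0 + i \<in> Kset" "\<And>w. w \<in> V \<Longrightarrow> w \<noteq> v \<Longrightarrow> 0 \<le> bary w (A (a0 + i) (garc g1 g2 \<theta>))"
      using direction_cases[OF pos[OF \<theta>]] by blast
    note F = fan_coords[OF i]
    have neg: "sin x < 0" if "- pi < x" "x < 0" for x :: real
      using sin_gt_zero[of "- x"] that by simp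
    have "i * \<alpha> \<le> \<theta> \<and> \<theta> \<le> i * \<alpha> + \<alpha>"
    proof (cases "i = 0")
      case True
      have t: "\<theta> < \<alpha> + pi" "\<alpha> < \<theta> + pi" using \<theta> in_int[OF K1] by auto
      have "\<theta> \<le> \<alpha>"
      proof (rule ccontr)
        assume "\<not> \<theta> \<le> \<alpha>"
        then have "sin (\<alpha> - \<theta>) < 0" using t by (intro neg) auto
        then show False using F(2) True by simp
      qed
      moreover have "0 \<le> \<theta>"
      proof (rule ccontr)
        assume "\<not> 0 \<le> \<theta>"
        then have "sin \<theta> < 0" using t alpha_range by (intro neg) auto
        then show False using F(1) True by simp
      qed
      ultimately show ?thesis using True by simp
    next
      case False
      then have t: "\<theta> < i * \<alpha> + pi" "i * \<alpha> < \<theta> + pi" using \<theta> in_int[OF i(1)] by auto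
      have "i * \<alpha> \<le> \<theta>"
      proof (rule ccontr)
        assume "\<not> i * \<alpha> \<le> \<theta>"
        then have "sin (\<theta> - i * \<alpha>) < 0" using t by (intro neg) auto
        then show False using F(1) by simp
      qed
      moreover have "\<theta> \<le> i * \<alpha> + \<alpha>"
      proof (rule ccontr)
        assume "\<not> \<theta> \<le> i * \<alpha> + \<alpha>"
        then have "sin (i * \<alpha> + \<alpha> - \<theta>) < 0" using t alpha_range by (intro neg) auto
        then show False using F(2) by simp
      qed
      ultimately show ?thesis by simp
    qed
    then have "of_int (int i) * \<alpha> \<le> \<theta>" "\<theta> \<le> of_int (int i + 1) * \<alpha>" by (auto simp: algebra_simps)
    from linkdir_sector[OF this, of v lab] have "A (a0 + i) (garc g1 g2 \<theta>) = linkdir v lab \<theta>"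
      using F(3) by (simp add: algebra_simps)
    then show "\<exists>n\<in>Kset. A n (garc g1 g2 \<theta>) = linkdir v lab \<theta> \<and> (\<forall>w\<in>V. w \<noteq> v \<longrightarrow> 0 \<le> bary w (A n (garc g1 g2 \<theta>)))"
      using i by blast
  qed
qed

end

section \<open>Rays from a vertex to the loop\<close>

context regular_tetra
begin

text \<open>The straight curve \<open>\<rho>\<close> leaves \<open>v\<close> in direction \<open>D\<close> and first meets the loop at time \<open>b\<close>, in \<open>\<gamma> \<sigma>\<close>; the values
  of \<open>\<rho>\<close> from time \<open>b\<close> on are irrelevant.\<close>

definition is_ray where
  "is_ray \<gamma> v D \<rho> b \<sigma> \<longleftrightarrow> 0 < b \<and> (\<exists>e>0. \<forall>r. 0 < r \<longrightarrow> r < e \<longrightarrow> \<rho> r = garc v D r) \<and>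
    (\<forall>r. 0 < r \<longrightarrow> r < b \<longrightarrow> straight_at \<rho> r \<and> \<rho> r \<notin> range \<gamma>) \<and>
    (\<exists>h r0. isCont h b \<and> h b = \<gamma> \<sigma> \<and> r0 < b \<and> (\<forall>r. r0 < r \<longrightarrow> r < b \<longrightarrow> \<rho> r = h r))"

lemma is_ray_not_less:
  assumes 1: "is_ray \<gamma> v D \<rho> b \<sigma>" and 2: "is_ray \<gamma>' v D \<rho>' b' \<sigma>'" and ran: "range \<gamma> = range \<gamma>'"
  shows "\<not> b < b'"
proof
  assume less: "b < b'"
  obtain e where e: "0 < e" "\<And>r. \<lbrakk>0 < r; r < e\<rbrakk> \<Longrightarrow> \<rho> r = garc v D r" using 1 unfolding is_ray_def by blast
  obtain e' where e': "0 < e'" "\<And>r. \<lbrakk>0 < r; r < e'\<rbrakk> \<Longrightarrow> \<rho>' r = garc v D r" using 2 unfolding is_ray_def by blast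
  obtain h r0 where h: "isCont h b" "h b = \<gamma> \<sigma>" "r0 < b" "\<And>r. \<lbrakk>r0 < r; r < b\<rbrakk> \<Longrightarrow> \<rho> r = h r"
    using 1 unfolding is_ray_def by blast
  have b: "0 < b" "\<And>r. \<lbrakk>0 < r; r < b\<rbrakk> \<Longrightarrow> straight_at \<rho> r" using 1 unfolding is_ray_def by auto
  have b': "\<And>r. \<lbrakk>0 < r; r < b'\<rbrakk> \<Longrightarrow> straight_at \<rho>' r" "\<And>r. \<lbrakk>0 < r; r < b'\<rbrakk> \<Longrightarrow> \<rho>' r \<notin> range \<gamma>'"
    using 2 unfolding is_ray_def by auto
  have eq: "\<rho> r = \<rho>' r" if "0 < r" "r < b" for r
    using less that e e' b b' by (intro straight_unique[of 0 b \<rho> \<rho>' "min e e'" r]) auto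
  have "\<rho>' b = h b"
  proof (rule frequently_eq_imp_eq[of b \<rho>' h])
    show "isCont \<rho>' b" by (rule straight_at_isCont) (use b'(1) b(1) less in auto)
    show "\<exists>r. b - x < r \<and> r < b \<and> \<rho>' r = h r" if "0 < x" for x
    proof -
      obtain r where "max (b - x) (max r0 0) < r" "r < b" using dense[of "max (b - x) (max r0 0)" b] h(3) b(1) \<open>0 < x\<close> by auto
      then show ?thesis using eq[of r] h(4)[of r] by auto
    qed
  qed (rule h(1))
  then show False using b'(2)[OF b(1) less] h(2) ran by auto
qed

lemma is_ray_unique:
  assumes 1: "is_ray \<gamma> v D \<rho> b \<sigma>" and 2: "is_ray \<gamma>' v D \<rho>' b' \<sigma>'" and ran: "range \<gamma> = range \<gamma>'"
  shows "\<gamma> \<sigma> = \<gamma>' \<sigma>'"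
proof -
  have bb: "b' = b" using is_ray_not_less[OF 1 2 ran] is_ray_not_less[OF 2 1 ran[symmetric]] by simp
  obtain e where e: "0 < e" "\<And>r. \<lbrakk>0 < r; r < e\<rbrakk> \<Longrightarrow> \<rho> r = garc v D r" using 1 unfolding is_ray_def by blast
  obtain e' where e': "0 < e'" "\<And>r. \<lbrakk>0 < r; r < e'\<rbrakk> \<Longrightarrow> \<rho>' r = garc v D r" using 2 unfolding is_ray_def by blast
  obtain h r0 where h: "isCont h b" "h b = \<gamma> \<sigma>" "r0 < b" "\<And>r. \<lbrakk>r0 < r; r < b\<rbrakk> \<Longrightarrow> \<rho> r = h r"
    using 1 unfolding is_ray_def by blast
  obtain h' r0' where h': "isCont h' b" "h' b = \<gamma>' \<sigma>'" "r0' < b" "\<And>r. \<lbrakk>r0' < r; r < b\<rbrakk> \<Longrightarrow> \<rho>' r = h' r"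
    using 2 unfolding is_ray_def bb by blast
  have b: "0 < b" "\<And>r. \<lbrakk>0 < r; r < b\<rbrakk> \<Longrightarrow> straight_at \<rho> r" "\<And>r. \<lbrakk>0 < r; r < b\<rbrakk> \<Longrightarrow> straight_at \<rho>' r"
    using 1 2 unfolding is_ray_def bb by auto
  have eq: "\<rho> r = \<rho>' r" if "0 < r" "r < b" for r
    using that e e' b by (intro straight_unique[of 0 b \<rho> \<rho>' "min e e'" r]) auto
  have "h b = h' b"
  proof (rule frequently_eq_imp_eq[of b h h'])
    show "\<exists>r. b - x < r \<and> r < b \<and> h r = h' r" if "0 < x" for x
    proof -
      obtain r where "max (b - x) (max r0 (max r0' 0)) < r" "r < b"
        using dense[of "max (b - x) (max r0 (max r0' 0))" b] h(3) h'(3) b(1) \<open>0 < x\<close> by auto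
      then show ?thesis using eq[of r] h(4)[of r] h'(4)[of r] by auto
    qed
  qed (rule h(1) h'(1))+
  then show ?thesis using h(2) h'(2) by simp
qed

definition ray_system where
  "ray_system \<gamma> z v L \<theta>0 \<sigma> \<longleftrightarrow> (\<forall>\<theta>. \<theta>0 < \<theta> \<longrightarrow> \<theta> < \<theta>0 + pi \<longrightarrow>
      z < \<sigma> \<theta> \<and> \<sigma> \<theta> < z + pi \<and> (\<exists>\<rho> b. is_ray \<gamma> v (linkdir v L \<theta>) \<rho> b (\<sigma> \<theta>))) \<and>
    (\<forall>\<theta> \<theta>'. \<theta>0 < \<theta> \<longrightarrow> \<theta> < \<theta>' \<longrightarrow> \<theta>' < \<theta>0 + pi \<longrightarrow> \<sigma> \<theta> < \<sigma> \<theta>')"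

lemma arcs_overlap:
  obtains n :: int where "\<theta>1 - pi < \<theta>2 + 3 * \<alpha> * n" "\<theta>2 + 3 * \<alpha> * n < \<theta>1 + pi"
proof -
  define n where "n = \<lfloor>(\<theta>1 - \<theta>2) / (3 * \<alpha>)\<rfloor>"
  have "n \<le> (\<theta>1 - \<theta>2) / (3 * \<alpha>)" "(\<theta>1 - \<theta>2) / (3 * \<alpha>) < n + 1" unfolding n_def by linarith+
  then have r: "3 * \<alpha> * n \<le> \<theta>1 - \<theta>2" "\<theta>1 - \<theta>2 < 3 * \<alpha> * n + 3 * \<alpha>"
    using alpha_range(1) by (simp_all add: pos_le_divide_eq pos_divide_less_eq algebra_simps)
  show ?thesis
  proof (cases "\<theta>1 - pi < \<theta>2 + 3 * \<alpha> * n")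
    case True
    then show ?thesis using that[of n] r by (simp add: add_pos_nonneg)
  next
    case False
    have e: "3 * \<alpha> * of_int (n + 1) = 3 * \<alpha> * n + 3 * \<alpha>" by (simp add: algebra_simps)
    show ?thesis by (rule that[of "n + 1"]) (use False r alpha_range e in linarith)+
  qed
qed

lemma rays_meet:
  assumes c1: "corner v p q r" "ori v p q r < 0" and c2: "corner v p' q' r'" "ori v p' q' r' < 0"
    and R1: "ray_system \<gamma> z v (cyc3 p q r) \<theta>1 \<sigma>" and R2: "ray_system \<gamma>' z' v (cyc3 p' q' r') \<theta>2 \<sigma>'" and ran: "range \<gamma> = range \<gamma>'"
  obtains a b \<delta> where "a < b"
    "\<And>\<theta>. \<lbrakk>a < \<theta>; \<theta> < b\<rbrakk> \<Longrightarrow> \<theta>1 < \<theta> \<and> \<theta> < \<theta>1 + pi \<and> \<theta>2 < \<theta> - \<delta> \<and> \<theta> - \<delta> < \<theta>2 + pi \<and> \<gamma> (\<sigma> \<theta>) = \<gamma>' (\<sigma>' (\<theta> - \<delta>))"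
proof -
  obtain k where k: "\<And>j. cyc3 p' q' r' j = cyc3 p q r (j + k)"
    using cyc3_shift[OF corner_ori_cases[OF c1(1) c2(1) c1(2) c2(2)]] by metis
  obtain n :: int where n: "\<theta>1 - pi < \<theta>2 + k * \<alpha> + 3 * \<alpha> * n" "\<theta>2 + k * \<alpha> + 3 * \<alpha> * n < \<theta>1 + pi"
    using arcs_overlap[of \<theta>1 "\<theta>2 + k * \<alpha>"] by blast
  define \<delta> where "\<delta> = k * \<alpha> + 3 * \<alpha> * n"
  have D: "linkdir v (cyc3 p' q' r') (\<theta> - \<delta>) = linkdir v (cyc3 p q r) \<theta>" for \<theta>
  proof -
    have "linkdir v (cyc3 p' q' r') (\<theta> - \<delta>) = linkdir v (cyc3 p q r) (\<theta> - \<delta> + k * \<alpha>)" by (rule linkdir_shift) (rule k)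
    also have "\<theta> - \<delta> + k * \<alpha> = \<theta> + 3 * \<alpha> * of_int (- n)" by (simp add: \<delta>_def)
    also have "linkdir v (cyc3 p q r) (\<theta> + 3 * \<alpha> * of_int (- n)) = linkdir v (cyc3 p q r) \<theta>"
      by (rule linkdir_period_int) simp
    finally show ?thesis .
  qed
  show ?thesis
  proof (rule that[of "max \<theta>1 (\<theta>2 + \<delta>)" "min (\<theta>1 + pi) (\<theta>2 + \<delta> + pi)" \<delta>])
    show "max \<theta>1 (\<theta>2 + \<delta>) < min (\<theta>1 + pi) (\<theta>2 + \<delta> + pi)" using n by (auto simp: \<delta>_def)
    fix \<theta> assume "max \<theta>1 (\<theta>2 + \<delta>) < \<theta>" "\<theta> < min (\<theta>1 + pi) (\<theta>2 + \<delta> + pi)"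
    then have \<theta>: "\<theta>1 < \<theta>" "\<theta> < \<theta>1 + pi" "\<theta>2 < \<theta> - \<delta>" "\<theta> - \<delta> < \<theta>2 + pi" by auto
    obtain \<rho> b where 1: "is_ray \<gamma> v (linkdir v (cyc3 p q r) \<theta>) \<rho> b (\<sigma> \<theta>)"
      using R1 \<theta>(1,2) unfolding ray_system_def by blast
    obtain \<rho>' b' where 2: "is_ray \<gamma>' v (linkdir v (cyc3 p q r) \<theta>) \<rho>' b' (\<sigma>' (\<theta> - \<delta>))"
      using R2 \<theta>(3,4) D[of \<theta>] unfolding ray_system_def by metis
    show "\<theta>1 < \<theta> \<and> \<theta> < \<theta>1 + pi \<and> \<theta>2 < \<theta> - \<delta> \<and> \<theta> - \<delta> < \<theta>2 + pi \<and> \<gamma> (\<sigma> \<theta>) = \<gamma>' (\<sigma>' (\<theta> - \<delta>))"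
      using is_ray_unique[OF 1 2 ran] \<theta> by blast
  qed
qed

end

context touched_lune
begin

lemma ray_end:
  assumes d: "norm d = 1" "P \<bullet> d = 0" "0 < m d"
  obtains b \<sigma> where "0 < b" "b < pi" "z < \<sigma>" "\<sigma> < z + pi" "garc P d b = eqc \<sigma>"
proof -
  have "\<exists>b. 0 \<le> b \<and> b \<le> pi \<and> hgt (garc P d b) = 0"
    using hgt_P by (intro IVT2') (auto simp: garc_def intro!: continuous_intros)
  then obtain b where b: "0 \<le> b" "b \<le> pi" "hgt (garc P d b) = 0" by blast
  have "b \<noteq> 0" "b \<noteq> pi" using b(3) hgt_P by (auto simp: garc_def)
  then have b': "0 < b" "b < pi" using b by auto
  have mb: "0 < m (garc P d b)" using m_P d(3) sin_gt_zero[OF b'] by (simp add: garc_def)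
  obtain \<sigma> where \<sigma>: "garc P d b = eqc \<sigma>" "z \<le> \<sigma>" "\<sigma> \<le> z + pi"
    using base_param[OF norm_garc[OF norm_P d(1,2)] b(3), of z t] mb by auto
  have "0 < sin (\<sigma> - z)" using mb unfolding \<sigma>(1) by simp
  then have "\<sigma> \<noteq> z" "\<sigma> \<noteq> z + pi" by auto
  then show ?thesis using that[OF b', of \<sigma>] \<sigma> by auto
qed

lemma is_ray_E:
  assumes n: "n \<in> Kset" and d: "norm d = 1" "P \<bullet> d = 0" "0 < m d" and w: "\<And>w. w \<in> V \<Longrightarrow> w \<noteq> v \<Longrightarrow> 0 \<le> bary w (A n d)"
    and b: "0 < b" "b < pi" "z < \<sigma>" "\<sigma> < z + pi" "garc P d b = eqc \<sigma>"
  shows "is_ray \<gamma> v (A n d) (\<lambda>r. E (garc P d r)) b \<sigma>"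
  unfolding is_ray_def
proof (intro conjI allI impI)
  have mb: "0 < m (garc P d b)" unfolding b(5) using b by (simp add: sin_gt_zero)
  have in_lune: "garc P d r \<in> lune z t" if "0 < r" "r < b" for r
    using that b hgt_P m_P mb by (intro arc_in_lune[of b]) auto
  show "straight_at (\<lambda>r. E (garc P d r)) r" if "0 < r" "r < b" for r
    by (rule E_straight[OF norm_P d(1,2) in_lune[OF that]])
  show "E (garc P d r) \<notin> range \<gamma>" if "0 < r" "r < b" for r
    using no_intrusion[OF in_lune[OF that] norm_garc[OF norm_P d(1,2)]] by auto
  show "\<exists>e>0. \<forall>r. 0 < r \<longrightarrow> r < e \<longrightarrow> E (garc P d r) = garc v (A n d) r"
  proof -
    have "continuous_on UNIV (\<lambda>r. bary v (A n (garc P d r)))" by (intro continuous_intros)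
    then have "\<forall>\<^sub>F r in nhds 0. 0 < bary v (A n (garc P d r))"
      using KsetD(2)[OF n] v_V by (intro continuous_pos_near) (auto simp: bary_V)
    then obtain x where x: "0 < x" "\<And>r. \<bar>r\<bar> < x \<Longrightarrow> 0 < bary v (A n (garc P d r))"
      unfolding eventually_near_iff by auto
    have "E (garc P d r) = garc v (A n d) r" if r: "0 < r" "r < min x b" for r
    proof -
      have "0 \<le> bary u (A n (garc P d r))" if u: "u \<in> V" for u
      proof (cases "u = v")
        case True
        then show ?thesis using x(2)[of r] r by simp
      next
        case False
        then have "bary u (A n (garc P d r)) = sin r * bary u (A n d)"
          using KsetD(2)[OF n] u v_V by (simp add: A_garc bary_garc bary_V)
        then show ?thesis using w[OF u False] sin_gt_zero[of r] r b by simp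
      qed
      then have "garc P d r \<in> tri n" by (simp add: tri_def)
      then have "E (garc P d r) = A n (garc P d r)" using in_lune r by (intro E_eq[OF KsetD(1)[OF n]]) auto
      then show ?thesis by (simp add: A_garc KsetD(2)[OF n])
    qed
    then show ?thesis using x(1) b(1) by (intro exI[of _ "min x b"]) auto
  qed
  show "\<exists>h r0. isCont h b \<and> h b = \<gamma> \<sigma> \<and> r0 < b \<and> (\<forall>r. r0 < r \<longrightarrow> r < b \<longrightarrow> E (garc P d r) = h r)"
  proof -
    obtain j r0 where j: "j \<in> base z" "0 < r0" "r0 < b" "\<gamma> \<sigma> = A j (eqc \<sigma>)"
      "\<And>r. \<lbrakk>r0 < r; r < b\<rbrakk> \<Longrightarrow> E (garc P d r) = A j (garc P d r)"
      using E_limit_eventually[of 0 b P d \<sigma>] in_lune b by auto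
    have "continuous_on UNIV (\<lambda>r. A j (garc P d r))" by (intro continuous_intros)
    then have "isCont (\<lambda>r. A j (garc P d r)) b" by (rule continuous_on_interior) simp
    then show ?thesis using j b(5) by (intro exI[of _ "\<lambda>r. A j (garc P d r)"] exI[of _ r0]) auto
  qed
qed (rule b(1))

lemma rays:
  obtains p q r \<theta>0 \<sigma> where "corner v p q r" "ori v p q r < 0" "ray_system \<gamma> z v (cyc3 p q r) \<theta>0 \<sigma>"
proof -
  obtain \<theta>0 where up: "\<And>\<theta>. \<lbrakk>\<theta>0 < \<theta>; \<theta> < \<theta>0 + pi\<rbrakk> \<Longrightarrow> 0 < m (garc g1 g2 \<theta>)"
    and lk: "\<And>\<theta>. \<lbrakk>\<theta>0 < \<theta>; \<theta> < \<theta>0 + pi\<rbrakk> \<Longrightarrow> \<exists>n\<in>Kset. A n (garc g1 g2 \<theta>) = linkdir v lab \<theta> \<and> (\<forall>w\<in>V. w \<noteq> v \<longrightarrow> 0 \<le> bary w (A n (garc g1 g2 \<theta>)))"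
    using fan_interval by blast
  define d where "d = garc g1 g2"
  have d: "norm (d \<theta>) = 1" "P \<bullet> d \<theta> = 0" for \<theta>
    unfolding d_def using fan_frame by (auto intro: norm_garc simp: garc_def[of g1 g2 \<theta>, THEN arg_cong[of _ _ "(\<bullet>) P"]] inner_add_right)
  have "\<forall>\<theta>. \<exists>b \<sigma>. \<theta>0 < \<theta> \<longrightarrow> \<theta> < \<theta>0 + pi \<longrightarrow> 0 < b \<and> b < pi \<and> z < \<sigma> \<and> \<sigma> < z + pi \<and> garc P (d \<theta>) b = eqc \<sigma>"
    using ray_end[OF d up[folded d_def]] by metis
  then obtain b \<sigma> where b: "\<And>\<theta>. \<lbrakk>\<theta>0 < \<theta>; \<theta> < \<theta>0 + pi\<rbrakk> \<Longrightarrow> 0 < b \<theta> \<and> b \<theta> < pi \<and> z < \<sigma> \<theta> \<and> \<sigma> \<theta> < z + pi \<and> garc P (d \<theta>) (b \<theta>) = eqc (\<sigma> \<theta>)"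
    by metis
  have "ray_system \<gamma> z v lab \<theta>0 \<sigma>"
    unfolding ray_system_def
  proof (intro conjI allI impI)
    fix \<theta> assume \<theta>: "\<theta>0 < \<theta>" "\<theta> < \<theta>0 + pi"
    show "z < \<sigma> \<theta>" "\<sigma> \<theta> < z + pi" using b[OF \<theta>] by auto
    obtain n where n: "n \<in> Kset" "A n (d \<theta>) = linkdir v lab \<theta>" "\<And>w. w \<in> V \<Longrightarrow> w \<noteq> v \<Longrightarrow> 0 \<le> bary w (A n (d \<theta>))"
      using lk[OF \<theta>] unfolding d_def by blast
    have "is_ray \<gamma> v (A n (d \<theta>)) (\<lambda>r. E (garc P (d \<theta>) r)) (b \<theta>) (\<sigma> \<theta>)"
      using b[OF \<theta>] up[OF \<theta>] by (intro is_ray_E[OF n(1) d _ n(3)]) (auto simp: d_def)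
    then show "\<exists>\<rho> b. is_ray \<gamma> v (linkdir v lab \<theta>) \<rho> b (\<sigma> \<theta>)" unfolding n(2) by blast
  next
    fix \<theta> \<theta>' assume "\<theta>0 < \<theta>" "\<theta> < \<theta>'" "\<theta>' < \<theta>0 + pi"
    then have b1: "0 < b \<theta>" "b \<theta> < pi" "z < \<sigma> \<theta>" "\<sigma> \<theta> < z + pi" "eqc (\<sigma> \<theta>) = garc P (d \<theta>) (b \<theta>)"
      and b2: "0 < b \<theta>'" "b \<theta>' < pi" "z < \<sigma> \<theta>'" "\<sigma> \<theta>' < z + pi" "eqc (\<sigma> \<theta>') = garc P (d \<theta>') (b \<theta>')"
      and \<theta>: "0 < sin (\<theta>' - \<theta>)"
      using b[of \<theta>] b[of \<theta>'] by (auto intro!: sin_gt_zero)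
    have "hgt P * sin (\<sigma> \<theta>' - \<sigma> \<theta>) = det3 P (eqc (\<sigma> \<theta>)) (eqc (\<sigma> \<theta>'))" by (rule det3_equator(1)[symmetric])
    also have "\<dots> = sin (b \<theta>) * sin (b \<theta>') * (sin (\<theta>' - \<theta>) * det3 P g1 g2)"
      unfolding b1(5) b2(5) sin_diff d_def
      by (simp add: garc_def det3_linear det3_swap[of P g2 g1]) (simp add: algebra_simps)
    also have "0 < \<dots>"
      using sin_gt_zero[OF b1(1,2)] sin_gt_zero[OF b2(1,2)] \<theta> det_fan by simp
    finally have "0 < sin (\<sigma> \<theta>' - \<sigma> \<theta>)" using hgt_P by (simp add: zero_less_mult_iff)
    show "\<sigma> \<theta> < \<sigma> \<theta>'"
    proof (rule ccontr)
      assume "\<not> \<sigma> \<theta> < \<sigma> \<theta>'"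
      then have "0 \<le> sin (\<sigma> \<theta> - \<sigma> \<theta>')" using b1 b2 by (intro sin_ge_zero) auto
      moreover have "sin (\<sigma> \<theta> - \<sigma> \<theta>') = - sin (\<sigma> \<theta>' - \<sigma> \<theta>)" by (metis minus_diff_eq sin_minus)
      ultimately show False using \<open>0 < sin (\<sigma> \<theta>' - \<sigma> \<theta>)\<close> by simp
    qed
  qed
  then show ?thesis using that lam_rho[OF a0(1)] unfolding lab_def by blast
qed

end

section \<open>Vertices touched by the free lunes\<close>

locale oriented_loop = developed_loop +
  assumes oriented: "\<And>n. 0 < n \<Longrightarrow> 0 < hgt (pos n (apex n)) * ori (apex n) (f (n - 1)) (f (Suc n)) (f n)"

context developed_loop
begin

abbreviation orn :: "nat \<Rightarrow> real" where
  "orn n \<equiv> hgt (pos n (apex n)) * ori (apex n) (f (n - 1)) (f (Suc n)) (f n)"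

lemma orn_Suc:
  assumes n: "0 < n"
  shows "0 < orn (Suc n) \<longleftrightarrow> 0 < orn n"
proof -
  have "f (Suc (Suc n)) \<in> V" "f (Suc (Suc n)) \<noteq> f n" "f (Suc (Suc n)) \<noteq> f (Suc n)"
    using f_V f_pred_Suc[of "Suc n"] f_Suc[of "Suc n"] by auto
  then have cs: "f (Suc (Suc n)) = apex n \<or> f (Suc (Suc n)) = f (n - 1)" using V_cases[OF n, of "f (Suc (Suc n))"] by metis
  note ap = apex[OF n] and ap' = apex[of "Suc n"]
  have "apex (Suc n) \<in> V" "apex (Suc n) \<noteq> f n" "apex (Suc n) \<noteq> f (Suc n)" using ap' by auto
  then have ca: "apex (Suc n) = apex n \<or> apex (Suc n) = f (n - 1)" using V_cases[OF n, of "apex (Suc n)"] by metis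
  show ?thesis
  proof (cases "f (Suc (Suc n)) = f (n - 1)")
    case True
    then have a: "apex (Suc n) = apex n" using ca ap' by auto
    have "pos (Suc n) (apex n) = pos n (apex n)" using ap by (intro pos_Suc)
    moreover have "ori (apex n) (f n) (f (n - 1)) (f (Suc n)) = ori (apex n) (f (n - 1)) (f (Suc n)) (f n)"
      unfolding ori_def by algebra
    ultimately show ?thesis using True a by simp
  next
    case False
    then have e: "f (Suc (Suc n)) = apex n" using cs by simp
    then have a: "apex (Suc n) = f (n - 1)" using ca ap' by auto
    have "pos (Suc n) (f (n - 1)) = pos n (f (n - 1))" using f_V f_pred[OF n] f_pred_Suc[OF n] by (intro pos_Suc)
    moreover have "ori (f (n - 1)) (f n) (apex n) (f (Suc n)) = - ori (apex n) (f (n - 1)) (f (Suc n)) (f n)"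
      unfolding ori_def by algebra
    ultimately have o: "orn (Suc n) = - (hgt (pos n (f (n - 1))) * ori (apex n) (f (n - 1)) (f (Suc n)) (f n))"
      using e a by simp
    have sgn: "0 < - (y * w) \<longleftrightarrow> 0 < x * w" if "x * y < 0" for x y w :: real
      using that by (auto simp: mult_less_0_iff zero_less_mult_iff)
    show ?thesis unfolding o by (rule sgn) (rule hgt_opposite(1)[OF n])
  qed
qed

lemma orn_constant: "0 < n \<Longrightarrow> 0 < orn n \<longleftrightarrow> 0 < orn 1"
proof (induction n)
  case (Suc n)
  then show ?case using orn_Suc[of n] by (cases "n = 0") auto
qed simp

end

definition mirror :: "pt3 \<Rightarrow> pt3" where "mirror = (\<lambda>(x, y, z). (x, y, - z))"

lemma mirror_simps: "mirror (x + y) = mirror x + mirror y" "mirror (r *\<^sub>R x) = r *\<^sub>R mirror x"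
  "mirror x \<bullet> mirror y = x \<bullet> y" "mirror (eqc \<sigma>) = eqc \<sigma>" "hgt (mirror x) = - hgt x"
  by (cases x; cases y; simp add: mirror_def eqc_def hgt_def)+

context developed_loop
begin

lemma strip_mirror: "strip s f (\<lambda>n x. A n (mirror x))"
  unfolding strip_def
proof (intro conjI allI impI)
  fix n
  show "s n < s (Suc n)" by (rule s_less)
  show "frame (f n) (\<lambda>x. A n (mirror x))"
    unfolding frame_def
  proof (intro conjI allI)
    show "linear (\<lambda>x. A n (mirror x))" by (rule linearI) (simp_all add: mirror_simps A_lin)
    show "A n (mirror x) \<bullet> A n (mirror y) = x \<bullet> y" for x y using frameD(2)[OF frm[of n]] by (simp add: mirror_simps)
  qed (rule f_V A_zero)+
  show "f (Suc n) \<noteq> f n" "\<gamma> (s (Suc n)) = A n (mirror (eqc (s (Suc n))))" "bary (f (Suc n)) (\<gamma> (s (Suc n))) = 0"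
    by (simp_all add: mirror_simps f_Suc zero_at_crossing flip: at_crossing)
  show "\<forall>w\<in>V - {f n, f (Suc n)}. 0 < bary w (\<gamma> (s (Suc n)))" using pos_at_crossing by blast
  show "(\<lambda>x. A (Suc n) (mirror x)) = cross_frame (f (Suc n)) (f n) (\<lambda>x. A n (mirror x))"
    unfolding cross_frame_def[abs_def] by (intro ext) (rule A_Suc)
next
  show "\<exists>n. M < s n" for M by (rule s_unbounded)
  show "in_face (f n) (\<lambda>x. A n (mirror x)) \<sigma>" if "s n < \<sigma> \<and> \<sigma> < s (Suc n)" for n \<sigma>
    using in_face_between[of n \<sigma>] that unfolding in_face_def mirror_simps by blast
qed

end

context geodesic_loop
begin

lemma oriented_exists: "\<exists>s f A. oriented_loop V c \<alpha> \<gamma> \<Lambda> s f A"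
proof -
  obtain s f A where st: "strip s f A" using strip_exists by blast
  interpret D: developed_loop V c \<alpha> \<gamma> \<Lambda> s f A by unfold_locales (rule st)
  show ?thesis
  proof (cases "0 < D.orn 1")
    case True
    have "oriented_loop V c \<alpha> \<gamma> \<Lambda> s f A"
      by unfold_locales (use D.orn_constant True in blast)
    then show ?thesis by blast
  next
    case False
    interpret F: developed_loop V c \<alpha> \<gamma> \<Lambda> s f "\<lambda>n x. A n (mirror x)" by unfold_locales (rule D.strip_mirror)
    have pos: "F.pos n w = mirror (D.pos n w)" if "w \<in> V" "w \<noteq> f n" for n w
    proof (rule F.pos_eqI)
      have "mirror (mirror x) = x" for x by (cases x) (simp add: mirror_def)
      then show "A n (mirror (mirror (D.pos n w))) = w" using D.A_pos[OF that] by simp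
    qed
    have "0 < F.orn n" if n: "0 < n" for n
    proof -
      have "F.orn n = - D.orn n"
        unfolding pos[OF D.apex(1,3)[OF n]] mirror_simps by simp
      moreover have "corner (D.apex n) (f (n - 1)) (f (Suc n)) (f n)" using D.corner_apex[OF n] unfolding corner_def by auto
      then have "D.orn n \<noteq> 0" using D.hgt_apex_nonzero[OF n] ori_nonzero by simp
      ultimately show ?thesis using D.orn_constant[OF n] False by linarith
    qed
    then have "oriented_loop V c \<alpha> \<gamma> \<Lambda> s f (\<lambda>n x. A n (mirror x))" by unfold_locales
    then show ?thesis by blast
  qed
qed

end

context oriented_loop
begin

definition touches :: "real \<Rightarrow> real \<Rightarrow> real ^ 4 \<Rightarrow> nat \<Rightarrow> bool" where
  "touches z t v n \<longleftrightarrow> n \<in> base z \<and> v \<in> V \<and> v \<noteq> f n \<and> 0 < hgt (pos n v) \<and> hsp z t (pos n v) = 0"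

text \<open>The vertices that keep the free lune over \<open>(z, z + \<pi>)\<close> from growing.\<close>

definition U :: "real \<Rightarrow> (real ^ 4) set" where
  "U z = {v. \<exists>t n. free z t \<and> touches z t v n}"

lemma freeD: "\<lbrakk>free z t; n \<in> base z; w \<in> V; w \<noteq> f n; 0 < hgt (pos n w)\<rbrakk> \<Longrightarrow> hsp z t (pos n w) \<le> 0"
  unfolding free_def by blast

lemma U_V: "U z \<subseteq> V"
  by (auto simp: U_def touches_def)

lemma U_nonempty:
  assumes z: "s 1 < z"
  shows "U z \<noteq> {}"
proof -
  define C where "C = {(n, w). n \<in> base z \<and> w \<in> V \<and> w \<noteq> f n \<and> 0 < hgt (pos n w)}"
  have "C \<subseteq> base z \<times> V" by (auto simp: C_def)
  then have fin: "finite C" using finite_base finite_V by (rule finite_subset[OF _ finite_cartesian_product])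
  obtain n where n: "n \<in> base z" using base_nonempty_aux[OF z] by blast
  have n0: "0 < n" by (rule base_pos_aux[OF z n])
  have "C \<noteq> {}"
  proof (cases "0 < hgt (pos n (apex n))")
    case True
    then have "(n, apex n) \<in> C" using n apex[OF n0] by (simp add: C_def)
    then show ?thesis by blast
  next
    case False
    then have "0 < hgt (pos n (f (Suc n)))" using hgt_opposite(2)[OF n0] by (auto simp: mult_less_0_iff)
    then have "(n, f (Suc n)) \<in> C" using n f_V f_Suc by (simp add: C_def)
    then show ?thesis by blast
  qed
  define sl where "sl = (\<lambda>(n, w). (pos n w \<bullet> eqt z) / hgt (pos n w))"
  define t where "t = Max (sl ` C)"
  have "t \<in> sl ` C" unfolding t_def using fin \<open>C \<noteq> {}\<close> by (intro Max_in) auto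
  then obtain k v where kv: "(k, v) \<in> C" "t = sl (k, v)" by auto
  have "hsp z t (pos n w) \<le> 0" if "(n, w) \<in> C" for n w
  proof -
    have h: "0 < hgt (pos n w)" using that by (simp add: C_def)
    have "sl (n, w) \<le> t" unfolding t_def using fin that by (intro Max_ge) auto
    then show ?thesis using h by (simp add: sl_def hsp_def pos_divide_le_eq)
  qed
  then have "free z t" by (auto simp: free_def C_def)
  moreover have "touches z t v k" using kv by (auto simp: touches_def C_def sl_def hsp_def)
  ultimately show ?thesis by (auto simp: U_def)
qed

lemma U_rays:
  assumes z: "s 1 < z" and v: "v \<in> U z"
  obtains p q r \<theta>0 \<sigma> where "corner v p q r" "ori v p q r < 0" "ray_system \<gamma> z v (cyc3 p q r) \<theta>0 \<sigma>"
proof -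
  obtain t n where t: "free z t" "touches z t v n" using v by (auto simp: U_def)
  interpret T: touched_lune V c \<alpha> \<gamma> \<Lambda> s f A z t v n
    by unfold_locales (use z t oriented in \<open>auto simp: touches_def\<close>)
  show ?thesis by (rule T.rays) (rule that)
qed

lemma period_multiple: "\<lbrakk>x = of_int n * \<Lambda>; 0 < x; x < \<Lambda>\<rbrakk> \<Longrightarrow> False"
proof -
  assume x: "x = of_int n * \<Lambda>" "0 < x" "x < \<Lambda>"
  then have "0 < n" using period_pos by (simp add: zero_less_mult_iff)
  then have "1 \<le> real_of_int n" by simp
  then have "1 * \<Lambda> \<le> of_int n * \<Lambda>" using period_pos by (intro mult_right_mono) auto
  then show False using x by linarith
qed

lemma U_half_turn:
  assumes \<Lambda>: "2 * pi \<le> \<Lambda>" and z: "s 1 < z"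
  shows "U z \<inter> U (z + pi) = {}"
proof (rule ccontr)
  assume "U z \<inter> U (z + pi) \<noteq> {}"
  then obtain v where v: "v \<in> U z" "v \<in> U (z + pi)" by blast
  have z': "s 1 < z + pi" using z pi_gt_zero by linarith
  obtain p q r \<theta>1 \<sigma> where 1: "corner v p q r" "ori v p q r < 0" and R1: "ray_system \<gamma> z v (cyc3 p q r) \<theta>1 \<sigma>" by (rule U_rays[OF z v(1)])
  obtain p' q' r' \<theta>2 \<sigma>' where 2: "corner v p' q' r'" "ori v p' q' r' < 0" and R2: "ray_system \<gamma> (z + pi) v (cyc3 p' q' r') \<theta>2 \<sigma>'"
    by (rule U_rays[OF z' v(2)])
  obtain a b \<delta> where ab: "a < b" "\<And>\<theta>. \<lbrakk>a < \<theta>; \<theta> < b\<rbrakk> \<Longrightarrow> \<theta>1 < \<theta> \<and> \<theta> < \<theta>1 + pi \<and> \<theta>2 < \<theta> - \<delta> \<and> \<theta> - \<delta> < \<theta>2 + pi \<and> \<gamma> (\<sigma> \<theta>) = \<gamma> (\<sigma>' (\<theta> - \<delta>))"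
    using rays_meet[OF 1 2 R1 R2 refl] by metis
  obtain \<theta> where \<theta>: "a < \<theta>" "\<theta> < b" using dense[OF ab(1)] by blast
  note m = ab(2)[OF \<theta>]
  have s1: "z < \<sigma> \<theta>" "\<sigma> \<theta> < z + pi" using R1 m unfolding ray_system_def by blast+
  have s2: "z + pi < \<sigma>' (\<theta> - \<delta>)" "\<sigma>' (\<theta> - \<delta>) < z + pi + pi" using R2 m unfolding ray_system_def by blast+
  obtain n :: int where "\<sigma>' (\<theta> - \<delta>) = \<sigma> \<theta> + of_int n * \<Lambda>" using loop_inj[of "\<sigma>' (\<theta> - \<delta>)" "\<sigma> \<theta>"] m by auto
  then show False using s1 s2 \<Lambda> by (intro period_multiple[of "\<sigma>' (\<theta> - \<delta>) - \<sigma> \<theta>" n]) linarith+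
qed

lemma U_reverse:
  assumes \<Lambda>: "2 * pi \<le> \<Lambda>" and z: "s 1 < z" and z': "s' 1 < z'"
    and rev: "oriented_loop V c \<alpha> (\<lambda>s. \<gamma> (- s)) \<Lambda> s' f' A'"
  shows "U z \<inter> oriented_loop.U V s' f' A' z' = {}"
proof (rule ccontr)
  interpret B: oriented_loop V c \<alpha> "\<lambda>s. \<gamma> (- s)" \<Lambda> s' f' A' by (rule rev)
  assume "\<not> ?thesis"
  then obtain v where v: "v \<in> U z" "v \<in> B.U z'" by blast
  obtain p q r \<theta>1 \<sigma> where 1: "corner v p q r" "ori v p q r < 0" and R1: "ray_system \<gamma> z v (cyc3 p q r) \<theta>1 \<sigma>" by (rule U_rays[OF z v(1)])
  obtain p' q' r' \<theta>2 \<sigma>' where 2: "corner v p' q' r'" "ori v p' q' r' < 0" and R2: "ray_system (\<lambda>s. \<gamma> (- s)) z' v (cyc3 p' q' r') \<theta>2 \<sigma>'"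
    by (rule B.U_rays[OF z' v(2)])
  have ran: "range \<gamma> = range (\<lambda>s. \<gamma> (- s))"
  proof -
    have "\<gamma> x \<in> range (\<lambda>s. \<gamma> (- s))" for x by (rule range_eqI[of _ _ "- x"]) simp
    then show ?thesis by auto
  qed
  obtain a b \<delta> where ab: "a < b" "\<And>\<theta>. \<lbrakk>a < \<theta>; \<theta> < b\<rbrakk> \<Longrightarrow> \<theta>1 < \<theta> \<and> \<theta> < \<theta>1 + pi \<and> \<theta>2 < \<theta> - \<delta> \<and> \<theta> - \<delta> < \<theta>2 + pi \<and> \<gamma> (\<sigma> \<theta>) = \<gamma> (- \<sigma>' (\<theta> - \<delta>))"
    using rays_meet[OF 1 2 R1 R2 ran] by metis
  define S where "S \<theta> = \<sigma> \<theta> + \<sigma>' (\<theta> - \<delta>)" for \<theta>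
  have S: "z + z' < S \<theta> \<and> S \<theta> < z + z' + 2 * pi \<and> (\<exists>n::int. S \<theta> = of_int n * \<Lambda>)" if "a < \<theta>" "\<theta> < b" for \<theta>
  proof -
    note m = ab(2)[OF that]
    have s1: "z < \<sigma> \<theta>" "\<sigma> \<theta> < z + pi" using R1 m unfolding ray_system_def by blast+
    have s2: "z' < \<sigma>' (\<theta> - \<delta>)" "\<sigma>' (\<theta> - \<delta>) < z' + pi" using R2 m unfolding ray_system_def by blast+
    obtain n :: int where "\<sigma> \<theta> = - \<sigma>' (\<theta> - \<delta>) + of_int n * \<Lambda>" using loop_inj[of "\<sigma> \<theta>" "- \<sigma>' (\<theta> - \<delta>)"] m by auto
    then have "S \<theta> = of_int n * \<Lambda>" by (simp add: S_def)
    then show ?thesis using s1 s2 by (auto simp: S_def)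
  qed
  obtain \<theta> where \<theta>: "a < \<theta>" "\<theta> < b" using dense[OF ab(1)] by blast
  obtain \<theta>' where \<theta>': "\<theta> < \<theta>'" "\<theta>' < b" using dense[OF \<theta>(2)] by blast
  have \<theta>2: "a < \<theta>'" using \<theta> \<theta>' by simp
  note m = ab(2)[OF \<theta>] ab(2)[OF \<theta>2 \<theta>'(2)]
  have "\<sigma> \<theta> < \<sigma> \<theta>'" using R1 m \<theta>' unfolding ray_system_def by blast
  moreover have "\<sigma>' (\<theta> - \<delta>) < \<sigma>' (\<theta>' - \<delta>)"
  proof -
    have "\<theta> - \<delta> < \<theta>' - \<delta>" using \<theta>' by simp
    then show ?thesis using R2 m unfolding ray_system_def by blast
  qed
  ultimately have lt: "0 < S \<theta>' - S \<theta>" by (simp add: S_def)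
  obtain n n' :: int where "S \<theta> = of_int n * \<Lambda>" "S \<theta>' = of_int n' * \<Lambda>" using S[OF \<theta>] S[OF \<theta>2 \<theta>'(2)] by blast
  then have e: "S \<theta>' - S \<theta> = of_int (n' - n) * \<Lambda>" by (simp add: algebra_simps)
  have "S \<theta>' - S \<theta> < \<Lambda>" using S[OF \<theta>] S[OF \<theta>2 \<theta>'(2)] \<Lambda> by auto
  then show False by (rule period_multiple[OF e lt])
qed

definition closed_base :: "real \<Rightarrow> nat set" where
  "closed_base z = {n. s n \<le> z + pi \<and> z \<le> s (Suc n)}"

lemma linear_equator:
  fixes F :: "pt3 \<Rightarrow> real"
  assumes "\<And>x y. F (x + y) = F x + F y" "\<And>r x. F (r *\<^sub>R x) = r * F x" "\<And>\<sigma>. F (eqc \<sigma>) = - k * sin (\<sigma> - z)"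
  shows "F x = - k * (x \<bullet> eqt z) + F (0, 0, 1) * hgt x"
proof -
  have 1: "F (1, 0, 0) = k * sin z" "F (0, 1, 0) = - k * cos z"
    using assms(3)[of 0] assms(3)[of "pi / 2"] by (simp_all add: eqc_def sin_diff)
  obtain a b d where x: "x = (a, b, d)" by (cases x)
  have "x = a *\<^sub>R (1, 0, 0) + b *\<^sub>R (0, 1, 0) + d *\<^sub>R (0, 0, 1)" by (simp add: x)
  then have "F x = a * F (1, 0, 0) + b * F (0, 1, 0) + d * F (0, 0, 1)" using assms(1,2) by metis
  then show ?thesis unfolding 1 by (simp add: x eqt_def hgt_def algebra_simps)
qed

text \<open>A triangle that meets the base only at an end point contributes no vertices to the boundary of the lune
  beyond those it shares with its neighbour.\<close>

lemma boundary_new_vertex: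
  assumes F: "\<And>x y. F (x + y) = F x + F y" "\<And>r x. F (r *\<^sub>R x) = r * F x" "\<And>\<sigma>. F (eqc \<sigma>) = - k * sin (\<sigma> - z)" and k: "0 < k"
    and x: "F x = 0" "0 < hgt x" "hsp z t x \<le> 0" and y: "F y = 1" "0 < hgt y"
  shows "hsp z t y < 0"
proof -
  define B where "B = F (0, 0, 1) / k"
  have Fe: "F x = - k * (x \<bullet> eqt z - B * hgt x)" for x
    using linear_equator[OF F, of x] k by (simp add: B_def algebra_simps)
  have "x \<bullet> eqt z = B * hgt x" using x(1) Fe[of x] k by simp
  then have "B * hgt x \<le> t * hgt x" using x(3) by (simp add: hsp_def)
  then have "B \<le> t" using x(2) by simp
  then have "B * hgt y \<le> t * hgt y" using y(2) by simp
  moreover have "y \<bullet> eqt z - B * hgt y < 0"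
  proof -
    have "k * (y \<bullet> eqt z - B * hgt y) < 0" using y(1) Fe[of y] by simp
    then show ?thesis using k by (simp add: mult_less_0_iff)
  qed
  ultimately show ?thesis by (simp add: hsp_def)
qed

lemma upper_shared:
  assumes n: "0 < n" and w: "w = f (n - 1) \<or> w = f (Suc n)"
  obtains u where "u \<in> {apex n, w}" "0 < hgt (pos n u)"
  using hgt_opposite[OF n] w that by (cases "0 < hgt (pos n (apex n))") (auto simp: mult_less_0_iff)

lemma closed_base_free:
  assumes z: "s 1 < z" and t: "free z t" and n: "n \<in> closed_base z" "0 < n" and w: "w \<in> V" "w \<noteq> f n" "0 < hgt (pos n w)"
  shows "hsp z t (pos n w) < 0 \<or> w \<in> U z"
proof -
  have base: ?thesis if "j \<in> base z" "w \<noteq> f j" "pos j w = pos n w" for j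
  proof -
    have "hsp z t (pos j w) \<le> 0" using that w by (intro freeD[OF t that(1)]) auto
    then show ?thesis using t that w unfolding U_def touches_def by force
  qed
  consider "n \<in> base z" | "s (Suc n) = z" | "s n = z + pi" using n by (force simp: closed_base_def base_def)
  then show ?thesis
  proof cases
    case 1
    then show ?thesis using base w by blast
  next
    case 2
    have Sb: "Suc n \<in> base z" using 2 s_less[of "Suc n"] pi_gt_zero by (auto simp: base_def)
    show ?thesis
    proof (cases "w = f (Suc n)")
      case False
      then show ?thesis using base[OF Sb] pos_Suc[of w n] w by auto
    next
      case True
      obtain u where u: "u \<in> {apex n, f (n - 1)}" "0 < hgt (pos n u)" by (rule upper_shared[OF n(2), of "f (n - 1)"]) auto
      have uV: "u \<in> V" "u \<noteq> f n" "u \<noteq> f (Suc n)" using u(1) apex[OF n(2)] f_V f_pred[OF n(2)] f_pred_Suc[OF n(2)] by auto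
      have "hsp z t (pos (Suc n) u) \<le> 0" using uV u(2) pos_Suc[of u n] by (intro freeD[OF t Sb]) auto
      then have "hsp z t (pos n u) \<le> 0" using pos_Suc[of u n] uV by simp
      then have "hsp z t (pos n w) < 0"
        using u(2) w(3) uV A_pos[of u n] A_pos[of w n] w(1,2) True 2
        by (intro boundary_new_vertex[of "rgt n" "\<eta> (Suc n)" z "pos n u" t "pos n w"])
          (auto simp: eta_pos rgt_def A_lin bary_V rgt_eqc[unfolded rgt_def])
      then show ?thesis by blast
    qed
  next
    case 3
    have z_less: "s (n - 1) < s n" using n(2) by (intro s_strict) auto
    have Pb: "n - 1 \<in> base z" using 3 n(2) z_less pi_gt_zero by (auto simp: base_def)
    have Sn: "Suc (n - 1) = n" using n(2) by simp
    show ?thesis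
    proof (cases "w = f (n - 1)")
      case False
      then show ?thesis using base[OF Pb] pos_Suc[of w "n - 1", unfolded Sn] w by auto
    next
      case True
      obtain u where u: "u \<in> {apex n, f (Suc n)}" "0 < hgt (pos n u)" by (rule upper_shared[OF n(2), of "f (Suc n)"]) auto
      have uV: "u \<in> V" "u \<noteq> f n" "u \<noteq> f (n - 1)" using u(1) apex[OF n(2)] f_V f_Suc[of n] f_pred_Suc[OF n(2)] by auto
      have e: "pos n u = pos (n - 1) u" using pos_Suc[of u "n - 1", unfolded Sn] uV by simp
      have "hsp z t (pos n u) \<le> 0" using t Pb uV u(2) unfolding free_def e by auto
      moreover have "lft n (eqc \<sigma>) = - \<eta> n * sin (\<sigma> - z)" for \<sigma>
      proof -
        have "\<sigma> - s n = (\<sigma> - z) - pi" using 3 by simp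
        then show ?thesis unfolding lft_eqc[OF n(2)] by (simp only: sin_minus_pi)
      qed
      ultimately have "hsp z t (pos n w) < 0"
        using u(2) w(3) uV A_pos[of u n] A_pos[of w n] w(1,2) True eta_pos[OF n(2)]
        by (intro boundary_new_vertex[of "lft n" "\<eta> n" z "pos n u" t "pos n w"])
          (auto simp: lft_def A_lin bary_V)
      then show ?thesis by blast
    qed
  qed
qed

lemma continuous_eqt: "isCont (\<lambda>z. x \<bullet> eqt z) z"
proof -
  obtain a b d where x: "x = (a, b, d)" by (cases x)
  show ?thesis by (simp add: x eqt_def)
qed

lemma U_open:
  assumes z: "s 1 < z" and v: "v \<in> V" "v \<notin> U z"
  shows "\<forall>\<^sub>F y in nhds z. v \<notin> U y"
proof -
  obtain u where "u \<in> U z" using U_nonempty[OF z] by blast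
  then obtain t k where t: "free z t" and k: "k \<in> base z" "u \<in> V" "u \<noteq> f k" "0 < hgt (pos k u)" "hsp z t (pos k u) = 0"
    by (auto simp: U_def touches_def)
  define G where "G n y = (pos k u \<bullet> eqt y) * hgt (pos n v) - (pos n v \<bullet> eqt y) * hgt (pos k u)" for n y
  define Q where "Q n y \<longleftrightarrow> (n \<in> base y \<and> v \<noteq> f n \<and> 0 < hgt (pos n v) \<longrightarrow> 0 < G n y)" for n y
  have near: "\<forall>\<^sub>F y in nhds z. a < y" if "a < z" for a using eventually_nhds_in_open[of "{a<..}" z] that by simp
  have near': "\<forall>\<^sub>F y in nhds z. y < a" if "z < a" for a using eventually_nhds_in_open[of "{..<a}" z] that by simp
  have Q: "\<forall>\<^sub>F y in nhds z. Q n y" for n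
  proof (cases "n \<in> closed_base z")
    case False
    then consider "z + pi < s n" | "s (Suc n) < z" by (auto simp: closed_base_def)
    then show ?thesis
    proof cases
      case 1
      then have "\<forall>\<^sub>F y in nhds z. y < s n - pi" by (intro near') simp
      then show ?thesis by (rule eventually_mono) (auto simp: Q_def base_def)
    next
      case 2
      then have "\<forall>\<^sub>F y in nhds z. s (Suc n) < y" by (intro near)
      then show ?thesis by (rule eventually_mono) (auto simp: Q_def base_def)
    qed
  next
    case True
    show ?thesis
    proof (cases "v \<noteq> f n \<and> 0 < hgt (pos n v)")
      case False
      then show ?thesis by (auto simp: Q_def intro: always_eventually)
    next
      case vn: True
      have "0 < n"
      proof (rule ccontr)
        assume "\<not> 0 < n"
        then have "z \<le> s 1" using True by (simp add: closed_base_def)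
        then show False using z by simp
      qed
      then have "hsp z t (pos n v) < 0" using closed_base_free[OF z t True _ v(1)] vn v(2) by blast
      then have "pos n v \<bullet> eqt z < t * hgt (pos n v)" by (simp add: hsp_def)
      then have "(pos n v \<bullet> eqt z) * hgt (pos k u) < t * hgt (pos n v) * hgt (pos k u)" using k(4) by simp
      also have "\<dots> = (pos k u \<bullet> eqt z) * hgt (pos n v)" using k(5) by (simp add: hsp_def)
      finally have "0 < G n z" by (simp add: G_def)
      moreover have "isCont (G n) z"
        unfolding G_def[abs_def] by (intro continuous_intros continuous_eqt)
      then have "(G n \<longlongrightarrow> G n z) (nhds z)" by (simp add: isCont_def tendsto_nhds_iff)
      ultimately have "\<forall>\<^sub>F y in nhds z. 0 < G n y" by (metis order_tendstoD(1))
      then show ?thesis by (rule eventually_mono) (simp add: Q_def)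
    qed
  qed
  obtain N where N: "z + 1 + pi < s N" using s_unbounded by blast
  have "\<forall>\<^sub>F y in nhds z. \<forall>n\<in>{..N}. Q n y" by (intro eventually_ball_finite) (use Q in auto)
  moreover have "\<forall>\<^sub>F y in nhds z. y < z + 1" by (rule near') simp
  moreover have "\<forall>\<^sub>F y in nhds z. y < s (Suc k)" "\<forall>\<^sub>F y in nhds z. s k - pi < y"
    using k(1) by (auto intro!: near near' simp: base_def)
  ultimately show ?thesis
  proof eventually_elim
    case (elim y)
    show "v \<notin> U y"
    proof
      assume "v \<in> U y"
      then obtain t' n where t': "free y t'" and n: "n \<in> base y" "v \<noteq> f n" "0 < hgt (pos n v)" "hsp y t' (pos n v) = 0"
        by (auto simp: U_def touches_def)
      have "n \<le> N"
      proof (rule ccontr)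
        assume "\<not> n \<le> N"
        then have "s N \<le> s n" by (intro s_mono) auto
        then show False using n(1) N elim(2) by (auto simp: base_def)
      qed
      then have "0 < G n y" using elim(1) n by (auto simp: Q_def)
      moreover have "k \<in> base y" using elim(3,4) by (auto simp: base_def)
      then have "hsp y t' (pos k u) \<le> 0" using t' k unfolding free_def by auto
      then have "(pos k u \<bullet> eqt y) * hgt (pos n v) \<le> t' * hgt (pos k u) * hgt (pos n v)" using n(3) by (simp add: hsp_def)
      moreover have "(pos n v \<bullet> eqt y) * hgt (pos k u) = t' * hgt (pos n v) * hgt (pos k u)" using n(4) by (simp add: hsp_def)
      moreover have "t' * hgt (pos n v) * hgt (pos k u) = t' * hgt (pos k u) * hgt (pos n v)" by simp
      ultimately show False unfolding G_def by linarith
    qed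
  qed
qed

lemma too_few_labels:
  assumes \<Lambda>: "2 * pi \<le> \<Lambda>" and X: "\<And>z. s 1 < z \<Longrightarrow> U z \<subseteq> X" "X \<subseteq> V" "card X \<le> 2"
  shows False
proof -
  have finX: "finite X" using X(2) finite_V by (rule finite_subset)
  have single: "card (U z) = 1" "U (z + pi) = X - U z" if z: "s 1 < z" for z
  proof -
    have z': "s 1 < z + pi" using z pi_gt_zero by linarith
    have fin: "finite (U z)" "finite (U (z + pi))" using X(1)[OF z] X(1)[OF z'] finX by (auto intro: finite_subset)
    have "0 < card (U z)" "0 < card (U (z + pi))" using U_nonempty[OF z] U_nonempty[OF z'] fin by (simp_all add: card_gt_0_iff)
    moreover have "card (U z) + card (U (z + pi)) = card (U z \<union> U (z + pi))"
      using card_Un_disjoint[OF fin U_half_turn[OF \<Lambda> z]] by simp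
    moreover have "card (U z \<union> U (z + pi)) \<le> card X" using X(1)[OF z] X(1)[OF z'] finX by (intro card_mono) auto
    ultimately have c: "card (U z) = 1" "card (U z \<union> U (z + pi)) = card X" using X(3) by linarith+
    show "card (U z) = 1" by (rule c(1))
    have "U z \<union> U (z + pi) = X" using c(2) X(1)[OF z] X(1)[OF z'] finX by (intro card_subset_eq) auto
    then show "U (z + pi) = X - U z" using U_half_turn[OF \<Lambda> z] by blast
  qed
  define z0 where "z0 = s 1 + 1"
  have z0: "s 1 < z0" "s 1 < z0 + pi" using pi_gt_zero unfolding z0_def by linarith+
  obtain a where a: "U z0 = {a}" using single(1)[OF z0(1)] by (auto simp: card_1_singleton_iff)
  obtain b where b: "U (z0 + pi) = {b}" using single(1)[OF z0(2)] by (auto simp: card_1_singleton_iff)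
  have Xab: "X = {a, b}" "a \<noteq> b" using single(2)[OF z0(1)] X(1)[OF z0(1)] a b by auto
  have ex: "a \<in> U z \<longleftrightarrow> b \<notin> U z" if z: "s 1 < z" for z
  proof -
    obtain x where "U z = {x}" using single(1)[OF z] by (auto simp: card_1_singleton_iff)
    then show ?thesis using X(1)[OF z] Xab by auto
  qed
  have open_set: "open {z. s 1 < z \<and> v \<notin> U z}" if "v \<in> V" for v
    unfolding open_subopen[of "{z. s 1 < z \<and> v \<notin> U z}"]
  proof
    fix z assume "z \<in> {z. s 1 < z \<and> v \<notin> U z}"
    then have "\<forall>\<^sub>F y in nhds z. s 1 < y \<and> v \<notin> U y"
      using U_open[of z v] that eventually_nhds_in_open[of "{s 1<..}" z] by (auto intro: eventually_conj)
    then show "\<exists>T. open T \<and> z \<in> T \<and> T \<subseteq> {z. s 1 < z \<and> v \<notin> U z}" unfolding eventually_nhds by blast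
  qed
  have V: "a \<in> V" "b \<in> V" using Xab X(2) by auto
  let ?A = "{z. s 1 < z \<and> a \<notin> U z}" and ?B = "{z. s 1 < z \<and> b \<notin> U z}"
  have "{s 1<..} \<subseteq> ?A \<union> ?B" "?A \<inter> ?B \<inter> {s 1<..} = {}" using ex by auto
  moreover have "?B \<inter> {s 1<..} \<noteq> {}"
  proof -
    have "z0 \<in> ?B" using z0(1) a Xab by simp
    then show ?thesis by blast
  qed
  moreover have "?A \<inter> {s 1<..} \<noteq> {}"
  proof -
    have "z0 + pi \<in> ?A" using z0(2) b Xab by simp
    then show ?thesis by blast
  qed
  ultimately show False
    using connectedD[OF connected_Ioi open_set[OF V(1)] open_set[OF V(2)], of "s 1"] by blast
qed

theorem length_bound: "\<Lambda> < 2 * pi"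
proof (rule ccontr)
  assume "\<not> \<Lambda> < 2 * pi"
  then have \<Lambda>: "2 * pi \<le> \<Lambda>" by simp
  have "\<exists>s' f' A'. oriented_loop V c \<alpha> (\<lambda>s. \<gamma> (- s)) \<Lambda> s' f' A'"
    by (rule geodesic_loop.oriented_exists) (rule reverse_loop)
  then obtain s' f' A' where rev: "oriented_loop V c \<alpha> (\<lambda>s. \<gamma> (- s)) \<Lambda> s' f' A'" by blast
  interpret B: oriented_loop V c \<alpha> "\<lambda>s. \<gamma> (- s)" \<Lambda> s' f' A' by (rule rev)
  define X where "X = (\<Union>z\<in>{s 1<..}. U z)"
  define Y where "Y = (\<Union>z\<in>{s' 1<..}. B.U z)"
  have XY: "X \<subseteq> V" "Y \<subseteq> V" using U_V B.U_V by (auto simp: X_def Y_def)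
  have "X \<inter> Y = {}" using U_reverse[OF \<Lambda> _ _ rev] by (fastforce simp: X_def Y_def)
  then have "card X + card Y = card (X \<union> Y)" using XY finite_V by (intro card_Un_disjoint[symmetric]) (auto intro: finite_subset)
  also have "\<dots> \<le> 4" using card_mono[OF finite_V, of "X \<union> Y"] XY card_V by simp
  finally have "card X \<le> 2 \<or> card Y \<le> 2" by linarith
  then show False
  proof
    assume "card X \<le> 2"
    then show False using XY(1) by (intro too_few_labels[OF \<Lambda>, of X]) (auto simp: X_def)
  next
    assume "card Y \<le> 2"
    then show False using XY(2) by (intro B.too_few_labels[OF \<Lambda>, of Y]) (auto simp: Y_def)
  qed
qed

end

section \<open>Simple closed geodesics\<close>

lemma perp_unit:
  fixes x y z :: "'a::real_inner"
  assumes "x \<bullet> x = 1"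
  shows "perp x y \<bullet> perp x z = y \<bullet> z - (x \<bullet> y) * (x \<bullet> z)"
  using assms by (simp add: perp_def inner_diff_left inner_diff_right inner_commute algebra_simps)

lemma regular_tetrahedron_edges:
  assumes "regular_tetrahedron V \<alpha>"
  obtains a where "pairwise (\<lambda>x y. sdist x y = a) V"
proof -
  have V: "card V = 4" "\<And>w. w \<in> V \<Longrightarrow> regular_triangle (V - {w}) \<alpha>"
    using assms by (auto simp: regular_tetrahedron_def)
  have "\<exists>a. pairwise (\<lambda>x y. sdist x y = a) (V - {w})" if "w \<in> V" for w
    using V(2)[OF that] unfolding regular_triangle_def by (elim conjE)
  then have "\<forall>w\<in>V. \<exists>a. pairwise (\<lambda>x y. sdist x y = a) (V - {w})" by (rule ballI)
  then obtain e where "\<forall>w\<in>V. pairwise (\<lambda>x y. sdist x y = e w) (V - {w})" by (rule bchoice[THEN exE])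
  then have e: "sdist x y = e w" if "w \<in> V" "x \<in> V" "y \<in> V" "x \<noteq> w" "y \<noteq> w" "x \<noteq> y" for w x y
    using that by (auto simp: pairwise_def)
  have fin: "finite V" using V(1) by (metis card.infinite zero_neq_numeral)
  have e_eq: "e w = e w'" if w: "w \<in> V" "w' \<in> V" "w \<noteq> w'" for w w'
  proof -
    have "card (V - {w, w'}) = 2" using w V(1) fin by (subst card_Diff_subset) auto
    then obtain x y where xy: "V - {w, w'} = {x, y}" "x \<noteq> y" by (auto simp: card_2_iff)
    then have "x \<in> V - {w, w'}" "y \<in> V - {w, w'}" by auto
    then have "sdist x y = e w" "sdist x y = e w'" using xy(2) w by (auto intro!: e)
    then show ?thesis by simp
  qed
  obtain w0 where w0: "w0 \<in> V" using V(1) by fastforce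
  have "sdist x y = e w0" if "x \<in> V" "y \<in> V" "x \<noteq> y" for x y
  proof -
    have "V - {x, y} \<noteq> {}"
    proof
      assume "V - {x, y} = {}"
      then have "card V \<le> card {x, y}" by (intro card_mono) auto
      then show False using V(1) that by simp
    qed
    then obtain w where "w \<in> V" "w \<noteq> x" "w \<noteq> y" by blast
    then show ?thesis using e[of w x y] e_eq[of w w0] w0 that by (cases "w = w0") auto
  qed
  then show ?thesis using that[of "e w0"] by (simp add: pairwise_def)
qed

lemma regular_tetra_exists:
  assumes \<alpha>: "pi / 3 < \<alpha>" "\<alpha> < 2 * pi / 3" and T: "regular_tetrahedron V \<alpha>"
  shows "\<exists>c. regular_tetra V c \<alpha>"
proof -
  have V: "card V = 4" "independent V" "V \<subseteq> sphere 0 1" "\<And>w. w \<in> V \<Longrightarrow> regular_triangle (V - {w}) \<alpha>"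
    using T by (auto simp: regular_tetrahedron_def)
  have nV: "norm x = 1" if "x \<in> V" for x using V(3) that by auto
  have fin: "finite V" using V(1) by (metis card.infinite zero_neq_numeral)
  obtain a where a: "pairwise (\<lambda>x y. sdist x y = a) V" by (rule regular_tetrahedron_edges[OF T])
  define c where "c = cos a"
  have inner: "x \<bullet> y = c" if "x \<in> V" "y \<in> V" "x \<noteq> y" for x y
    using cos_sdist[OF nV[OF that(1)] nV[OF that(2)]] a that by (auto simp: pairwise_def c_def)
  have self: "x \<bullet> x = 1" if "x \<in> V" for x using nV[OF that] by (simp add: norm_eq_1)
  have "card V = Suc 3" using V(1) by simp
  then obtain x B where x: "V = insert x B" "x \<notin> B" "card B = 3" unfolding card_Suc_eq by blast
  have "card B = Suc 2" using x(3) by simp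
  then obtain y C where y: "B = insert y C" "y \<notin> C" "card C = 2" unfolding card_Suc_eq by blast
  obtain z w where zw: "C = {z, w}" "z \<noteq> w" using y(3) by (auto simp: card_2_iff)
  have d: "distinct [x, y, z, w]" "V = {x, y, z, w}" using x y zw by auto
  have mem: "x \<in> V" "y \<in> V" "z \<in> V" "w \<in> V" using d(2) by simp_all
  have in_c: "x \<bullet> y = c" "x \<bullet> z = c" "x \<bullet> w = c" "y \<bullet> z = c" "y \<bullet> w = c" "z \<bullet> w = c"
    using d(1) mem inner by auto
  have "c < 1"
  proof -
    have "(x - y) \<bullet> (x - y) = 2 - 2 * c"
      using in_c(1) self[OF mem(1)] self[OF mem(2)] by (simp add: inner_diff_left inner_diff_right inner_commute)
    moreover have "0 < (x - y) \<bullet> (x - y)" using d(1) by simp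
    ultimately show ?thesis by simp
  qed
  moreover have "- 1 < 3 * c"
  proof -
    have "x + y + z + w \<noteq> 0"
    proof
      assume "x + y + z + w = 0"
      then have "(\<Sum>v\<in>V. 1 *\<^sub>R v) = 0" using d by (simp add: add.assoc)
      then have "(1::real) = 0" using independentD[OF V(2) fin order_refl, of "\<lambda>_. 1" x] mem(1) by simp
      then show False by simp
    qed
    then have "0 < (x + y + z + w) \<bullet> (x + y + z + w)" by simp
    also have "\<dots> = 4 + 12 * c"
      using in_c self[OF mem(1)] self[OF mem(2)] self[OF mem(3)] self[OF mem(4)]
      by (simp add: inner_add_left inner_add_right inner_commute)
    finally show ?thesis by simp
  qed
  moreover have "(1 + c) * cos \<alpha> = c"
  proof -
    have c: "c < 1" "- 1 < 3 * c" by fact+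
    have "interior_angle x y z = \<alpha>" using V(4)[OF mem(4)] mem d(1) unfolding regular_triangle_def by auto
    then have \<alpha>_eq: "\<alpha> = arccos ((perp x y \<bullet> perp x z) / (norm (perp x y) * norm (perp x z)))"
      by (simp add: interior_angle_def vangle_def)
    have "norm (perp x y) * norm (perp x z) = (1 - c) * (1 + c)"
    proof -
      have "norm (perp x y) = sqrt (1 - c * c)" "norm (perp x z) = sqrt (1 - c * c)"
        using in_c self mem by (simp_all add: norm_eq_sqrt_inner perp_unit)
      moreover have "0 \<le> (1 - c) * (1 + c)" using c by (intro mult_nonneg_nonneg) auto
      then have "0 \<le> 1 - c * c" by (simp add: algebra_simps)
      ultimately show ?thesis by (simp add: algebra_simps)
    qed
    moreover have "perp x y \<bullet> perp x z = (1 - c) * c" using in_c self mem by (simp add: perp_unit algebra_simps)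
    ultimately have "\<alpha> = arccos (c / (1 + c))" using \<alpha>_eq c by simp
    moreover have "- 1 \<le> c / (1 + c)" "c / (1 + c) \<le> 1" using c by (simp_all add: field_simps)
    ultimately have "cos \<alpha> = c / (1 + c)" by simp
    then show ?thesis using c by simp
  qed
  ultimately have "regular_tetra V c \<alpha>" using V(1,2) nV inner \<alpha> by unfold_locales auto
  then show ?thesis by blast
qed

lemma continuous_on_frac_loop:
  fixes g :: "real \<Rightarrow> 'a::topological_space"
  assumes g: "continuous_on {0..1} g" "g 1 = g 0"
  shows "continuous_on UNIV (\<lambda>s. g (frac s))"
proof -
  let ?G = "\<lambda>s. g (frac s)"
  have piece: "continuous_on {of_int n..of_int n + 1} ?G" for n
  proof -
    have "continuous_on {of_int n..of_int n + 1} (\<lambda>s. g (s - of_int n))"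
      by (rule continuous_on_compose2[OF g(1)]) (auto intro!: continuous_intros)
    moreover have "g (s - of_int n) = ?G s" if "s \<in> {of_int n..of_int n + 1}" for s
    proof (cases "s = of_int n + 1")
      case True
      have "frac (of_int n + 1 :: real) = 0" using frac_of_int[of "n + 1", where 'a = real] by simp
      then show ?thesis using True g(2) by simp
    next
      case False
      then have "\<lfloor>s\<rfloor> = n" using that by (intro floor_unique) auto
      then show ?thesis by (simp add: frac_def)
    qed
    ultimately show ?thesis by (rule continuous_on_eq)
  qed
  have "isCont ?G t" for t
  proof -
    define n where "n = \<lfloor>t\<rfloor>"
    have n: "of_int n \<le> t" "t < of_int n + 1" unfolding n_def by linarith+
    have "continuous_on ({of_int (n - 1)..of_int (n - 1) + 1} \<union> {of_int n..of_int n + 1}) ?G"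
      by (intro continuous_on_closed_Un piece closed_atLeastAtMost)
    also have "{of_int (n - 1)..of_int (n - 1) + 1} \<union> {of_int n..of_int n + 1} = {of_int n - 1..of_int n + 1 :: real}"
      by auto
    finally show ?thesis using n by (rule_tac continuous_on_interior) auto
  qed
  then show ?thesis by (simp add: continuous_at_imp_continuous_on)
qed

lemma (in regular_tetra) shortest_loop_frac:
  assumes "simple_closed_geodesic (tetrahedron_surface V) g"
  shows "shortest_loop V c \<alpha> (\<lambda>s. g (frac s))" "curve_length 0 1 (\<lambda>s. g (frac s)) = curve_length 0 1 g"
proof -
  have g: "path g" "path_image g \<subseteq> surface" "g 1 = g 0" "simple_path g"
    "\<exists>e>0. curve_length (t - e) (t + e) (\<lambda>s. g (frac s)) = intrinsic_dist surface (g (frac (t - e))) (g (frac (t + e)))" for t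
    using assms unfolding simple_closed_geodesic_def closed_geodesic_def tetrahedron_surface_eq
    by (auto simp: pathstart_def pathfinish_def)
  show "shortest_loop V c \<alpha> (\<lambda>s. g (frac s))"
  proof unfold_locales
    show "continuous_on UNIV (\<lambda>s. g (frac s))"
      using g(1,3) by (intro continuous_on_frac_loop) (auto simp: path_def)
    show "g (frac t) \<in> surface" for t
      using g(2) frac_ge_0[of t] frac_lt_1[of t] by (auto simp: path_image_def less_imp_le)
    show "\<exists>e>0. curve_length (t - e) (t + e) (\<lambda>s. g (frac s)) = intrinsic_dist surface (g (frac (t - e))) (g (frac (t + e)))" for t
      by (rule g(5))
    show "g (frac (t + 1)) = g (frac t)" for t by (simp add: frac_1_eq)
    show "s - t \<in> \<int>" if "g (frac s) = g (frac t)" for s t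
    proof -
      have "frac s \<in> {0..1}" "frac t \<in> {0..1}" "frac s \<noteq> 1" "frac t \<noteq> 1"
        using frac_ge_0 frac_lt_1[of s] frac_lt_1[of t] by (auto simp: less_imp_le)
      then have "frac s = frac t" using g(4) that unfolding simple_path_def loop_free_def by blast
      then have "s - t = of_int (\<lfloor>s\<rfloor> - \<lfloor>t\<rfloor>)" by (simp add: frac_def)
      then show ?thesis by (simp only: Ints_of_int)
    qed
  qed
  show "curve_length 0 1 (\<lambda>s. g (frac s)) = curve_length 0 1 g"
  proof (rule curve_length_cong)
    fix t :: real assume t: "0 \<le> t" "t \<le> 1"
    show "g (frac t) = g t"
      using t g(3) by (cases "t = 1") (auto simp: frac_eq)
  qed
qed

theorem lemma5p1:
  fixes V :: "(real ^ 4) set" and \<alpha> :: real and g :: "real \<Rightarrow> real ^ 4"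
  assumes "pi / 3 < \<alpha>" and "\<alpha> < 2 * pi / 3"
    and "regular_tetrahedron V \<alpha>"
    and "simple_closed_geodesic (tetrahedron_surface V) g"
  shows "curve_length 0 1 g < ennreal (2 * pi)"
proof -
  obtain c where c: "regular_tetra V c \<alpha>" using regular_tetra_exists[OF assms(1-3)] by blast
  interpret regular_tetra V c \<alpha> by (rule c)
  interpret L: shortest_loop V c \<alpha> "\<lambda>s. g (frac s)" by (rule shortest_loop_frac(1)[OF assms(4)])
  interpret D: geodesic_loop V c \<alpha> L.unit_curve L.loop_len
  proof unfold_locales
    show "\<exists>n::int. s = t + n * L.loop_len" if "L.unit_curve s = L.unit_curve t" for s t
      using L.unit_curve_inj[OF that] by blast
  qed (rule L.loop_len_pos L.unit_curve_period L.unit_curve_straight)+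
  obtain s f A where "oriented_loop V c \<alpha> L.unit_curve L.loop_len s f A" using D.oriented_exists by blast
  then have "L.loop_len < 2 * pi" by (rule oriented_loop.length_bound)
  then have "ennreal L.loop_len < ennreal (2 * pi)" using L.loop_len_pos by (intro ennreal_lessI) auto
  then show ?thesis using L.curve_length_loop shortest_loop_frac(2)[OF assms(4)] by simp
qed

end
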